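(* Up to projective equivalence (under $\mathrm{P\Gamma L}(12,2)$) there are exactly three $4$-dimensional pseudo-ovals in $\mathrm{PG}(11,2)$, and each of them is elementary: they arise, respectively, from a conic $\mathcal C$, a pointed conic $\mathcal{PC}$, and a Lunelli–Sce oval $\mathcal K$ of $\mathrm{PG}(2,16)$.
   Context: A $4$-dimensional pseudo-oval in $\mathrm{PG}(11,2)$ is a set of $17$ projective $3$-dimensional subspaces any three of which span $\mathrm{PG}(11,2)$. Identifying $\mathrm{GF}(2)^{12}$ with $\mathrm{GF}(16)^3$ as $\mathrm{GF}(2)$-vector spaces, each point of $\mathrm{PG}(2,16)$ becomes a $3$-dimensional subspace of $\mathrm{PG}(11,2)$, and an oval of $\mathrm{PG}(2,16)$ (17 points, no three collinear) becomes a $4$-dimensional pseudo-oval, called elementary and said to arise from that oval. A conic is a nondegenerate conic of $\mathrm{PG}(2,16)$; a pointed conic is obtained from a conic by deleting one point and adding the nucleus of the conic; a Lunelli–Sce oval is an oval of $\mathrm{PG}(2,16)$ that is neither a conic nor a pointed conic (all such ovals are projectively equivalent). *)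

theory Defs
  imports Main "HOL-Library.Cardinality"
begin

(* The field GF(16) is modelled as an arbitrary finite field 'f with CARD('f) = 16
   (unique up to isomorphism).  GF(16)^3 is the type 'f vec3.  Viewed as a
   GF(2)-vector space, GF(16)^3 is GF(2)^12; we take this identification to be
   the identity, i.e. PG(11,2) is modelled on the additive group of GF(16)^3
   (over GF(2) the only scalars are 0 and 1, so GF(2)-subspaces are exactly
   additively closed subsets containing 0, and GF(2)-linear maps are exactly
   additive maps). *)

type_synonym 'f vec3 = "'f \<times> 'f \<times> 'f"

definition vzero :: "'f::field vec3" where
  "vzero = (0, 0, 0)"

definition vadd :: "'f::field vec3 \<Rightarrow> 'f vec3 \<Rightarrow> 'f vec3" where
  "vadd u v = (case u of (a, b, c) \<Rightarrow> case v of (d, e, f) \<Rightarrow> (a + d, b + e, c + f))"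

definition smul :: "'f::field \<Rightarrow> 'f vec3 \<Rightarrow> 'f vec3" where
  "smul t v = (case v of (a, b, c) \<Rightarrow> (t * a, t * b, t * c))"

definition gf2_subspace :: "'f::field vec3 set \<Rightarrow> bool" where
  "gf2_subspace S \<longleftrightarrow> vzero \<in> S \<and> (\<forall>x\<in>S. \<forall>y\<in>S. vadd x y \<in> S)"

(* projective 3-dimensional subspace of PG(11,2) = 4-dimensional GF(2)-subspace,
   i.e. a GF(2)-subspace with 2^4 elements *)
definition proj3_subspace :: "'f::field vec3 set \<Rightarrow> bool" where
  "proj3_subspace S \<longleftrightarrow> gf2_subspace S \<and> card S = 2 ^ 4"

definition span3 :: "'f::field vec3 set \<Rightarrow> 'f vec3 set \<Rightarrow> 'f vec3 set \<Rightarrow> 'f vec3 set" where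
  "span3 A B C = {vadd (vadd a b) c | a b c. a \<in> A \<and> b \<in> B \<and> c \<in> C}"

definition pseudo_oval :: "'f::field vec3 set set \<Rightarrow> bool" where
  "pseudo_oval Ov \<longleftrightarrow> card Ov = 17 \<and> (\<forall>S\<in>Ov. proj3_subspace S) \<and>
     (\<forall>A\<in>Ov. \<forall>B\<in>Ov. \<forall>C\<in>Ov. A \<noteq> B \<and> A \<noteq> C \<and> B \<noteq> C \<longrightarrow> span3 A B C = UNIV)"

definition gf2_linear :: "('f::field vec3 \<Rightarrow> 'f vec3) \<Rightarrow> bool" where
  "gf2_linear g \<longleftrightarrow> (\<forall>x y. g (vadd x y) = vadd (g x) (g y))"

(* projective equivalence under P\<Gamma>L(12,2) = GL(12,2) *)
definition proj_equiv :: "'f::field vec3 set set \<Rightarrow> 'f vec3 set set \<Rightarrow> bool" where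
  "proj_equiv O1 O2 \<longleftrightarrow> (\<exists>g. bij g \<and> gf2_linear g \<and> (\<lambda>U. g ` U) ` O1 = O2)"

definition pg_point :: "'f::field vec3 set \<Rightarrow> bool" where
  "pg_point P \<longleftrightarrow> (\<exists>v. v \<noteq> vzero \<and> P = {smul t v | t. True})"

definition lform :: "'f::field vec3 \<Rightarrow> 'f vec3 \<Rightarrow> 'f" where
  "lform u x = (case u of (a, b, c) \<Rightarrow> case x of (x0, x1, x2) \<Rightarrow> a * x0 + b * x1 + c * x2)"

definition pg_line :: "'f::field vec3 set set \<Rightarrow> bool" where
  "pg_line L \<longleftrightarrow> (\<exists>u. u \<noteq> vzero \<and> L = {P. pg_point P \<and> (\<forall>x\<in>P. lform u x = 0)})"

definition collinear3 :: "'f::field vec3 set \<Rightarrow> 'f vec3 set \<Rightarrow> 'f vec3 set \<Rightarrow> bool" where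
  "collinear3 P Q R \<longleftrightarrow> (\<exists>L. pg_line L \<and> P \<in> L \<and> Q \<in> L \<and> R \<in> L)"

definition oval :: "'f::{field,finite} vec3 set set \<Rightarrow> bool" where
  "oval K \<longleftrightarrow> card K = CARD('f) + 1 \<and> (\<forall>P\<in>K. pg_point P) \<and>
     (\<forall>P\<in>K. \<forall>Q\<in>K. \<forall>R\<in>K. P \<noteq> Q \<and> P \<noteq> R \<and> Q \<noteq> R \<longrightarrow> \<not> collinear3 P Q R)"

type_synonym 'f qcoeffs = "'f \<times> 'f \<times> 'f \<times> 'f \<times> 'f \<times> 'f"

definition qform :: "'f::field qcoeffs \<Rightarrow> 'f vec3 \<Rightarrow> 'f" where
  "qform Q v = (case Q of (a, b, c, d, e, f) \<Rightarrow> case v of (x, y, z) \<Rightarrow>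
     a*x*x + b*y*y + c*z*z + d*x*y + e*x*z + f*y*z)"

definition qgrad :: "'f::field qcoeffs \<Rightarrow> 'f vec3 \<Rightarrow> 'f vec3" where
  "qgrad Q v = (case Q of (a, b, c, d, e, f) \<Rightarrow> case v of (x, y, z) \<Rightarrow>
     (2*a*x + d*y + e*z, 2*b*y + d*x + f*z, 2*c*z + e*x + f*y))"

definition nonsingular :: "'f::field qcoeffs \<Rightarrow> bool" where
  "nonsingular Q \<longleftrightarrow> \<not> (\<exists>v. v \<noteq> vzero \<and> qform Q v = 0 \<and> qgrad Q v = vzero)"

definition conic :: "'f::field vec3 set set \<Rightarrow> bool" where
  "conic C \<longleftrightarrow> (\<exists>Q. nonsingular Q \<and> C = {P. pg_point P \<and> (\<forall>x\<in>P. qform Q x = 0)})"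

definition nucleus :: "'f::field vec3 set set \<Rightarrow> 'f vec3 set \<Rightarrow> bool" where
  "nucleus K n \<longleftrightarrow> pg_point n \<and> n \<notin> K \<and>
     (\<forall>L. pg_line L \<and> n \<in> L \<longrightarrow> card (L \<inter> K) = 1)"

definition pointed_conic :: "'f::field vec3 set set \<Rightarrow> bool" where
  "pointed_conic K \<longleftrightarrow> (\<exists>C p n. conic C \<and> p \<in> C \<and> nucleus C n \<and> K = insert n (C - {p}))"

definition lunelli_sce_oval :: "'f::{field,finite} vec3 set set \<Rightarrow> bool" where
  "lunelli_sce_oval K \<longleftrightarrow> oval K \<and> \<not> conic K \<and> \<not> pointed_conic K"

(* the (elementary) pseudo-oval arising from a set of points of PG(2,16):
   each point, a 1-dim GF(16)-subspace, is a 4-dim GF(2)-subspace, i.e. a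
   projective 3-space of PG(11,2) under the (identity) identification *)
definition arising :: "'f::field vec3 set set \<Rightarrow> 'f vec3 set set" where
  "arising K = (\<lambda>P. P) ` K"

end

theory Submission
  imports Defs "HOL-Library.Product_Plus" "HOL-Computational_Algebra.Polynomial"
begin

text \<open>A pseudo-oval has a nucleus: counting tangent spaces shows that the tangent spaces of the seventeen
  members meet in one further 4-dimensional subspace. Choose coordinates in which the nucleus consists of
  the vectors \<open>(0, 0, z)\<close> and one member of the vectors \<open>(0, y, 0)\<close>. The other members are then the
  graphs \<open>{(x, A x, B x)}\<close> of sixteen pairs of additive maps of GF(16); the maps \<open>A\<close> form a spread set,
  and so do the maps \<open>B\<close>. A computer search, made short by the group fixing four components of a
  spread, leaves the Desarguesian spread set and seven others. The others are impossible because the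
  dual of a pseudo-oval would give, in the plane of the dual spread set, sixteen affine lines of different
  slopes without three concurrent ones, and a second search finds no such lines. Hence the \<open>A\<close> may be
  taken to be the multiplications by the field elements, and comparing the field generated by one \<open>B\<close>
  with the commutation of all the \<open>B\<close> shows that these are multiplications as well. So the pseudo-oval is
  elementary and is given by an o-function \<open>f\<close>, where \<open>A\<close> is the multiplication by \<open>t\<close> and \<open>B\<close> the
  multiplication by \<open>f t\<close>. A third search classifies the o-functions up to equivalence.

  An equivalence of two elementary pseudo-ovals respects nuclei, which makes it semilinear. It
  therefore carries quadrics to quadrics, and the three classes differ in the largest number of points
  that lie on a quadric.\<close>

section \<open>The field with sixteen elements\<close>

text \<open>The obstacle is that nothing in a pseudo-oval refers to GF(16): its members are
  arbitrary binary subspaces, and the field has to be found in the data. What helps is that the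
  members and the nucleus together are eighteen subspaces on an equal footing as far as independence
  goes. Exchanging the nucleus with another member turns every result on the maps A into one on the
  maps B. A spread set other than the Desarguesian one cannot be refuted by its own equations,
  because it does exist; only the second components can exclude it. Seen through functionals they
  become a choice of one line in each parallel class, which is a finite search. All searches are
  carried out by rewriting. This explains the concrete field, the tables, and the reductions that
  precede each search. A bad spread set is first given the element w, by the conjugacy of maps
  without fixed vectors, so that a group acts on the remaining candidates. Every solution is paired
  with a list of coordinate changes that identifies it, so that isomorphisms are only verified and
  never searched for.\<close>

text \<open>The field is GF(2)[w] / (w^4 + w + 1), and \<open>Gi\<close> is the polynomial whose coefficients are the binary
  digits of \<open>i\<close>. So \<open>G2\<close> is the class of w, addition is the bitwise exclusive or, and
  \<open>G1, G2, G4, G8\<close> is a basis over the prime field.\<close>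

datatype gf16 = G0 | G1 | G2 | G3 | G4 | G5 | G6 | G7
  | G8 | G9 | G10 | G11 | G12 | G13 | G14 | G15

primrec gadd :: "gf16 \<Rightarrow> gf16 \<Rightarrow> gf16" where
  "gadd G0 = case_gf16 G0 G1 G2 G3 G4 G5 G6 G7 G8 G9 G10 G11 G12 G13 G14 G15"
|   "gadd G1 = case_gf16 G1 G0 G3 G2 G5 G4 G7 G6 G9 G8 G11 G10 G13 G12 G15 G14"
|   "gadd G2 = case_gf16 G2 G3 G0 G1 G6 G7 G4 G5 G10 G11 G8 G9 G14 G15 G12 G13"
|   "gadd G3 = case_gf16 G3 G2 G1 G0 G7 G6 G5 G4 G11 G10 G9 G8 G15 G14 G13 G12"
|   "gadd G4 = case_gf16 G4 G5 G6 G7 G0 G1 G2 G3 G12 G13 G14 G15 G8 G9 G10 G11"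
|   "gadd G5 = case_gf16 G5 G4 G7 G6 G1 G0 G3 G2 G13 G12 G15 G14 G9 G8 G11 G10"
|   "gadd G6 = case_gf16 G6 G7 G4 G5 G2 G3 G0 G1 G14 G15 G12 G13 G10 G11 G8 G9"
|   "gadd G7 = case_gf16 G7 G6 G5 G4 G3 G2 G1 G0 G15 G14 G13 G12 G11 G10 G9 G8"
|   "gadd G8 = case_gf16 G8 G9 G10 G11 G12 G13 G14 G15 G0 G1 G2 G3 G4 G5 G6 G7"
|   "gadd G9 = case_gf16 G9 G8 G11 G10 G13 G12 G15 G14 G1 G0 G3 G2 G5 G4 G7 G6"
|   "gadd G10 = case_gf16 G10 G11 G8 G9 G14 G15 G12 G13 G2 G3 G0 G1 G6 G7 G4 G5"
|   "gadd G11 = case_gf16 G11 G10 G9 G8 G15 G14 G13 G12 G3 G2 G1 G0 G7 G6 G5 G4"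
|   "gadd G12 = case_gf16 G12 G13 G14 G15 G8 G9 G10 G11 G4 G5 G6 G7 G0 G1 G2 G3"
|   "gadd G13 = case_gf16 G13 G12 G15 G14 G9 G8 G11 G10 G5 G4 G7 G6 G1 G0 G3 G2"
|   "gadd G14 = case_gf16 G14 G15 G12 G13 G10 G11 G8 G9 G6 G7 G4 G5 G2 G3 G0 G1"
|   "gadd G15 = case_gf16 G15 G14 G13 G12 G11 G10 G9 G8 G7 G6 G5 G4 G3 G2 G1 G0"

primrec gmul :: "gf16 \<Rightarrow> gf16 \<Rightarrow> gf16" where
  "gmul G0 = case_gf16 G0 G0 G0 G0 G0 G0 G0 G0 G0 G0 G0 G0 G0 G0 G0 G0"
|   "gmul G1 = case_gf16 G0 G1 G2 G3 G4 G5 G6 G7 G8 G9 G10 G11 G12 G13 G14 G15"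
|   "gmul G2 = case_gf16 G0 G2 G4 G6 G8 G10 G12 G14 G3 G1 G7 G5 G11 G9 G15 G13"
|   "gmul G3 = case_gf16 G0 G3 G6 G5 G12 G15 G10 G9 G11 G8 G13 G14 G7 G4 G1 G2"
|   "gmul G4 = case_gf16 G0 G4 G8 G12 G3 G7 G11 G15 G6 G2 G14 G10 G5 G1 G13 G9"
|   "gmul G5 = case_gf16 G0 G5 G10 G15 G7 G2 G13 G8 G14 G11 G4 G1 G9 G12 G3 G6"
|   "gmul G6 = case_gf16 G0 G6 G12 G10 G11 G13 G7 G1 G5 G3 G9 G15 G14 G8 G2 G4"
|   "gmul G7 = case_gf16 G0 G7 G14 G9 G15 G8 G1 G6 G13 G10 G3 G4 G2 G5 G12 G11"
|   "gmul G8 = case_gf16 G0 G8 G3 G11 G6 G14 G5 G13 G12 G4 G15 G7 G10 G2 G9 G1"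
|   "gmul G9 = case_gf16 G0 G9 G1 G8 G2 G11 G3 G10 G4 G13 G5 G12 G6 G15 G7 G14"
|   "gmul G10 = case_gf16 G0 G10 G7 G13 G14 G4 G9 G3 G15 G5 G8 G2 G1 G11 G6 G12"
|   "gmul G11 = case_gf16 G0 G11 G5 G14 G10 G1 G15 G4 G7 G12 G2 G9 G13 G6 G8 G3"
|   "gmul G12 = case_gf16 G0 G12 G11 G7 G5 G9 G14 G2 G10 G6 G1 G13 G15 G3 G4 G8"
|   "gmul G13 = case_gf16 G0 G13 G9 G4 G1 G12 G8 G5 G2 G15 G11 G6 G3 G14 G10 G7"
|   "gmul G14 = case_gf16 G0 G14 G15 G1 G13 G3 G2 G12 G9 G7 G6 G8 G4 G10 G11 G5"
|   "gmul G15 = case_gf16 G0 G15 G13 G2 G9 G6 G4 G11 G1 G14 G12 G3 G8 G7 G5 G10"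

primrec ginv :: "gf16 \<Rightarrow> gf16" where
  "ginv G0 = G0" | "ginv G1 = G1" | "ginv G2 = G9" | "ginv G3 = G14"
| "ginv G4 = G13" | "ginv G5 = G11" | "ginv G6 = G7" | "ginv G7 = G6"
| "ginv G8 = G15" | "ginv G9 = G2" | "ginv G10 = G12" | "ginv G11 = G5"
| "ginv G12 = G10" | "ginv G13 = G4" | "ginv G14 = G3" | "ginv G15 = G8"

lemma all_gf16: "(\<forall>x. P x) \<longleftrightarrow> P G0 \<and> P G1 \<and> P G2 \<and> P G3 \<and> P G4 \<and> P G5 \<and> P G6 \<and> P G7 \<and> P G8 \<and> P G9 \<and> P G10 \<and> P G11 \<and> P G12 \<and> P G13 \<and> P G14 \<and> P G15"
  (is "_ = ?R")
proof
  assume ?R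
  have "P x" for x
    using \<open>?R\<close> by (cases x) simp_all
  then show "\<forall>x. P x" ..
qed simp

lemmas gadd_tab = gadd.simps[unfolded fun_eq_iff all_gf16 gf16.case]
lemmas gmul_tab = gmul.simps[unfolded fun_eq_iff all_gf16 gf16.case]
lemmas gf16_eq = gf16.distinct simp_thms(6)

instantiation gf16 :: field
begin
definition zero_gf16 :: gf16 where "0 = G0"
definition one_gf16 :: gf16 where "1 = G1"
definition plus_gf16 :: "gf16 \<Rightarrow> gf16 \<Rightarrow> gf16" where "x + y = gadd x y"
definition times_gf16 :: "gf16 \<Rightarrow> gf16 \<Rightarrow> gf16" where "x * y = gmul x y"
definition uminus_gf16 :: "gf16 \<Rightarrow> gf16" where "- x = (x :: gf16)"
definition minus_gf16 :: "gf16 \<Rightarrow> gf16 \<Rightarrow> gf16" where "x - y = gadd x y"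
definition inverse_gf16 :: "gf16 \<Rightarrow> gf16" where "inverse x = ginv x"
definition divide_gf16 :: "gf16 \<Rightarrow> gf16 \<Rightarrow> gf16" where "x div y = x * inverse (y :: gf16)"

lemmas gf16_ops = zero_gf16_def one_gf16_def plus_gf16_def times_gf16_def uminus_gf16_def
  minus_gf16_def inverse_gf16_def

instance
proof -
  have assoc: "\<forall>a b c. gadd (gadd a b) c = gadd a (gadd b c)"
    by (simp only: all_gf16 gadd_tab simp_thms)
  have comm: "\<forall>a b. gadd a b = gadd b a"
    by (simp only: all_gf16 gadd_tab simp_thms)
  have zero: "\<forall>a. gadd G0 a = a \<and> gadd a a = G0"
    by (simp only: all_gf16 gadd_tab simp_thms)
  have massoc: "\<forall>a b c. gmul (gmul a b) c = gmul a (gmul b c)"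
    by (simp only: all_gf16 gmul_tab simp_thms)
  have mcomm: "\<forall>a b. gmul a b = gmul b a"
    by (simp only: all_gf16 gmul_tab simp_thms)
  have one: "\<forall>a. gmul G1 a = a"
    by (simp only: all_gf16 gmul_tab simp_thms)
  have distrib: "\<forall>a b c. gmul (gadd a b) c = gadd (gmul a c) (gmul b c)"
    by (simp only: all_gf16 gadd_tab gmul_tab simp_thms)
  have inv: "\<forall>a. a \<noteq> G0 \<longrightarrow> gmul (ginv a) a = G1"
    by (simp only: all_gf16 gmul_tab ginv.simps gf16.distinct simp_thms not_False_eq_True)
  show "OFCLASS(gf16, field_class)"
  proof
    fix a b c :: gf16
    show "a + b + c = a + (b + c)" "a + b = b + a" "0 + a = a" "- a + a = 0" "a - b = a + - b"
      using assoc comm zero by (auto simp only: gf16_ops)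
    show "a * b * c = a * (b * c)" "a * b = b * a" "1 * a = a" "(a + b) * c = a * c + b * c"
      using massoc mcomm one distrib by (auto simp only: gf16_ops)
    show "(0 :: gf16) \<noteq> 1" by (simp add: gf16_ops)
    show "a \<noteq> 0 \<Longrightarrow> inverse a * a = 1" using inv by (auto simp only: gf16_ops)
    show "a div b = a * inverse b" by (rule divide_gf16_def)
    show "inverse (0 :: gf16) = 0" by (simp add: gf16_ops)
  qed
qed
end

lemma UNIV_gf16: "UNIV = {G0, G1, G2, G3, G4, G5, G6, G7, G8, G9, G10, G11, G12, G13, G14, G15}"
proof -
  have "x \<in> {G0, G1, G2, G3, G4, G5, G6, G7, G8, G9, G10, G11, G12, G13, G14, G15}" for x
    by (cases x) simp_all
  then show ?thesis by auto
qed

instance gf16 :: finite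
  by standard (simp add: UNIV_gf16)

lemma card_gf16: "CARD(gf16) = 16"
  by (simp add: UNIV_gf16)

lemma gf16_double [simp]: "x + x = (0 :: gf16)"
proof -
  have "\<forall>x. gadd x x = G0" by (simp only: all_gf16 gadd_tab simp_thms)
  then show ?thesis by (simp add: gf16_ops)
qed

lemma gf16_minus [simp]: "x - y = x + (y :: gf16)"
  by (simp add: minus_gf16_def plus_gf16_def)

lemma gf16_add_eq_0 [simp]: "x + y = 0 \<longleftrightarrow> x = (y :: gf16)"
  by (metis gf16_minus eq_iff_diff_eq_0)

lemma gf16_add_cancel [simp]: "x + (x + y) = (y :: gf16)"
  by (simp add: add.assoc[symmetric])

section \<open>Tables and searches\<close>

text \<open>Functions on the field are evaluated as lists of their sixteen values.\<close>

abbreviation gU :: "gf16 list" where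
  "gU \<equiv> [G0, G1, G2, G3, G4, G5, G6, G7, G8, G9, G10, G11, G12, G13, G14, G15]"

primrec gidx :: "gf16 \<Rightarrow> nat" where
  "gidx G0 = 0" | "gidx G1 = 1" | "gidx G2 = 2" | "gidx G3 = 3"
| "gidx G4 = 4" | "gidx G5 = 5" | "gidx G6 = 6" | "gidx G7 = 7"
| "gidx G8 = 8" | "gidx G9 = 9" | "gidx G10 = 10" | "gidx G11 = 11"
| "gidx G12 = 12" | "gidx G13 = 13" | "gidx G14 = 14" | "gidx G15 = 15"

definition look :: "gf16 \<Rightarrow> 'a list \<Rightarrow> 'a" where
  "look x l = l ! gidx x"

lemma look_eval:
  "look G0 (a0 # as) = a0"
  "look G1 (a0 # a1 # as) = a1"
  "look G2 (a0 # a1 # a2 # as) = a2"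
  "look G3 (a0 # a1 # a2 # a3 # as) = a3"
  "look G4 (a0 # a1 # a2 # a3 # a4 # as) = a4"
  "look G5 (a0 # a1 # a2 # a3 # a4 # a5 # as) = a5"
  "look G6 (a0 # a1 # a2 # a3 # a4 # a5 # a6 # as) = a6"
  "look G7 (a0 # a1 # a2 # a3 # a4 # a5 # a6 # a7 # as) = a7"
  "look G8 (a0 # a1 # a2 # a3 # a4 # a5 # a6 # a7 # a8 # as) = a8"
  "look G9 (a0 # a1 # a2 # a3 # a4 # a5 # a6 # a7 # a8 # a9 # as) = a9"
  "look G10 (a0 # a1 # a2 # a3 # a4 # a5 # a6 # a7 # a8 # a9 # a10 # as) = a10"
  "look G11 (a0 # a1 # a2 # a3 # a4 # a5 # a6 # a7 # a8 # a9 # a10 # a11 # as) = a11"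
  "look G12 (a0 # a1 # a2 # a3 # a4 # a5 # a6 # a7 # a8 # a9 # a10 # a11 # a12 # as) = a12"
  "look G13 (a0 # a1 # a2 # a3 # a4 # a5 # a6 # a7 # a8 # a9 # a10 # a11 # a12 # a13 # as) = a13"
  "look G14 (a0 # a1 # a2 # a3 # a4 # a5 # a6 # a7 # a8 # a9 # a10 # a11 # a12 # a13 # a14 # as) = a14"
  "look G15 (a0 # a1 # a2 # a3 # a4 # a5 # a6 # a7 # a8 # a9 # a10 # a11 # a12 # a13 # a14 # a15 # as) = a15"
  by (simp_all add: look_def)

definition tab :: "(gf16 \<Rightarrow> 'a) \<Rightarrow> 'a list" where
  "tab f = map f gU"

lemma look_tab [simp]: "look x (tab f) = f x"
  by (cases x) (simp_all add: look_def tab_def)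

lemma tab_eq_iff: "tab f = tab g \<longleftrightarrow> f = g"
  by (metis look_tab ext)

lemma list16_cases:
  assumes "length l = 16"
  obtains a0 a1 a2 a3 a4 a5 a6 a7 a8 a9 a10 a11 a12 a13 a14 a15
  where "l = [a0, a1, a2, a3, a4, a5, a6, a7, a8, a9, a10, a11, a12, a13, a14, a15]"
  using assms by (auto simp: numeral_eq_Suc length_Suc_conv)

lemma tab_look: "length l = 16 \<Longrightarrow> tab (\<lambda>x. look x l) = l"
  by (erule list16_cases) (simp add: tab_def look_def)

lemma length_tab [simp]: "length (tab f) = 16"
  by (simp add: tab_def)

text \<open>Conditionals in the evaluated functions are replaced by auxiliary constants that match on
  the value of the condition: the simplifier then never looks into the branches.\<close>

definition cons_if :: "bool \<Rightarrow> 'a \<Rightarrow> 'a list \<Rightarrow> 'a list" where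
  "cons_if b x xs = (if b then x # xs else xs)"

lemma cons_if_eval: "cons_if True x xs = x # xs" "cons_if False x xs = xs"
  by (simp_all add: cons_if_def)

lemma filter_eval: "filter P [] = []" "filter P (x # xs) = cons_if (P x) x (filter P xs)"
  by (simp_all add: cons_if_def)

text \<open>Lists of different lengths are compared on their common prefix, so that a table under
  construction can already be tested.\<close>

fun differ :: "'a list \<Rightarrow> 'a list \<Rightarrow> bool" where
  "differ [] bs = True"
| "differ (a # as) [] = True"
| "differ (a # as) (b # bs) \<longleftrightarrow> a \<noteq> b \<and> differ as bs"

definition differ_if :: "bool \<Rightarrow> 'a list \<Rightarrow> 'a list \<Rightarrow> bool" where
  "differ_if b as bs \<longleftrightarrow> \<not> b \<and> differ as bs"

lemma differ_eval:
  "differ [] bs = True" "differ (a # as) [] = True"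
  "differ (a # as) (b # bs) = differ_if (a = b) as bs"
  "differ_if True as bs = False" "differ_if False as bs = differ as bs"
  by (simp_all add: differ_if_def)

text \<open>The entry at 0 is skipped because all additive maps agree there.\<close>

definition tdiffer :: "'a list \<Rightarrow> 'a list \<Rightarrow> bool" where
  "tdiffer as bs = differ (tl as) (tl bs)"

lemma tdiffer_eval: "tdiffer (a # as) (b # bs) = differ as bs"
  by (simp add: tdiffer_def)

lemma tdiffer_tab: "tdiffer (tab f) (tab g) \<longleftrightarrow> (\<forall>x. x \<noteq> 0 \<longrightarrow> f x \<noteq> g x)"
  by (simp add: tdiffer_def tab_def all_gf16 zero_gf16_def)

section \<open>Backtracking search, smallest group first\<close>

fun shorter :: "'a list \<Rightarrow> 'b list \<Rightarrow> bool" where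
  "shorter [] [] = False"
| "shorter [] (y # ys) = True"
| "shorter (x # xs) [] = False"
| "shorter (x # xs) (y # ys) = shorter xs ys"

fun pick :: "'l \<times> 'a list \<Rightarrow> ('l \<times> 'a list) list \<Rightarrow> ('l \<times> 'a list) list \<Rightarrow>
    ('l \<times> 'a list) \<times> ('l \<times> 'a list) list" where
  "pick b [] acc = (b, acc)"
| "pick b (h # hs) acc = (if shorter (snd h) (snd b) then pick h hs (b # acc) else pick b hs (h # acc))"

definition pick_if where
  "pick_if c b h hs acc = (if c then pick h hs (b # acc) else pick b hs (h # acc))"

lemma pick_eval:
  "pick b [] acc = (b, acc)"
  "pick (y, g) ((z, h) # hs) acc = pick_if (shorter h g) (y, g) (z, h) hs acc"
  "pick_if True b b' hs acc = pick b' hs (b # acc)"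
  "pick_if False b b' hs acc = pick b hs (b' # acc)"
  by (simp_all add: pick_if_def)

definition prune :: "('a \<Rightarrow> bool) \<Rightarrow> ('l \<times> 'a list) list \<Rightarrow> ('l \<times> 'a list) list" where
  "prune P gs = map (\<lambda>(y, g). (y, filter P g)) gs"

lemma prune_eval: "prune P [] = []" "prune P ((y, g) # gs) = (y, filter P g) # prune P gs"
  by (simp_all add: prune_def)

text \<open>\<open>search D Q us ch gs\<close> extends the partial choice \<open>ch\<close> by one item from each of the labelled groups
  in \<open>gs\<close>, always branching on a smallest group. After the choice of \<open>c\<close> the test \<open>Q (D ch c)\<close>
  filters the other groups. The list \<open>us\<close> only serves as fuel.\<close>

primrec search :: "('a list \<Rightarrow> 'a \<Rightarrow> 'd) \<Rightarrow> ('d \<Rightarrow> 'a \<Rightarrow> bool) \<Rightarrow> 'u list \<Rightarrow> 'a list \<Rightarrow>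
    ('l \<times> 'a list) list \<Rightarrow> 'a list list" where
  "search D Q [] ch gs = [ch]"
| "search D Q (u # us) ch gs = (case gs of [] \<Rightarrow> [ch] | g # gs' \<Rightarrow>
     (case pick g gs' [] of (b, rest) \<Rightarrow>
        concat (map (\<lambda>c. search D Q us (c # ch) (prune (Q (D ch c)) rest)) (snd b))))"

definition branch where
  "branch D Q us ch cs rest =
     concat (map (\<lambda>c. search D Q us (c # ch) (prune (Q (D ch c)) rest)) cs)"

definition branch_pick where
  "branch_pick D Q us ch p = branch D Q us ch (snd (fst p)) (snd p)"

lemma search_eval:
  "search D Q [] ch gs = [ch]"
  "search D Q (u # us) ch [] = [ch]"
  "search D Q (u # us) ch (g # gs) = branch_pick D Q us ch (pick g gs [])"
  "branch_pick D Q us ch ((y, cs), rest) = branch D Q us ch cs rest"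
  "branch D Q us ch [] rest = []"
  "branch D Q us ch (c # cs) rest =
     search D Q us (c # ch) (prune (Q (D ch c)) rest) @ branch D Q us ch cs rest"
  by (simp_all add: branch_def branch_pick_def case_prod_beta)

text \<open>The value at \<open>G1\<close> serves as a label: a spread set contains exactly one map
  with a given value there.\<close>

definition grp :: "gf16 \<Rightarrow> gf16 list list \<Rightarrow> gf16 list list" where
  "grp y ls = filter (\<lambda>l. look G1 l = y) ls"

lemma grp_eval: "grp y [] = []" "grp y (l # ls) = cons_if (look G1 l = y) l (grp y ls)"
  by (simp_all add: grp_def cons_if_def)

primrec groups :: "gf16 list \<Rightarrow> gf16 list list \<Rightarrow> (gf16 \<times> gf16 list list) list" where
  "groups [] ls = []"
| "groups (y # ys) ls = (y, grp y ls) # groups ys ls"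

definition dlast :: "'a list \<Rightarrow> 'a \<Rightarrow> 'a" where "dlast ch c = c"

section \<open>Addition, composition and inversion of tables\<close>

fun addt :: "gf16 list \<Rightarrow> gf16 list \<Rightarrow> gf16 list" where
  "addt (a # as) (b # bs) = gadd a b # addt as bs"
| "addt [] bs = []"
| "addt (a # as) [] = []"

primrec compt :: "gf16 list \<Rightarrow> gf16 list \<Rightarrow> gf16 list" where
  "compt f [] = []"
| "compt f (x # xs) = look x f # compt f xs"

fun preim :: "gf16 \<Rightarrow> gf16 list \<Rightarrow> gf16 list \<Rightarrow> gf16" where
  "preim y (a # as) (u # us) = (if a = y then u else preim y as us)"
| "preim y as us = G0"

definition preim_if where "preim_if b y u as us = (if b then u else preim y as us)"
lemma preim_eval:
  "preim y (a # as) (u # us) = preim_if (a = y) y u as us"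
  "preim_if True y u as us = u" "preim_if False y u as us = preim y as us"
  by (simp_all add: preim_if_def)

definition invt :: "gf16 list \<Rightarrow> gf16 list" where
  "invt l = map (\<lambda>y. preim y l gU) gU"

lemma invt_eval: "invt l = [preim G0 l gU, preim G1 l gU, preim G2 l gU, preim G3 l gU,
  preim G4 l gU, preim G5 l gU, preim G6 l gU, preim G7 l gU, preim G8 l gU, preim G9 l gU,
  preim G10 l gU, preim G11 l gU, preim G12 l gU, preim G13 l gU, preim G14 l gU, preim G15 l gU]"
  by (simp add: invt_def)

primrec shiftl :: "gf16 \<Rightarrow> gf16 list \<Rightarrow> gf16 list" where
  "shiftl r [] = []" | "shiftl r (x # xs) = gadd r x # shiftl r xs"

text \<open>Passes from the table on a subspace to the table on a subspace of twice the size;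
  \<open>r\<close> is the value at the next basis vector.\<close>

definition ext :: "gf16 list \<Rightarrow> gf16 \<Rightarrow> gf16 list" where "ext l r = l @ shiftl r l"

definition addtab :: "gf16 \<Rightarrow> gf16 \<Rightarrow> gf16 \<Rightarrow> gf16 \<Rightarrow> gf16 list" where
  "addtab a b c d = ext (ext (ext (ext [G0] a) b) c) d"

text \<open>Changes of coordinates of a set of maps. Each map is addressed by its value at \<open>G1\<close>: \<open>Tr y\<close> adds the map
  with value \<open>y\<close> to all others, \<open>Iv\<close> inverts all maps, \<open>Nm y\<close> multiplies them by the inverse of the
  map with value \<open>y\<close>, and \<open>Cj a b c d\<close> conjugates them by the additive map with the values
  \<open>a, b, c, d\<close> on the basis.\<close>

datatype frame_op = Tr gf16 | Iv | Nm gf16 | Cj gf16 gf16 gf16 gf16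

text \<open>The default \<open>[]\<close> signals that no map has the value \<open>y\<close>. The
  operations \<open>Tr\<close> and \<open>Nm\<close> then return the empty list, and the tables of a
  plane are not found in it, so a faulty certificate is rejected.\<close>

primrec sel :: "gf16 \<Rightarrow> gf16 list list \<Rightarrow> gf16 list" where
  "sel y [] = []"
| "sel y (l # ls) = (if look G1 l = y then l else sel y ls)"

definition sel_if where "sel_if b y l ls = (if b then l else sel y ls)"
lemma sel_eval: "sel y [] = []" "sel y (l # ls) = sel_if (look G1 l = y) y l ls"
  "sel_if True y l ls = l" "sel_if False y l ls = sel y ls"
  by (simp_all add: sel_if_def)

primrec shift_others :: "gf16 \<Rightarrow> gf16 list \<Rightarrow> gf16 list list \<Rightarrow> gf16 list list" where
  "shift_others y l [] = []"
| "shift_others y l (m # ms) = (if look G1 m = y then shift_others y l ms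
     else addt l m # shift_others y l ms)"

definition shift_others_if where
  "shift_others_if b y l m ms = (if b then shift_others y l ms else addt l m # shift_others y l ms)"
lemma shift_others_eval: "shift_others y l [] = []"
  "shift_others y l (m # ms) = shift_others_if (look G1 m = y) y l m ms"
  "shift_others_if True y l m ms = shift_others y l ms"
  "shift_others_if False y l m ms = addt l m # shift_others y l ms"
  by (simp_all add: shift_others_if_def)

text \<open>The zero map of a spread set is never listed. Adding \<open>l\<close> turns zero into
  \<open>l\<close> and \<open>l\<close> into zero, so \<open>l\<close> is kept at the head and
  dropped from the rest.\<close>

definition shift_all where "shift_all y l r = (if l = [] then [] else l # shift_others y l r)"
lemma shift_all_eval: "shift_all y [] r = []"
  "shift_all y (a # as) r = (a # as) # shift_others y (a # as) r"
  by (simp_all add: shift_all_def)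

definition norm_all where "norm_all l r = (if l = [] then [] else map (compt (invt l)) r)"
lemma norm_all_eval: "norm_all [] r = []" "norm_all (a # as) r = map (compt (invt (a # as))) r"
  by (simp_all add: norm_all_def)

definition eqt :: "gf16 list \<Rightarrow> gf16 list \<Rightarrow> bool" where "eqt as bs \<longleftrightarrow> as = bs"
definition eqt_if where "eqt_if b as bs \<longleftrightarrow> b \<and> eqt as bs"
lemma eqt_eval: "eqt [] [] = True" "eqt [] (b # bs) = False" "eqt (a # as) [] = False"
  "eqt (a # as) (b # bs) = eqt_if (a = b) as bs"
  "eqt_if True as bs = eqt as bs" "eqt_if False as bs = False" by (simp_all add: eqt_if_def eqt_def)

definition conjt where "conjt p q l = compt p (compt l q)"

definition invertible :: "gf16 list \<Rightarrow> bool" where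
  "invertible p \<longleftrightarrow> eqt (compt p (invt p)) gU"

definition conj_all where
  "conj_all p r = (if invertible p then map (conjt p (invt p)) r else [])"
definition conj_if where "conj_if b p q r = (if b then map (conjt p q) r else [])"
lemma conj_all_eval: "conj_all p r = conj_if (invertible p) p (invt p) r"
  "conj_if True p q r = map (conjt p q) r" "conj_if False p q r = []"
  by (simp_all add: conj_all_def conj_if_def)

primrec apply_op :: "frame_op \<Rightarrow> gf16 list list \<Rightarrow> gf16 list list" where
  "apply_op (Tr y) r = shift_all y (sel y r) r"
| "apply_op Iv r = map invt r"
| "apply_op (Nm y) r = norm_all (sel y r) r"
| "apply_op (Cj a b c d) r = conj_all (addtab a b c d) r"

primrec apply_ops where
  "apply_ops [] r = r"
| "apply_ops (p # ps) r = apply_ops ps (apply_op p r)"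

primrec subt :: "gf16 list list \<Rightarrow> gf16 list list \<Rightarrow> bool" where
  "subt [] r = True"
| "subt (c # cs) r \<longleftrightarrow> eqt c (sel (look G1 c) r) \<and> subt cs r"
definition subt_if where "subt_if b cs r \<longleftrightarrow> b \<and> subt cs r"
lemma subt_eval: "subt [] r = True" "subt (c # cs) r = subt_if (eqt c (sel (look G1 c) r)) cs r"
  "subt_if True cs r = subt cs r" "subt_if False cs r = False" by (simp_all add: subt_if_def)

text \<open>One certificate for each solution, in the order in which the search returns
  them.\<close>

fun certify where
  "certify [] [] = True"
| "certify ((pl, ps) # cs) (r # rs) \<longleftrightarrow> subt pl (apply_ops ps r) \<and> certify cs rs"
| "certify [] (r # rs) = False"
| "certify (c # cs) [] = False"
definition certify_if where "certify_if b cs rs \<longleftrightarrow> b \<and> certify cs rs"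
lemma certify_eval: "certify [] [] = True"
  "certify ((pl, ps) # cs) (r # rs) = certify_if (subt pl (apply_ops ps r)) cs rs"
  "certify [] (r # rs) = False" "certify (c # cs) [] = False"
  "certify_if True cs rs = certify cs rs" "certify_if False cs rs = False"
  by (simp_all add: certify_if_def)

definition zero_tab :: "gf16 list" where
  "zero_tab = [G0, G0, G0, G0, G0, G0, G0, G0, G0, G0, G0, G0, G0, G0, G0, G0]"
definition tab_w :: "gf16 list" where "tab_w = addtab G2 G4 G8 G3"

text \<open>The coordinate changes \<open>A \<mapsto> w A\<^sup>-\<^sup>1\<close> and \<open>A \<mapsto> w + w\<^sup>5 (A + w)\<^sup>-\<^sup>1\<close> induce double transpositions of
  the components \<open>0, \<infinity>, 1, w\<close> of a spread. Together with the conjugation \<open>cw\<close> by w they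
  generate a group of order 60 on the remaining candidates.\<close>

definition v1 where "v1 l = compt (addtab G2 G4 G8 G3) (invt l)"
definition v2 where "v2 l = addt (addtab G2 G4 G8 G3) (compt (addtab G6 G12 G11 G5) (invt (addt l (addtab G2 G4 G8 G3))))"
definition cw where "cw l = conjt (addtab G2 G4 G8 G3) (invt (addtab G2 G4 G8 G3)) l"

section \<open>Orbits of candidates and completeness of the list of candidates\<close>

primrec member :: "gf16 list \<Rightarrow> gf16 list list \<Rightarrow> bool" where
  "member x [] = False" | "member x (y # ys) \<longleftrightarrow> eqt x y \<or> member x ys"
definition member_if where "member_if b x ys \<longleftrightarrow> b \<or> member x ys"
lemma member_eval: "member x [] = False" "member x (y # ys) = member_if (eqt x y) x ys"
  "member_if True x ys = True" "member_if False x ys = member x ys" by (simp_all add: member_if_def)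

primrec iter :: "unit list \<Rightarrow> gf16 list \<Rightarrow> gf16 list list" where
  "iter [] x = []" | "iter (u # us) x = x # iter us (cw x)"

text \<open>\<open>invt\<close> is meaningful for bijections only. The three conditions guarantee
  this for the inversions in \<open>v1 x\<close>, \<open>v2 x\<close> and
  \<open>v1 (v2 x)\<close>.\<close>

definition valid_rep :: "gf16 list \<Rightarrow> bool" where
  "valid_rep x \<longleftrightarrow> invertible x \<and> invertible (addt x tab_w) \<and> invertible (v2 x)"

text \<open>The lists of units say how many conjugates under \<open>cw\<close> of \<open>x\<close>,
  \<open>v1 x\<close>, \<open>v2 x\<close> and \<open>v1 (v2 x)\<close> are listed. Listing too few
  can only make the test \<open>covered\<close> fail.\<close>

definition orbit where
  "orbit x n0 n1 n2 n3 = (if valid_rep x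
     then iter n0 x @ iter n1 (v1 x) @ iter n2 (v2 x) @ iter n3 (v1 (v2 x)) else [])"
definition orbit_if where
  "orbit_if b x n0 n1 n2 n3 = (if b then iter n0 x @ iter n1 (v1 x) @ iter n2 (v2 x) @ iter n3 (v1 (v2 x)) else [])"
definition conj_bool :: "bool \<Rightarrow> bool \<Rightarrow> bool" where "conj_bool a b = (a \<and> b)"
lemma conj_bool_eval: "conj_bool True b = b" "conj_bool False b = False" by (simp_all add: conj_bool_def)
lemma orbit_eval:
  "orbit x n0 n1 n2 n3 = orbit_if (valid_rep x) x n0 n1 n2 n3"
  "orbit_if True x n0 n1 n2 n3 = iter n0 x @ iter n1 (v1 x) @ iter n2 (v2 x) @ iter n3 (v1 (v2 x))"
  "orbit_if False x n0 n1 n2 n3 = []"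
  "valid_rep x = conj_bool (invertible x) (conj_bool (invertible (addt x tab_w)) (invertible (v2 x)))"
  by (simp_all add: orbit_def orbit_if_def valid_rep_def conj_bool_def)

abbreviation "u15 \<equiv> [(),(),(),(),(),(),(),(),(),(),(),(),(),(),()]"
abbreviation "u5 \<equiv> [(),(),(),(),()]"
abbreviation "u3 \<equiv> [(),(),()]"
abbreviation "u1 \<equiv> [()]"
abbreviation "u0 \<equiv> [] :: unit list"

text \<open>\<open>refs\<close> are maps from which the new one has to differ at every nonzero
  vector. Testing this after every doubling keeps the enumeration of additive maps small.\<close>

primrec extend :: "gf16 list list \<Rightarrow> gf16 list \<Rightarrow> gf16 list \<Rightarrow> gf16 list list" where
  "extend refs l [] = []"
| "extend refs l (r # rs) = (if list_all (tdiffer (ext l r)) refs then ext l r # extend refs l rs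
     else extend refs l rs)"

primrec all_differ :: "gf16 list \<Rightarrow> gf16 list list \<Rightarrow> bool" where
  "all_differ l [] = True" | "all_differ l (m # ms) = (if tdiffer l m then all_differ l ms else False)"
definition all_differ_if where "all_differ_if b l ms = (if b then all_differ l ms else False)"
definition extend_if where "extend_if b m refs l rs = (if b then m # extend refs l rs else extend refs l rs)"
definition extend1 where "extend1 m refs l rs = extend_if (all_differ m refs) m refs l rs"
lemma all_differ: "all_differ l ms = list_all (tdiffer l) ms" by (induction ms) auto
lemma extend_eval: "extend refs l [] = []"
  "extend refs l (r # rs) = extend1 (ext l r) refs l rs"
  "extend1 m refs l rs = extend_if (all_differ m refs) m refs l rs"
  "extend_if True m refs l rs = m # extend refs l rs" "extend_if False m refs l rs = extend refs l rs"
  "all_differ l [] = True" "all_differ l (m # ms) = all_differ_if (tdiffer l m) l ms"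
  "all_differ_if True l ms = all_differ l ms" "all_differ_if False l ms = False"
  by (simp_all add: extend1_def extend_if_def all_differ all_differ_if_def)

primrec extend_all where
  "extend_all refs [] = []" | "extend_all refs (l # ls) = extend refs l gU @ extend_all refs ls"

definition tables_from where
  "tables_from refs y = extend_all refs (extend_all refs (extend_all refs (extend refs [G0] [y])))"

primrec all_member where
  "all_member [] ls = True" | "all_member (x # xs) ls = (if member x ls then all_member xs ls else False)"
definition all_member_if where "all_member_if b xs ls = (if b then all_member xs ls else False)"
lemma all_member_eval: "all_member [] ls = True"
  "all_member (x # xs) ls = all_member_if (member x ls) xs ls"
  "all_member_if True xs ls = all_member xs ls" "all_member_if False xs ls = False"
  by (simp_all add: all_member_if_def)

primrec covered where
  "covered [] ls = True"
| "covered (y # ys) ls = (if all_member (tables_from [zero_tab, gU, tab_w] y) (grp y ls) then covered ys ls else False)"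
definition covered_if where "covered_if b ys ls = (if b then covered ys ls else False)"
lemma covered_eval: "covered [] ls = True"
  "covered (y # ys) ls = covered_if (all_member (tables_from [zero_tab, gU, tab_w] y) (grp y ls)) ys ls"
  "covered_if True ys ls = covered ys ls" "covered_if False ys ls = False"
  by (simp_all add: covered_if_def)

primrec remove_lab :: "gf16 \<Rightarrow> gf16 list \<Rightarrow> gf16 list" where
  "remove_lab y [] = []" | "remove_lab y (z # zs) = (if z = y then zs else z # remove_lab y zs)"
definition remove_lab_if where "remove_lab_if b y z zs = (if b then zs else z # remove_lab y zs)"
lemma remove_lab_eval: "remove_lab y [] = []" "remove_lab y (z # zs) = remove_lab_if (z = y) y z zs"
  "remove_lab_if True y z zs = zs" "remove_lab_if False y z zs = z # remove_lab y zs"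
  by (simp_all add: remove_lab_if_def)

text \<open>\<open>phase x os\<close> lists the spread sets that contain \<open>0, 1, w, x\<close> and are made of candidates from the
  orbits \<open>os\<close>. When these are all settled, the whole orbit of \<open>x\<close> can be dropped, which is what
  \<open>phases\<close> does with one orbit after the other.\<close>

definition phase where
  "phase x os = search dlast tdiffer [(),(),(),(),(),(),(),(),(),(),(),()] [x, tab_w, gU]
     (groups (remove_lab (look G1 x) [G3, G4, G5, G6, G7, G8, G9, G10, G11, G12, G13, G14, G15])
        (filter (tdiffer x) (concat os)))"

fun phases where
  "phases [] cs = True"
| "phases (o' # os) (c # cs) \<longleftrightarrow> certify c (phase (hd o') (o' # os)) \<and> phases os cs"
| "phases (o' # os) [] = False"
definition phases_if where "phases_if b os cs \<longleftrightarrow> b \<and> phases os cs"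
lemma phases_eval: "phases [] cs = True"
  "phases ((x # o') # os) (c # cs) = phases_if (certify c (phase x ((x # o') # os))) os cs"
  "phases_if True os cs = phases os cs" "phases_if False os cs = False" by (simp_all add: phases_if_def)

lemmas tables_eval = gf16_eq gadd_tab look_eval append.simps shiftl.simps ext_def addtab_def
  compt.simps preim_eval invt_eval addt.simps list.map conjt_def eqt_eval invertible_def v1_def v2_def cw_def
  concat.simps filter_eval cons_if_eval tdiffer_eval differ_eval grp_eval tab_w_def zero_tab_def
lemmas orbits_eval = tables_eval orbit_eval conj_bool_eval iter.simps
lemmas cover_eval = tables_eval extend_eval extend_all.simps tables_from_def member_eval all_member_eval covered_eval
lemmas phases_evals = tables_eval remove_lab_eval
  shorter.simps pick_eval prune_eval search_eval groups.simps dlast_def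
  sel_eval shift_others_eval shift_all_eval norm_all_eval conj_all_eval apply_op.simps apply_ops.simps
  subt_eval certify_eval phase_def phases_eval

text \<open>\<open>trc\<close> is not the trace but the coefficient of w^3; all that matters is that \<open>(x, y) \<mapsto> trc (x * y)\<close> is
  nondegenerate. \<open>adjt\<close> is the adjoint with respect to this form.\<close>

primrec trc :: "gf16 \<Rightarrow> gf16" where
  "trc G0 = G0" | "trc G1 = G0" | "trc G2 = G0" | "trc G3 = G0"
| "trc G4 = G0" | "trc G5 = G0" | "trc G6 = G0" | "trc G7 = G0"
| "trc G8 = G1" | "trc G9 = G1" | "trc G10 = G1" | "trc G11 = G1"
| "trc G12 = G1" | "trc G13 = G1" | "trc G14 = G1" | "trc G15 = G1"

definition adjt :: "gf16 list \<Rightarrow> gf16 \<Rightarrow> gf16" where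
  "adjt l b = gadd (gadd (gmul (trc (gmul b (look G1 l))) G9) (gmul (trc (gmul b (look G2 l))) G4))
    (gadd (gmul (trc (gmul b (look G4 l))) G2) (gmul (trc (gmul b (look G8 l))) G1))"

definition adjtab where "adjtab l = map (adjt l) gU"

primrec lines :: "gf16 list \<Rightarrow> gf16 list \<Rightarrow> gf16 list list" where
  "lines [] L = []" | "lines (y # ys) L = shiftl y L # lines ys L"

fun meet :: "gf16 \<times> gf16 \<Rightarrow> gf16 list \<Rightarrow> gf16 list \<Rightarrow> gf16 list \<Rightarrow> gf16 \<times> gf16" where
  "meet d (a # as) (b # bs) (u # us) = (if a = b then (u, a) else meet d as bs us)"
| "meet d as bs us = d"
definition meet_if where "meet_if c d u a as bs us = (if c then (u, a) else meet d as bs us)"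
lemma meet_eval: "meet d (a # as) (b # bs) (u # us) = meet_if (a = b) d u a as bs us"
  "meet_if True d u a as bs us = (u, a)" "meet_if False d u a as bs us = meet d as bs us"
  "meet d [] bs us = d"
  by (simp_all add: meet_if_def)

primrec meets where
  "meets d c [] = []" | "meets d c (m # ms) = meet d m c gU # meets d c ms"

text \<open>The points that further lines have to avoid after the choice of \<open>c\<close>: its
  point over 0 and its intersections with the earlier lines. The point over 0 is also the default of
  \<open>meet\<close>, where it adds no new condition.\<close>

definition doubles :: "gf16 list list \<Rightarrow> gf16 list \<Rightarrow> (gf16 \<times> gf16) list" where
  "doubles ch c = (G0, look G0 c) # meets (G0, look G0 c) c ch"

fun avoids :: "(gf16 \<times> gf16) list \<Rightarrow> gf16 list \<Rightarrow> bool" where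
  "avoids [] c = True" | "avoids ((u, v) # ds) c \<longleftrightarrow> look u c \<noteq> v \<and> avoids ds c"
definition avoids_if where "avoids_if b ds c \<longleftrightarrow> \<not> b \<and> avoids ds c"
lemma avoids_eval: "avoids [] c = True" "avoids ((u, v) # ds) c = avoids_if (look u c = v) ds c"
  "avoids_if True ds c = False" "avoids_if False ds c = avoids ds c" by (simp_all add: avoids_if_def)

fun nonid where
  "nonid [] = []" | "nonid (l # ls) = (if eqt l gU then nonid ls else l # nonid ls)"
definition nonid_if where "nonid_if b l ls = (if b then nonid ls else l # nonid ls)"
lemma nonid_eval: "nonid [] = []" "nonid (l # ls) = nonid_if (eqt l gU) l ls"
  "nonid_if True l ls = nonid ls" "nonid_if False l ls = l # nonid ls" by (simp_all add: nonid_if_def)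

primrec line_groups where
  "line_groups [] = []"
| "line_groups (l # ls) = (look G1 l, lines gU (adjtab l)) # line_groups ls"

text \<open>If \<open>S\<close> comes from a pseudo-oval and \<open>c \<noteq> 0\<close>, then the sixteen affine lines
  \<open>b \<mapsto> adjt B c + adjt A b\<close> with \<open>(A, B) \<in> T\<close> have no three concurrent ones, and no two of them
  meet at \<open>b = 0\<close>. \<open>kill\<close> searches for such a choice of one line in every parallel class, the line of
  slope \<open>0\<close> being the axis and the line of slope \<open>1\<close> passing through \<open>(0, g)\<close>.\<close>

definition kill where
  "kill pl g = search doubles avoids [(),(),(),(),(),(),(),(),(),(),(),(),(),()] [shiftl g gU, zero_tab]
    (prune (avoids (doubles [zero_tab] (shiftl g gU))) (prune (avoids [(G0, G0)]) (line_groups (nonid pl))))"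

lemmas kill_eval = phases_evals gmul_tab trc.simps adjt_def adjtab_def lines.simps meet_eval meets.simps
  doubles_def avoids_eval nonid_eval line_groups.simps kill_def

section \<open>Pseudo-ovals in coordinates\<close>

definition addmap :: "('a::ab_group_add \<Rightarrow> 'b::ab_group_add) \<Rightarrow> bool" where
  "addmap f \<longleftrightarrow> (\<forall>x y. f (x + y) = f x + f y)"

lemma addmapD: "addmap f \<Longrightarrow> f (x + y) = f x + f y"
  by (simp add: addmap_def)

lemma addmap_0: "addmap f \<Longrightarrow> f 0 = 0"
  by (metis addmapD add_cancel_right_right)

lemma addmap_comp: "addmap f \<Longrightarrow> addmap g \<Longrightarrow> addmap (f \<circ> g)"
  by (simp add: addmap_def)

lemma addmap_add: "addmap f \<Longrightarrow> addmap g \<Longrightarrow> addmap (\<lambda>x. f x + g x)"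
  by (simp add: addmap_def ac_simps)

lemma addmap_zero: "addmap (\<lambda>x. 0)"
  by (simp add: addmap_def)

lemma addmap_id: "addmap (\<lambda>x. x)" "addmap id"
  by (simp_all add: addmap_def)

lemma addmap_mult: "addmap ((*) (c :: 'a::field))"
  by (simp add: addmap_def algebra_simps)

lemma addmap_inv: "addmap f \<Longrightarrow> bij f \<Longrightarrow> addmap (inv f)"
  unfolding addmap_def by (metis bij_inv_eq_iff)

lemma addmap_inj:
  assumes "addmap f" "\<And>x. f x = 0 \<Longrightarrow> x = 0" shows "inj f"
proof (rule injI)
  fix x y assume "f x = f y"
  have "f (x - y) + f y = f x" using assms(1) by (metis addmapD diff_add_cancel)
  then show "x = y" using \<open>f x = f y\<close> assms(2)[of "x - y"] by simp
qed

lemma addmap_bij: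
  fixes f :: "'a::{ab_group_add, finite} \<Rightarrow> 'a"
  assumes "addmap f" "\<And>x. f x = 0 \<Longrightarrow> x = 0" shows "bij f"
  using addmap_inj[OF assms] finite_UNIV_inj_surj[of f] by (simp add: bij_def)

text \<open>Independence stands for spanning. For three subspaces of 16 vectors among 4096 both
  amount to the same by counting, but independence is inherited under injective additive maps into
  any group.\<close>

definition indep3 :: "'a::ab_group_add set set \<Rightarrow> bool" where
  "indep3 H \<longleftrightarrow> (\<forall>U\<in>H. \<forall>V\<in>H. \<forall>W\<in>H. U \<noteq> V \<and> U \<noteq> W \<and> V \<noteq> W \<longrightarrow>
     (\<forall>u\<in>U. \<forall>v\<in>V. \<forall>w\<in>W. u + v + w = 0 \<longrightarrow> u = 0 \<and> v = 0 \<and> w = 0))"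

lemma indep3D:
  assumes "indep3 H" "U \<in> H" "V \<in> H" "W \<in> H" "U \<noteq> V" "U \<noteq> W" "V \<noteq> W"
    "u \<in> U" "v \<in> V" "w \<in> W" "u + v + w = 0"
  shows "u = 0 \<and> v = 0 \<and> w = 0"
  by (rule assms(1)[unfolded indep3_def, rule_format,
        OF assms(2-4) conjI[OF assms(5) conjI[OF assms(6,7)]] assms(8-11)])

lemma indep3_image:
  assumes "addmap f" "inj f" "indep3 H"
  shows "indep3 ((`) f ` H)"
  unfolding indep3_def
proof (intro ballI impI)
  fix U' V' W' u' v' w'
  assume m: "U' \<in> (`) f ` H" "V' \<in> (`) f ` H" "W' \<in> (`) f ` H"
    and d: "U' \<noteq> V' \<and> U' \<noteq> W' \<and> V' \<noteq> W'"
    and e: "u' \<in> U'" "v' \<in> V'" "w' \<in> W'" "u' + v' + w' = 0"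
  obtain U V W where U: "U \<in> H" "U' = f ` U" and V: "V \<in> H" "V' = f ` V" and W: "W \<in> H" "W' = f ` W"
    using m by auto
  obtain u v w where u: "u \<in> U" "u' = f u" and v: "v \<in> V" "v' = f v" and w: "w \<in> W" "w' = f w"
    using e U V W by auto
  have "f (u + v + w) = f 0"
    using e(4) u v w assms(1) by (simp add: addmapD addmap_0)
  then have "u + v + w = 0" using assms(2) by (simp add: inj_eq)
  then show "u' = 0 \<and> v' = 0 \<and> w' = 0"
    using indep3D[OF assms(3) U(1) V(1) W(1) _ _ _ u(1) v(1) w(1)] d U V W u v w
      addmap_0[OF assms(1)] by blast
qed

type_synonym gmap = "gf16 \<Rightarrow> gf16"

definition graph3 :: "gmap \<Rightarrow> gmap \<Rightarrow> gf16 vec3 set" where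
  "graph3 A B = range (\<lambda>x. (x, A x, B x))"

definition ysub :: "gf16 vec3 set" where "ysub = range (\<lambda>x. (0, x, 0))"
definition zsub :: "gf16 vec3 set" where "zsub = range (\<lambda>x. (0, 0, x))"

definition members :: "(gmap \<times> gmap) set \<Rightarrow> gf16 vec3 set set" where
  "members T = insert ysub ((\<lambda>(A, B). graph3 A B) ` T)"

definition wf :: "(gmap \<times> gmap) set \<Rightarrow> bool" where
  "wf T \<longleftrightarrow> card T = 16 \<and> (\<forall>(A, B)\<in>T. addmap A \<and> addmap B)"

text \<open>Coordinates of a pseudo-hyperoval: the member \<open>zsub\<close> is the nucleus, the other members are
  \<open>ysub\<close> and the graphs of the sixteen pairs in \<open>T\<close>.\<close>

definition phyp :: "(gmap \<times> gmap) set \<Rightarrow> bool" where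
  "phyp T \<longleftrightarrow> wf T \<and> indep3 (insert zsub (members T))"

lemma graph3_inj: "graph3 A B = graph3 A' B' \<longleftrightarrow> A = A' \<and> B = B'"
proof
  assume e: "graph3 A B = graph3 A' B'"
  have "A x = A' x \<and> B x = B' x" for x
  proof -
    have "(x, A x, B x) \<in> graph3 A' B'" unfolding e[symmetric] by (simp add: graph3_def)
    then show ?thesis by (auto simp: graph3_def)
  qed
  then show "A = A' \<and> B = B'" by auto
qed simp

lemma graph3_neq: "graph3 A B \<noteq> ysub" "graph3 A B \<noteq> zsub" "ysub \<noteq> zsub"
proof -
  have "(1, A 1, B 1) \<in> graph3 A B" by (simp add: graph3_def)
  then show "graph3 A B \<noteq> ysub" "graph3 A B \<noteq> zsub" by (auto simp: ysub_def zsub_def)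
  have "(0, 1, 0) \<in> ysub" "(0, 1, 0) \<notin> zsub" by (auto simp: ysub_def zsub_def)
  then show "ysub \<noteq> zsub" by metis
qed

lemma phypD:
  assumes "phyp T"
  shows "finite T" "card T = 16" "(A, B) \<in> T \<Longrightarrow> addmap A" "(A, B) \<in> T \<Longrightarrow> addmap B"
  using assms by (auto simp: phyp_def wf_def intro: card_ge_0_finite)

lemma graph3_mem: "(A, B) \<in> T \<Longrightarrow> graph3 A B \<in> insert zsub (members T)"
  by (force simp: members_def)

lemma ysub_mem: "ysub \<in> insert zsub (members T)"
  by (simp add: members_def)

lemma phyp_indep: "phyp T \<Longrightarrow> indep3 (insert zsub (members T))"
  by (simp add: phyp_def)

lemma mem_graph3: "(x, A x, B x) \<in> graph3 A B"
  by (simp add: graph3_def)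

text \<open>The vectors of the two graphs over the same x differ by a vector of the nucleus
  \<open>zsub\<close>, which is the third member. In \<open>phyp_differ2\<close> the third member is
  \<open>ysub\<close>.\<close>

lemma phyp_differ1:
  assumes "phyp T" "(A, B) \<in> T" "(A', B') \<in> T" "(A, B) \<noteq> (A', B')" "A x = A' x"
  shows "x = 0"
proof -
  have ne: "graph3 A B \<noteq> graph3 A' B'" using assms(4) by (simp add: graph3_inj)
  have z: "(0, 0, B x + B' x) \<in> zsub" by (simp add: zsub_def)
  have "(x, A x, B x) + (x, A' x, B' x) + (0, 0, B x + B' x) = (0 :: gf16 vec3)"
    using assms(5) by (simp add: zero_prod_def)
  from indep3D[OF phyp_indep[OF assms(1)] graph3_mem[OF assms(2)] graph3_mem[OF assms(3)] insertI1
      ne graph3_neq(2) graph3_neq(2) mem_graph3 mem_graph3 z this]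
  show ?thesis by (simp add: zero_prod_def)
qed

lemma phyp_differ2:
  assumes "phyp T" "(A, B) \<in> T" "(A', B') \<in> T" "(A, B) \<noteq> (A', B')" "B x = B' x"
  shows "x = 0"
proof -
  have ne: "graph3 A B \<noteq> graph3 A' B'" using assms(4) by (simp add: graph3_inj)
  have z: "(0, A x + A' x, 0) \<in> ysub" by (simp add: ysub_def)
  have "(x, A x, B x) + (x, A' x, B' x) + (0, A x + A' x, 0) = (0 :: gf16 vec3)"
    using assms(5) by (simp add: zero_prod_def)
  from indep3D[OF phyp_indep[OF assms(1)] graph3_mem[OF assms(2)] graph3_mem[OF assms(3)] ysub_mem
      ne graph3_neq(1) graph3_neq(1) mem_graph3 mem_graph3 z this]
  show ?thesis by (simp add: zero_prod_def)
qed

lemma phyp_triple: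
  assumes "phyp T" "(A, B) \<in> T" "(A', B') \<in> T" "(A'', B'') \<in> T"
    "(A, B) \<noteq> (A', B')" "(A, B) \<noteq> (A'', B'')" "(A', B') \<noteq> (A'', B'')"
    "A x + A' y = A'' (x + y)" "B x + B' y = B'' (x + y)"
  shows "x = 0 \<and> y = 0"
proof -
  have ne: "graph3 A B \<noteq> graph3 A' B'" "graph3 A B \<noteq> graph3 A'' B''" "graph3 A' B' \<noteq> graph3 A'' B''"
    using assms(5-7) by (simp_all add: graph3_inj)
  have "(x, A x, B x) + (y, A' y, B' y) + (x + y, A'' (x + y), B'' (x + y)) = (0 :: gf16 vec3)"
    using assms(8,9) by (simp add: zero_prod_def)
  from indep3D[OF phyp_indep[OF assms(1)] graph3_mem[OF assms(2)] graph3_mem[OF assms(3)]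
      graph3_mem[OF assms(4)] ne mem_graph3 mem_graph3 mem_graph3 this]
  show ?thesis by (simp add: zero_prod_def)
qed

text \<open>The nucleus has to be fixed so that the independence of all eighteen subspaces is
  transported, not only that of the seventeen members.\<close>

definition geqv :: "(gmap \<times> gmap) set \<Rightarrow> (gmap \<times> gmap) set \<Rightarrow> bool" where
  "geqv T T' \<longleftrightarrow> (\<exists>g. addmap g \<and> bij g \<and> (`) g ` members T = members T' \<and> g ` zsub = zsub)"

lemma geqv_refl: "geqv T T"
  unfolding geqv_def by (rule exI[of _ id]) (simp add: addmap_id)

lemma geqv_trans:
  assumes "geqv T T'" "geqv T' T''" shows "geqv T T''"
proof -
  obtain g where g: "addmap g" "bij g" "(`) g ` members T = members T'" "g ` zsub = zsub"
    using assms(1) by (auto simp: geqv_def)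
  obtain h where h: "addmap h" "bij h" "(`) h ` members T' = members T''" "h ` zsub = zsub"
    using assms(2) by (auto simp: geqv_def)
  have "(`) (h \<circ> g) ` members T = (`) h ` ((`) g ` members T)"
    unfolding image_image by (simp add: image_comp)
  moreover have "(h \<circ> g) ` zsub = h ` (g ` zsub)" by (simp add: image_comp)
  ultimately show ?thesis
    unfolding geqv_def using g h addmap_comp[OF h(1) g(1)] bij_comp[OF g(2) h(2)]
    by (intro exI[of _ "h \<circ> g"]) simp
qed

lemma phyp_geqv:
  assumes "phyp T" "geqv T T'" "wf T'" shows "phyp T'"
proof -
  obtain g where g: "addmap g" "bij g" "(`) g ` members T = members T'" "g ` zsub = zsub"
    using assms(2) by (auto simp: geqv_def)
  have "(`) g ` insert zsub (members T) = insert zsub (members T')"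
    using g by simp
  then show ?thesis
    using indep3_image[OF g(1) bij_is_inj[OF g(2)], of "insert zsub (members T)"] assms
    by (simp add: phyp_def)
qed

section \<open>Changes of coordinates\<close>

lemma fun_inj_image:
  assumes "card T = 16" "\<And>p q. p \<in> T \<Longrightarrow> q \<in> T \<Longrightarrow> f p = f q \<Longrightarrow> p = q"
  shows "card (f ` T) = 16"
  using assms by (subst card_image) (auto intro: inj_onI)

definition shiftT :: "gmap \<Rightarrow> gmap \<Rightarrow> (gmap \<times> gmap) set \<Rightarrow> (gmap \<times> gmap) set" where
  "shiftT A0 B0 T = (\<lambda>(A, B). (\<lambda>x. A x + A0 x, \<lambda>x. B x + B0 x)) ` T"

lemma shiftT:
  assumes "phyp T" "addmap A0" "addmap B0"
  shows "geqv T (shiftT A0 B0 T)" "phyp (shiftT A0 B0 T)"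
proof -
  define g :: "gf16 vec3 \<Rightarrow> gf16 vec3" where "g = (\<lambda>(x, y, z). (x, y + A0 x, z + B0 x))"
  have gi: "g (g v) = v" for v by (cases v) (simp add: g_def add.assoc)
  have bij: "bij g" by (rule o_bij[of g g]) (auto simp: gi)
  have add: "addmap g"
    using assms(2,3) by (auto simp: addmap_def g_def ac_simps)
  have gr: "g ` graph3 A B = graph3 (\<lambda>x. A x + A0 x) (\<lambda>x. B x + B0 x)" for A B
    by (simp add: graph3_def image_image g_def)
  have "g ` ysub = ysub" "g ` zsub = zsub"
    using addmap_0[OF assms(2)] addmap_0[OF assms(3)]
    by (simp_all add: ysub_def zsub_def image_image g_def)
  then show eq: "geqv T (shiftT A0 B0 T)"
    unfolding geqv_def members_def shiftT_def using add bij
    by (intro exI[of _ g]) (auto simp: image_image case_prod_beta gr)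
  have "card (shiftT A0 B0 T) = 16" unfolding shiftT_def
    by (rule fun_inj_image) (use phypD[OF assms(1)] in \<open>auto simp: fun_eq_iff\<close>)
  then have "wf (shiftT A0 B0 T)"
    using phypD[OF assms(1)] assms(2,3) by (auto simp: wf_def shiftT_def addmap_add)
  then show "phyp (shiftT A0 B0 T)" by (rule phyp_geqv[OF assms(1) eq])
qed

definition linT :: "gmap \<Rightarrow> gmap \<Rightarrow> gmap \<Rightarrow> (gmap \<times> gmap) set \<Rightarrow> (gmap \<times> gmap) set" where
  "linT P Q R T = (\<lambda>(A, B). (Q \<circ> A \<circ> P, R \<circ> B \<circ> P)) ` T"

lemma bij_comp_cancel:
  assumes "bij P" "bij Q" "Q \<circ> A \<circ> P = Q \<circ> A' \<circ> P" shows "A = A'"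
proof
  fix x
  obtain y where "x = P y" using assms(1) by (metis bij_pointE)
  then have "Q (A x) = Q (A' x)" using assms(3) by (metis comp_apply)
  then show "A x = A' x" using assms(2) by (simp add: bij_def inj_eq)
qed

lemma linT:
  assumes "phyp T" "addmap P" "bij P" "addmap Q" "bij Q" "addmap R" "bij R"
  shows "geqv T (linT P Q R T)" "phyp (linT P Q R T)"
proof -
  define g :: "gf16 vec3 \<Rightarrow> gf16 vec3" where "g = (\<lambda>(x, y, z). (inv P x, Q y, R z))"
  have i: "inj (inv P)" by (rule bij_is_inj[OF bij_imp_bij_inv[OF assms(3)]])
  note j = i bij_is_inj[OF assms(5)] bij_is_inj[OF assms(7)]
  have "inj g"
  proof (rule injI)
    fix u v assume e: "g u = g v"
    obtain x y z x' y' z' where uv: "u = (x, y, z)" "v = (x', y', z')" by (cases u, cases v) blast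
    have "inv P x = inv P x'" "Q y = Q y'" "R z = R z'" using e by (simp_all add: uv g_def)
    from j(1)[THEN injD, OF this(1)] j(2)[THEN injD, OF this(2)] j(3)[THEN injD, OF this(3)]
    show "u = v" unfolding uv by simp
  qed
  then have bij: "bij g" unfolding bij_def using finite_UNIV_inj_surj[of g] by auto
  have add: "addmap g"
    using addmap_inv[OF assms(2,3)] assms(4,6) by (auto simp: addmap_def g_def)
  have gr: "g ` graph3 A B = graph3 (Q \<circ> A \<circ> P) (R \<circ> B \<circ> P)" for A B
  proof -
    have "g ` graph3 A B = range (\<lambda>x. (inv P x, Q (A x), R (B x)))"
      by (simp add: graph3_def image_image g_def)
    also have "\<dots> = (\<lambda>x. (inv P x, Q (A x), R (B x))) ` range P"
      by (simp only: bij_is_surj[OF assms(3)])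
    also have "\<dots> = graph3 (Q \<circ> A \<circ> P) (R \<circ> B \<circ> P)"
      unfolding graph3_def image_image by (simp add: inv_f_f[OF bij_is_inj[OF assms(3)]])
    finally show ?thesis .
  qed
  have P0: "inv P 0 = 0" using addmap_inv[OF assms(2,3)] by (rule addmap_0)
  note sur = bij_is_surj[OF assms(5)] bij_is_surj[OF assms(7)]
  have "g ` ysub = (\<lambda>y. (0, y, 0)) ` range Q" "g ` zsub = (\<lambda>y. (0, 0, y)) ` range R"
    using P0 addmap_0[OF assms(4)] addmap_0[OF assms(6)]
    by (simp_all add: ysub_def zsub_def image_image g_def)
  then have "g ` ysub = ysub" "g ` zsub = zsub"
    unfolding sur by (simp_all add: ysub_def zsub_def)
  then show eq: "geqv T (linT P Q R T)"
    unfolding geqv_def members_def linT_def using add bij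
    by (intro exI[of _ g]) (auto simp: image_image case_prod_beta gr)
  have "card (linT P Q R T) = 16" unfolding linT_def
  proof (rule fun_inj_image)
    show "card T = 16" using phypD[OF assms(1)] by simp
    fix p q
    assume "(\<lambda>(A, B). (Q \<circ> A \<circ> P, R \<circ> B \<circ> P)) p = (\<lambda>(A, B). (Q \<circ> A \<circ> P, R \<circ> B \<circ> P)) q"
    then show "p = q"
      using bij_comp_cancel[OF assms(3,5), of "fst p" "fst q"] bij_comp_cancel[OF assms(3,7), of "snd p" "snd q"]
      by (simp add: case_prod_beta prod_eq_iff)
  qed
  then have "wf (linT P Q R T)"
    using phypD[OF assms(1)] assms by (auto simp: wf_def linT_def intro!: addmap_comp)
  then show "phyp (linT P Q R T)" by (rule phyp_geqv[OF assms(1) eq])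
qed

text \<open>This exchanges the nucleus with \<open>ysub\<close>. It is not an equivalence of the
  seventeen members, but the eighteen subspaces stay the same up to coordinates, and this is enough
  to apply results on first components to second ones.\<close>

definition swapT :: "(gmap \<times> gmap) set \<Rightarrow> (gmap \<times> gmap) set" where
  "swapT T = (\<lambda>(A, B). (B, A)) ` T"

lemma swapT:
  assumes "phyp T" shows "phyp (swapT T)"
proof -
  define g :: "gf16 vec3 \<Rightarrow> gf16 vec3" where "g = (\<lambda>(x, y, z). (x, z, y))"
  have gi: "g (g v) = v" for v by (cases v) (simp add: g_def)
  have inj: "inj g" by (rule inj_on_inverseI[of _ g]) (simp add: gi)
  have add: "addmap g" by (auto simp: addmap_def g_def)
  have "(`) g ` insert zsub (members T) = insert zsub (members (swapT T))"
  proof -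
    have "g ` ysub = zsub" "g ` zsub = ysub" "\<And>A B. g ` graph3 A B = graph3 B A"
      by (auto simp: ysub_def zsub_def graph3_def image_image g_def)
    then show ?thesis
      by (auto simp: members_def swapT_def image_image case_prod_beta)
  qed
  then have "indep3 (insert zsub (members (swapT T)))"
    using indep3_image[OF add inj] assms by (metis phyp_def)
  moreover have "card (swapT T) = 16" unfolding swapT_def
    by (rule fun_inj_image) (use phypD[OF assms] in auto)
  ultimately show ?thesis
    using phypD[OF assms] by (auto simp: phyp_def wf_def swapT_def)
qed

abbreviation zmap :: gmap where "zmap \<equiv> \<lambda>_. 0"

text \<open>The exchange of the first two coordinates swaps \<open>ysub\<close> with the graph of
  the zero pair and reparametrizes every other graph by y = A x.\<close>

definition invT :: "(gmap \<times> gmap) set \<Rightarrow> (gmap \<times> gmap) set" where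
  "invT T = insert (zmap, zmap) ((\<lambda>(A, B). (inv A, B \<circ> inv A)) ` (T - {(zmap, zmap)}))"

lemma phyp_bij:
  assumes "phyp T" "(zmap, zmap) \<in> T" "(A, B) \<in> T - {(zmap, zmap)}"
  shows "bij A" "bij B"
proof -
  have "x = 0" if "A x = 0" for x
    using phyp_differ1[OF assms(1), of A B zmap zmap x] assms that by auto
  then show "bij A" using addmap_bij phypD[OF assms(1)] assms(3) by blast
  have "x = 0" if "B x = 0" for x
    using phyp_differ2[OF assms(1), of A B zmap zmap x] assms that by auto
  then show "bij B" using addmap_bij phypD[OF assms(1)] assms(3) by blast
qed

lemma invT:
  assumes "phyp T" "(zmap, zmap) \<in> T"
  shows "geqv T (invT T)" "phyp (invT T)"
proof -
  define g :: "gf16 vec3 \<Rightarrow> gf16 vec3" where "g = (\<lambda>(x, y, z). (y, x, z))"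
  have gi: "g (g v) = v" for v by (cases v) (simp add: g_def)
  have bij: "bij g" by (rule o_bij[of g g]) (auto simp: gi)
  have add: "addmap g" by (auto simp: addmap_def g_def)
  have gr: "g ` graph3 A B = graph3 (inv A) (B \<circ> inv A)" if "bij A" for A B
  proof -
    have "graph3 (inv A) (B \<circ> inv A) = (\<lambda>x. (x, inv A x, B (inv A x))) ` range A"
      unfolding graph3_def by (simp only: bij_is_surj[OF that] comp_apply)
    also have "\<dots> = g ` graph3 A B"
      unfolding graph3_def image_image by (simp add: g_def inv_f_f[OF bij_is_inj[OF that]])
    finally show ?thesis ..
  qed
  have y: "g ` ysub = graph3 zmap zmap" "g ` graph3 zmap zmap = ysub" "g ` zsub = zsub"
    by (simp_all add: ysub_def zsub_def graph3_def image_image g_def)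
  have T: "T = insert (zmap, zmap) (T - {(zmap, zmap)})" using assms by auto
  have "(`) g ` members T = members (invT T)"
  proof -
    define F where "F = (\<lambda>(A, B). graph3 A B)"
    define I where "I = (\<lambda>(A :: gmap, B :: gmap). (inv A, B \<circ> inv A))"
    have "(`) g ` F ` (T - {(zmap, zmap)}) = F ` I ` (T - {(zmap, zmap)})"
      unfolding image_image by (rule image_cong) (use gr phyp_bij[OF assms] in \<open>auto simp: F_def I_def\<close>)
    moreover have "members T = insert ysub (insert (graph3 zmap zmap) (F ` (T - {(zmap, zmap)})))"
    proof -
      have "F ` T = insert (F (zmap, zmap)) (F ` (T - {(zmap, zmap)}))" using T by (metis image_insert)
      then show ?thesis unfolding members_def F_def[symmetric] by (simp add: F_def)
    qed
    moreover have "members (invT T) = insert ysub (insert (graph3 zmap zmap) (F ` I ` (T - {(zmap, zmap)})))"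
      unfolding members_def invT_def F_def[symmetric] I_def[symmetric] by (simp add: F_def)
    ultimately show ?thesis by (simp add: y insert_commute)
  qed
  then show eq: "geqv T (invT T)"
    unfolding geqv_def using add bij y by blast
  have "inj_on (\<lambda>(A, B). (inv A, B \<circ> inv A)) (T - {(zmap, zmap)})"
  proof (rule inj_onI)
    fix p q
    assume p: "p \<in> T - {(zmap, zmap)}" and q: "q \<in> T - {(zmap, zmap)}"
      and e: "(\<lambda>(A, B). (inv A, B \<circ> inv A)) p = (\<lambda>(A, B). (inv A, B \<circ> inv A)) q"
    obtain A B A' B' where pq: "p = (A, B)" "q = (A', B')" by (cases p, cases q) blast
    have e': "inv A = inv A'" "B \<circ> inv A = B' \<circ> inv A'"
      using e unfolding pq prod.case prod.inject by (elim conjunct1 conjunct2)+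
    have b: "bij A" "bij A'" using phyp_bij[OF assms] p q unfolding pq by blast+
    have "A = A'" using b e'(1) by (metis inv_inv_eq)
    then have "B \<circ> inv A \<circ> A = B' \<circ> inv A \<circ> A" using e'(2) by simp
    then have "B = B'"
      unfolding o_assoc[symmetric] inv_o_cancel[OF bij_is_inj[OF b(1)]] by simp
    then show "p = q" using \<open>A = A'\<close> pq by simp
  qed
  moreover have "(zmap, zmap) \<notin> (\<lambda>(A, B). (inv A, B \<circ> inv A)) ` (T - {(zmap, zmap)})"
  proof
    assume "(zmap, zmap) \<in> (\<lambda>(A, B). (inv A, B \<circ> inv A)) ` (T - {(zmap, zmap)})"
    then obtain p where p: "(zmap, zmap) = (\<lambda>(A, B). (inv A, B \<circ> inv A)) p" "p \<in> T - {(zmap, zmap)}"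
      by (rule imageE)
    obtain A B where pq: "p = (A, B)" by (cases p) blast
    have "inv A = zmap" using p(1) unfolding pq prod.case prod.inject by (elim conjE) simp
    moreover have "(A, B) \<in> T - {(zmap, zmap)}" using p(2) pq by simp
    ultimately have "(A, B) \<in> T - {(zmap, zmap)}" "inv A = zmap" by simp_all
    then have "bij zmap" using phyp_bij[OF assms] bij_imp_bij_inv by metis
    then show False by (metis bij_def injD zero_neq_one)
  qed
  ultimately have "card (invT T) = 16"
    using phypD[OF assms(1)] assms(2) by (simp add: invT_def card_image)
  moreover have "addmap A \<and> addmap B" if ab: "(A, B) \<in> invT T" for A B
  proof (cases "(A, B) = (zmap, zmap)")
    case False
    then obtain p where p: "(A, B) = (\<lambda>(A, B). (inv A, B \<circ> inv A)) p" "p \<in> T - {(zmap, zmap)}"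
      using ab unfolding invT_def by blast
    obtain A' B' where pq: "p = (A', B')" by (cases p) blast
    have m: "(A', B') \<in> T - {(zmap, zmap)}" using p(2) pq by simp
    have "bij A'" "addmap A'" "addmap B'"
      using phyp_bij(1)[OF assms m] phypD(3,4)[OF assms(1)] m by blast+
    then show ?thesis using p(1) unfolding pq
      by (simp add: addmap_inv addmap_comp)
  qed (simp add: addmap_zero)
  ultimately have "wf (invT T)" by (auto simp: wf_def)
  then show "phyp (invT T)" by (rule phyp_geqv[OF assms(1) eq])
qed

lemma gf16_add_cancel2 [simp]: "x + y + y = (x :: gf16)"
  by (simp only: add.assoc gf16_double add_0_right)

section \<open>Spread sets\<close>

text \<open>Only spread sets that extend to a pseudo-oval are considered, since the other planes are
  excluded by means of the second components.\<close>

definition osp :: "gmap set \<Rightarrow> bool" where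
  "osp S \<longleftrightarrow> (\<exists>T. phyp T \<and> S = fst ` T)"

lemma phyp_fst_inj:
  assumes "phyp T" shows "inj_on fst T"
proof (rule inj_onI)
  fix p q assume m: "p \<in> T" "q \<in> T" "fst p = fst q"
  show "p = q"
  proof (rule ccontr)
    assume ne: "p \<noteq> q"
    obtain A B A' B' where pq: "p = (A, B)" "q = (A', B')" by (cases p, cases q) blast
    have "(1 :: gf16) = 0"
      by (rule phyp_differ1[OF assms m(1)[unfolded pq] m(2)[unfolded pq] ne[unfolded pq]])
        (use m(3) pq in simp)
    then show False by simp
  qed
qed

lemma osp_card: assumes "osp S" shows "card S = 16" "finite S"
proof -
  obtain T where T: "phyp T" "S = fst ` T" using assms by (auto simp: osp_def)
  show "card S = 16" using card_image[OF phyp_fst_inj[OF T(1)]] phypD(2)[OF T(1)] T(2) by simp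
  then show "finite S" by (metis card.infinite zero_neq_numeral)
qed

lemma osp_addmap: "osp S \<Longrightarrow> A \<in> S \<Longrightarrow> addmap A"
  using phypD(3) by (fastforce simp: osp_def)

lemma osp_differ:
  assumes "osp S" "A \<in> S" "A' \<in> S" "A \<noteq> A'" "A x = A' x" shows "x = 0"
proof -
  obtain T where T: "phyp T" "S = fst ` T" using assms by (auto simp: osp_def)
  obtain B B' where "(A, B) \<in> T" "(A', B') \<in> T" using assms(2,3) T(2) by auto
  then show ?thesis using phyp_differ1[OF T(1)] assms(4,5) by blast
qed

lemma osp_bij:
  assumes "osp S" "A \<in> S" "zmap \<in> S" "A \<noteq> zmap" shows "bij A"
  by (rule addmap_bij[OF osp_addmap[OF assms(1,2)]]) (use osp_differ[OF assms] in auto)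

lemma osp_shift:
  assumes "osp S" "addmap A0" shows "osp ((\<lambda>A x. A x + A0 x) ` S)"
proof -
  obtain T where T: "phyp T" "S = fst ` T" using assms by (auto simp: osp_def)
  have "fst ` shiftT A0 zmap T = (\<lambda>A x. A x + A0 x) ` S"
    unfolding T(2) shiftT_def image_image by (rule image_cong) auto
  then show ?thesis using shiftT(2)[OF T(1) assms(2) addmap_zero] unfolding osp_def by metis
qed

lemma osp_lin:
  assumes "osp S" "addmap P" "bij P" "addmap Q" "bij Q"
  shows "osp ((\<lambda>A. Q \<circ> A \<circ> P) ` S)"
proof -
  obtain T where T: "phyp T" "S = fst ` T" using assms by (auto simp: osp_def)
  have "fst ` linT P Q id T = (\<lambda>A. Q \<circ> A \<circ> P) ` S"
    unfolding T(2) linT_def image_image by (rule image_cong) auto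
  then show ?thesis
    using linT(2)[OF T(1) assms(2-5) addmap_id(2) bij_id] unfolding osp_def by metis
qed

definition inv_set :: "gmap set \<Rightarrow> gmap set" where
  "inv_set S = insert zmap (inv ` (S - {zmap}))"

text \<open>Adding a map to all second components leaves the first components alone.\<close>

lemma phyp_zero:
  assumes "phyp T" "zmap \<in> fst ` T"
  obtains T' where "phyp T'" "fst ` T' = fst ` T" "(zmap, zmap) \<in> T'"
proof -
  obtain B where B: "(zmap, B) \<in> T" using assms(2) by auto
  have b: "addmap B" using phypD(4)[OF assms(1) B] .
  have "fst ` shiftT zmap B T = fst ` T"
    unfolding shiftT_def image_image by (rule image_cong) auto
  moreover have "(zmap, zmap) \<in> shiftT zmap B T"
    unfolding shiftT_def by (rule image_eqI[OF _ B]) simp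
  ultimately show ?thesis using that shiftT(2)[OF assms(1) addmap_zero b] by blast
qed

lemma osp_inv:
  assumes "osp S" "zmap \<in> S" shows "osp (inv_set S)"
proof -
  obtain T0 where T0: "phyp T0" "S = fst ` T0" using assms by (auto simp: osp_def)
  then obtain T where T: "phyp T" "fst ` T = S" "(zmap, zmap) \<in> T"
    using phyp_zero[OF T0(1)] assms(2) by metis
  have "fst ` (T - {(zmap, zmap)}) = S - {zmap}"
    using inj_on_image_set_diff[OF phyp_fst_inj[OF T(1)], of T "{(zmap, zmap)}"] T by simp
  then have "fst ` invT T = inv_set S"
    unfolding invT_def inv_set_def by (simp add: image_image case_prod_beta) (metis image_image)
  then show ?thesis using invT(2)[OF T(1,3)] unfolding osp_def by metis
qed

text \<open>\<open>desarg S\<close> says that \<open>S\<close> is a Desarguesian spread set, in a form that does not depend on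
  the chosen coordinates.\<close>

definition desarg :: "gmap set \<Rightarrow> bool" where
  "desarg S \<longleftrightarrow> (\<exists>(P :: gmap) (Q :: gmap) (R :: gmap). addmap P \<and> bij P \<and> addmap Q \<and> bij Q \<and> addmap R \<and>
     (\<forall>c. (\<lambda>x. Q (c * P x) + R x) \<in> S))"

lemma desarg_shift:
  assumes "addmap A0" "desarg ((\<lambda>A x. A x + A0 x) ` S)" shows "desarg S"
proof -
  obtain P Q R :: gmap where h: "addmap P" "bij P" "addmap Q" "bij Q" "addmap R"
    and c: "\<And>c. (\<lambda>x. Q (c * P x) + R x) \<in> (\<lambda>A x. A x + A0 x) ` S"
    using assms(2) unfolding desarg_def by blast
  have "(\<lambda>x. Q (c * P x) + (R x + A0 x)) \<in> S" for c
  proof -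
    obtain A where A: "A \<in> S" "(\<lambda>x. Q (c * P x) + R x) = (\<lambda>x. A x + A0 x)" using c by blast
    have "Q (c * P x) + (R x + A0 x) = A x" for x
      using fun_cong[OF A(2), of x] by (simp only: add.assoc[symmetric]) (rule gf16_add_cancel2)
    then have eq: "(\<lambda>x. Q (c * P x) + (R x + A0 x)) = A" by (rule ext)
    show ?thesis unfolding eq by (rule A(1))
  qed
  then show ?thesis unfolding desarg_def using h(1-4) addmap_add[OF h(5) assms(1)] by blast
qed

lemma desarg_lin:
  assumes "addmap P0" "bij P0" "addmap Q0" "bij Q0" "desarg ((\<lambda>A. Q0 \<circ> A \<circ> P0) ` S)"
  shows "desarg S"
proof -
  obtain P Q R :: gmap where h: "addmap P" "bij P" "addmap Q" "bij Q" "addmap R"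
    and c: "\<And>c. (\<lambda>x. Q (c * P x) + R x) \<in> (\<lambda>A. Q0 \<circ> A \<circ> P0) ` S"
    using assms(5) unfolding desarg_def by blast
  note i = addmap_inv[OF assms(1,2)] addmap_inv[OF assms(3,4)]
    bij_imp_bij_inv[OF assms(2)] bij_imp_bij_inv[OF assms(4)]
  have "(\<lambda>x. (inv Q0 \<circ> Q) (c * (P \<circ> inv P0) x) + (inv Q0 \<circ> R \<circ> inv P0) x) \<in> S" for c
  proof -
    obtain A where A: "A \<in> S" "(\<lambda>x. Q (c * P x) + R x) = Q0 \<circ> A \<circ> P0" using c by blast
    have "(inv Q0 \<circ> Q) (c * (P \<circ> inv P0) x) + (inv Q0 \<circ> R \<circ> inv P0) x = A x" for x
    proof -
      have "Q (c * P (inv P0 x)) + R (inv P0 x) = Q0 (A x)"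
        using fun_cong[OF A(2), of "inv P0 x"] assms(2) by (simp add: bij_is_surj surj_f_inv_f)
      then have "inv Q0 (Q (c * P (inv P0 x)) + R (inv P0 x)) = A x"
        using assms(4) by (simp add: bij_is_inj inv_f_f)
      then show ?thesis using i(2) by (simp add: addmapD)
    qed
    then have eq: "(\<lambda>x. (inv Q0 \<circ> Q) (c * (P \<circ> inv P0) x) + (inv Q0 \<circ> R \<circ> inv P0) x) = A" by (rule ext)
    show ?thesis unfolding eq by (rule A(1))
  qed
  then show ?thesis unfolding desarg_def
    using addmap_comp[OF h(1) i(1)] bij_comp[OF i(3) h(2)] addmap_comp[OF i(2) h(3)]
      bij_comp[OF h(4) i(4)] addmap_comp[OF addmap_comp[OF i(2) h(5)] i(1)] by blast
qed

text \<open>The sixteen maps named in \<open>desarg\<close> exhaust \<open>S\<close>. One of them is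
  zero, so R x = Q (d * P x) for some d, and R is absorbed by replacing c with c + d.\<close>

lemma desarg_family:
  assumes "osp S" "zmap \<in> S" "desarg S"
  obtains P Q :: gmap where "addmap P" "bij P" "addmap Q" "bij Q" "S = range (\<lambda>c x. Q (c * P x))"
proof -
  obtain P Q R :: gmap where h: "addmap P" "bij P" "addmap Q" "bij Q" "addmap R"
    and c: "\<And>c. (\<lambda>x. Q (c * P x) + R x) \<in> S"
    using assms(3) unfolding desarg_def by blast
  define F where "F c = (\<lambda>x. Q (c * P x) + R x)" for c
  have "inj F"
  proof (rule injI)
    fix c d assume e: "F c = F d"
    obtain x where x: "P x = 1" using h(2) by (metis bij_pointE)
    have "Q (c * P x) = Q (d * P x)" using fun_cong[OF e, of x] by (simp add: F_def)
    then show "c = d" using h(4) x by (simp add: bij_def inj_eq)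
  qed
  then have "card (range F) = 16" by (simp add: card_image card_gf16)
  moreover have "range F \<subseteq> S" using c by (auto simp: F_def)
  ultimately have S: "S = range F"
    using osp_card[OF assms(1)] card_subset_eq by metis
  then obtain d where d: "zmap = F d" using assms(2) by auto
  have R: "R x = Q (d * P x)" for x
    using fun_cong[OF d, of x] by (simp add: F_def eq_commute[of 0])
  have "F c = (\<lambda>x. Q ((c + d) * P x))" for c
    by (simp add: F_def R distrib_right addmapD[OF h(3)])
  then have "S = (\<lambda>c x. Q (c * P x)) ` range (\<lambda>c. c + d)"
    unfolding S image_image by (intro image_cong) auto
  moreover have "range (\<lambda>c. c + d) = UNIV"
  proof -
    have "c \<in> range (\<lambda>c. c + d)" for c
      by (rule image_eqI[of _ _ "c + d"]) (simp_all add: add.assoc)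
    then show ?thesis by blast
  qed
  ultimately show ?thesis using that h by metis
qed

lemma bij_mult: "c \<noteq> 0 \<Longrightarrow> bij ((*) (c :: gf16))"
  by (rule addmap_bij[OF addmap_mult]) simp

lemma inv_mult: "c \<noteq> 0 \<Longrightarrow> inv ((*) (c :: gf16)) = (*) (inverse c)"
  by (rule inv_unique_comp) (auto simp: fun_eq_iff)

lemma desarg_inv:
  assumes "osp S" "zmap \<in> S" "desarg (inv_set S)" shows "desarg S"
proof -
  obtain P Q :: gmap where h: "addmap P" "bij P" "addmap Q" "bij Q" "inv_set S = range (\<lambda>c x. Q (c * P x))"
    using desarg_family[OF osp_inv[OF assms(1,2)] _ assms(3)] by (auto simp: inv_set_def)
  have "(\<lambda>x. inv P (c * inv Q x) + 0) \<in> S" for c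
  proof (cases "c = 0")
    case True
    then show ?thesis using assms(2) addmap_0[OF addmap_inv[OF h(1,2)]] by simp
  next
    case False
    define M where "M = (\<lambda>x. Q (inverse c * P x))"
    have M: "M = Q \<circ> (*) (inverse c) \<circ> P" by (auto simp: M_def)
    have b: "bij ((*) (inverse c))" using False by (simp add: bij_mult)
    have bM: "bij M" unfolding M by (intro bij_comp h b)
    have iM: "inv M = (\<lambda>x. inv P (c * inv Q x))"
    proof (rule inv_unique_comp)
      note r = surj_f_inv_f[OF bij_is_surj[OF h(2)]] surj_f_inv_f[OF bij_is_surj[OF h(4)]]
        inv_f_f[OF bij_is_inj[OF h(2)]] inv_f_f[OF bij_is_inj[OF h(4)]]
      show "M \<circ> (\<lambda>x. inv P (c * inv Q x)) = id" "(\<lambda>x. inv P (c * inv Q x)) \<circ> M = id"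
        using False by (auto simp: fun_eq_iff M_def r mult.assoc[symmetric])
    qed
    have "M \<in> inv_set S" unfolding h(5) M_def by blast
    moreover have "M \<noteq> zmap" using bM by (metis bij_is_inj injD zero_neq_one)
    ultimately obtain A where A: "A \<in> S" "A \<noteq> zmap" "M = inv A" by (auto simp: inv_set_def)
    have "inv M = A" using A osp_bij[OF assms(1) A(1) assms(2) A(2)] by (simp add: inv_inv_eq)
    then show ?thesis using iM A(1) by simp
  qed
  then show ?thesis unfolding desarg_def
    using addmap_inv[OF h(1,2)] addmap_inv[OF h(3,4)] bij_imp_bij_inv[OF h(2)]
      bij_imp_bij_inv[OF h(4)] addmap_zero by blast
qed

text \<open>\<open>frame S S'\<close>: the spread set \<open>S'\<close> describes \<open>S\<close> in other coordinates.\<close>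

definition frame :: "gmap set \<Rightarrow> gmap set \<Rightarrow> bool" where
  "frame S S' \<longleftrightarrow> osp S' \<and> zmap \<in> S' \<and> (desarg S' \<longrightarrow> desarg S)"

lemma frame_refl: "osp S \<Longrightarrow> zmap \<in> S \<Longrightarrow> frame S S"
  by (simp add: frame_def)

lemma frameD: "frame S S' \<Longrightarrow> osp S'" "frame S S' \<Longrightarrow> zmap \<in> S'"
  "frame S S' \<Longrightarrow> desarg S' \<Longrightarrow> desarg S"
  by (simp_all add: frame_def)

lemma frameI: "osp S' \<Longrightarrow> zmap \<in> S' \<Longrightarrow> (desarg S' \<Longrightarrow> desarg S) \<Longrightarrow> frame S S'"
  by (simp add: frame_def)

lemma frame_shift:
  assumes "frame S S'" "A0 \<in> S'" shows "frame S ((\<lambda>A x. A x + A0 x) ` S')"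
proof (rule frameI)
  have a: "addmap A0" by (rule osp_addmap[OF frameD(1)[OF assms(1)] assms(2)])
  show "zmap \<in> (\<lambda>A x. A x + A0 x) ` S'" by (rule image_eqI[OF _ assms(2)]) simp
  show "osp ((\<lambda>A x. A x + A0 x) ` S')" by (rule osp_shift[OF frameD(1)[OF assms(1)] a])
  show "desarg S" if "desarg ((\<lambda>A x. A x + A0 x) ` S')"
    by (rule frameD(3)[OF assms(1) desarg_shift[OF a that]])
qed

lemma frame_inv:
  assumes "frame S S'" shows "frame S (inv_set S')"
proof (rule frameI)
  show "osp (inv_set S')" by (rule osp_inv[OF frameD(1,2)[OF assms]])
  show "zmap \<in> inv_set S'" by (simp add: inv_set_def)
  show "desarg S" if "desarg (inv_set S')"
    by (rule frameD(3)[OF assms desarg_inv[OF frameD(1,2)[OF assms] that]])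
qed

lemma frame_lin:
  assumes "frame S S'" "addmap P" "bij P" "addmap Q" "bij Q"
  shows "frame S ((\<lambda>A. Q \<circ> A \<circ> P) ` S')"
proof (rule frameI)
  show "zmap \<in> (\<lambda>A. Q \<circ> A \<circ> P) ` S'"
    by (rule image_eqI[OF _ frameD(2)[OF assms(1)]]) (simp add: addmap_0[OF assms(4)] comp_def)
  show "osp ((\<lambda>A. Q \<circ> A \<circ> P) ` S')" by (rule osp_lin[OF frameD(1)[OF assms(1)] assms(2-5)])
  show "desarg S" if "desarg ((\<lambda>A. Q \<circ> A \<circ> P) ` S')"
    by (rule frameD(3)[OF assms(1) desarg_lin[OF assms(2-5) that]])
qed

section \<open>Tables of additive maps\<close>

lemma addt_tab: "addt (tab f) (tab g) = tab (\<lambda>x. f x + g x)"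
  by (simp add: tab_def plus_gf16_def)

lemma compt_map: "compt l m = map (\<lambda>x. look x l) m"
  by (induction m) simp_all

lemma compt_tab: "compt (tab f) (tab g) = tab (f \<circ> g)"
  by (simp add: compt_map tab_def[of g] tab_def[of "f \<circ> g"])

lemma preim_map: "inj f \<Longrightarrow> x \<in> set us \<Longrightarrow> preim (f x) (map f us) us = x"
  by (induction us) (auto simp: inj_eq)

lemma gU_mem: "x \<in> set gU"
proof -
  have "\<forall>x. x \<in> set gU" unfolding all_gf16 by simp
  then show ?thesis ..
qed

lemma preim_tab:
  assumes "bij f" shows "preim y (tab f) gU = inv f y"
proof -
  have "preim (f (inv f y)) (map f gU) gU = inv f y"
    by (rule preim_map[OF bij_is_inj[OF assms] gU_mem])
  then show ?thesis unfolding surj_f_inv_f[OF bij_is_surj[OF assms]] tab_def .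
qed

lemma invt_tab: "bij f \<Longrightarrow> invt (tab f) = tab (inv f)"
  unfolding invt_def tab_def[of "inv f"] by (intro map_cong refl preim_tab)

lemma shiftl_map: "shiftl r l = map (\<lambda>x. r + x) l"
  by (induction l) (simp_all add: plus_gf16_def)

lemma tab_id: "tab (\<lambda>x. x) = gU" "tab id = gU"
  by (simp_all add: tab_def)

primrec bit0 :: "gf16 \<Rightarrow> bool" where
  "bit0 G0 = False" | "bit0 G1 = True" | "bit0 G2 = False" | "bit0 G3 = True"
| "bit0 G4 = False" | "bit0 G5 = True" | "bit0 G6 = False" | "bit0 G7 = True"
| "bit0 G8 = False" | "bit0 G9 = True" | "bit0 G10 = False" | "bit0 G11 = True"
| "bit0 G12 = False" | "bit0 G13 = True" | "bit0 G14 = False" | "bit0 G15 = True"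

primrec bit1 :: "gf16 \<Rightarrow> bool" where
  "bit1 G0 = False" | "bit1 G1 = False" | "bit1 G2 = True" | "bit1 G3 = True"
| "bit1 G4 = False" | "bit1 G5 = False" | "bit1 G6 = True" | "bit1 G7 = True"
| "bit1 G8 = False" | "bit1 G9 = False" | "bit1 G10 = True" | "bit1 G11 = True"
| "bit1 G12 = False" | "bit1 G13 = False" | "bit1 G14 = True" | "bit1 G15 = True"

primrec bit2 :: "gf16 \<Rightarrow> bool" where
  "bit2 G0 = False" | "bit2 G1 = False" | "bit2 G2 = False" | "bit2 G3 = False"
| "bit2 G4 = True" | "bit2 G5 = True" | "bit2 G6 = True" | "bit2 G7 = True"
| "bit2 G8 = False" | "bit2 G9 = False" | "bit2 G10 = False" | "bit2 G11 = False"
| "bit2 G12 = True" | "bit2 G13 = True" | "bit2 G14 = True" | "bit2 G15 = True"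

primrec bit3 :: "gf16 \<Rightarrow> bool" where
  "bit3 G0 = False" | "bit3 G1 = False" | "bit3 G2 = False" | "bit3 G3 = False"
| "bit3 G4 = False" | "bit3 G5 = False" | "bit3 G6 = False" | "bit3 G7 = False"
| "bit3 G8 = True" | "bit3 G9 = True" | "bit3 G10 = True" | "bit3 G11 = True"
| "bit3 G12 = True" | "bit3 G13 = True" | "bit3 G14 = True" | "bit3 G15 = True"

lemma bits_add:
  "bit0 (x + y) \<longleftrightarrow> bit0 x \<noteq> bit0 y" "bit1 (x + y) \<longleftrightarrow> bit1 x \<noteq> bit1 y"
  "bit2 (x + y) \<longleftrightarrow> bit2 x \<noteq> bit2 y" "bit3 (x + y) \<longleftrightarrow> bit3 x \<noteq> bit3 y"
proof -
  have "\<forall>x y. (bit0 (gadd x y) = (bit0 x \<noteq> bit0 y)) \<and> (bit1 (gadd x y) = (bit1 x \<noteq> bit1 y)) \<and>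
      (bit2 (gadd x y) = (bit2 x \<noteq> bit2 y)) \<and> (bit3 (gadd x y) = (bit3 x \<noteq> bit3 y))"
    by (simp only: all_gf16 gadd_tab bit0.simps bit1.simps bit2.simps bit3.simps simp_thms)
  then show "bit0 (x + y) \<longleftrightarrow> bit0 x \<noteq> bit0 y" "bit1 (x + y) \<longleftrightarrow> bit1 x \<noteq> bit1 y"
    "bit2 (x + y) \<longleftrightarrow> bit2 x \<noteq> bit2 y" "bit3 (x + y) \<longleftrightarrow> bit3 x \<noteq> bit3 y"
    unfolding plus_gf16_def by metis+
qed

text \<open>The values lie in an arbitrary group because this map also parametrizes the
  4-dimensional subspaces and embeds the concrete field into the given one.\<close>

definition lincomb :: "'a::ab_group_add \<Rightarrow> 'a \<Rightarrow> 'a \<Rightarrow> 'a \<Rightarrow> gf16 \<Rightarrow> 'a" where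
  "lincomb a b c d x = (if bit0 x then a else 0) + (if bit1 x then b else 0) +
     (if bit2 x then c else 0) + (if bit3 x then d else 0)"

lemma addmap_lincomb:
  assumes "a + a = 0" "b + b = 0" "c + c = 0" "d + d = 0"
  shows "addmap (lincomb a b c d)"
  unfolding addmap_def
proof (intro allI)
  have e: "(if (p \<noteq> q) then t else 0) = (if p then t else 0) + (if q then t else 0)"
    if "t + t = 0" for p q and t :: 'a
    using that by auto
  fix x y
  show "lincomb a b c d (x + y) = lincomb a b c d x + lincomb a b c d y"
    unfolding lincomb_def bits_add e[OF assms(1)] e[OF assms(2)] e[OF assms(3)] e[OF assms(4)]
    by (simp only: ac_simps)
qed

lemma addtab_tab: "addtab a b c d = tab (lincomb a b c d)"
  unfolding addtab_def ext_def shiftl_map tab_def lincomb_def list.map append.simps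
    bit0.simps bit1.simps bit2.simps bit3.simps if_True if_False
  unfolding zero_gf16_def[symmetric] by (simp add: ac_simps)

lemma addmap_lincomb_gf: "addmap (lincomb a b c (d :: gf16))"
  by (rule addmap_lincomb) simp_all

lemma lincomb_basis:
  "lincomb a b c d G1 = a" "lincomb a b c d G2 = b" "lincomb a b c d G4 = c" "lincomb a b c d G8 = d"
  by (simp_all add: lincomb_def)

lemma addmap_eq_lincomb:
  assumes "addmap f" shows "f x = lincomb (f G1) (f G2) (f G4) (f G8) x"
proof -
  have s: "G3 = G1 + G2" "G5 = G1 + G4" "G6 = G2 + G4" "G7 = G1 + G2 + G4" "G9 = G1 + G8"
    "G10 = G2 + G8" "G11 = G1 + G2 + G8" "G12 = G4 + G8" "G13 = G1 + G4 + G8" "G14 = G2 + G4 + G8"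
    "G15 = G1 + G2 + G4 + G8"
    by (simp_all add: plus_gf16_def)
  have "\<forall>x. f x = lincomb (f G1) (f G2) (f G4) (f G8) x"
    unfolding all_gf16 lincomb_def bit0.simps bit1.simps bit2.simps bit3.simps if_True if_False
    unfolding s addmapD[OF assms] addmap_0[OF assms, unfolded zero_gf16_def]
    unfolding zero_gf16_def[symmetric] by (simp add: addmap_0[OF assms])
  then show ?thesis ..
qed

section \<open>Soundness of the search for spread sets\<close>

lemma pick_sound:
  "set (fst (pick b hs acc) # snd (pick b hs acc)) = set (b # hs @ acc)"
  "distinct (map fst (b # hs @ acc)) \<Longrightarrow> distinct (map fst (fst (pick b hs acc) # snd (pick b hs acc)))"
  "length (snd (pick b hs acc)) = length hs + length acc"
proof (induction b hs acc rule: pick.induct)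
  case (2 b h hs acc)
  { case 1 show ?case using "2.IH"(1) "2.IH"(4) by (auto split: if_splits) }
  { case 2
    have "distinct (map fst (h # hs @ b # acc))" "distinct (map fst (b # hs @ h # acc))"
      using 2 by auto
    note d = this
    show ?case
    proof (cases "shorter (snd h) (snd b)")
      case True
      then have e: "pick b (h # hs) acc = pick h hs (b # acc)" by simp
      show ?thesis unfolding e by (rule "2.IH"(2)[OF True d(1)])
    next
      case False
      then have e: "pick b (h # hs) acc = pick b hs (h # acc)" by simp
      show ?thesis unfolding e by (rule "2.IH"(5)[OF False d(2)])
    qed }
  { case 3 show ?case using "2.IH"(3) "2.IH"(6) by (auto split: if_splits) }
qed auto

lemma prune_fst: "map fst (prune P gs) = map fst gs"
  by (induction gs) (auto simp: prune_def)

text \<open>A hypothetical solution is a function \<open>t\<close> on labels. In every group the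
  branch that picks \<open>t i\<close> is present, and by \<open>Q\<close> the values
  \<open>t j\<close> of the other labels survive its filter. So the search returns the solution, in
  an order \<open>ls'\<close> of the labels that depends on the branching.\<close>

lemma search_sound:
  assumes Q: "\<And>ls i j. distinct (i # j # ls) \<Longrightarrow> set (i # j # ls) \<subseteq> L \<Longrightarrow> Q (D (map t ls) (t i)) (t j)"
  shows "\<lbrakk>length us = length gs; distinct (map fst gs @ ls); fst ` set gs \<union> set ls \<subseteq> L;
      \<And>i g. (i, g) \<in> set gs \<Longrightarrow> t i \<in> set g\<rbrakk>
    \<Longrightarrow> \<exists>ls'. set ls' = fst ` set gs \<union> set ls \<and> map t ls' \<in> set (search D Q us (map t ls) gs)"
proof (induction us arbitrary: gs ls)
  case Nil
  then show ?case by (intro exI[of _ ls]) auto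
next
  case (Cons u us)
  obtain g gs' where gs: "gs = g # gs'" using Cons.prems(1) by (cases gs) auto
  obtain i cs rest where p: "pick g gs' [] = ((i, cs), rest)" by (metis surj_pair)
  have st: "insert (i, cs) (set rest) = set gs" "distinct (i # map fst rest)" "length rest = length gs'"
    using pick_sound[of g gs' "[]"] Cons.prems(2) p gs by auto
  have ti: "t i \<in> set cs" using Cons.prems(4)[of i cs] st(1) by auto
  define gs1 where "gs1 = prune (Q (D (map t ls) (t i))) rest"
  have f1: "map fst gs1 = map fst rest" by (simp add: gs1_def prune_fst)
  then have f2: "fst ` set gs1 = fst ` set rest" by (metis list.set_map)
  have labels: "fst ` set gs = insert i (fst ` set rest)" using st(1)[symmetric] by (auto intro: rev_image_eqI)
  have nl: "i \<notin> set ls" "fst ` set rest \<inter> set ls = {}" "distinct ls"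
    using Cons.prems(2) labels by auto
  have "\<exists>ls'. set ls' = fst ` set gs1 \<union> set (i # ls) \<and>
      map t ls' \<in> set (search D Q us (map t (i # ls)) gs1)"
  proof (rule Cons.IH)
    show "length us = length gs1"
      using Cons.prems(1) st(3) gs by (simp add: gs1_def prune_def)
    show "distinct (map fst gs1 @ i # ls)"
      using nl st(2) f1 by auto
    show "fst ` set gs1 \<union> set (i # ls) \<subseteq> L"
      using Cons.prems(3) f2 labels by auto
    fix j g' assume "(j, g') \<in> set gs1"
    then obtain g0 where g0: "(j, g0) \<in> set rest" "g' = filter (Q (D (map t ls) (t i))) g0"
      by (auto simp: gs1_def prune_def)
    have j: "j \<in> fst ` set rest" using g0(1) by force
    have "Q (D (map t ls) (t i)) (t j)"
    proof (rule Q)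
      show "distinct (i # j # ls)" using j nl st(2) by auto
      show "set (i # j # ls) \<subseteq> L" using j Cons.prems(3) labels by auto
    qed
    moreover have "t j \<in> set g0" using Cons.prems(4)[of j g0] g0(1) st(1) by auto
    ultimately show "t j \<in> set g'" using g0(2) by simp
  qed
  then obtain ls' where ls': "set ls' = fst ` set gs1 \<union> set (i # ls)"
    "map t ls' \<in> set (search D Q us (map t (i # ls)) gs1)" by blast
  have "map t ls' \<in> set (search D Q (u # us) (map t ls) gs)"
    using ls'(2) ti by (auto simp: gs p gs1_def)
  then show ?case using ls'(1) f2 labels by (intro exI[of _ ls']) auto
qed

text \<open>The list need not be the whole spread set. In particular the empty list is allowed,
  which takes care of operations that fail.\<close>

definition pool :: "gmap set \<Rightarrow> gf16 list list \<Rightarrow> bool" where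
  "pool S r \<longleftrightarrow> (\<exists>S'. frame S S' \<and> set r \<subseteq> tab ` (S' - {zmap}))"

lemma poolI: "frame S S' \<Longrightarrow> set r \<subseteq> tab ` (S' - {zmap}) \<Longrightarrow> pool S r"
  by (auto simp: pool_def)

lemma sel_mem: "sel y r = [] \<or> (sel y r \<in> set r \<and> look G1 (sel y r) = y)"
  by (induction r) auto

lemma shift_others_set: "set (shift_others y l r) = addt l ` {m \<in> set r. look G1 m \<noteq> y}"
  by (induction r) auto

lemma invertible_bij:
  assumes "invertible (tab P)" shows "bij P"
proof -
  have "map P (invt (tab P)) = gU"
    using assms by (simp add: invertible_def eqt_def compt_map)
  then have "set gU \<subseteq> range P" by (metis image_mono list.set_map subset_UNIV)
  then have "surj P" using gU_mem by blast
  then show ?thesis using finite_UNIV_surj_inj[of P] by (simp add: bij_def)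
qed

lemma tab_neq_Nil: "tab f \<noteq> []"
  by (simp add: tab_def)

lemma frame_bij: "frame S S' \<Longrightarrow> A \<in> S' - {zmap} \<Longrightarrow> bij A"
  using osp_bij[OF frameD(1) _ frameD(2)] by blast

lemma bij_neq_zmap: "bij A \<Longrightarrow> A \<noteq> zmap"
  by (metis bij_is_inj injD zero_neq_one)

lemma pool_op:
  assumes "pool S r" shows "pool S (apply_op p r)"
proof -
  obtain S' where S': "frame S S'" "set r \<subseteq> tab ` (S' - {zmap})" using assms by (auto simp: pool_def)
  have nil: "pool S []" by (rule poolI[OF S'(1)]) simp
  show ?thesis
  proof (cases p)
    case (Tr y)
    show ?thesis
    proof (cases "sel y r = []")
      case True
      then show ?thesis using nil Tr by (simp add: shift_all_def)
    next
      case False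
      then have l: "sel y r \<in> set r" "look G1 (sel y r) = y" using sel_mem by auto
      obtain A0 where A0: "A0 \<in> S' - {zmap}" "sel y r = tab A0" using l(1) S'(2) by blast
      let ?S = "(\<lambda>A x. A x + A0 x) ` S'"
      have "set (apply_op p r) \<subseteq> tab ` (?S - {zmap})"
      proof
        fix m assume "m \<in> set (apply_op p r)"
        then consider "m = tab A0" | m' where "m' \<in> set r" "look G1 m' \<noteq> y" "m = addt (tab A0) m'"
          using False by (auto simp: Tr shift_all_def shift_others_set A0(2))
        then show "m \<in> tab ` (?S - {zmap})"
        proof cases
          case 1
          have "A0 \<in> ?S" by (rule image_eqI[OF _ frameD(2)[OF S'(1)]]) simp
          then show ?thesis using A0 1 by blast
        next
          case 2
          then obtain A where A: "A \<in> S'" "m' = tab A" using S'(2) by blast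
          have ne: "A G1 \<noteq> A0 G1" using 2(2) l(2) A(2) A0(2) by simp
          have "(\<lambda>x. A x + A0 x) \<in> ?S" using A(1) by blast
          moreover have "(\<lambda>x. A x + A0 x) \<noteq> zmap" using ne by (metis gf16_add_eq_0)
          moreover have "m = tab (\<lambda>x. A x + A0 x)" using 2(3) A(2) by (simp add: addt_tab add.commute)
          ultimately show ?thesis by blast
        qed
      qed
      then show ?thesis using poolI[OF frame_shift[OF S'(1)]] A0 by blast
    qed
  next
    case Iv
    have "set (apply_op p r) \<subseteq> tab ` (inv_set S' - {zmap})"
    proof
      fix m assume "m \<in> set (apply_op p r)"
      then obtain A where A: "A \<in> S' - {zmap}" "m = invt (tab A)" using S'(2) Iv by auto
      have b: "bij A" by (rule frame_bij[OF S'(1) A(1)])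
      have "inv A \<in> inv_set S'" using A(1) by (simp add: inv_set_def)
      then show "m \<in> tab ` (inv_set S' - {zmap})"
        using A(2) invt_tab[OF b] bij_neq_zmap[OF bij_imp_bij_inv[OF b]] by blast
    qed
    then show ?thesis by (rule poolI[OF frame_inv[OF S'(1)]])
  next
    case (Nm y)
    show ?thesis
    proof (cases "sel y r = []")
      case True
      then show ?thesis using nil Nm by (simp add: norm_all_def)
    next
      case False
      then have l: "sel y r \<in> set r" using sel_mem by auto
      obtain A0 where A0: "A0 \<in> S' - {zmap}" "sel y r = tab A0" using l S'(2) by blast
      have b: "bij A0" by (rule frame_bij[OF S'(1) A0(1)])
      have a: "addmap A0" by (rule osp_addmap[OF frameD(1)[OF S'(1)]]) (use A0 in simp)
      let ?S = "(\<lambda>A. inv A0 \<circ> A \<circ> (\<lambda>x. x)) ` S'"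
      have "set (apply_op p r) \<subseteq> tab ` (?S - {zmap})"
      proof
        fix m assume "m \<in> set (apply_op p r)"
        then obtain A where A: "A \<in> S' - {zmap}" "m = compt (invt (tab A0)) (tab A)"
          using S'(2) False by (auto simp: Nm norm_all_def A0(2))
        have "inv A0 \<circ> A \<in> ?S" by (rule image_eqI[of _ _ A]) (use A in \<open>auto simp: fun_eq_iff\<close>)
        moreover have "inv A0 \<circ> A \<noteq> zmap"
          by (rule bij_neq_zmap[OF bij_comp[OF frame_bij[OF S'(1) A(1)] bij_imp_bij_inv[OF b]]])
        ultimately show "m \<in> tab ` (?S - {zmap})"
          using A(2) by (auto simp: invt_tab[OF b] compt_tab)
      qed
      then show ?thesis
        by (rule poolI[OF frame_lin[OF S'(1) addmap_id(1) bij_id[unfolded id_def]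
              addmap_inv[OF a b] bij_imp_bij_inv[OF b]]])
    qed
  next
    case (Cj a b c d)
    let ?P = "lincomb a b c d"
    show ?thesis
    proof (cases "invertible (addtab a b c d)")
      case False
      then show ?thesis using nil Cj by (simp add: conj_all_def)
    next
      case True
      then have bP: "bij ?P" by (simp add: invertible_bij addtab_tab)
      let ?S = "(\<lambda>A. ?P \<circ> A \<circ> inv ?P) ` S'"
      have "set (apply_op p r) \<subseteq> tab ` (?S - {zmap})"
      proof
        fix m assume "m \<in> set (apply_op p r)"
        then obtain A where A: "A \<in> S' - {zmap}" "m = conjt (tab ?P) (invt (tab ?P)) (tab A)"
          using S'(2) True by (auto simp: Cj conj_all_def addtab_tab)
        have "m = tab (?P \<circ> A \<circ> inv ?P)"
          using A(2) by (simp add: conjt_def invt_tab[OF bP] compt_tab o_assoc)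
        moreover have "?P \<circ> A \<circ> inv ?P \<in> ?S" using A(1) by blast
        moreover have "?P \<circ> A \<circ> inv ?P \<noteq> zmap"
          by (rule bij_neq_zmap[OF bij_comp[OF bij_imp_bij_inv[OF bP] bij_comp[OF frame_bij[OF S'(1) A(1)] bP]]])
        ultimately show "m \<in> tab ` (?S - {zmap})" by blast
      qed
      then show ?thesis
        by (rule poolI[OF frame_lin[OF S'(1) addmap_inv[OF addmap_lincomb_gf bP] bij_imp_bij_inv[OF bP]
              addmap_lincomb_gf bP]])
    qed
  qed
qed

lemma pool_ops: "pool S r \<Longrightarrow> pool S (apply_ops ps r)"
  by (induction ps arbitrary: r) (simp_all add: pool_op)

lemma subt_subset: "subt pl r \<Longrightarrow> (\<And>c. c \<in> set pl \<Longrightarrow> c \<noteq> []) \<Longrightarrow> set pl \<subseteq> set r"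
proof (induction pl)
  case (Cons c cs)
  have "c = sel (look G1 c) r" "c \<noteq> []" using Cons.prems by (auto simp: eqt_def)
  then have "c \<in> set r" using sel_mem[of "look G1 c" r] by auto
  then show ?case using Cons by auto
qed simp

lemma certify_mem: "certify cs rs \<Longrightarrow> r \<in> set rs \<Longrightarrow> \<exists>(pl, ps) \<in> set cs. subt pl (apply_ops ps r)"
  by (induction cs rs rule: certify.induct) auto

section \<open>Symmetries of the components 0, infinity, 1, w\<close>

abbreviation wm :: gmap where "wm \<equiv> (*) G2"

lemma tab_wm: "tab_w = tab wm" "addtab G2 G4 G8 G3 = tab wm"
  by (simp_all add: tab_w_def addtab_def ext_def shiftl_map tab_def plus_gf16_def times_gf16_def)

lemma tab_w5m: "addtab G6 G12 G11 G5 = tab ((*) G6)"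
  by (simp add: addtab_def ext_def shiftl_map tab_def plus_gf16_def times_gf16_def)

lemma tab_zmap: "zero_tab = tab zmap"
  by (simp add: zero_tab_def tab_def zero_gf16_def)

lemma gnz: "G2 \<noteq> 0" "G6 \<noteq> 0" "G3 \<noteq> 0"
  by (simp_all add: zero_gf16_def one_gf16_def)

lemma bij_wm: "bij wm" "bij ((*) G6)" "addmap wm" "addmap ((*) G6)"
  by (simp_all add: bij_mult gnz addmap_mult)

definition bad :: "gmap set \<Rightarrow> bool" where
  "bad S \<longleftrightarrow> osp S \<and> zmap \<in> S \<and> id \<in> S \<and> \<not> desarg S"

definition badw :: "gmap set \<Rightarrow> bool" where
  "badw S \<longleftrightarrow> bad S \<and> wm \<in> S"

lemma badD: "bad S \<Longrightarrow> osp S" "bad S \<Longrightarrow> zmap \<in> S" "bad S \<Longrightarrow> id \<in> S" "bad S \<Longrightarrow> frame S S"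
  by (simp_all add: bad_def frame_refl)

lemma bad_frame: "bad S \<Longrightarrow> frame S S' \<Longrightarrow> id \<in> S' \<Longrightarrow> bad S'"
  by (auto simp: bad_def frame_def)

lemma badwD: "badw S \<Longrightarrow> bad S" "badw S \<Longrightarrow> wm \<in> S"
  by (simp_all add: badw_def)

lemma badw_frame: "badw S \<Longrightarrow> frame S S' \<Longrightarrow> id \<in> S' \<Longrightarrow> wm \<in> S' \<Longrightarrow> badw S'"
  unfolding badw_def by (blast intro: bad_frame)

lemma table_fn: "length l = 16 \<Longrightarrow> l = tab (\<lambda>x. look x l)"
  by (simp add: tab_look)

text \<open>Conjugation by a field element commutes with w and so keeps 0, 1 and w in the spread
  set.\<close>

lemma conj_mult_badw:
  assumes "badw S" "c \<noteq> 0" "(*) c \<circ> f \<circ> inv ((*) c) \<in> S"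
  shows "\<exists>S'. badw S' \<and> f \<in> S'"
proof (intro exI conjI)
  let ?M = "(*) c" and ?S = "(\<lambda>A. inv ((*) c) \<circ> A \<circ> (*) c) ` S"
  have b: "bij ?M" by (rule bij_mult[OF assms(2)])
  have c: "inv ?M \<circ> ?M = id" by (rule inv_o_cancel[OF bij_is_inj[OF b]])
  show "badw ?S"
  proof (rule badw_frame[OF assms(1)])
    show "frame S ?S"
      by (rule frame_lin[OF badD(4)[OF badwD(1)[OF assms(1)]] addmap_mult b addmap_inv[OF addmap_mult b]
            bij_imp_bij_inv[OF b]])
    show "id \<in> ?S"
      by (rule image_eqI[OF _ badD(3)[OF badwD(1)[OF assms(1)]]]) (simp add: c)
    have "wm = inv ?M \<circ> wm \<circ> ?M"
      using assms(2) by (simp add: inv_mult fun_eq_iff)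
    then show "wm \<in> ?S" by (rule image_eqI[OF _ badwD(2)[OF assms(1)]])
  qed
  have "inv ?M \<circ> (?M \<circ> f \<circ> inv ?M) \<circ> ?M = (inv ?M \<circ> ?M) \<circ> f \<circ> (inv ?M \<circ> ?M)"
    by (simp only: o_assoc)
  then have "f = inv ?M \<circ> (?M \<circ> f \<circ> inv ?M) \<circ> ?M" by (simp add: c)
  then show "f \<in> ?S" by (rule image_eqI[OF _ assms(3)])
qed

lemma cw_tab: "cw (tab f) = tab (wm \<circ> f \<circ> inv wm)"
  by (simp add: cw_def conjt_def tab_wm invt_tab bij_wm compt_tab o_assoc)

text \<open>The direction is backwards, from the conjugate to its source, because the search is only
  made for the head of an orbit.\<close>

lemma cw_badw:
  assumes "badw S" "cw l \<in> tab ` S" "length l = 16"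
  shows "\<exists>S'. badw S' \<and> l \<in> tab ` S'"
proof -
  let ?f = "\<lambda>x. look x l"
  have l: "l = tab ?f" by (rule table_fn[OF assms(3)])
  obtain C where C: "C \<in> S" "cw (tab ?f) = tab C" using assms(2) l by auto
  have "wm \<circ> ?f \<circ> inv wm = C" using C(2) unfolding cw_tab tab_eq_iff .
  then obtain S' where "badw S'" "?f \<in> S'"
    using conj_mult_badw[OF assms(1) gnz(1), of ?f] C(1) by auto
  then show ?thesis using l by blast
qed

lemma length_cw: "length l = 16 \<Longrightarrow> length (cw l) = 16"
  by (metis cw_tab length_tab table_fn)

lemma iter_badw:
  "\<lbrakk>badw S; l \<in> tab ` S; l \<in> set (iter us x); length x = 16\<rbrakk> \<Longrightarrow> \<exists>S'. badw S' \<and> x \<in> tab ` S'"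
proof (induction us arbitrary: x)
  case (Cons u us)
  show ?case
  proof (cases "l = x")
    case True
    then show ?thesis using Cons.prems by blast
  next
    case False
    then have "l \<in> set (iter us (cw x))" using Cons.prems(3) by simp
    then obtain S' where "badw S'" "cw x \<in> tab ` S'"
      using Cons.IH Cons.prems length_cw by blast
    then show ?thesis using cw_badw Cons.prems(4) by blast
  qed
qed simp

text \<open>Applying \<open>v1\<close> twice gives w f w^-1 and not f, hence the final conjugation
  by w.\<close>

lemma v1_badw:
  assumes "badw S" "bij f" "v1 (tab f) \<in> tab ` S"
  shows "\<exists>S'. badw S' \<and> tab f \<in> tab ` S'"
proof -
  let ?S = "(\<lambda>A. wm \<circ> A \<circ> id) ` inv_set S"
  obtain C where C: "C \<in> S" "v1 (tab f) = tab C" using assms(3) by auto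
  have "C = wm \<circ> inv f"
    using C(2) by (simp add: v1_def tab_wm invt_tab assms(2) compt_tab tab_eq_iff)
  then have iC: "inv C = f \<circ> inv wm"
    by (simp add: o_inv_distrib bij_wm bij_imp_bij_inv assms(2) inv_inv_eq)
  have bC: "bij C" unfolding \<open>C = wm \<circ> inv f\<close> by (intro bij_comp bij_imp_bij_inv assms bij_wm)
  have inS: "wm \<circ> inv A \<in> ?S" if "A \<in> S" "bij A" for A
  proof (rule image_eqI)
    show "inv A \<in> inv_set S" using that bij_neq_zmap by (auto simp: inv_set_def)
  qed simp
  have "badw ?S"
  proof (rule badw_frame[OF assms(1)])
    show "frame S ?S"
      by (rule frame_lin[OF frame_inv[OF badD(4)[OF badwD(1)[OF assms(1)]]] addmap_id(2) bij_id bij_wm(3,1)])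
    show "id \<in> ?S" using inS[OF badwD(2)[OF assms(1)] bij_wm(1)]
      by (simp add: surj_iff[THEN iffD1, OF bij_is_surj[OF bij_wm(1)]])
    show "wm \<in> ?S" using inS[OF badD(3)[OF badwD(1)[OF assms(1)]] bij_id] by simp
  qed
  moreover have "wm \<circ> f \<circ> inv wm \<in> ?S" using inS[OF C(1) bC] by (simp add: iC o_assoc)
  ultimately show ?thesis using conj_mult_badw[OF _ gnz(1)] by blast
qed

text \<open>The shift by w, the inversion, the factor w^5 = \<open>G6\<close> and another shift by w
  are performed on the whole spread set. Applying \<open>v2\<close> twice gives the conjugate of f
  by w^5, which is undone at the end.\<close>

lemma v2_badw:
  assumes "badw S" "bij (\<lambda>x. f x + wm x)" "v2 (tab f) \<in> tab ` S"
  shows "\<exists>S'. badw S' \<and> tab f \<in> tab ` S'"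
proof -
  let ?g = "\<lambda>x. f x + wm x" and ?K = "(*) G6"
  let ?S1 = "(\<lambda>A x. A x + wm x) ` S" let ?S2 = "inv_set ?S1"
  let ?S3 = "(\<lambda>A. ?K \<circ> A \<circ> id) ` ?S2" let ?S4 = "(\<lambda>A x. A x + wm x) ` ?S3"
  obtain C where C: "C \<in> S" "v2 (tab f) = tab C" using assms(3) by auto
  have Cx: "C = (\<lambda>x. wm x + (?K \<circ> inv ?g) x)"
    using C(2) by (simp add: v2_def tab_wm tab_w5m addt_tab invt_tab assms(2) compt_tab tab_eq_iff fun_eq_iff)
  have f1: "frame S ?S1"
    by (rule frame_shift[OF badD(4)[OF badwD(1)[OF assms(1)]] badwD(2)[OF assms(1)]])
  have f3: "frame S ?S3"
    by (rule frame_lin[OF frame_inv[OF f1] addmap_id(2) bij_id bij_wm(4,2)])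
  have inS3: "?K \<circ> inv B \<in> ?S3" if "B \<in> ?S1" "bij B" for B
  proof (rule image_eqI)
    show "inv B \<in> ?S2" using that bij_neq_zmap by (auto simp: inv_set_def)
  qed simp
  \<comment> \<open>The identity has become 1 + w = w^4 = \<open>G3\<close>, and w^5 / w^4 = w. In
    the same way 0 leads to w^5 / w + w = w^4 + w = 1 below.\<close>
  have m3: "(*) G3 \<in> ?S1"
    by (rule image_eqI[OF _ badD(3)[OF badwD(1)[OF assms(1)]]])
      (simp add: fun_eq_iff all_gf16 times_gf16_def plus_gf16_def)
  have "?K \<circ> inv ((*) G3) = wm"
    by (simp add: inv_mult gnz fun_eq_iff all_gf16 times_gf16_def inverse_gf16_def)
  then have w3: "wm \<in> ?S3" using inS3[OF m3 bij_mult[OF gnz(3)]] by simp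
  have f4: "frame S ?S4" by (rule frame_shift[OF f3 w3])
  have b4: "badw ?S4"
  proof (rule badw_frame[OF assms(1) f4])
    have "wm \<in> ?S1" by (rule image_eqI[OF _ badD(2)[OF badwD(1)[OF assms(1)]]]) simp
    from inS3[OF this bij_wm(1)] have p1: "?K \<circ> inv wm \<in> ?S3" .
    have p2: "id = (\<lambda>x. (?K \<circ> inv wm) x + wm x)"
      by (simp add: inv_mult gnz fun_eq_iff all_gf16 times_gf16_def inverse_gf16_def plus_gf16_def)
    show "id \<in> ?S4" by (rule image_eqI[OF _ p1]) (rule p2)
    show "wm \<in> ?S4" by (rule image_eqI[OF _ frameD(2)[OF f3]]) simp
  qed
  have C1: "?K \<circ> inv ?g \<in> ?S1"
    by (rule image_eqI[OF _ C(1)]) (simp add: Cx fun_eq_iff add.commute[of "wm _"])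
  have bC: "bij (?K \<circ> inv ?g)" by (intro bij_comp bij_imp_bij_inv assms bij_wm)
  have "inv (?K \<circ> inv ?g) = ?g \<circ> inv ?K"
    by (simp add: o_inv_distrib bij_wm bij_imp_bij_inv assms(2) inv_inv_eq)
  then have p1: "?K \<circ> (?g \<circ> inv ?K) \<in> ?S3" using inS3[OF C1 bC] by simp
  have p2: "?K \<circ> f \<circ> inv ?K = (\<lambda>x. (?K \<circ> (?g \<circ> inv ?K)) x + wm x)"
  proof
    fix x
    have "G6 * (G2 * (inverse G6 * x)) = G2 * x"
      using gnz(2) by (simp add: mult.left_commute[of G6 G2] mult.assoc[symmetric])
    then show "(?K \<circ> f \<circ> inv ?K) x = (?K \<circ> (?g \<circ> inv ?K)) x + wm x"
      by (simp add: inv_mult gnz(2) distrib_left)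
  qed
  have "?K \<circ> f \<circ> inv ?K \<in> ?S4" by (rule image_eqI[OF _ p1]) (rule p2)
  then show ?thesis using conj_mult_badw[OF b4 gnz(2)] by blast
qed

lemma valid_rep_tab:
  assumes "valid_rep (tab f)"
  shows "bij f" "bij (\<lambda>x. f x + wm x)" "v2 (tab f) = tab (\<lambda>x. look x (v2 (tab f)))"
    "bij (\<lambda>x. look x (v2 (tab f)))" "f \<noteq> zmap" "f \<noteq> id" "f \<noteq> wm"
proof -
  show b: "bij f" using assms invertible_bij by (auto simp: valid_rep_def)
  show c: "bij (\<lambda>x. f x + wm x)"
    using assms invertible_bij by (auto simp: valid_rep_def tab_wm addt_tab)
  define h where "h = (\<lambda>x. wm x + ((*) G6 \<circ> inv (\<lambda>x. f x + wm x)) x)"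
  have v: "v2 (tab f) = tab h"
    by (simp add: h_def v2_def tab_wm tab_w5m addt_tab invt_tab c compt_tab)
  then have lh: "(\<lambda>x. look x (v2 (tab f))) = h" by simp
  show "v2 (tab f) = tab (\<lambda>x. look x (v2 (tab f)))" unfolding lh by (rule v)
  have bh: "bij h" using assms invertible_bij[of h] by (simp add: valid_rep_def v)
  then show "bij (\<lambda>x. look x (v2 (tab f)))" unfolding lh .
  show "f \<noteq> zmap" using b bij_neq_zmap by blast
  show "f \<noteq> wm" using bij_neq_zmap[OF c] by auto
  \<comment> \<open>\<open>v2\<close> sends the identity to zero, which is not invertible.\<close>
  show "f \<noteq> id"
  proof
    assume f: "f = id"
    have g: "(\<lambda>x. f x + wm x) = (*) G3"
      by (simp add: f fun_eq_iff all_gf16 times_gf16_def plus_gf16_def)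
    have "h = zmap"
      unfolding h_def g by (simp add: inv_mult gnz fun_eq_iff all_gf16 times_gf16_def inverse_gf16_def
          plus_gf16_def zero_gf16_def)
    then show False using bij_neq_zmap[OF bh] by simp
  qed
qed

definition orbit_ok :: "gf16 list list \<Rightarrow> bool" where
  "orbit_ok os \<longleftrightarrow> os \<noteq> [] \<longrightarrow> length (hd os) = 16 \<and> valid_rep (hd os) \<and>
     (\<forall>S l. badw S \<longrightarrow> l \<in> set os \<longrightarrow> l \<in> tab ` S \<longrightarrow> (\<exists>S'. badw S' \<and> hd os \<in> tab ` S'))"

lemma orbit_ok_orbit:
  assumes "length x = 16" shows "orbit_ok (orbit x (u # n0) n1 n2 n3)"
proof (cases "valid_rep x")
  case True
  let ?f = "\<lambda>y. look y x"
  have x: "x = tab ?f" by (rule table_fn[OF assms])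
  note v = valid_rep_tab[of ?f, folded x, OF True]
  have len: "length (v1 m) = 16" for m by (simp add: v1_def compt_map invt_def)
  have len2: "length (v2 x) = 16" by (metis v(3) length_tab)
  have "\<exists>S'. badw S' \<and> x \<in> tab ` S'"
    if S: "badw S" "l \<in> tab ` S" and l: "l \<in> set (orbit x (u # n0) n1 n2 n3)" for S l
  proof -
    have back1: "\<exists>S'. badw S' \<and> x \<in> tab ` S'" if "badw S'" "v1 x \<in> tab ` S'" for S'
      using v1_badw[OF that(1) v(1)] that(2) x by simp
    have back2: "\<exists>S'. badw S' \<and> x \<in> tab ` S'" if "badw S'" "v2 x \<in> tab ` S'" for S'
      using v2_badw[OF that(1) v(2)] that(2) x by simp
    have back3: "\<exists>S'. badw S' \<and> x \<in> tab ` S'" if "badw S'" "v1 (v2 x) \<in> tab ` S'" for S'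
      using v1_badw[OF that(1) v(4)] that(2) v(3) back2 by metis
    consider "l \<in> set (iter (u # n0) x)" | "l \<in> set (iter n1 (v1 x))" | "l \<in> set (iter n2 (v2 x))"
      | "l \<in> set (iter n3 (v1 (v2 x)))"
      using l True by (auto simp: orbit_def)
    then show ?thesis
    proof cases
      case 1 then show ?thesis using iter_badw[OF S _ assms] by blast
    next
      case 2 then show ?thesis using iter_badw[OF S _ len] back1 by blast
    next
      case 3 then show ?thesis using iter_badw[OF S _ len2] back2 by blast
    next
      case 4 then show ?thesis using iter_badw[OF S _ len] back3 by blast
    qed
  qed
  moreover have "hd (orbit x (u # n0) n1 n2 n3) = x" using True by (simp add: orbit_def)
  ultimately show ?thesis using assms True unfolding orbit_ok_def by metis
qed (simp add: orbit_ok_def orbit_def)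

text \<open>Two maps of a spread set agree at no nonzero vector, so evaluation at \<open>G1\<close>
  is injective on sixteen maps and takes every value once.\<close>

lemma osp_head:
  assumes "osp S" shows "\<exists>!A. A \<in> S \<and> A G1 = y"
proof -
  have inj: "inj_on (\<lambda>A. A G1) S"
  proof (rule inj_onI, rule ccontr)
    fix A B assume "A \<in> S" "B \<in> S" "A G1 = B G1" "A \<noteq> B"
    then have "G1 = 0" using osp_differ[OF assms] by blast
    then show False by (simp add: zero_gf16_def)
  qed
  then have "card ((\<lambda>A. A G1) ` S) = CARD(gf16)"
    using osp_card[OF assms] by (simp add: card_image card_gf16)
  then have "(\<lambda>A. A G1) ` S = UNIV" by (simp add: card_eq_UNIV_imp_eq_UNIV)
  then have "y \<in> (\<lambda>A. A G1) ` S" by simp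
  then show ?thesis using inj by (auto simp: inj_on_def)
qed

section \<open>Soundness of the phases\<close>

definition elem :: "gmap set \<Rightarrow> gf16 \<Rightarrow> gmap" where
  "elem S y = (THE A. A \<in> S \<and> A G1 = y)"

lemma elem: "osp S \<Longrightarrow> elem S y \<in> S" "osp S \<Longrightarrow> elem S y G1 = y"
  using theI'[OF osp_head] by (auto simp: elem_def)

lemma elem_eq: "osp S \<Longrightarrow> A \<in> S \<Longrightarrow> A G1 = y \<Longrightarrow> elem S y = A"
  using osp_head elem by blast

lemma elem_neq: "osp S \<Longrightarrow> i \<noteq> j \<Longrightarrow> elem S i \<noteq> elem S j"
  using elem(2) by metis

lemma remove_lab:
  "distinct zs \<Longrightarrow> set (remove_lab y zs) = set zs - {y}" "distinct zs \<Longrightarrow> distinct (remove_lab y zs)"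
  "y \<in> set zs \<Longrightarrow> length zs = Suc (length (remove_lab y zs))"
proof (induction zs)
  case (Cons z zs)
  { case 1 then show ?case using Cons.IH(1) by auto }
  { case 2 then show ?case using Cons.IH(1,2) by auto }
  { case 3 then show ?case using Cons.IH(3) by auto }
qed auto

lemma groups_fst: "map fst (groups ys ls) = ys"
  by (induction ys) auto

lemma groups_mem: "(i, g) \<in> set (groups ys ls) \<Longrightarrow> g = grp i ls"
  by (induction ys) auto

lemma tab_mem: "tab f \<in> tab ` X \<longleftrightarrow> f \<in> X"
  by (auto simp: tab_eq_iff)

lemma phase_sound:
  assumes S: "badw S" and x: "tab X \<in> tab ` S" "X \<notin> {zmap, id, wm}"
    and cov: "\<And>A. A \<in> S \<Longrightarrow> A \<notin> {zmap, id, wm} \<Longrightarrow> tab A \<in> set (concat os)"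
  shows "\<exists>r \<in> set (phase (tab X) os). set r \<subseteq> tab ` (S - {zmap})"
proof -
  have b: "bad S" by (rule badwD(1)[OF S])
  have o: "osp S" by (rule badD(1)[OF b])
  define t where "t y = tab (elem S y)" for y
  have X: "X \<in> S" using x(1) by (simp add: tab_mem)
  have e: "elem S G0 = zmap" "elem S G1 = id" "elem S G2 = wm" "elem S (X G1) = X"
    by (rule elem_eq[OF o]; use badD[OF b] badwD(2)[OF S] X in \<open>simp add: zero_gf16_def times_gf16_def\<close>)+
  have nX: "X G1 \<noteq> G0" "X G1 \<noteq> G1" "X G1 \<noteq> G2"
    using x(2) e by (metis insertCI)+
  let ?ys = "[G3, G4, G5, G6, G7, G8, G9, G10, G11, G12, G13, G14, G15]"
  \<comment> \<open>Twelve steps: the sixteen labels without those of 0, 1, w and X.\<close>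
  let ?us = "[(),(),(),(),(),(),(),(),(),(),(),()]"
  let ?gs = "groups (remove_lab (X G1) ?ys) (filter (tdiffer (tab X)) (concat os))"
  let ?ls = "[X G1, G2, G1]"
  have mem: "X G1 \<in> set ?ys" using nX by (cases "X G1") simp_all
  have d: "distinct ?ys" by simp
  have fs: "map fst ?gs = remove_lab (X G1) ?ys" by (rule groups_fst)
  then have fs': "fst ` set ?gs = set ?ys - {X G1}"
    using remove_lab(1)[OF d] by (metis list.set_map)
  have "\<exists>ls'. set ls' = fst ` set ?gs \<union> set ?ls \<and>
      map t ls' \<in> set (search dlast tdiffer ?us (map t ?ls) ?gs)"
  proof (rule search_sound[where L = "UNIV - {G0}"])
    fix ls and i j :: gf16 assume "distinct (i # j # ls)"
    then have "elem S i \<noteq> elem S j" using elem_neq[OF o] by simp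
    then show "tdiffer (dlast (map t ls) (t i)) (t j)"
      using osp_differ[OF o elem(1)[OF o] elem(1)[OF o]] by (auto simp: dlast_def t_def tdiffer_tab)
  next
    show "length ?us = length ?gs"
      using remove_lab(3)[OF mem] fs by (metis (no_types, lifting) length_map length_Cons list.size(3) nat.inject)
    show "distinct (map fst ?gs @ ?ls)"
      unfolding fs using remove_lab(1,2)[OF d, of "X G1"] nX by auto
    show "fst ` set ?gs \<union> set ?ls \<subseteq> UNIV - {G0}"
      unfolding fs' using nX by auto
    fix i g assume ig: "(i, g) \<in> set ?gs"
    have "i \<in> set ?ys - {X G1}" using imageI[OF ig, of fst] unfolding fs' fst_conv .
    then have i: "i \<in> set ?ys" "i \<noteq> X G1" by blast+
    have "elem S i \<notin> {zmap, id, wm}"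
      using i(1) elem(2)[OF o, of i] by (auto simp: zero_gf16_def times_gf16_def)
    then have "tab (elem S i) \<in> set (concat os)" using cov elem(1)[OF o] by blast
    moreover have "tdiffer (tab X) (tab (elem S i))"
      unfolding tdiffer_tab using osp_differ[OF o X elem(1)[OF o]] i(2) elem(2)[OF o] by metis
    moreover have "look G1 (tab (elem S i)) = i" using elem(2)[OF o] by simp
    ultimately show "t i \<in> set g"
      unfolding groups_mem[OF ig] grp_def t_def by simp
  qed
  then obtain ls' where ls': "set ls' = fst ` set ?gs \<union> set ?ls"
    "map t ls' \<in> set (search dlast tdiffer ?us (map t ?ls) ?gs)" by blast
  have "map t ?ls = [tab X, tab_w, gU]" by (simp add: t_def e tab_wm tab_id)
  then have "map t ls' \<in> set (phase (tab X) os)" using ls'(2) by (simp add: phase_def)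
  moreover have "set (map t ls') \<subseteq> tab ` (S - {zmap})"
  proof
    fix m assume "m \<in> set (map t ls')"
    then obtain y where y: "y \<in> set ls'" "m = tab (elem S y)" by (auto simp: t_def)
    have "y \<in> set ?ys - {X G1} \<union> set ?ls" using y(1) unfolding ls'(1) fs' .
    then have "y \<noteq> G0" using nX by auto
    then have "elem S y \<noteq> zmap" using elem(2)[OF o, of y] by (auto simp: zero_gf16_def)
    then show "m \<in> tab ` (S - {zmap})" using y(2) elem(1)[OF o] by blast
  qed
  ultimately show ?thesis by blast
qed

text \<open>A bad spread set that meets the current orbit could be moved to one that contains the
  head of the orbit. The search lists all of these, and the certificates show that each is
  Desarguesian or impossible. Hence no bad spread set meets this orbit, and the later phases may
  ignore it.\<close>

lemma phases_sound:
  assumes PL: "\<And>pl S. \<lbrakk>pl \<in> PL; osp S; zmap \<in> S; set pl \<subseteq> tab ` (S - {zmap})\<rbrakk> \<Longrightarrow> desarg S"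
    and PLn: "\<And>pl c. pl \<in> PL \<Longrightarrow> c \<in> set pl \<Longrightarrow> c \<noteq> []"
  shows "\<lbrakk>phases os cs; \<forall>o'\<in>set os. orbit_ok o'; \<forall>c\<in>set cs. \<forall>(pl, ps)\<in>set c. pl \<in> PL;
    \<And>S A. badw S \<Longrightarrow> A \<in> S \<Longrightarrow> A \<notin> {zmap, id, wm} \<Longrightarrow> tab A \<in> set (concat os)\<rbrakk> \<Longrightarrow> \<not> badw S"
proof (induction os cs arbitrary: S rule: phases.induct)
  case (1 cs)
  show ?case
  proof
    assume S: "badw S"
    have o: "osp S" by (rule badD(1)[OF badwD(1)[OF S]])
    \<comment> \<open>With all orbits dropped there is no candidate left for the label
      \<open>G3\<close>.\<close>
    have "elem S G3 \<notin> {zmap, id, wm}"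
      using elem(2)[OF o, of G3] by (auto simp: zero_gf16_def times_gf16_def)
    from "1.prems"(4)[OF S elem(1)[OF o] this] show False by simp
  qed
next
  case (2 o' os c cs)
  have cert: "certify c (phase (hd o') (o' # os))" and ph: "phases os cs" using "2.prems"(1) by auto
  have ok: "orbit_ok o'" using "2.prems"(2) by simp
  have avoid: "l \<notin> tab ` S" if S: "badw S" and l: "l \<in> set o'" for S l
  proof
    assume "l \<in> tab ` S"
    then obtain S' where S': "badw S'" "hd o' \<in> tab ` S'"
      using ok S l unfolding orbit_ok_def by (metis empty_iff list.set(1))
    have ho: "length (hd o') = 16" "valid_rep (hd o')" using ok l unfolding orbit_ok_def by auto
    let ?X = "\<lambda>x. look x (hd o')"
    have X: "hd o' = tab ?X" by (rule table_fn[OF ho(1)])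
    have "?X \<notin> {zmap, id, wm}"
      using valid_rep_tab(5-7)[of ?X, folded X, OF ho(2)] by blast
    then obtain r where r: "r \<in> set (phase (hd o') (o' # os))" "set r \<subseteq> tab ` (S' - {zmap})"
      using phase_sound[OF S'(1), of ?X "o' # os"] "2.prems"(4)[OF S'(1)] S'(2) X by metis
    obtain pl ps where p: "(pl, ps) \<in> set c" "subt pl (apply_ops ps r)"
      using certify_mem[OF cert r(1)] by blast
    have pl: "pl \<in> PL" using p(1) "2.prems"(3) by auto
    have bS': "bad S'" by (rule badwD(1)[OF S'(1)])
    have "pool S' (apply_ops ps r)"
      by (rule pool_ops[OF poolI[OF badD(4)[OF bS'] r(2)]])
    then obtain S'' where S'': "frame S' S''" "set (apply_ops ps r) \<subseteq> tab ` (S'' - {zmap})"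
      by (auto simp: pool_def)
    have "set pl \<subseteq> tab ` (S'' - {zmap})"
      using subt_subset[OF p(2) PLn[OF pl]] S''(2) by blast
    then have "desarg S''" by (rule PL[OF pl frameD(1,2)[OF S''(1)]])
    then have "desarg S'" by (rule frameD(3)[OF S''(1)])
    then show False using bS' by (simp add: bad_def)
  qed
  show ?case
  proof (rule "2.IH"[OF ph])
    show "\<forall>o'\<in>set os. orbit_ok o'" "\<forall>c\<in>set cs. \<forall>(pl, ps)\<in>set c. pl \<in> PL"
      using "2.prems"(2,3) by auto
    fix S A assume S: "badw S" "A \<in> S" "A \<notin> {zmap, id, wm}"
    have "tab A \<notin> set o'" using avoid[OF S(1)] S(2) by blast
    then show "tab A \<in> set (concat os)" using "2.prems"(4)[OF S] by simp
  qed
next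
  case (3 o' os)
  then show ?case by simp
qed

section \<open>Completeness of the enumeration of tables\<close>

lemma differ_prefix: "differ (xs @ ys) zs \<Longrightarrow> differ xs zs"
  by (induction xs zs rule: differ.induct) auto

lemma extend_mem: "r \<in> set rs \<Longrightarrow> list_all (tdiffer (ext l r)) refs \<Longrightarrow> ext l r \<in> set (extend refs l rs)"
  by (induction rs) auto

lemma extend_all_mem:
  "l \<in> set ls \<Longrightarrow> list_all (tdiffer (ext l r)) refs \<Longrightarrow> ext l r \<in> set (extend_all refs ls)"
proof (induction ls)
  case (Cons a ls)
  then show ?case using extend_mem[OF gU_mem Cons.prems(2)] by (cases "l = a") (simp_all del: extend.simps)
qed simp

lemma tdiffer_ext: "l \<noteq> [] \<Longrightarrow> tdiffer (ext l r) m \<Longrightarrow> tdiffer l m"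
  by (auto simp: tdiffer_def ext_def intro: differ_prefix)

lemma ext_ne: "l \<noteq> [] \<Longrightarrow> ext l r \<noteq> []"
  by (simp add: ext_def)

text \<open>Pruning loses nothing: a table that differs from the references has prefixes that differ
  from them.\<close>

lemma tables_from_mem:
  assumes "addmap A" "list_all (tdiffer (tab A)) refs"
  shows "tab A \<in> set (tables_from refs (A G1))"
proof -
  define l1 where "l1 = ext [G0] (A G1)"
  define l2 where "l2 = ext l1 (A G2)"
  define l3 where "l3 = ext l2 (A G4)"
  have "A = lincomb (A G1) (A G2) (A G4) (A G8)"
    by (rule HOL.ext) (rule addmap_eq_lincomb[OF assms(1)])
  then have "tab A = addtab (A G1) (A G2) (A G4) (A G8)"
    unfolding addtab_tab by (rule arg_cong)
  then have A: "tab A = ext l3 (A G8)"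
    by (simp only: addtab_def l1_def l2_def l3_def)
  have ne: "l1 \<noteq> []" "l2 \<noteq> []" "l3 \<noteq> []" by (simp_all add: l1_def l2_def l3_def ext_ne)
  have d4: "list_all (tdiffer (ext l3 (A G8))) refs" using assms(2) A by simp
  have d3: "list_all (tdiffer (ext l2 (A G4))) refs"
    using d4 tdiffer_ext[OF ne(3)] unfolding l3_def by (auto simp: list_all_iff)
  have d2: "list_all (tdiffer (ext l1 (A G2))) refs"
    using d3 tdiffer_ext[OF ne(2)] unfolding l2_def by (auto simp: list_all_iff)
  have d1: "list_all (tdiffer (ext [G0] (A G1))) refs"
    using d2 tdiffer_ext[OF ne(1)] unfolding l1_def by (auto simp: list_all_iff)
  have "l1 \<in> set (extend refs [G0] [A G1])" unfolding l1_def by (rule extend_mem[OF _ d1]) simp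
  then have "l2 \<in> set (extend_all refs (extend refs [G0] [A G1]))"
    unfolding l2_def using d2 by (rule extend_all_mem)
  then have "l3 \<in> set (extend_all refs (extend_all refs (extend refs [G0] [A G1])))"
    unfolding l3_def using d3 by (rule extend_all_mem)
  then show ?thesis unfolding A tables_from_def using d4 by (rule extend_all_mem)
qed

lemma member_iff: "member x ls \<longleftrightarrow> x \<in> set ls"
  by (induction ls) (auto simp: eqt_def)

lemma all_member_iff: "all_member xs ls \<longleftrightarrow> set xs \<subseteq> set ls"
  by (induction xs) (auto simp: member_iff)

lemma covered_mem:
  assumes "covered ys ls" "addmap A" "A G1 \<in> set ys" "list_all (tdiffer (tab A)) [zero_tab, gU, tab_w]"
  shows "tab A \<in> set ls"
  using assms(1,3)
proof (induction ys)
  case (Cons y ys)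
  then show ?case using tables_from_mem[OF assms(2,4)]
    by (auto simp: all_member_iff grp_def split: if_splits)
qed simp

lemma badw_covered:
  assumes "covered [G3, G4, G5, G6, G7, G8, G9, G10, G11, G12, G13, G14, G15] ls"
    "badw S" "A \<in> S" "A \<notin> {zmap, id, wm}"
  shows "tab A \<in> set ls"
proof (rule covered_mem[OF assms(1)])
  have b: "bad S" by (rule badwD(1)[OF assms(2)])
  have o: "osp S" by (rule badD(1)[OF b])
  show "addmap A" by (rule osp_addmap[OF o assms(3)])
  have "elem S G0 = zmap" "elem S G1 = id" "elem S G2 = wm"
    by (rule elem_eq[OF o]; use badD[OF b] badwD(2)[OF assms(2)] in \<open>simp add: zero_gf16_def times_gf16_def\<close>)+
  moreover have "elem S (A G1) = A" by (rule elem_eq[OF o assms(3) refl])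
  ultimately have "A G1 \<noteq> G0" "A G1 \<noteq> G1" "A G1 \<noteq> G2" using assms(4) by (metis insertCI)+
  then show "A G1 \<in> set [G3, G4, G5, G6, G7, G8, G9, G10, G11, G12, G13, G14, G15]"
    by (cases "A G1") simp_all
  have "tdiffer (tab A) (tab B)" if "B \<in> {zmap, id, wm}" for B
    unfolding tdiffer_tab using osp_differ[OF o assms(3), of B] that assms(4)
      badD(2,3)[OF b] badwD(2)[OF assms(2)] by blast
  then show "list_all (tdiffer (tab A)) [zero_tab, gU, tab_w]"
    by (simp add: tab_zmap tab_id(2)[symmetric] tab_wm)
qed

section \<open>Excluding planes by dual arcs\<close>

lemma trc_add: "trc (x + y) = trc x + trc y"
proof -
  have "\<forall>x y. trc (gadd x y) = gadd (trc x) (trc y)"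
    by (simp only: all_gf16 gadd_tab trc.simps simp_thms)
  then show ?thesis by (simp add: plus_gf16_def)
qed

lemma trc_01: "trc x = G0 \<or> trc x = G1"
  by (cases x) simp_all

lemma trc_0: "trc 0 = 0"
  by (simp add: zero_gf16_def)

lemma trc_nondeg:
  assumes "\<And>x. trc (c * x) = 0" shows "c = 0"
proof (rule ccontr)
  assume "c \<noteq> 0"
  then have "trc (c * (inverse c * G8)) = G1" by (simp add: mult.assoc[symmetric])
  then show False using assms[of "inverse c * G8"] by (simp add: zero_gf16_def)
qed

text \<open>The field element that represents a functional with values 0 and 1. The basis
  \<open>G9, G4, G2, G1\<close> is dual to \<open>G1, G2, G4, G8\<close> for the form given by
  \<open>trc (x * y)\<close>.\<close>

definition functional :: "(gf16 \<Rightarrow> gf16) \<Rightarrow> gf16" where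
  "functional p = gadd (gadd (gmul (p G1) G9) (gmul (p G2) G4)) (gadd (gmul (p G4) G2) (gmul (p G8) G1))"

lemma functional:
  assumes "addmap p" "\<And>x. p x = G0 \<or> p x = G1"
  shows "p x = trc (functional p * x)"
proof -
  have a: "addmap (\<lambda>x. trc (functional p * x))"
    by (simp add: addmap_def distrib_left trc_add)
  have "trc (functional p * G1) = p G1 \<and> trc (functional p * G2) = p G2 \<and>
      trc (functional p * G4) = p G4 \<and> trc (functional p * G8) = p G8"
    unfolding functional_def times_gf16_def
    using assms(2)[of G1] assms(2)[of G2] assms(2)[of G4] assms(2)[of G8]
    by (elim disjE) (simp_all only: gadd_tab gmul_tab trc.simps simp_thms)
  then show ?thesis
    using addmap_eq_lincomb[OF assms(1), of x] addmap_eq_lincomb[OF a, of x] by simp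
qed

lemma adjt_functional: "adjt (tab A) b = functional (\<lambda>x. trc (b * A x))"
  by (simp add: adjt_def functional_def times_gf16_def)

lemma adjt:
  assumes "addmap A" shows "trc (b * A x) = trc (adjt (tab A) b * x)"
  unfolding adjt_functional
  by (rule functional) (auto simp: addmap_def addmapD[OF assms] distrib_left trc_add trc_01)

lemma adjt_unique:
  assumes "\<And>x. trc (c * x) = trc (d * x)" shows "c = (d :: gf16)"
proof -
  have "c + d = 0"
    by (rule trc_nondeg) (simp add: distrib_right trc_add assms)
  then show ?thesis by simp
qed

lemma addmap_adjt:
  assumes "addmap A" shows "adjt (tab A) (b + c) = adjt (tab A) b + adjt (tab A) c"
  by (rule adjt_unique) (simp add: adjt[OF assms, symmetric] distrib_right trc_add)

lemma adjt_0: "addmap A \<Longrightarrow> adjt (tab A) 0 = 0"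
  by (rule adjt_unique) (simp add: adjt[symmetric])

lemma adjt_zmap: "adjt (tab zmap) b = 0"
  by (rule adjt_unique) (simp add: adjt[OF addmap_zero, symmetric] trc_0)

lemma adjt_id: "adjt (tab id) b = b"
  by (rule adjt_unique) (simp add: adjt[OF addmap_id(2), symmetric])

lemma member_add:
  assumes "phyp T" "U \<in> insert zsub (members T)" "u \<in> U" "v \<in> U" shows "u + v \<in> U"
proof -
  consider "U = zsub" | "U = ysub" | A B where "(A, B) \<in> T" "U = graph3 A B"
    using assms(2) by (auto simp: members_def)
  then show ?thesis
  proof cases
    case 3
    then have ab: "A (x + y) = A x + A y" "B (x + y) = B x + B y" for x y
      using phypD(3,4)[OF assms(1)] by (auto simp: addmapD)
    obtain x y where "u = (x, A x, B x)" "v = (y, A y, B y)"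
      using assms(3,4) by (auto simp: 3(2) graph3_def)
    then have "u + v = (x + y, A (x + y), B (x + y))" by (simp add: ab)
    then show ?thesis using mem_graph3 by (simp add: 3(2))
  qed (use assms(3,4) in \<open>auto simp: zsub_def ysub_def\<close>)
qed

lemma member_card:
  assumes "U \<in> insert zsub (members T)" shows "card U = 16"
proof -
  have i: "card (range f) = 16" if "inj f" for f :: "gf16 \<Rightarrow> gf16 vec3"
    using card_image[OF that] by (simp add: card_gf16)
  consider "U = zsub" | "U = ysub" | A B where "U = graph3 A B"
    using assms by (auto simp: members_def)
  then show ?thesis
    by cases (auto simp: zsub_def ysub_def graph3_def inj_def intro!: i)
qed

text \<open>By independence the sum map is injective on 16^3 triples, and there are 16^3
  vectors.\<close>

lemma members_span:
  assumes T: "phyp T" and m: "U \<in> insert zsub (members T)" "V \<in> insert zsub (members T)"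
    "W \<in> insert zsub (members T)" and d: "U \<noteq> V" "U \<noteq> W" "V \<noteq> W"
  shows "\<exists>u\<in>U. \<exists>v\<in>V. \<exists>w\<in>W. x = u + v + w"
proof -
  define g :: "gf16 vec3 \<times> gf16 vec3 \<times> gf16 vec3 \<Rightarrow> gf16 vec3" where "g = (\<lambda>(u, v, w). u + v + w)"
  have dbl: "a + a = 0" for a :: "gf16 vec3" by (cases a) (simp add: zero_prod_def)
  have eqI: "a = b" if "a + b = 0" for a b :: "gf16 vec3"
    using that dbl[of b] by (metis add_right_cancel)
  have "inj_on g (U \<times> V \<times> W)"
  proof (rule inj_onI)
    fix p q assume p: "p \<in> U \<times> V \<times> W" and q: "q \<in> U \<times> V \<times> W" and e: "g p = g q"
    obtain u v w u' v' w' where pq: "p = (u, v, w)" "q = (u', v', w')"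
      by (cases p, cases q) blast
    have "(u + u') + (v + v') + (w + w') = g p + g q" by (simp add: pq g_def ac_simps)
    then have "(u + u') + (v + v') + (w + w') = 0" using e dbl by simp
    from indep3D[OF phyp_indep[OF T] m d _ _ _ this]
    have "u + u' = 0 \<and> v + v' = 0 \<and> w + w' = 0"
      using member_add[OF T] m p q unfolding pq by blast
    then show "p = q" using eqI pq by blast
  qed
  then have "card (g ` (U \<times> V \<times> W)) = CARD(gf16 vec3)"
    using m[THEN member_card] by (simp add: card_image card_cartesian_product card_gf16)
  then have "g ` (U \<times> V \<times> W) = UNIV" by (simp add: card_eq_UNIV_imp_eq_UNIV)
  then have "x \<in> g ` (U \<times> V \<times> W)" by simp
  then show ?thesis by (auto simp: g_def)
qed

text \<open>This is the dual of the spanning condition: a functional that vanishes on three members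
  vanishes everywhere. Its values at the vectors (0, 0, t) then show that c = 0.\<close>

lemma functional_members:
  assumes T: "phyp T" and m: "U \<in> insert zsub (members T)" "V \<in> insert zsub (members T)"
    "W \<in> insert zsub (members T)" and d: "U \<noteq> V" "U \<noteq> W" "V \<noteq> W"
    and z: "\<And>x y z. (x, y, z) \<in> U \<union> V \<union> W \<Longrightarrow> trc (a * x) + trc (b * y) + trc (c * z) = 0"
  shows "c = 0"
proof (rule trc_nondeg)
  fix t
  define F :: "gf16 vec3 \<Rightarrow> gf16" where "F = (\<lambda>(x, y, z). trc (a * x) + trc (b * y) + trc (c * z))"
  have F: "F (u + v) = F u + F v" for u v
    by (cases u, cases v) (simp add: F_def distrib_left trc_add ac_simps)
  obtain u v w where uvw: "u \<in> U" "v \<in> V" "w \<in> W" "(0, 0, t) = u + v + w"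
    using members_span[OF T m d] by blast
  have "F p = 0" if "p \<in> U \<union> V \<union> W" for p using z that by (cases p) (auto simp: F_def)
  then have "F (u + v + w) = 0" using uvw by (simp add: F)
  then have "F (0, 0, t) = 0" using uvw(4) by simp
  then show "trc (c * t) = 0" by (simp add: F_def trc_0)
qed

text \<open>The coefficient a for which the functional with coefficients (a, b, c) vanishes on the
  graph of the pair. For fixed c it is an affine line in b with slope the adjoint of the first
  component.\<close>

definition vline :: "(gmap \<times> gmap) \<Rightarrow> gf16 \<Rightarrow> gf16 \<Rightarrow> gf16" where
  "vline p c b = adjt (tab (snd p)) c + adjt (tab (fst p)) b"

lemma vline_fun: "vline p c = (\<lambda>b. adjt (tab (snd p)) c + adjt (tab (fst p)) b)"
  by (rule HOL.ext) (simp add: vline_def)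

lemma vline_graph:
  assumes "phyp T" "(A, B) \<in> T" "(x, y, z) \<in> graph3 A B"
  shows "trc (vline (A, B) c b * x) + trc (b * y) + trc (c * z) = 0"
proof -
  have yz: "y = A x" "z = B x" using assms(3) by (auto simp: graph3_def)
  show ?thesis
    unfolding yz adjt[OF phypD(3)[OF assms(1,2)]] adjt[OF phypD(4)[OF assms(1,2)]]
      vline_def fst_conv snd_conv distrib_right trc_add gf16_add_cancel2 by (rule gf16_double)
qed

lemma vline_triple:
  assumes T: "phyp T" and p: "p \<in> T" "q \<in> T" "r \<in> T" "p \<noteq> q" "p \<noteq> r" "q \<noteq> r" and c: "c \<noteq> 0"
    and e: "vline p c b = vline q c b" "vline q c b = vline r c b"
  shows False
proof -
  obtain A B A' B' A'' B'' where pqr: "p = (A, B)" "q = (A', B')" "r = (A'', B'')"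
    by (cases p, cases q, cases r) blast
  have "c = 0"
  proof (rule functional_members[OF T])
    show "graph3 A B \<in> insert zsub (members T)" "graph3 A' B' \<in> insert zsub (members T)"
      "graph3 A'' B'' \<in> insert zsub (members T)"
      using p graph3_mem unfolding pqr by blast+
    show "graph3 A B \<noteq> graph3 A' B'" "graph3 A B \<noteq> graph3 A'' B''" "graph3 A' B' \<noteq> graph3 A'' B''"
      using p pqr by (auto simp: graph3_inj)
    fix x y z assume "(x, y, z) \<in> graph3 A B \<union> graph3 A' B' \<union> graph3 A'' B''"
    then show "trc (vline p c b * x) + trc (b * y) + trc (c * z) = 0"
      using vline_graph[OF T] p e unfolding pqr by (elim UnE) metis+
  qed
  then show False using c by simp
qed

text \<open>For b = 0 the functional also vanishes on \<open>ysub\<close>, so two graphs already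
  give three members.\<close>

lemma vline_pair:
  assumes T: "phyp T" and p: "p \<in> T" "q \<in> T" "p \<noteq> q" and c: "c \<noteq> 0"
    and e: "vline p c 0 = vline q c 0"
  shows False
proof -
  obtain A B A' B' where pqr: "p = (A, B)" "q = (A', B')" by (cases p, cases q) blast
  have "c = 0"
  proof (rule functional_members[OF T])
    show "graph3 A B \<in> insert zsub (members T)" "graph3 A' B' \<in> insert zsub (members T)"
      using p graph3_mem unfolding pqr by blast+
    show "ysub \<in> insert zsub (members T)" by (rule ysub_mem)
    show "graph3 A B \<noteq> graph3 A' B'" "graph3 A B \<noteq> ysub" "graph3 A' B' \<noteq> ysub"
      using p pqr by (auto simp: graph3_inj graph3_neq)
    fix x y z assume m: "(x, y, z) \<in> graph3 A B \<union> graph3 A' B' \<union> ysub"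
    show "trc (vline p c 0 * x) + trc (0 * y) + trc (c * z) = 0"
    proof (cases "(x, y, z) \<in> ysub")
      case True
      then show ?thesis by (auto simp: ysub_def trc_0)
    next
      case False
      then show ?thesis using m vline_graph[OF T] p e unfolding pqr by (elim UnE) (metis, metis, blast)
    qed
  qed
  then show False using c by simp
qed

lemma meet_map:
  "meet d (map f us) (map h us) us = d \<or> (\<exists>u. meet d (map f us) (map h us) us = (u, f u) \<and> f u = h u)"
  by (induction us) auto

lemma meets_set: "set (meets d c ms) = (\<lambda>m. meet d m c gU) ` set ms"
  by (induction ms) auto

lemma avoids_iff: "avoids ds c \<longleftrightarrow> (\<forall>(u, v) \<in> set ds. look u c \<noteq> v)"
  by (induction ds c rule: avoids.induct) auto

lemma avoids_doubles:
  assumes "c 0 \<noteq> c' 0" "\<And>m u. m \<in> M \<Longrightarrow> m u = c u \<Longrightarrow> c' u \<noteq> c u" "set ms = tab ` M"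
  shows "avoids (doubles ms (tab c)) (tab c')"
proof -
  have "c' u \<noteq> v" if uv: "(u, v) \<in> set (doubles ms (tab c))" for u v
  proof -
    let ?d = "(G0, c G0)"
    have z: "c' G0 \<noteq> c G0" using assms(1) by (simp add: zero_gf16_def)
    consider "(u, v) = ?d" | m where "m \<in> M" "(u, v) = meet ?d (tab m) (tab c) gU"
      using uv(1) assms(3) by (auto simp: doubles_def meets_set)
    then show ?thesis
    proof cases
      case 1 then show ?thesis using z by simp
    next
      case 2
      have "(u, v) = ?d \<or> (v = m u \<and> m u = c u)"
        using meet_map[of ?d m gU c, folded tab_def] unfolding 2(2)[symmetric] by auto
      then show ?thesis using z assms(2)[OF 2(1), of u] by auto
    qed
  qed
  then show ?thesis by (auto simp: avoids_iff)
qed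

lemma nonid_set: "set (nonid ls) = set ls - {gU}"
  by (induction ls) (auto simp: eqt_def)

lemma nonid_labels:
  "distinct (map (look G1) ls) \<Longrightarrow> distinct (map fst (line_groups (nonid ls)))"
  "fst ` set (line_groups (nonid ls)) = look G1 ` set (nonid ls)"
proof -
  have f: "map fst (line_groups l) = map (look G1) l" for l by (induction l) auto
  have "nonid ls = filter (\<lambda>l. l \<noteq> gU) ls" by (induction ls) (auto simp: eqt_def)
  then show "distinct (map fst (line_groups (nonid ls)))" if "distinct (map (look G1) ls)"
    using that unfolding f by (simp add: distinct_map_filter)
  show "fst ` set (line_groups (nonid ls)) = look G1 ` set (nonid ls)"
    using f[of "nonid ls"] by (metis list.set_map)
qed

lemma line_groups_mem:
  "(y, g) \<in> set (line_groups ls) \<Longrightarrow> \<exists>l \<in> set ls. y = look G1 l \<and> g = lines gU (adjtab l)"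
  by (induction ls) auto

lemma lines_mem: "y \<in> set ys \<Longrightarrow> shiftl y L \<in> set (lines ys L)"
  by (induction ys) auto

lemma adjtab_tab: "shiftl y (adjtab (tab A)) = tab (\<lambda>b. y + adjt (tab A) b)"
  by (simp add: shiftl_map adjtab_def tab_def)

lemma prune_mem: "(y, g) \<in> set (prune P gs) \<Longrightarrow> \<exists>g0. (y, g0) \<in> set gs \<and> g = filter P g0"
  by (auto simp: prune_def)

text \<open>A shift of the second components makes the line of slope 0 the axis. The line of slope 1
  meets b = 0 in the value at c of the adjoint of \<open>B1\<close>; this adjoint is bijective, so c
  can be chosen to make the value g.\<close>

lemma kill_sound:
  assumes k: "kill pl g = []" "g \<noteq> G0"
    and pl: "gU \<in> set pl" "distinct (map (look G1) pl)" "length (nonid pl) = 14"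
    and S: "osp S" "zmap \<in> S" "set pl \<subseteq> tab ` (S - {zmap})"
  shows False
proof -
  obtain T0 where T0: "phyp T0" "S = fst ` T0" using S(1) by (auto simp: osp_def)
  then obtain T where T: "phyp T" "fst ` T = S" "(zmap, zmap) \<in> T"
    using phyp_zero[OF T0(1)] S(2) by metis
  have "id \<in> S" using pl(1) S(3) by (auto simp: tab_id(2)[symmetric] tab_eq_iff simp del: tab_id)
  then obtain B1 where B1: "(id, B1) \<in> T" using T(2) by auto
  have idz: "id \<noteq> zmap" by (rule bij_neq_zmap[OF bij_id])
  have bB1: "bij B1" using phyp_bij(2)[OF T(1,3)] B1 idz by blast
  have aB1: "addmap B1" using phypD(4)[OF T(1) B1] .
  obtain c where c: "adjt (tab B1) c = g"
  proof -
    have "addmap (adjt (tab B1))" by (simp add: addmap_def addmap_adjt[OF aB1])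
    moreover have "x = 0" if "adjt (tab B1) x = 0" for x
    proof (rule trc_nondeg)
      fix y
      obtain z where "y = B1 z" using bB1 by (metis bij_pointE)
      then show "trc (x * y) = 0" using adjt[OF aB1, of x z] that by (simp add: trc_0)
    qed
    ultimately have "bij (adjt (tab B1))" by (rule addmap_bij)
    then show ?thesis using that by (metis bij_pointE)
  qed
  have c0: "c \<noteq> 0" using c k(2) adjt_0[OF aB1] by (auto simp: zero_gf16_def)
  define B where "B A = (SOME B. (A, B) \<in> T)" for A
  have B: "(A, B A) \<in> T" if "A \<in> S" for A
  proof -
    have "\<exists>B. (A, B) \<in> T" using that T(2) by auto
    then show ?thesis unfolding B_def by (rule someI_ex)
  qed
  have Beq: "B A = B'" if "(A, B') \<in> T" for A B'
  proof -
    have "A \<in> S" using that T(2) by force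
    from inj_onD[OF phyp_fst_inj[OF T(1)] _ B[OF this] that] show ?thesis by simp
  qed
  define p where "p y = (elem S y, B (elem S y))" for y
  have pT: "p y \<in> T" for y using B[OF elem(1)[OF S(1)]] by (simp add: p_def)
  have pinj: "p y \<noteq> p y'" if "y \<noteq> y'" for y y' using elem_neq[OF S(1) that] by (simp add: p_def)
  define t where "t y = tab (vline (p y) c)" for y
  have e: "elem S G0 = zmap" "elem S G1 = id"
    by (rule elem_eq[OF S(1)]; use S(2) \<open>id \<in> S\<close> in \<open>simp add: zero_gf16_def\<close>)+
  have t0: "t G0 = zero_tab"
    by (simp add: t_def p_def e Beq[OF T(3)] vline_fun adjt_zmap tab_zmap)
  have t1: "t G1 = shiftl g gU"
  proof -
    have "t G1 = tab (\<lambda>b. g + b)" by (simp add: t_def p_def e Beq[OF B1] vline_fun adjt_id c)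
    also have "\<dots> = shiftl g gU" by (simp add: shiftl_map tab_def)
    finally show ?thesis .
  qed
  have Q: "avoids (doubles (map t ls) (t i)) (t j)" if "distinct (i # j # ls)" for ls i j
  proof -
    have ne: "p i \<noteq> p j" using that pinj by simp
    show ?thesis unfolding t_def
    proof (rule avoids_doubles[where M = "(\<lambda>y. vline (p y) c) ` set ls"])
      show "vline (p i) c 0 \<noteq> vline (p j) c 0" using vline_pair[OF T(1) pT pT ne c0] by blast
      fix m u assume m: "m \<in> (\<lambda>y. vline (p y) c) ` set ls" "m u = vline (p i) c u"
      then obtain y where y: "y \<in> set ls" "m = vline (p y) c" by blast
      have "y \<noteq> i" "y \<noteq> j" using y(1) that by auto
      note pinj[OF this(1)] pinj[OF this(2)]
      then show "vline (p j) c u \<noteq> vline (p i) c u"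
        using vline_triple[OF T(1) pT pT pT _ _ ne c0] m(2) y(2) by metis
    qed auto
  qed
  let ?gs = "prune (avoids (doubles [zero_tab] (shiftl g gU))) (prune (avoids [(G0, G0)]) (line_groups (nonid pl)))"
  have labs: "map fst ?gs = map fst (line_groups (nonid pl))" by (simp add: prune_fst)
  have labset: "fst ` set ?gs = look G1 ` set (nonid pl)"
    using labs nonid_labels(2)[of pl] by (metis list.set_map)
  have lab_in: "\<exists>A \<in> S. l = tab A \<and> A = elem S (look G1 l) \<and> look G1 l \<noteq> G0 \<and> look G1 l \<noteq> G1"
    if "l \<in> set (nonid pl)" for l
  proof -
    have l: "l \<in> set pl" "l \<noteq> gU" using that by (simp_all add: nonid_set)
    then obtain A where A: "A \<in> S" "A \<noteq> zmap" "l = tab A" using S(3) by blast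
    have el: "elem S (look G1 l) = A" by (rule elem_eq[OF S(1) A(1)]) (simp add: A(3))
    have ni: "A \<noteq> id"
    proof
      assume "A = id"
      then show False using l(2) A(3) tab_id(2) by simp
    qed
    have "look G1 l \<noteq> G0"
    proof
      assume "look G1 l = G0"
      then show False using el e(1) A(2) by simp
    qed
    moreover have "look G1 l \<noteq> G1"
    proof
      assume "look G1 l = G1"
      then show False using el e(2) ni by simp
    qed
    ultimately show ?thesis
      by (intro bexI[OF _ A(1)] conjI A(3) el[symmetric])
  qed
  have "\<exists>ls'. set ls' = fst ` set ?gs \<union> set [G1, G0] \<and>
    map t ls' \<in> set (search doubles avoids [(),(),(),(),(),(),(),(),(),(),(),(),(),()] (map t [G1, G0]) ?gs)"
  proof (rule search_sound[where L = UNIV])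
    show "avoids (doubles (map t ls) (t i)) (t j)" if "distinct (i # j # ls)" for ls i j by (rule Q[OF that])
    have "length (line_groups l) = length l" for l by (induction l) auto
    then show "length [(),(),(),(),(),(),(),(),(),(),(),(),(),()] = length ?gs"
      using pl(3) by (simp add: prune_def)
    have "look G1 l \<noteq> G0 \<and> look G1 l \<noteq> G1" if "l \<in> set (nonid pl)" for l
      using lab_in[OF that] by blast
    then have dj: "set (map fst ?gs) \<inter> {G1, G0} = {}"
      unfolding set_map labset by blast
    have "distinct (map fst ?gs)" unfolding labs by (rule nonid_labels(1)[OF pl(2)])
    then show "distinct (map fst ?gs @ [G1, G0])"
      using dj unfolding distinct_append list.set by simp
    fix i G assume iG: "(i, G) \<in> set ?gs"
    obtain G1' where g1: "(i, G1') \<in> set (prune (avoids [(G0, G0)]) (line_groups (nonid pl)))"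
      "G = filter (avoids (doubles [zero_tab] (shiftl g gU))) G1'" using prune_mem[OF iG] by (elim exE conjE)
    obtain G2' where g2: "(i, G2') \<in> set (line_groups (nonid pl))" "G1' = filter (avoids [(G0, G0)]) G2'"
      using prune_mem[OF g1(1)] by (elim exE conjE)
    obtain l where l: "l \<in> set (nonid pl)" "i = look G1 l" "G2' = lines gU (adjtab l)"
      using line_groups_mem[OF g2(1)] by (elim bexE conjE)
    obtain A where A: "A \<in> S" "l = tab A" "A = elem S i" "i \<noteq> G0" "i \<noteq> G1"
      using lab_in[OF l(1)] unfolding l(2)[symmetric] by (elim bexE conjE)
    have ti: "t i = shiftl (adjt (tab (B A)) c) (adjtab l)"
      unfolding A(2) adjtab_tab t_def p_def A(3)[symmetric] by (simp add: vline_fun)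
    have c1: "t i \<in> set G2'" unfolding ti l(3) by (rule lines_mem[OF gU_mem])
    have d0: "distinct [i, G0, G1]" using A(4,5) by simp
    \<comment> \<open>The search starts with the lines of the labels \<open>G0\<close> and
      \<open>G1\<close> already chosen, so their conditions on the other lines are imposed
      beforehand by the two filters in \<open>kill\<close>.\<close>
    then have "avoids (doubles (map t []) (t G0)) (t i)" by (intro Q) auto
    then have c2: "avoids [(G0, G0)] (t i)" by (simp add: t0 doubles_def zero_tab_def look_eval)
    have "avoids (doubles (map t [G0]) (t G1)) (t i)" by (intro Q) (use d0 in auto)
    then have c3: "avoids (doubles [zero_tab] (shiftl g gU)) (t i)" unfolding list.map t0 t1 .
    show "t i \<in> set G" unfolding g1(2) g2(2) set_filter using c1 c2 c3 by blast
  qed (rule subset_UNIV)+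
  moreover have "search doubles avoids [(),(),(),(),(),(),(),(),(),(),(),(),(),()] (map t [G1, G0]) ?gs = []"
    using k(1) unfolding kill_def list.map t0 t1 .
  ultimately show False by (simp only: list.set empty_iff simp_thms)
qed

section \<open>The search for spread sets\<close>

text \<open>\<open>plane0\<close> is the Desarguesian plane. The seven other planes, the orbits and the coordinate changes that
  take the solutions of each phase to one of the planes are the output of a computer search.\<close>

definition plane0 :: "gf16 list list" where
  "plane0 = [addtab G15 G13 G9 G1,
    addtab G13 G9 G1 G2,
    addtab G2 G4 G8 G3,
    addtab G9 G1 G2 G4,
    addtab G6 G12 G11 G5,
    addtab G4 G8 G3 G6,
    addtab G11 G5 G10 G7,
    addtab G1 G2 G4 G8,
    addtab G14 G15 G13 G9,
    addtab G12 G11 G5 G10,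
    addtab G3 G6 G12 G11,
    addtab G8 G3 G6 G12,
    addtab G7 G14 G15 G13,
    addtab G5 G10 G7 G14,
    addtab G10 G7 G14 G15]"

definition plane1 :: "gf16 list list" where
  "plane1 = [addtab G5 G8 G2 G1,
    addtab G13 G7 G3 G2,
    addtab G2 G4 G8 G3,
    addtab G7 G9 G12 G4,
    addtab G8 G3 G10 G5,
    addtab G12 G14 G1 G6,
    addtab G15 G11 G9 G7,
    addtab G1 G2 G4 G8,
    addtab G14 G6 G13 G9,
    addtab G6 G1 G15 G10,
    addtab G9 G5 G6 G11,
    addtab G10 G15 G14 G12,
    addtab G3 G12 G11 G13,
    addtab G11 G10 G7 G14,
    addtab G4 G13 G5 G15]"

definition plane2 :: "gf16 list list" where
  "plane2 = [addtab G5 G8 G2 G1,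
    addtab G13 G7 G12 G2,
    addtab G2 G4 G8 G3,
    addtab G7 G9 G11 G4,
    addtab G8 G3 G7 G5,
    addtab G12 G14 G15 G6,
    addtab G15 G11 G6 G7,
    addtab G1 G2 G4 G8,
    addtab G14 G6 G3 G9,
    addtab G6 G1 G14 G10,
    addtab G9 G5 G13 G11,
    addtab G10 G15 G1 G12,
    addtab G3 G12 G5 G13,
    addtab G11 G10 G9 G14,
    addtab G4 G13 G10 G15]"

definition plane3 :: "gf16 list list" where
  "plane3 = [addtab G5 G8 G2 G1,
    addtab G15 G7 G3 G2,
    addtab G2 G4 G8 G3,
    addtab G3 G9 G12 G4,
    addtab G14 G10 G7 G5,
    addtab G12 G14 G15 G6,
    addtab G9 G6 G13 G7,
    addtab G1 G2 G4 G8,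
    addtab G11 G5 G6 G9,
    addtab G6 G1 G14 G10,
    addtab G4 G13 G5 G11,
    addtab G10 G15 G1 G12,
    addtab G8 G3 G10 G13,
    addtab G13 G12 G11 G14,
    addtab G7 G11 G9 G15]"

definition plane4 :: "gf16 list list" where
  "plane4 = [addtab G6 G8 G11 G1,
    addtab G4 G12 G3 G2,
    addtab G2 G4 G8 G3,
    addtab G9 G11 G10 G4,
    addtab G15 G3 G1 G5,
    addtab G13 G7 G9 G6,
    addtab G11 G15 G2 G7,
    addtab G1 G2 G4 G8,
    addtab G7 G10 G15 G9,
    addtab G5 G14 G7 G10,
    addtab G3 G6 G12 G11,
    addtab G8 G9 G14 G12,
    addtab G14 G1 G5 G13,
    addtab G12 G5 G13 G14,
    addtab G10 G13 G6 G15]"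

definition plane5 :: "gf16 list list" where
  "plane5 = [addtab G6 G8 G11 G1,
    addtab G7 G13 G3 G2,
    addtab G2 G4 G8 G3,
    addtab G14 G6 G9 G4,
    addtab G8 G3 G7 G5,
    addtab G13 G10 G15 G6,
    addtab G11 G15 G2 G7,
    addtab G1 G2 G4 G8,
    addtab G10 G7 G6 G9,
    addtab G5 G9 G14 G10,
    addtab G15 G14 G12 G11,
    addtab G4 G1 G10 G12,
    addtab G3 G12 G5 G13,
    addtab G12 G5 G13 G14,
    addtab G9 G11 G1 G15]"

definition plane6 :: "gf16 list list" where
  "plane6 = [addtab G13 G3 G11 G1,
    addtab G6 G13 G10 G2,
    addtab G2 G4 G8 G3,
    addtab G10 G8 G1 G4,
    addtab G15 G6 G2 G5,
    addtab G14 G11 G9 G6,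
    addtab G4 G14 G5 G7,
    addtab G1 G2 G4 G8,
    addtab G12 G1 G15 G9,
    addtab G7 G15 G14 G10,
    addtab G9 G5 G6 G11,
    addtab G3 G7 G13 G12,
    addtab G11 G12 G3 G13,
    addtab G5 G10 G7 G14,
    addtab G8 G9 G12 G15]"

definition plane7 :: "gf16 list list" where
  "plane7 = [addtab G13 G3 G11 G1,
    addtab G15 G7 G3 G2,
    addtab G2 G4 G8 G3,
    addtab G7 G13 G12 G4,
    addtab G10 G14 G7 G5,
    addtab G8 G10 G15 G6,
    addtab G3 G8 G2 G7,
    addtab G1 G2 G4 G8,
    addtab G14 G15 G13 G9,
    addtab G12 G11 G5 G10,
    addtab G9 G5 G6 G11,
    addtab G4 G1 G10 G12,
    addtab G6 G9 G14 G13,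
    addtab G11 G6 G9 G14,
    addtab G5 G12 G1 G15]"

definition orbits :: "gf16 list list list" where
  "orbits = [orbit (addtab G5 G8 G2 G1) u15 u15 u15 u15,
    orbit (addtab G4 G15 G2 G1) u15 u15 u15 u15,
    orbit (addtab G6 G8 G11 G1) u15 u15 u15 u15,
    orbit (addtab G7 G15 G5 G1) u15 u15 u15 u15,
    orbit (addtab G7 G14 G12 G1) u15 u15 u15 u15,
    orbit (addtab G12 G5 G2 G1) u15 u15 u15 u15,
    orbit (addtab G14 G9 G3 G1) u15 u15 u15 u15,
    orbit (addtab G6 G9 G2 G1) u15 u15 u15 u15,
    orbit (addtab G13 G10 G3 G1) u15 u15 u15 u15,
    orbit (addtab G13 G10 G2 G1) u15 u15 u15 u15,
    orbit (addtab G13 G15 G6 G1) u15 u15 u15 u15,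
    orbit (addtab G6 G14 G11 G1) u15 u15 u15 u15,
    orbit (addtab G5 G8 G11 G1) u15 u15 u15 u15,
    orbit (addtab G12 G7 G2 G1) u15 u15 u15 u15,
    orbit (addtab G13 G5 G2 G1) u15 u15 u15 u15,
    orbit (addtab G10 G13 G5 G1) u15 u15 u15 u15,
    orbit (addtab G4 G10 G3 G1) u15 u15 u15 u15,
    orbit (addtab G4 G8 G3 G1) u15 u15 u15 u15,
    orbit (addtab G6 G14 G5 G1) u15 u15 u15 u15,
    orbit (addtab G7 G9 G3 G1) u15 u15 u15 u15,
    orbit (addtab G10 G7 G5 G1) u15 u15 u0 u0,
    orbit (addtab G5 G10 G2 G1) u15 u0 u15 u0,
    orbit (addtab G6 G9 G11 G1) u15 u0 u15 u0,
    orbit (addtab G13 G10 G15 G1) u15 u15 u0 u0,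
    orbit (addtab G15 G8 G2 G1) u15 u15 u15 u15,
    orbit (addtab G12 G3 G7 G1) u15 u15 u0 u0,
    orbit (addtab G4 G10 G7 G1) u15 u15 u0 u0,
    orbit (addtab G10 G5 G7 G1) u15 u0 u0 u0,
    orbit (addtab G5 G10 G7 G1) u15 u0 u0 u0,
    orbit (addtab G5 G10 G11 G2) u15 u0 u0 u0,
    orbit (addtab G13 G3 G11 G1) u5 u5 u5 u5,
    orbit (addtab G4 G9 G2 G1) u5 u5 u5 u5,
    orbit (addtab G10 G5 G12 G1) u5 u0 u5 u0,
    orbit (addtab G5 G14 G3 G1) u5 u5 u0 u0,
    orbit (addtab G7 G10 G11 G2) u5 u5 u0 u0,
    orbit (addtab G15 G13 G9 G1) u1 u1 u1 u1,
    orbit (addtab G13 G9 G1 G2) u1 u1 u1 u1,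
    orbit (addtab G6 G12 G11 G5) u1 u1 u1 u1,
    orbit (addtab G5 G10 G7 G14) u1 u0 u0 u0]"

definition certs where
  "certs = [[(plane1, []),
     (plane2, []),
     (plane2, [Iv, Nm G1, Cj G9 G10 G6 G13]),
     (plane3, [])],
    [(plane2, [Tr G1, Iv, Nm G1, Cj G5 G4 G13 G14]),
     (plane2, [Tr G3, Iv, Tr G12, Nm G1, Cj G5 G3 G7 G12])],
    [(plane4, []),
     (plane4, [Tr G9, Iv, Nm G3, Cj G3 G8 G12 G2]),
     (plane5, []),
     (plane4, [Tr G3, Iv, Nm G3, Cj G13 G5 G10 G4])],
    [(plane2, [Tr G1, Iv, Tr G7, Nm G1, Cj G11 G12 G2 G10]),
     (plane4, [Tr G7, Iv, Nm G2, Cj G5 G6 G9 G11]),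
     (plane2, [Tr G1, Iv, Tr G2, Nm G1, Cj G12 G15 G10 G8]),
     (plane4, [Tr G11, Iv, Nm G2, Cj G9 G4 G3 G2]),
     (plane5, [Iv, Nm G8, Cj G10 G5 G14 G7]),
     (plane5, [Iv, Tr G2, Nm G4, Cj G10 G8 G9 G5])],
    [(plane4, [Tr G5, Iv, Nm G2, Cj G9 G8 G6 G13]),
     (plane5, [Iv, Tr G3, Nm G12, Cj G12 G1 G8 G11]),
     (plane2, [Tr G3, Iv, Tr G8, Nm G1, Cj G8 G11 G9 G15]),
     (plane2, [Tr G3, Iv, Tr G8, Nm G1, Cj G11 G8 G12 G2]),
     (plane1, [Iv, Tr G6, Nm G1, Cj G8 G3 G10 G6]),
     (plane4, [Tr G2, Iv, Nm G4, Cj G14 G6 G3 G7])],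
    [(plane4, [Tr G12, Iv, Nm G5, Cj G12 G3 G4 G14]),
     (plane5, [Tr G2, Iv, Nm G15, Cj G1 G15 G13 G9]),
     (plane2, [Tr G3, Iv, Tr G8, Nm G1, Cj G13 G4 G14 G2]),
     (plane2, [Tr G6, Iv, Tr G13, Nm G1, Cj G9 G5 G7 G4])],
    [(plane5, [Iv, Nm G2, Cj G1 G3 G10 G4]),
     (plane5, [Iv, Tr G1, Nm G12, Cj G6 G13 G5 G2]),
     (plane1, [Iv, Tr G4, Nm G1, Cj G3 G5 G9 G7])],
    [],
    [(plane5, [Tr G1, Iv, Tr G3, Nm G4, Cj G14 G4 G15 G2]),
     (plane3, [Tr G10, Iv, Nm G2, Cj G15 G7 G2 G14])],
    [],
    [(plane4, [Tr G9, Iv, Nm G3, Cj G7 G3 G14 G6]),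
     (plane4, [Tr G10, Iv, Nm G4, Cj G8 G10 G1 G12]),
     (plane5, [Iv, Nm G7, Cj G15 G12 G8 G13]),
     (plane2, [Tr G2, Iv, Nm G1, Cj G3 G8 G13 G4]),
     (plane4, [Tr G14, Iv, Nm G6, Cj G11 G13 G14 G9]),
     (plane4, [Tr G15, Iv, Nm G2, Cj G10 G8 G15 G4]),
     (plane5, [Iv, Nm G8, Cj G5 G4 G8 G3]),
     (plane2, [Tr G4, Iv, Tr G6, Nm G2, Cj G1 G7 G15 G11]),
     (plane4, [Tr G9, Iv, Nm G1, Cj G10 G15 G9 G1]),
     (plane4, [Tr G14, Iv, Nm G2, Cj G7 G4 G14 G5]),
     (plane5, [Iv, Tr G1, Nm G5, Cj G15 G12 G4 G13]),
     (plane2, [Tr G10, Iv, Tr G10, Nm G1, Cj G1 G15 G9 G11])],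
    [(plane5, [Tr G1, Iv, Tr G2, Nm G12, Cj G2 G9 G10 G4]),
     (plane3, [Tr G6, Iv, Nm G1, Cj G14 G2 G1 G5])],
    [(plane2, [Iv, Tr G1, Nm G1, Cj G8 G10 G3 G15]),
     (plane4, [Tr G10, Iv, Nm G2, Cj G13 G4 G3 G5]),
     (plane4, [Tr G8, Iv, Nm G1, Cj G15 G7 G4 G14]),
     (plane2, [Tr G5, Iv, Tr G8, Nm G4, Cj G14 G12 G10 G11]),
     (plane5, [Iv, Nm G8, Cj G14 G15 G11 G12])],
    [(plane4, [Tr G4, Iv, Nm G1, Cj G7 G13 G2 G11]),
     (plane4, [Tr G15, Iv, Nm G2, Cj G9 G13 G1 G6]),
     (plane4, [Tr G11, Iv, Nm G7, Cj G1 G11 G9 G14]),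
     (plane5, [Iv, Tr G2, Nm G3, Cj G3 G12 G13 G10]),
     (plane4, [Tr G4, Iv, Nm G2, Cj G7 G8 G5 G6]),
     (plane5, [Iv, Tr G1, Nm G9, Cj G9 G7 G2 G13]),
     (plane2, [Tr G3, Iv, Tr G8, Nm G1, Cj G11 G10 G15 G13])],
    [(plane2, [Tr G6, Iv, Tr G6, Nm G1, Cj G1 G13 G6 G9])],
    [(plane5, [Iv, Nm G11, Cj G2 G10 G13 G14]),
     (plane5, [Iv, Nm G5, Cj G5 G10 G13 G3]),
     (plane2, [Tr G10, Iv, Tr G8, Nm G2, Cj G12 G6 G3 G2])],
    [(plane2, [Tr G4, Iv, Tr G7, Nm G1, Cj G6 G8 G11 G12])],
    [(plane4, [Tr G5, Iv, Nm G6, Cj G11 G1 G5 G2]),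
     (plane2, [Tr G2, Iv, Tr G11, Nm G1, Cj G8 G1 G3 G15]),
     (plane2, [Tr G2, Iv, Tr G11, Nm G1, Cj G7 G12 G5 G10]),
     (plane1, [Iv, Nm G1, Cj G9 G14 G2 G3]),
     (plane3, [Tr G2, Iv, Tr G1, Nm G2, Cj G4 G8 G14 G9])],
    [(plane2, [Iv, Tr G4, Nm G1, Cj G7 G4 G15 G1]),
     (plane2, [Tr G4, Iv, Nm G1, Cj G13 G12 G15 G4]),
     (plane4, [Tr G5, Iv, Nm G5, Cj G12 G6 G9 G11]),
     (plane5, [Iv, Nm G7, Cj G13 G1 G7 G4])],
    [(plane2, [Tr G2, Iv, Tr G5, Nm G1, Cj G13 G11 G4 G8]),
     (plane2, [Tr G3, Iv, Tr G7, Nm G1, Cj G14 G13 G9 G8])],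
    [(plane3, [Tr G5, Iv, Nm G1, Cj G3 G8 G5 G4]),
     (plane1, [Iv, Tr G3, Nm G1, Cj G5 G7 G12 G1]),
     (plane2, [Tr G5, Iv, Nm G1, Cj G12 G6 G1 G3])],
    [(plane1, [Iv, Tr G5, Nm G1, Cj G13 G4 G3 G5]),
     (plane3, [Tr G5, Iv, Nm G1, Cj G3 G11 G6 G10]),
     (plane2, [Tr G5, Iv, Nm G1, Cj G10 G6 G3 G1])],
    [(plane2, [Tr G6, Iv, Tr G2, Nm G1, Cj G12 G4 G13 G14]),
     (plane2, [Tr G6, Iv, Tr G2, Nm G1, Cj G9 G2 G5 G6]),
     (plane2, [Tr G6, Iv, Tr G3, Nm G1, Cj G5 G6 G8 G9])],
    [(plane2, [Tr G5, Iv, Tr G4, Nm G1, Cj G2 G8 G1 G6]),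
     (plane2, [Tr G5, Iv, Tr G4, Nm G1, Cj G8 G6 G2 G1]),
     (plane2, [Tr G5, Iv, Tr G5, Nm G1, Cj G10 G13 G3 G12])],
    [(plane2, [Tr G3, Iv, Tr G7, Nm G1, Cj G3 G5 G10 G11]),
     (plane2, [Tr G3, Iv, Tr G3, Nm G2, Cj G12 G11 G6 G9]),
     (plane2, [Tr G3, Iv, Tr G5, Nm G1, Cj G13 G7 G8 G6])],
    [(plane2, [Tr G5, Iv, Tr G8, Nm G4, Cj G15 G10 G9 G1])],
    [(plane2, [Tr G3, Iv, Tr G14, Nm G2, Cj G4 G9 G1 G6])],
    [],
    [],
    [],
    [(plane6, []),
     (plane6, [Iv, Nm G2, Cj G13 G1 G9 G15]),
     (plane6, [Iv, Nm G9, Cj G14 G3 G15 G6]),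
     (plane6, [Iv, Nm G3, Cj G1 G8 G15 G2]),
     (plane6, [Iv, Tr G1, Nm G2, Cj G1 G15 G9 G13]),
     (plane6, [Iv, Nm G5, Cj G3 G1 G8 G15]),
     (plane6, [Iv, Nm G6, Cj G2 G1 G15 G8]),
     (plane6, [Iv, Nm G9, Cj G8 G12 G1 G3]),
     (plane6, [Iv, Nm G2, Cj G13 G12 G9 G11]),
     (plane6, [Iv, Tr G1, Nm G2, Cj G9 G1 G2 G4]),
     (plane6, [Iv, Nm G3, Cj G4 G1 G10 G12]),
     (plane6, [Iv, Tr G1, Nm G2, Cj G14 G1 G13 G10]),
     (plane7, []),
     (plane7, [Iv, Tr G1, Nm G1, Cj G1 G12 G11 G9]),
     (plane6, [Iv, Nm G3, Cj G15 G1 G10 G13]),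
     (plane6, [Iv, Nm G6, Cj G14 G13 G15 G7]),
     (plane6, [Iv, Tr G1, Nm G2, Cj G8 G9 G4 G14]),
     (plane6, [Iv, Nm G4, Cj G1 G8 G15 G2]),
     (plane6, [Iv, Nm G3, Cj G10 G11 G2 G13]),
     (plane6, [Iv, Nm G3, Cj G1 G13 G11 G3]),
     (plane7, [Iv, Tr G2, Nm G2, Cj G5 G12 G4 G6]),
     (plane7, [Iv, Nm G4, Cj G1 G10 G13 G14]),
     (plane6, [Iv, Tr G2, Nm G1, Cj G14 G13 G15 G7]),
     (plane6, [Iv, Tr G2, Nm G1, Cj G3 G2 G11 G5])],
    [(plane7, [Tr G2, Iv, Tr G2, Nm G2, Cj G5 G12 G4 G6]),
     (plane7, [Iv, Nm G2, Cj G1 G12 G10 G4])],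
    [(plane7, [Iv, Nm G5, Cj G9 G2 G1 G13])],
    [(plane7, [Iv, Nm G6, Cj G15 G1 G10 G13])],
    [(plane7, [Iv, Nm G4, Cj G1 G13 G11 G3])],
    [(plane0, [])],
    [],
    [],
    []]"

lemmas planes_def = plane0_def plane1_def plane2_def plane3_def plane4_def plane5_def plane6_def plane7_def

lemma length_addtab: "length (addtab a b c d) = 16"
  by (simp add: addtab_tab)

lemma orbits_ok: "\<forall>o'\<in>set orbits. orbit_ok o'"
  unfolding orbits_def by (simp add: orbit_ok_orbit length_addtab)

lemma covered_orbits:
  "covered [G3, G4, G5, G6, G7, G8, G9, G10, G11, G12, G13, G14, G15] (concat orbits)"
  by (simp only: orbits_def orbits_eval cover_eval)

lemma phases_orbits: "phases orbits certs"
  by (simp only: orbits_def certs_def orbits_eval phases_evals planes_def)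

lemma kill_plane1: "kill plane1 G1 = []"
  by (simp only: plane1_def kill_eval)

lemma kill_plane2: "kill plane2 G1 = []"
  by (simp only: plane2_def kill_eval)

lemma kill_plane3: "kill plane3 G1 = []"
  by (simp only: plane3_def kill_eval)

lemma kill_plane5: "kill plane5 G1 = []"
  by (simp only: plane5_def kill_eval)

lemma kill_plane6: "kill plane6 G1 = []"
  by (simp only: plane6_def kill_eval)

lemma kill_plane7: "kill plane7 G1 = []"
  by (simp only: plane7_def kill_eval)

lemma kill_plane4: "kill plane4 G1 = []"
  by (simp only: plane4_def kill_eval)

text \<open>The tables of \<open>plane0\<close> are the multiplications by the nonzero field
  elements.\<close>

lemma desarg_plane0:
  assumes "osp S" "zmap \<in> S" "set plane0 \<subseteq> tab ` (S - {zmap})"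
  shows "desarg S"
proof -
  have m: "\<forall>c. c = G0 \<or> member (tab ((*) c)) plane0"
    by (simp only: all_gf16 plane0_def tables_eval member_eval tab_def list.map times_gf16_def gmul_tab
        gf16_eq simp_thms)
  have "(*) c \<in> S" for c
  proof (cases "c = G0")
    case True
    then have "(*) c = zmap" by (simp add: fun_eq_iff zero_gf16_def[symmetric])
    then show ?thesis using assms(2) by simp
  next
    case False
    then have "tab ((*) c) \<in> set plane0" using m member_iff by blast
    then show ?thesis using assms(3) tab_mem[of "(*) c" "S - {zmap}"] by blast
  qed
  then show ?thesis
    unfolding desarg_def
    by (intro exI[of _ id] exI[of _ zmap]) (simp add: addmap_id addmap_zero)
qed

lemma plane_tables:
  "gU \<in> set plane1" "gU \<in> set plane2" "gU \<in> set plane3" "gU \<in> set plane4" "gU \<in> set plane5"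
  "gU \<in> set plane6" "gU \<in> set plane7"
  unfolding member_iff[symmetric] by (simp_all only: planes_def tables_eval member_eval)

lemma plane_labels:
  "distinct (map (look G1) plane1)" "distinct (map (look G1) plane2)" "distinct (map (look G1) plane3)"
  "distinct (map (look G1) plane4)" "distinct (map (look G1) plane5)" "distinct (map (look G1) plane6)"
  "distinct (map (look G1) plane7)"
  by (simp_all only: planes_def tables_eval distinct.simps list.set insert_iff empty_iff simp_thms not_False_eq_True)

lemma plane_lengths:
  "length (nonid plane1) = 14" "length (nonid plane2) = 14" "length (nonid plane3) = 14"
  "length (nonid plane4) = 14" "length (nonid plane5) = 14" "length (nonid plane6) = 14"
  "length (nonid plane7) = 14"
  unfolding planes_def by (simp_all only: kill_eval) simp_all

lemma no_plane:
  assumes "pl \<in> {plane1, plane2, plane3, plane4, plane5, plane6, plane7}"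
    "osp S" "zmap \<in> S" "set pl \<subseteq> tab ` (S - {zmap})"
  shows False
proof -
  have "kill pl G1 = []" "gU \<in> set pl" "distinct (map (look G1) pl)" "length (nonid pl) = 14"
    using assms(1) kill_plane1 kill_plane2 kill_plane3 kill_plane4 kill_plane5 kill_plane6 kill_plane7
      plane_tables plane_labels plane_lengths by blast+
  from kill_sound[OF this(1) _ this(2-4) assms(2-4)] show False by simp
qed

lemma no_badw: "\<not> badw S"
proof (rule phases_sound[OF _ _ phases_orbits orbits_ok])
  let ?PL = "{plane0, plane1, plane2, plane3, plane4, plane5, plane6, plane7}"
  show "desarg S" if "pl \<in> ?PL" "osp S" "zmap \<in> S" "set pl \<subseteq> tab ` (S - {zmap})" for pl S
    using that desarg_plane0[of S] no_plane[of pl S] by blast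
  show "c \<noteq> []" if "pl \<in> ?PL" "c \<in> set pl" for pl c
  proof -
    have "c \<in> (\<Union>pl\<in>?PL. set pl)" using that by blast
    then have "\<exists>a b d e. c = addtab a b d e" unfolding planes_def by auto
    then show ?thesis using tab_neq_Nil by (auto simp: addtab_tab)
  qed
  show "\<forall>c\<in>set certs. \<forall>(pl, ps)\<in>set c. pl \<in> ?PL" unfolding certs_def by simp
  show "tab A \<in> set (concat orbits)" if "badw S" "A \<in> S" "A \<notin> {zmap, id, wm}" for S A
    by (rule badw_covered[OF covered_orbits that])
qed

section \<open>Normal forms of fixed-point-free maps\<close>

lemma gf16_two [simp]: "(2 :: gf16) = 0"
  by (metis one_add_one gf16_double)

text \<open>Companion matrices of x^4+x+1, x^4+x^3+1, x^4+x^3+x^2+x+1 and (x^2+x+1)^2, and the map with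
  minimal polynomial x^2+x+1. The first three generate the field GF(16), and the coordinate changes in
  \<open>irreducible_targets\<close> take the second and third one to the first.\<close>

definition ta where "ta = addtab G2 G4 G8 G3"
definition tb where "tb = addtab G2 G4 G8 G9"
definition tc where "tc = addtab G2 G4 G8 G15"
definition te where "te = addtab G2 G4 G8 G5"
definition td where "td = addtab G2 G3 G8 G12"

text \<open>The basis v, A v, A^2 v, A^3 v, in which a map with cyclic vector v becomes a companion
  matrix.\<close>

definition chain where "chain v l = addtab v (look v l) (look (look v l) l) (look (look (look v l) l) l)"
definition similar where "similar p l m \<longleftrightarrow> eqt (compt l p) (compt p m)"
definition or_bool :: "bool \<Rightarrow> bool \<Rightarrow> bool" where "or_bool a b = (a \<or> b)"
lemma or_bool_eval: "or_bool True b = True" "or_bool False b = b" by (simp_all add: or_bool_def)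
definition normal where
  "normal p l = conj_bool (invertible p)
     (or_bool (similar p l ta) (or_bool (similar p l tb) (or_bool (similar p l tc) (similar p l te))))"
primrec normals where
  "normals l [] = False" | "normals l (v # vs) = or_bool (normal (chain v l) l) (normals l vs)"
primrec all_normal where
  "all_normal [] = True" | "all_normal (l # ls) = conj_bool (normals l gU) (all_normal ls)"
lemma preim_Nil: "preim y [] [] = G0" by simp
lemmas normal_eval = preim_Nil cover_eval conj_bool_eval or_bool_eval chain_def similar_def normal_def normals.simps all_normal.simps ta_def tb_def tc_def te_def
text \<open>\<open>[G0, G2, G4, G6]\<close> is the partial table with \<open>G1\<close> sent to
  \<open>G2\<close> and \<open>G2\<close> to \<open>G4\<close>. The two missing values run through
  everything that avoids the eigenvalues 0 and 1, and every v is tried as a cyclic vector.\<close>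

lemma all_normal_tables: "all_normal (extend_all [zero_tab, gU] (extend [zero_tab, gU] [G0, G2, G4, G6] gU))"
  by (simp only: normal_eval)

text \<open>The equation is (A^2 + A + 1)^2 = 0, which both \<open>te\<close> and \<open>td\<close>
  satisfy; \<open>type_d\<close> is the equation A^2 + A + 1 = 0 of \<open>td\<close>.\<close>

definition type_de where "type_de l = (eqt (compt (compt l l) (compt l l)) (addt (compt l l) gU))"
definition type_d where "type_d l = eqt (compt l l) (addt l gU)"
primrec tables_all where
  "tables_all refs [] = []" | "tables_all refs (y # ys) = tables_from refs y @ tables_all refs ys"
text \<open>Dividing a bad spread set by one of its members E gives a bad spread set again. So the
  restriction on types holds for A and for E^-1 A alike, and \<open>e\<close> is the table of
  E^-1.\<close>

primrec keep where
  "keep f e [] = []" | "keep f e (l # ls) = cons_if (conj_bool (f l) (f (compt e l))) l (keep f e ls)"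
lemmas start_eval = normal_eval type_de_def type_d_def keep.simps tables_all.simps shorter.simps pick_eval prune_eval search_eval groups.simps dlast_def
lemma search_te: "search dlast tdiffer [(),(),(),(),(),(),(),(),(),(),(),(),()] [te, gU]
   (groups [G3, G4, G5, G6, G7, G8, G9, G10, G11, G12, G13, G14, G15]
     (keep type_de (invt te) (tables_all [zero_tab, gU, te] [G3, G4, G5, G6, G7, G8, G9, G10, G11, G12, G13, G14, G15]))) = []"
  by (simp only: start_eval)
lemma search_td: "search dlast tdiffer [(),(),(),(),(),(),(),(),(),(),(),(),()] [td, gU]
   (groups [G3, G4, G5, G6, G7, G8, G9, G10, G11, G12, G13, G14, G15]
     (keep type_d (invt td) (tables_all [zero_tab, gU, td] [G3, G4, G5, G6, G7, G8, G9, G10, G11, G12, G13, G14, G15]))) = []"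
  by (simp only: start_eval td_def)

lemma lincomb_bij:
  fixes a b c d :: gf16
  assumes "a \<noteq> 0" "b \<notin> {0, a}" "c \<notin> {0, a, b, a + b}"
    "d \<notin> {0, a, b, a + b, c, a + c, b + c, a + b + c}"
  shows "bij (lincomb a b c d)"
proof (rule addmap_bij[OF addmap_lincomb_gf])
  fix x assume "lincomb a b c d x = 0"
  then show "x = 0" using assms by (cases x) (auto simp: lincomb_def zero_gf16_def[symmetric])
qed

lemma ex_outside: "\<exists>d :: gf16. d \<notin> {0, a, b, a + b, c, a + c, b + c, a + b + c}"
proof (rule ccontr)
  assume "\<not> ?thesis"
  then have "UNIV \<subseteq> set [0, a, b, a + b, c, a + c, b + c, a + b + c]" by auto
  then have "CARD(gf16) \<le> card (set [0, a, b, a + b, c, a + c, b + c, a + b + c])"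
    by (rule card_mono[OF finite_set])
  also have "\<dots> \<le> 8" by (rule order_trans[OF card_length]) simp
  finally show False by (simp add: card_gf16)
qed

lemma similar_tab: "similar (tab P) (tab A) (tab M) \<longleftrightarrow> A \<circ> P = P \<circ> M"
  by (simp add: similar_def eqt_def compt_tab tab_eq_iff)

lemma target_tabs:
  "ta = tab (lincomb G2 G4 G8 G3)" "tb = tab (lincomb G2 G4 G8 G9)" "tc = tab (lincomb G2 G4 G8 G15)"
  "te = tab (lincomb G2 G4 G8 G5)" "td = tab (lincomb G2 G3 G8 G12)"
  by (simp_all add: ta_def tb_def tc_def td_def te_def addtab_tab)

section \<open>Conjugacy to the normal forms\<close>

definition conjugate :: "gmap \<Rightarrow> gmap \<Rightarrow> bool" where
  "conjugate A M \<longleftrightarrow> (\<exists>P. addmap P \<and> bij P \<and> A \<circ> P = P \<circ> M)"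

lemma conjugate_trans:
  assumes "conjugate A M" "conjugate M N" shows "conjugate A N"
proof -
  obtain P where P: "addmap P" "bij P" "A \<circ> P = P \<circ> M" using assms(1) by (auto simp: conjugate_def)
  obtain Q where Q: "addmap Q" "bij Q" "M \<circ> Q = Q \<circ> N" using assms(2) by (auto simp: conjugate_def)
  have "A \<circ> (P \<circ> Q) = P \<circ> (M \<circ> Q)" unfolding o_assoc P(3) ..
  also have "\<dots> = (P \<circ> Q) \<circ> N" unfolding Q(3) o_assoc ..
  finally show ?thesis
    unfolding conjugate_def using addmap_comp[OF P(1) Q(1)] bij_comp[OF Q(2) P(2)] by blast
qed

definition targets :: "gmap set" where
  "targets = {M. tab M \<in> {ta, tb, tc, te}}"

lemma normal_sound:
  assumes "normal (addtab a b c d) (tab A)" shows "\<exists>M \<in> targets. conjugate A M"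
proof -
  let ?P = "lincomb a b c d"
  have n: "invertible (tab ?P)" "\<exists>t \<in> {ta, tb, tc, te}. similar (tab ?P) (tab A) t"
    using assms by (auto simp: normal_def conj_bool_def or_bool_def addtab_tab)
  then obtain M where M: "tab M \<in> {ta, tb, tc, te}" "similar (tab ?P) (tab A) (tab M)"
    unfolding target_tabs by auto
  have "conjugate A M"
    unfolding conjugate_def
    using addmap_lincomb_gf[of a b c d] invertible_bij[OF n(1)] M(2)[unfolded similar_tab] by blast
  then show ?thesis using M(1) by (auto simp: targets_def)
qed

lemma normals_sound: "normals (tab A) vs \<Longrightarrow> \<exists>M \<in> targets. conjugate A M"
proof (induction vs)
  case (Cons v vs)
  then show ?case using normal_sound[of _ _ _ _ A]
    by (cases "normal (chain v (tab A)) (tab A)") (auto simp: or_bool_def chain_def)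
qed simp

lemma all_normal_mem: "all_normal ls \<Longrightarrow> l \<in> set ls \<Longrightarrow> normals l gU"
  by (induction ls) (auto simp: conj_bool_def)

lemma tables_from2_mem:
  assumes "addmap A" "list_all (tdiffer (tab A)) refs"
  shows "tab A \<in> set (extend_all refs (extend refs (ext (ext [G0] (A G1)) (A G2)) gU))"
proof -
  define l2 where "l2 = ext (ext [G0] (A G1)) (A G2)"
  define l3 where "l3 = ext l2 (A G4)"
  have "A = lincomb (A G1) (A G2) (A G4) (A G8)"
    by (rule HOL.ext) (rule addmap_eq_lincomb[OF assms(1)])
  then have "tab A = addtab (A G1) (A G2) (A G4) (A G8)"
    unfolding addtab_tab by (rule arg_cong)
  then have A: "tab A = ext l3 (A G8)"
    by (simp only: addtab_def l2_def l3_def)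
  have ne: "l2 \<noteq> []" "l3 \<noteq> []" by (simp_all add: l2_def l3_def ext_ne)
  have d4: "list_all (tdiffer (ext l3 (A G8))) refs" using assms(2) A by simp
  have d3: "list_all (tdiffer (ext l2 (A G4))) refs"
    using d4 tdiffer_ext[OF ne(2)] unfolding l3_def by (auto simp: list_all_iff)
  have "l3 \<in> set (extend refs l2 gU)" unfolding l3_def by (rule extend_mem[OF gU_mem d3])
  then show ?thesis unfolding A l2_def[symmetric] using d4 by (rule extend_all_mem)
qed

text \<open>The vectors v, A v, A^2 v are independent, since A fixes no nonzero vector and
  \<open>ex\<close> excludes the remaining relation. In a basis that starts with them A has a table
  covered by \<open>all_normal_tables\<close>.\<close>

lemma fixed_point_free_normal:
  assumes A: "addmap A" "\<And>x. x \<noteq> 0 \<Longrightarrow> A x \<noteq> 0 \<and> A x \<noteq> x" and ex: "A (A v) \<noteq> A v + v"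
  shows "\<exists>M \<in> targets. conjugate A M"
proof -
  have v: "v \<noteq> 0" using ex by (auto simp: addmap_0[OF A(1)])
  have b: "A v \<notin> {0, v}" using A(2)[OF v] by simp
  have "A (A v) \<noteq> v"
  proof
    assume "A (A v) = v"
    then have "A (v + A v) = v + A v" by (simp add: addmapD[OF A(1)] add.commute)
    then have "v + A v = 0" using A(2) by blast
    then show False using b by simp
  qed
  then have c: "A (A v) \<notin> {0, v, A v, v + A v}"
    using A(2)[of "A v"] b ex by (auto simp: add.commute)
  obtain u where u: "u \<notin> {0, v, A v, v + A v, A (A v), v + A (A v), A v + A (A v), v + A v + A (A v)}"
    using ex_outside by blast
  let ?P = "lincomb v (A v) (A (A v)) u"
  have P: "addmap ?P" "bij ?P" by (rule addmap_lincomb_gf, rule lincomb_bij[OF v b c u])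
  let ?A = "inv ?P \<circ> A \<circ> ?P"
  have PA: "?P (inv ?P x) = x" "inv ?P (?P x) = x" for x
    using P(2) by (simp_all add: bij_is_surj surj_f_inv_f bij_is_inj)
  have con: "conjugate A ?A"
    unfolding conjugate_def using P by (intro exI[of _ ?P]) (simp add: fun_eq_iff PA)
  have aA: "addmap ?A" using addmap_comp[OF addmap_comp[OF addmap_inv[OF P] A(1)] P(1)] .
  have "?A G1 = inv ?P (?P G2)" "?A G2 = inv ?P (?P G4)" by (simp_all add: lincomb_basis)
  then have A12: "?A G1 = G2" "?A G2 = G4" by (simp_all only: PA)
  have "?A x \<noteq> 0 \<and> ?A x \<noteq> x" if "x \<noteq> 0" for x
  proof -
    have "?P x \<noteq> 0" using that PA(2)[of x] PA(2)[of 0] addmap_0[OF P(1)] by metis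
    from A(2)[OF this] show ?thesis
      using PA(1)[of "A (?P x)"] addmap_0[OF P(1)] by (metis comp_apply)
  qed
  then have "list_all (tdiffer (tab ?A)) [zero_tab, gU]"
    by (simp add: tab_zmap tab_id(2)[symmetric] tdiffer_tab del: tab_id)
  from tables_from2_mem[OF aA this]
  have "tab ?A \<in> set (extend_all [zero_tab, gU] (extend [zero_tab, gU] [G0, G2, G4, G6] gU))"
    by (simp only: A12 ext_def shiftl.simps gadd_tab append.simps)
  from all_normal_mem[OF all_normal_tables this] obtain M where "M \<in> targets" "conjugate ?A M"
    using normals_sound by blast
  then show ?thesis using conjugate_trans[OF con] by blast
qed

section \<open>Bad spread sets that contain a normal form\<close>

lemma bad_conjugate:
  assumes "bad S" "A \<in> S" "conjugate A M"
  shows "\<exists>S'. bad S' \<and> M \<in> S'"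
proof -
  obtain P where P: "addmap P" "bij P" "A \<circ> P = P \<circ> M" using assms(3) by (auto simp: conjugate_def)
  let ?S = "(\<lambda>A. inv P \<circ> A \<circ> P) ` S"
  have c: "inv P \<circ> P = id" by (rule inv_o_cancel[OF bij_is_inj[OF P(2)]])
  have "inv P \<circ> A \<circ> P = inv P \<circ> (P \<circ> M)" unfolding o_assoc[symmetric] P(3) ..
  also have "\<dots> = M" unfolding o_assoc c by simp
  finally have M: "M \<in> ?S" using assms(2) by (auto intro: rev_image_eqI)
  have "id \<in> ?S" by (rule image_eqI[OF _ badD(3)[OF assms(1)]]) (simp add: c)
  then have "bad ?S"
    by (rule bad_frame[OF assms(1) frame_lin[OF badD(4)[OF assms(1)] P(1,2)
          addmap_inv[OF P(1,2)] bij_imp_bij_inv[OF P(2)]]])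
  then show ?thesis using M by blast
qed

lemma bad_pool:
  assumes "bad S" "pool S r" "gU \<in> set r" "tab_w \<in> set r"
  shows "\<exists>S'. badw S'"
proof -
  obtain S' where S': "frame S S'" "set r \<subseteq> tab ` (S' - {zmap})"
    using assms(2) by (auto simp: pool_def)
  have "id \<in> S'" using S'(2) assms(3) unfolding tab_id(2)[symmetric] by (auto simp: tab_eq_iff)
  moreover have "wm \<in> S'" using S'(2) assms(4) unfolding tab_wm by (auto simp: tab_eq_iff)
  ultimately show ?thesis
    using bad_frame[OF assms(1) S'(1)] by (auto simp: badw_def)
qed

lemma bad_initial_pool:
  assumes "bad S" "M \<in> S" "M \<noteq> zmap"
  shows "pool S [gU, tab M]"
proof (rule poolI[OF badD(4)[OF assms(1)]])
  have "id \<noteq> zmap" by (rule bij_neq_zmap[OF bij_id])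
  then show "set [gU, tab M] \<subseteq> tab ` (S - {zmap})"
    using assms(2,3) badD(3)[OF assms(1)] by (simp add: tab_id(2)[symmetric] image_iff tab_eq_iff del: tab_id)
qed

text \<open>The inverse of a root of x^4+x^3+1 is a root of x^4+x+1, and the shift by 1 takes a root
  of x^4+x^3+x^2+x+1 to one of x^4+x^3+1. The final conjugation turns the map so obtained into
  w.\<close>

lemma irreducible_targets:
  assumes "bad S" "M \<in> S" "tab M \<in> {ta, tb, tc}"
  shows "\<exists>S'. badw S'"
proof -
  have nz: "M \<noteq> zmap" using assms(3)
    by (auto simp: ta_def tb_def tc_def addtab_tab tab_eq_iff fun_eq_iff all_gf16 lincomb_def zero_gf16_def)
  note p = bad_initial_pool[OF assms(1,2) nz]
  consider "tab M = ta" | "tab M = tb" | "tab M = tc" using assms(3) by blast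
  then show ?thesis
  proof cases
    case 1
    show ?thesis by (rule bad_pool[OF assms(1) p]) (simp_all add: 1 ta_def tab_w_def)
  next
    case 2
    have "apply_ops [Iv, Cj G8 G4 G2 G1] [gU, tb] = [gU, tab_w]"
      by (simp only: tb_def phases_evals)
    then show ?thesis using bad_pool[OF assms(1) pool_ops[OF p, of "[Iv, Cj G8 G4 G2 G1]"]] 2 by simp
  next
    case 3
    have "apply_ops [Tr G1, Iv, Cj G8 G12 G10 G15] [gU, tc] = [gU, tab_w]"
      by (simp only: tc_def phases_evals)
    then show ?thesis
      using bad_pool[OF assms(1) pool_ops[OF p, of "[Tr G1, Iv, Cj G8 G12 G10 G15]"]] 3 by simp
  qed
qed

lemma bad_fixed_point_free:
  assumes "bad S" "A \<in> S" "A \<notin> {zmap, id}" "x \<noteq> 0" shows "A x \<noteq> 0 \<and> A x \<noteq> x"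
  using osp_differ[OF badD(1)[OF assms(1)] assms(2) badD(2)[OF assms(1)], of x]
    osp_differ[OF badD(1)[OF assms(1)] assms(2) badD(3)[OF assms(1)], of x] assms(3,4) by auto

text \<open>The irreducible normal forms would lead to a spread set with w, against
  \<open>no_badw\<close>.\<close>

lemma bad_normal:
  assumes S: "bad S" "A \<in> S" "A \<notin> {zmap, id}" and ne: "A (A v) \<noteq> A v + v"
  shows "conjugate A (lincomb G2 G4 G8 G5)"
proof -
  obtain M where M: "M \<in> targets" "conjugate A M"
    using fixed_point_free_normal[OF osp_addmap[OF badD(1)[OF S(1)] S(2)] bad_fixed_point_free[OF S] ne]
    by blast
  obtain S' where "bad S'" "M \<in> S'" using bad_conjugate[OF S(1,2) M(2)] by blast
  then have "tab M \<notin> {ta, tb, tc}" using irreducible_targets no_badw by blast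
  then have "tab M = te" using M(1) by (auto simp: targets_def)
  then show ?thesis using M(2) by (simp add: target_tabs tab_eq_iff)
qed

lemma type_de_tab: "type_de (tab A) \<longleftrightarrow> (\<forall>x. A (A (A (A x))) = A (A x) + x)"
  unfolding type_de_def eqt_def tab_id(1)[symmetric] compt_tab addt_tab tab_eq_iff by (simp add: fun_eq_iff)

lemma type_d_tab: "type_d (tab A) \<longleftrightarrow> (\<forall>x. A (A x) = A x + x)"
  unfolding type_d_def eqt_def tab_id(1)[symmetric] compt_tab addt_tab tab_eq_iff by (simp add: fun_eq_iff)

lemma bad_type_de:
  assumes S: "bad S" "A \<in> S" "A \<notin> {zmap, id}"
  shows "type_de (tab A)"
proof (cases "\<forall>x. A (A x) = A x + x")
  case True
  show ?thesis unfolding type_de_tab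
  proof
    fix x
    have "A (A (A (A x))) = A (A (A x)) + A (A x)" "A (A (A x)) = A (A x) + A x" "A (A x) = A x + x"
      by (rule spec[OF True])+
    then show "A (A (A (A x))) = A (A x) + x" by (metis add.commute gf16_add_cancel)
  qed
next
  case False
  let ?E = "lincomb G2 G4 G8 G5"
  obtain P where P: "addmap P" "bij P" "A \<circ> P = P \<circ> ?E"
    using bad_normal[OF S] False unfolding conjugate_def by blast
  have AP: "A (P y) = P (?E y)" for y using P(3) by (simp add: fun_eq_iff)
  have "type_de te" by (simp only: start_eval)
  then have E: "?E (?E (?E (?E x))) = ?E (?E x) + x" for x by (simp add: target_tabs type_de_tab)
  show ?thesis unfolding type_de_tab
  proof
    fix x
    obtain y where "x = P y" using P(2) by (metis bij_pointE)
    then show "A (A (A (A x))) = A (A x) + x" by (simp add: AP E addmapD[OF P(1)])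
  qed
qed

lemma tables_all_mem:
  assumes "addmap A" "list_all (tdiffer (tab A)) refs" "A G1 \<in> set ys"
  shows "tab A \<in> set (tables_all refs ys)"
  using assms(3) tables_from_mem[OF assms(1,2)] by (induction ys) auto

lemma keep_mem: "l \<in> set (keep f e ls) \<longleftrightarrow> l \<in> set ls \<and> f l \<and> f (compt e l)"
  by (induction ls) (auto simp: cons_if_def conj_bool_def)

lemma start_sound:
  assumes S: "bad S" "E \<in> S" "E G1 = G2"
    and f: "\<And>S A. bad S \<Longrightarrow> A \<in> S \<Longrightarrow> A \<notin> {zmap, id} \<Longrightarrow> f (tab A)"
    and s: "search dlast tdiffer [(),(),(),(),(),(),(),(),(),(),(),(),()] [tab E, gU]
      (groups [G3, G4, G5, G6, G7, G8, G9, G10, G11, G12, G13, G14, G15]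
        (keep f (invt (tab E)) (tables_all [zero_tab, gU, tab E]
          [G3, G4, G5, G6, G7, G8, G9, G10, G11, G12, G13, G14, G15]))) = []"
  shows False
proof -
  have o: "osp S" by (rule badD(1)[OF S(1)])
  define t where "t y = tab (elem S y)" for y
  have e: "elem S G0 = zmap" "elem S G1 = id" "elem S G2 = E"
    by (rule elem_eq[OF o]; use badD[OF S(1)] S in \<open>simp add: zero_gf16_def\<close>)+
  have Ez: "E \<notin> {zmap, id}" using S(3) by (auto simp: zero_gf16_def)
  have bE: "bij E" using osp_bij[OF o S(2) badD(2)[OF S(1)]] Ez by simp
  let ?SE = "(\<lambda>A. inv E \<circ> A \<circ> id) ` S"
  have "id \<in> ?SE"
    by (rule image_eqI[OF _ S(2)]) (simp add: inv_o_cancel[OF bij_is_inj[OF bE]])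
  then have bSE: "bad ?SE"
    by (rule bad_frame[OF S(1) frame_lin[OF badD(4)[OF S(1)] addmap_id(2) bij_id
          addmap_inv[OF osp_addmap[OF o S(2)] bE] bij_imp_bij_inv[OF bE]]])
  let ?ys = "[G3, G4, G5, G6, G7, G8, G9, G10, G11, G12, G13, G14, G15]"
  let ?gs = "groups ?ys (keep f (invt (tab E)) (tables_all [zero_tab, gU, tab E] ?ys))"
  let ?ls = "[G2, G1]"
  have fs: "map fst ?gs = ?ys" by (rule groups_fst)
  then have fs': "fst ` set ?gs = set ?ys" by (metis list.set_map)
  have "\<exists>ls'. set ls' = fst ` set ?gs \<union> set ?ls \<and>
      map t ls' \<in> set (search dlast tdiffer [(),(),(),(),(),(),(),(),(),(),(),(),()] (map t ?ls) ?gs)"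
  proof (rule search_sound[where L = UNIV])
    fix ls and i j :: gf16 assume "distinct (i # j # ls)"
    then have "elem S i \<noteq> elem S j" using elem_neq[OF o] by simp
    then show "tdiffer (dlast (map t ls) (t i)) (t j)"
      using osp_differ[OF o elem(1)[OF o] elem(1)[OF o]] by (auto simp: dlast_def t_def tdiffer_tab)
  next
    show "length [(),(),(),(),(),(),(),(),(),(),(),(),()] = length ?gs" by simp
    show "distinct (map fst ?gs @ ?ls)" unfolding fs by simp
    fix i g assume ig: "(i, g) \<in> set ?gs"
    have i: "i \<in> set ?ys" using imageI[OF ig, of fst] unfolding fs' fst_conv .
    let ?A = "elem S i"
    have A: "?A \<in> S" "?A G1 = i" using elem[OF o] by auto
    have nA: "?A \<notin> {zmap, id, E}"
      using i A(2) S(3) by (auto simp: zero_gf16_def)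
    have d: "tdiffer (tab ?A) (tab B)" if "B \<in> S" "B \<in> {zmap, id, E}" for B
      unfolding tdiffer_tab using osp_differ[OF o A(1) that(1)] nA that(2) by blast
    have dl: "list_all (tdiffer (tab ?A)) [zero_tab, gU, tab E]"
      using d[OF badD(2)[OF S(1)]] d[OF badD(3)[OF S(1)]] d[OF S(2)] by (simp add: tab_zmap tab_id)
    have m: "tab ?A \<in> set (tables_all [zero_tab, gU, tab E] ?ys)"
      by (rule tables_all_mem[OF osp_addmap[OF o A(1)] dl]) (use i A(2) in simp)
    have f1: "f (tab ?A)" using f[OF S(1) A(1)] nA by blast
    have "inv E \<circ> ?A \<circ> id \<in> ?SE" using A(1) by blast
    moreover have "inv E \<circ> ?A \<circ> id \<notin> {zmap, id}"
    proof -
      have EE: "E \<circ> (inv E \<circ> ?A \<circ> id) = ?A" using surj_f_inv_f[OF bij_is_surj[OF bE]] by (simp add: fun_eq_iff)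
      have "E \<circ> zmap = zmap" by (simp add: comp_def addmap_0[OF osp_addmap[OF o S(2)]])
      then show ?thesis using EE nA by auto
    qed
    ultimately have "f (tab (inv E \<circ> ?A \<circ> id))" by (rule f[OF bSE])
    then have f2: "f (compt (invt (tab E)) (tab ?A))" by (simp add: invt_tab[OF bE] compt_tab)
    have "look G1 (tab ?A) = i" using A(2) by simp
    then show "t i \<in> set g"
      unfolding groups_mem[OF ig] grp_def t_def using m f1 f2 by (simp add: keep_mem del: keep.simps tables_all.simps)
  qed simp_all
  moreover have m: "map t ?ls = [tab E, gU]" by (simp add: t_def e tab_id)
  have "search dlast tdiffer [(),(),(),(),(),(),(),(),(),(),(),(),()] (map t ?ls) ?gs = []"
    unfolding m by (rule s)
  ultimately show False by (simp only: list.set empty_iff simp_thms)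
qed

lemma bad_type_d:
  assumes S: "bad S" "A \<in> S" "A \<notin> {zmap, id}"
  shows "type_d (tab A)"
proof (rule ccontr)
  assume "\<not> type_d (tab A)"
  then obtain v where v: "A (A v) \<noteq> A v + v" unfolding type_d_tab by blast
  obtain S' where S': "bad S'" "lincomb G2 G4 G8 G5 \<in> S'"
    using bad_conjugate[OF S(1,2) bad_normal[OF S v]] by blast
  show False
    by (rule start_sound[OF S' lincomb_basis(1), of type_de])
      (use bad_type_de search_te in \<open>simp_all add: target_tabs\<close>)
qed

text \<open>What remains is A^2 = A + 1 for every member besides 0 and 1. Such an A makes the space
  a plane over GF(4), with basis \<open>G1\<close> and u, and is therefore conjugate to
  \<open>td\<close>.\<close>

lemma not_bad: "\<not> bad S"
proof
  assume S: "bad S"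
  have o: "osp S" by (rule badD(1)[OF S])
  let ?A = "elem S G2"
  have A: "?A \<in> S" "?A G1 = G2" using elem[OF o] by auto
  have nA: "?A \<notin> {zmap, id}" using A(2) by (auto simp: zero_gf16_def)
  have d: "?A (?A x) = ?A x + x" for x
    using bad_type_d[OF S A(1) nA] by (simp add: type_d_tab)
  have aA: "addmap ?A" by (rule osp_addmap[OF o A(1)])
  note fp = bad_fixed_point_free[OF S A(1) nA]
  have v: "G1 \<noteq> 0" by (simp add: zero_gf16_def)
  have b: "?A G1 \<notin> {0, G1}" using fp[OF v] by simp
  \<comment> \<open>With c = 0 in \<open>ex_outside\<close> the vector u only has to avoid the span
    of \<open>G1\<close> and its image.\<close>
  obtain u where u: "u \<notin> {0, G1, ?A G1, G1 + ?A G1, 0, G1 + 0, ?A G1 + 0, G1 + ?A G1 + 0}"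
    using ex_outside by blast
  then have c: "u \<notin> {0, G1, ?A G1, G1 + ?A G1}" by blast
  have "?A u \<notin> {0, G1, ?A G1, G1 + ?A G1, u, G1 + u, ?A G1 + u, G1 + ?A G1 + u}"
  proof
    assume as: "?A u \<in> {0, G1, ?A G1, G1 + ?A G1, u, G1 + u, ?A G1 + u, G1 + ?A G1 + u}"
    have u0: "u \<noteq> 0" using c by simp
    have e: "u = ?A (?A u) + ?A u" using d[of u] by (metis add.commute gf16_add_cancel2)
    have "?A u \<in> {0, G1, ?A G1, G1 + ?A G1} \<union> (\<lambda>y. y + u) ` {0, G1, ?A G1, G1 + ?A G1}"
      unfolding image_insert image_empty add_0 using as by blast
    then consider "?A u \<in> {0, G1, ?A G1, G1 + ?A G1}" | y where "y \<in> {0, G1, ?A G1, G1 + ?A G1}" "?A u = y + u"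
      by blast
    then show False
    proof cases
      case 1
      then have "?A (?A u) \<in> {0, G1, ?A G1, G1 + ?A G1}"
        using d[of G1] by (auto simp: addmapD[OF aA] addmap_0[OF aA] add.commute)
      then have "?A (?A u) + ?A u \<in> {0, G1, ?A G1, G1 + ?A G1}"
        using 1 by (auto simp: add.commute add.left_commute)
      then show False using e c by metis
    next
      case 2
      then have "?A (?A u) = ?A y + y + u" by (simp add: addmapD[OF aA] add.assoc)
      then have "?A y = u" using e 2(2) by (simp add: add.assoc add.left_commute)
      moreover have "?A y \<in> {0, G1, ?A G1, G1 + ?A G1}"
        using 2(1) d[of G1] by (auto simp: addmapD[OF aA] addmap_0[OF aA] add.commute)
      ultimately show False using c by metis
    qed
  qed
  from lincomb_bij[OF v b c this] have bP: "bij (lincomb G1 (?A G1) u (?A u))" (is "bij ?P") .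
  have "?A \<circ> ?P = ?P \<circ> lincomb G2 G3 G8 G12"
  proof
    fix x
    have l: "addmap (?A \<circ> ?P)" "addmap (?P \<circ> lincomb G2 G3 G8 G12)"
      by (intro addmap_comp aA addmap_lincomb_gf)+
    have P3: "?P G3 = G1 + ?A G1" "?P G12 = u + ?A u" by (simp_all add: lincomb_def)
    show "(?A \<circ> ?P) x = (?P \<circ> lincomb G2 G3 G8 G12) x"
      unfolding addmap_eq_lincomb[OF l(1), of x] addmap_eq_lincomb[OF l(2), of x]
      by (simp add: lincomb_basis P3 d add.commute)
  qed
  then have "conjugate ?A (lincomb G2 G3 G8 G12)"
    unfolding conjugate_def using bP addmap_lincomb_gf by blast
  then obtain S' where S': "bad S'" "lincomb G2 G3 G8 G12 \<in> S'"
    using bad_conjugate[OF S A(1)] by blast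
  show False
    by (rule start_sound[OF S' lincomb_basis(1), of type_d])
      (use bad_type_d search_td in \<open>simp_all add: target_tabs\<close>)
qed

section \<open>The second components are multiplications\<close>

definition join where "join b ls = map (addt b) ls @ ls"
primrec subset_sums :: "gf16 list list \<Rightarrow> gf16 list list" where
  "subset_sums [] = [zero_tab]"
| "subset_sums (b # bs) = join b (subset_sums bs)"

definition commuting :: "gf16 list \<Rightarrow> gf16 list \<Rightarrow> bool" where
  "commuting l m \<longleftrightarrow> eqt (compt l m) (compt m l)"
text \<open>If \<open>b\<close> and \<open>x\<close> are the second components that belong to w and w^2, then the second components commute in
  the coordinates \<open>invT T\<close> and \<open>invT (shiftT id id T)\<close> as well; the tables are the multiplications by
  w^-2 and (w^2+1)^-1.\<close>

definition allowed where
  "allowed d m x = conj_bool (commuting d (compt x (addtab G13 G9 G1 G2)))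
     (commuting m (compt (addt x gU) (addtab G11 G5 G10 G7)))"
primrec excluded where
  "excluded b d m [] = True"
| "excluded b d m (x # xs) = (if allowed d m x then member x [zero_tab, gU, b] \<and> excluded b d m xs else excluded b d m xs)"
definition excluded_if where
  "excluded_if c b d m x xs = (if c then member x [zero_tab, gU, b] \<and> excluded b d m xs else excluded b d m xs)"
lemma excluded_eval: "excluded b d m [] = True"
  "excluded b d m (x # xs) = excluded_if (allowed d m x) b d m x xs"
  "excluded_if True b d m x xs = conj_bool (member x [zero_tab, gU, b]) (excluded b d m xs)"
  "excluded_if False b d m x xs = excluded b d m xs"
  by (simp_all add: excluded_if_def conj_bool_def)
definition powers where "powers b b2 = [gU, b, b2, compt b b2]"
text \<open>If b does not commute with w and generates a field of order 16, then the second
  component at w^2 is a sum of powers of b. The test shows that only 0, 1 and b satisfy the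
  commutation conditions, and these belong to the labels 0, 1 and w already.\<close>

definition check_pair where
  "check_pair b = or_bool (commuting b tab_w) (or_bool (type_d b)
     (excluded b (compt b (addtab G9 G1 G2 G4)) (compt (addt b gU) (addtab G14 G15 G13 G9))
       (subset_sums (powers b (compt b b)))))"
primrec check_pairs where
  "check_pairs [] = True" | "check_pairs (b # bs) = conj_bool (check_pair b) (check_pairs bs)"
lemmas pair_eval = start_eval join_def subset_sums.simps commuting_def allowed_def excluded_eval powers_def
  check_pair_def check_pairs.simps

lemma check_pairs1: "check_pairs (tables_all [zero_tab, gU, tab_w] [G3, G4, G5, G6, G7])"
  by (simp only: pair_eval)
lemma check_pairs2: "check_pairs (tables_all [zero_tab, gU, tab_w] [G8, G9, G10, G11])"
  by (simp only: pair_eval)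
lemma check_pairs3: "check_pairs (tables_all [zero_tab, gU, tab_w] [G12, G13, G14, G15])"
  by (simp only: pair_eval)

lemma check_pairs_mem: "check_pairs ls \<Longrightarrow> l \<in> set ls \<Longrightarrow> check_pair l"
  by (induction ls) (auto simp: conj_bool_def)

lemma check_pairs_all:
  assumes "addmap B" "list_all (tdiffer (tab B)) [zero_tab, gU, tab_w]" "B G1 \<notin> {G0, G1, G2}"
  shows "check_pair (tab B)"
proof -
  have "B G1 \<in> set [G3, G4, G5, G6, G7] \<or> B G1 \<in> set [G8, G9, G10, G11] \<or>
      B G1 \<in> set [G12, G13, G14, G15]"
    using assms(3) by (cases "B G1") auto
  then show ?thesis
    using tables_all_mem[OF assms(1,2)] check_pairs1 check_pairs2 check_pairs3 check_pairs_mem by metis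
qed

text \<open>The assumptions say that b lies outside of GF(4), so b generates the field.\<close>

lemma gf16_powers_basis:
  assumes "b \<notin> {0, 1}" "b * b \<noteq> b + 1"
  shows "bij (lincomb 1 b (b * b) (b * b * (b :: gf16)))"
proof (rule lincomb_bij)
  show "(1 :: gf16) \<noteq> 0" by simp
  show "b \<notin> {0, 1}" by fact
  show "b * b \<notin> {0, 1, b, 1 + b}"
    using assms by (cases b) (simp_all add: gf16_ops)
  show "b * b * b \<notin> {0, 1, b, 1 + b, b * b, 1 + b * b, b + b * b, 1 + b + b * b}"
    using assms by (cases b) (simp_all add: gf16_ops)
qed

lemma addmap_of_lincomb:
  assumes "addmap f" shows "f (lincomb a b c d e) = lincomb (f a) (f b) (f c) (f d) e"
  unfolding lincomb_def by (cases e) (simp_all add: addmapD[OF assms] addmap_0[OF assms])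

section \<open>Fields of additive maps\<close>

definition power_sum :: "gmap \<Rightarrow> gf16 \<Rightarrow> gmap" where
  "power_sum B e = (\<lambda>x. lincomb x (B x) (B (B x)) (B (B (B x))) e)"

definition field_family :: "gmap set \<Rightarrow> bool" where
  "field_family S \<longleftrightarrow> (\<exists>P :: gmap. addmap P \<and> bij P \<and> S = range (\<lambda>c x. inv P (c * P x)))"

text \<open>The identity is a member x \<mapsto> Q (c * P x), so Q is the inverse of P up to the
  factor c.\<close>

lemma desarg_field_family:
  assumes "osp S" "zmap \<in> S" "id \<in> S" "desarg S" shows "field_family S"
proof -
  obtain P Q :: gmap where PQ: "addmap P" "bij P" "addmap Q" "bij Q" "S = range (\<lambda>c x. Q (c * P x))"
    using desarg_family[OF assms(1,2,4)] .
  obtain c where c: "id = (\<lambda>x. Q (c * P x))" using assms(3) unfolding PQ(5) by blast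
  have Pi: "P (inv P x) = x" for x by (rule surj_f_inv_f[OF bij_is_surj[OF PQ(2)]])
  have Q: "Q (c * x) = inv P x" for x using fun_cong[OF c, of "inv P x"] by (simp add: Pi)
  have c0: "c \<noteq> 0"
  proof
    assume "c = 0"
    then have "id = zmap" using c addmap_0[OF PQ(3)] by simp
    then show False using bij_neq_zmap[OF bij_id] by simp
  qed
  have Q': "Q y = inv P (inverse c * y)" for y using Q[of "inverse c * y"] c0 by (simp add: mult.assoc[symmetric])
  have "S = range (\<lambda>d x. inv P (d * P x))"
  proof (rule set_eqI, rule iffI)
    fix A assume "A \<in> S"
    then obtain d where "A = (\<lambda>x. Q (d * P x))" unfolding PQ(5) by blast
    then have "A = (\<lambda>x. inv P ((inverse c * d) * P x))" by (simp add: Q' mult.assoc)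
    then show "A \<in> range (\<lambda>d x. inv P (d * P x))" by blast
  next
    fix A assume "A \<in> range (\<lambda>d x. inv P (d * P x))"
    then obtain d where "A = (\<lambda>x. inv P (d * P x))" by blast
    then have "A = (\<lambda>x. Q ((c * d) * P x))" using c0 by (simp add: Q' mult.assoc[symmetric])
    then show "A \<in> S" unfolding PQ(5) by blast
  qed
  then show ?thesis unfolding field_family_def using PQ(1,2) by blast
qed

lemma field_family_commute:
  assumes "field_family S" "A \<in> S" "B \<in> S" shows "A \<circ> B = B \<circ> A"
proof -
  obtain P :: gmap where P: "bij P" "S = range (\<lambda>c x. inv P (c * P x))"
    using assms(1) by (auto simp: field_family_def)
  obtain a b where "A = (\<lambda>x. inv P (a * P x))" "B = (\<lambda>x. inv P (b * P x))"
    using assms(2,3) unfolding P(2) by blast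
  then show ?thesis
    by (simp add: comp_def surj_f_inv_f[OF bij_is_surj[OF P(1)]] mult.left_commute)
qed

lemma field_family_powers:
  assumes "field_family S" "B \<in> S" "X \<in> S" "B \<notin> {zmap, id}" "\<not> type_d (tab B)"
  obtains e where "X = power_sum B e"
proof -
  obtain P :: gmap where P: "addmap P" "bij P" "S = range (\<lambda>c x. inv P (c * P x))"
    using assms(1) by (auto simp: field_family_def)
  have Pi: "P (inv P x) = x" "inv P (P x) = x" for x
    using P(2) by (simp_all add: surj_f_inv_f bij_is_surj bij_is_inj)
  have ai: "addmap (inv P)" by (rule addmap_inv[OF P(1,2)])
  obtain b c where bc: "B = (\<lambda>x. inv P (b * P x))" "X = (\<lambda>x. inv P (c * P x))"
    using assms(2,3) unfolding P(3) by blast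
  have "b \<noteq> 0" using assms(4) by (auto simp: bc(1) addmap_0[OF ai])
  moreover have "b \<noteq> 1" using assms(4) by (auto simp: bc(1) Pi fun_eq_iff)
  moreover have "b * b \<noteq> b + 1"
  proof
    assume bb: "b * b = b + 1"
    have "B (B x) = B x + x" for x
    proof -
      have "B (B x) = inv P ((b * b) * P x)" by (simp add: bc(1) Pi mult.assoc)
      also have "\<dots> = inv P (b * P x + P x)" by (simp add: bb distrib_right)
      also have "\<dots> = B x + x" by (simp add: addmapD[OF ai] bc(1) Pi)
      finally show ?thesis .
    qed
    then show False using assms(5) by (simp add: type_d_tab)
  qed
  ultimately have "bij (lincomb 1 b (b * b) (b * b * b))" by (intro gf16_powers_basis) auto
  then obtain e where e: "c = lincomb 1 b (b * b) (b * b * b) e" by (metis bij_pointE)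
  have "X x = power_sum B e x" for x
  proof -
    have a: "addmap (\<lambda>c. inv P (c * P x))" by (simp add: addmap_def distrib_right addmapD[OF ai])
    show ?thesis
      unfolding bc(2) e power_sum_def addmap_of_lincomb[OF a]
      by (simp add: bc(1) Pi mult.assoc)
  qed
  then have "X = power_sum B e" by (simp add: fun_eq_iff)
  then show ?thesis by (rule that)
qed

lemma power_sum_mem: "tab (power_sum B e) \<in> set (subset_sums (powers (tab B) (compt (tab B) (tab B))))"
proof -
  have p: "powers (tab B) (compt (tab B) (tab B)) =
      [tab (\<lambda>x. x), tab B, tab (\<lambda>x. B (B x)), tab (\<lambda>x. B (B (B x)))]"
    by (simp add: powers_def compt_tab comp_def tab_id)
  show ?thesis
    unfolding p power_sum_def lincomb_def
    by (cases e) (simp_all add: join_def tab_zmap addt_tab add.assoc del: tab_id)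
qed

lemma excluded_mem:
  "excluded b d m xs \<Longrightarrow> x \<in> set xs \<Longrightarrow> allowed d m x \<Longrightarrow> x \<in> {zero_tab, gU, b}"
  by (induction xs) (auto simp: member_iff simp del: member.simps split: if_splits)

lemma mult_tabs:
  "addtab G13 G9 G1 G2 = tab (inv ((*) G4))" "addtab G9 G1 G2 G4 = tab (inv wm)"
  "addtab G14 G15 G13 G9 = tab (inv ((*) G3))" "addtab G11 G5 G10 G7 = tab (inv ((*) G5))"
proof -
  have "inv ((*) G4) = (*) G13" "inv wm = (*) G9" "inv ((*) G3) = (*) G14" "inv ((*) G5) = (*) G11"
    by (subst inv_mult; simp add: gf16_ops)+
  then show "addtab G13 G9 G1 G2 = tab (inv ((*) G4))" "addtab G9 G1 G2 G4 = tab (inv wm)"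
    "addtab G14 G15 G13 G9 = tab (inv ((*) G3))" "addtab G11 G5 G10 G7 = tab (inv ((*) G5))"
    by (simp_all only: tables_eval tab_def list.map times_gf16_def gmul_tab)
qed

definition based :: "(gmap \<times> gmap) set \<Rightarrow> bool" where
  "based T \<longleftrightarrow> phyp T \<and> (zmap, zmap) \<in> T \<and> (id, id) \<in> T"

lemma basedD: "based T \<Longrightarrow> phyp T" "based T \<Longrightarrow> (zmap, zmap) \<in> T" "based T \<Longrightarrow> (id, id) \<in> T"
  by (simp_all add: based_def)

lemma osp_desarg: "osp S \<Longrightarrow> zmap \<in> S \<Longrightarrow> id \<in> S \<Longrightarrow> desarg S"
  using not_bad by (auto simp: bad_def)

text \<open>By \<open>swapT\<close> the second components are the first components of a set of the
  same kind, and such spread sets are Desarguesian by \<open>not_bad\<close>.\<close>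

lemma based_snd_family:
  assumes T: "based T" shows "field_family (snd ` T)"
proof -
  have s: "snd ` T = fst ` swapT T" by (force simp: swapT_def image_image)
  have o: "osp (snd ` T)" unfolding osp_def s using swapT[OF basedD(1)[OF T]] by blast
  have "zmap \<in> snd ` T" "id \<in> snd ` T"
    using basedD(2,3)[OF T] by (auto intro: rev_image_eqI)
  then show ?thesis using desarg_field_family[OF o] osp_desarg[OF o] by blast
qed

lemma based_snd_commute:
  assumes "based T" "(A, B) \<in> T" "(A', B') \<in> T" shows "B \<circ> B' = B' \<circ> B"
  using field_family_commute[OF based_snd_family[OF assms(1)]] assms(2,3) by (metis imageI snd_conv)

lemma based_inv:
  assumes "based T" shows "based (invT T)"
proof -
  have "id \<noteq> zmap" by (rule bij_neq_zmap[OF bij_id])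
  then have "(id, id) \<in> T - {(zmap, zmap)}" using basedD(3)[OF assms] by auto
  then have "(\<lambda>(A, B). (inv A, B \<circ> inv A)) (id, id) \<in> invT T" unfolding invT_def by blast
  then have "(id, id) \<in> invT T" by simp
  then show ?thesis
    using invT(2)[OF basedD(1,2)[OF assms]] by (simp add: based_def invT_def)
qed

lemma invT_mem: "(A, B) \<in> T \<Longrightarrow> A \<noteq> zmap \<Longrightarrow> (inv A, B \<circ> inv A) \<in> invT T"
  unfolding invT_def by (rule insertI2, rule image_eqI[of _ _ "(A, B)"]) auto

lemma based_shift:
  assumes "based T" shows "based (shiftT id id T)"
proof -
  have "(id, id) \<in> shiftT id id T"
    unfolding shiftT_def by (rule image_eqI[OF _ basedD(2)[OF assms]]) (simp add: fun_eq_iff)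
  moreover have "(zmap, zmap) \<in> shiftT id id T"
    unfolding shiftT_def by (rule image_eqI[OF _ basedD(3)[OF assms]]) simp
  ultimately show ?thesis
    using shiftT(2)[OF basedD(1)[OF assms] addmap_id(2) addmap_id(2)] by (simp add: based_def)
qed

lemma shiftT_mem: "(A, B) \<in> T \<Longrightarrow> (\<lambda>x. A x + x, \<lambda>x. B x + x) \<in> shiftT id id T"
  unfolding shiftT_def by (rule image_eqI[of _ _ "(A, B)"]) auto

lemma commuting_tab: "commuting (tab A) (tab B) \<longleftrightarrow> A \<circ> B = B \<circ> A"
  by (simp add: commuting_def eqt_def compt_tab tab_eq_iff)

lemma mult_shift: "(\<lambda>x. (*) c x + x) = (*) (c + 1 :: gf16)"
  by (simp add: fun_eq_iff distrib_right)

lemma mult_neq: "c \<noteq> d \<Longrightarrow> (*) c \<noteq> (*) (d :: gf16)"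
  by (metis mult.right_neutral)

lemma mult_zmap: "c \<noteq> 0 \<Longrightarrow> (*) (c :: gf16) \<noteq> zmap"
  by (metis mult.right_neutral)

lemma mult_id: "(*) (1 :: gf16) = id" "(*) (0 :: gf16) = zmap"
  by (simp_all add: fun_eq_iff)

lemma pair_commutes:
  assumes T: "based T" "(wm, B) \<in> T" "((*) G4, X) \<in> T"
    and nd: "\<not> type_d (tab B)"
  shows "B \<circ> wm = wm \<circ> B"
proof (rule ccontr)
  assume ne: "\<not> ?thesis"
  note p = basedD(1)[OF T(1)]
  have z: "G1 = 1" "G0 = 0" by (simp_all add: gf16_ops)
  have neq: "wm \<noteq> id" "wm \<noteq> zmap" "wm \<noteq> (*) G4" "(*) G4 \<noteq> id" "(*) G4 \<noteq> zmap"
    unfolding mult_id[symmetric] by (rule mult_neq, simp add: gf16_ops)+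
  have diff: "B' x \<noteq> B'' x" if "(A', B') \<in> T" "(A'', B'') \<in> T" "A' \<noteq> A''" "x \<noteq> 0" for A' B' A'' B'' x
    using phyp_differ2[OF p that(1,2)] that(3,4) by blast
  \<comment> \<open>Only tables that differ from w were checked. An equality would make the graphs
    of the identity pair at w x, of the zero pair at x + w x and of (w, B) at x dependent.\<close>
  have "B x \<noteq> wm x" if x: "x \<noteq> 0" for x
  proof
    assume e: "B x = wm x"
    have c: "wm x + (x + wm x) = x" by (simp add: add.left_commute)
    have "wm x = 0 \<and> x + wm x = 0"
    proof (rule phyp_triple[OF p basedD(3)[OF T(1)] basedD(2)[OF T(1)] T(2)])
      show "(id, id) \<noteq> (zmap, zmap)" using bij_neq_zmap[OF bij_id] by blast
      show "(id, id) \<noteq> (wm, B)" "(zmap, zmap) \<noteq> (wm, B)" using neq by auto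
    qed (simp_all only: c e id_apply add_0_right)
    then show False using x gnz by simp
  qed
  then have "list_all (tdiffer (tab B)) [zero_tab, gU, tab_w]"
    using diff[OF T(2) basedD(2)[OF T(1)] neq(2)] diff[OF T(2) basedD(3)[OF T(1)] neq(1)]
    by (simp add: tab_zmap tab_wm tab_id(2)[symmetric] tdiffer_tab del: tab_id)
  moreover have "B G1 \<notin> {G0, G1, G2}"
    using diff[OF T(2) basedD(2)[OF T(1)] neq(2), of 1] diff[OF T(2) basedD(3)[OF T(1)] neq(1), of 1]
      \<open>\<And>x. x \<noteq> 0 \<Longrightarrow> B x \<noteq> wm x\<close>[of 1] by (simp add: z)
  ultimately have "check_pair (tab B)" using check_pairs_all[OF phypD(4)[OF p T(2)]] by blast
  then have ex: "excluded (tab B) (compt (tab B) (addtab G9 G1 G2 G4))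
      (compt (addt (tab B) gU) (addtab G14 G15 G13 G9)) (subset_sums (powers (tab B) (compt (tab B) (tab B))))"
    using nd ne by (auto simp: check_pair_def or_bool_def tab_wm commuting_tab split: if_splits)
  have Bz: "B \<notin> {zmap, id}"
    using diff[OF T(2) basedD(2)[OF T(1)] neq(2), of 1] diff[OF T(2) basedD(3)[OF T(1)] neq(1), of 1] by auto
  obtain e where e: "X = power_sum B e"
    using field_family_powers[OF based_snd_family[OF T(1)] _ _ Bz nd] T(2,3) by (metis imageI snd_conv)
  let ?T1 = "invT T" and ?T2 = "invT (shiftT id id T)"
  have "(B \<circ> inv wm) \<circ> (X \<circ> inv ((*) G4)) = (X \<circ> inv ((*) G4)) \<circ> (B \<circ> inv wm)"
    by (rule based_snd_commute[OF based_inv[OF T(1)] invT_mem[OF T(2) neq(2)] invT_mem[OF T(3) neq(5)]])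
  moreover have "((\<lambda>x. B x + x) \<circ> inv ((*) G3)) \<circ> ((\<lambda>x. X x + x) \<circ> inv ((*) G5)) =
      ((\<lambda>x. X x + x) \<circ> inv ((*) G5)) \<circ> ((\<lambda>x. B x + x) \<circ> inv ((*) G3))"
  proof (rule based_snd_commute[OF based_inv[OF based_shift[OF T(1)]]])
    have "G2 + 1 = G3" "G4 + 1 = G5" by (simp_all add: gf16_ops)
    then have m: "((*) G3, \<lambda>x. B x + x) \<in> shiftT id id T" "((*) G5, \<lambda>x. X x + x) \<in> shiftT id id T"
      using shiftT_mem[OF T(2)] shiftT_mem[OF T(3)] unfolding mult_shift by simp_all
    show "(inv ((*) G3), (\<lambda>x. B x + x) \<circ> inv ((*) G3)) \<in> invT (shiftT id id T)"
      by (rule invT_mem[OF m(1) mult_zmap]) (simp add: gf16_ops)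
    show "(inv ((*) G5), (\<lambda>x. X x + x) \<circ> inv ((*) G5)) \<in> invT (shiftT id id T)"
      by (rule invT_mem[OF m(2) mult_zmap]) (simp add: gf16_ops)
  qed
  ultimately have "allowed (compt (tab B) (addtab G9 G1 G2 G4))
      (compt (addt (tab B) gU) (addtab G14 G15 G13 G9)) (tab X)"
    unfolding allowed_def mult_tabs tab_id(1)[symmetric] addt_tab compt_tab commuting_tab by (simp add: conj_bool_def)
  then have "tab X \<in> {zero_tab, gU, tab B}" using excluded_mem[OF ex power_sum_mem[of B e]] e by simp
  then have "X \<in> {zmap, id, B}" unfolding tab_zmap tab_id(2)[symmetric] by (simp add: tab_eq_iff)
  then show False
    using diff[OF T(3) basedD(2)[OF T(1)] neq(5), of 1] diff[OF T(3) basedD(3)[OF T(1)] neq(4), of 1]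
      diff[OF T(3,2) neq(3)[symmetric], of 1] by auto
qed

text \<open>Commuting with w determines B on the basis 1, w, w^2, w^3 from its value at 1.\<close>

lemma commute_wm_mult:
  assumes "addmap B" "B \<circ> wm = wm \<circ> B" shows "B = (*) (B 1)"
proof
  fix x
  have s: "B (G2 * y) = G2 * B y" for y using fun_cong[OF assms(2), of y] by simp
  have e: "G2 * G2 = G4" "G2 * G4 = G8" "G1 = 1" by (simp_all add: gf16_ops)
  have b2: "B G2 = G2 * B 1" using s[of 1] by simp
  have b4: "B G4 = G4 * B 1" using s[of G2] by (simp add: e b2 mult.assoc[symmetric])
  have b8: "B G8 = G8 * B 1" using s[of G4] by (simp add: e b4 mult.assoc[symmetric])
  have b: "B G1 = B 1 * G1" "B G2 = B 1 * G2" "B G4 = B 1 * G4" "B G8 = B 1 * G8"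
    using b2 b4 b8 by (simp_all add: e(3) mult.commute)
  show "B x = B 1 * x"
    unfolding addmap_eq_lincomb[OF assms(1), of x] addmap_eq_lincomb[OF addmap_mult[of "B 1"], of x] b ..
qed

definition gr :: "gmap \<Rightarrow> (gmap \<times> gmap) set" where
  "gr f = range (\<lambda>t. ((*) t, (*) (f t)))"

text \<open>Once B is a multiplication, all second components are, being sums of powers of
  B.\<close>

lemma based_mult_snd:
  assumes T: "based T" "fst ` T = range (*)" "(wm, B) \<in> T"
    and nd: "\<not> type_d (tab B)"
  shows "\<exists>f. T = gr f"
proof -
  note p = basedD(1)[OF T(1)]
  have ex: "\<exists>B. ((*) c, B) \<in> T" for c
  proof -
    have "(*) c \<in> fst ` T" unfolding T(2) by blast
    then show ?thesis by auto
  qed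
  obtain X where X: "((*) G4, X) \<in> T" using ex by blast
  have aB: "addmap B" by (rule phypD(4)[OF p T(3)])
  obtain s where s: "B = (*) s"
    using commute_wm_mult[OF aB pair_commutes[OF T(1,3) X nd]] by blast
  have "wm \<noteq> zmap" "wm \<noteq> id"
    unfolding mult_id[symmetric] by (rule mult_neq, simp add: gf16_ops)+
  then have "B x \<noteq> 0" "B x \<noteq> x" if "x \<noteq> 0" for x
    using phyp_differ2[OF p T(3) basedD(2)[OF T(1)], of x] phyp_differ2[OF p T(3) basedD(3)[OF T(1)], of x] that
    by auto
  then have Bz: "B \<notin> {zmap, id}" by (metis empty_iff id_apply insert_iff one_neq_zero)
  have m: "\<exists>u. Y = (*) u" if Y: "(A, Y) \<in> T" for A Y
  proof -
    obtain e where "Y = power_sum B e"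
      using field_family_powers[OF based_snd_family[OF T(1)] _ _ Bz nd] T(3) Y by (metis imageI snd_conv)
    then have "Y \<circ> wm = wm \<circ> Y"
      unfolding power_sum_def s lincomb_def
      by (cases e) (simp_all add: fun_eq_iff mult_ac distrib_left)
    then show ?thesis using commute_wm_mult[OF phypD(4)[OF p Y]] by blast
  qed
  have "\<exists>u. ((*) c, (*) u) \<in> T" for c using ex[of c] m by blast
  then obtain f where f: "\<And>c. ((*) c, (*) (f c)) \<in> T" by metis
  have "T = gr f"
  proof
    show "gr f \<subseteq> T" unfolding gr_def using f by blast
    show "T \<subseteq> gr f"
    proof
      fix q assume q: "q \<in> T"
      then have "fst q \<in> range (*)" using T(2) by blast
      then obtain c where c: "fst q = (*) c" by blast
      then have "q = ((*) c, (*) (f c))" using inj_onD[OF phyp_fst_inj[OF p] _ q f[of c]] by simp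
      then show "q \<in> gr f" unfolding gr_def by blast
    qed
  qed
  then show ?thesis by blast
qed

section \<open>The Frobenius map and the choice of a generating component\<close>

definition frob :: gmap where "frob x = x * x"

lemma frob: "addmap frob" "bij frob" "frob (x * y) = frob x * frob y"
proof -
  show "addmap frob" by (simp add: addmap_def frob_def distrib_left distrib_right mult.commute)
  then show "bij frob" by (rule addmap_bij) (simp add: frob_def)
qed (simp add: frob_def mult_ac)

lemma inv_frob: "frob (inv frob x) = x" "inv frob (frob x) = x"
  using frob(2) by (simp_all add: surj_f_inv_f bij_is_surj bij_is_inj)

text \<open>Conjugation by the Frobenius map turns multiplication by t^2 into multiplication by t,
  so a suitable component at w^2 or w^4 can be brought to w.\<close>

lemma frob_descent:
  assumes T: "based T" "fst ` T = range (*)" "((*) (t * t), B) \<in> T" and nd: "\<not> type_d (tab B)"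
  shows "\<exists>T' B'. based T' \<and> fst ` T' = range (*) \<and> geqv T T' \<and> ((*) t, B') \<in> T' \<and> \<not> type_d (tab B')"
proof (intro exI conjI)
  let ?T = "linT frob (inv frob) (inv frob) T" and ?B = "inv frob \<circ> B \<circ> frob"
  have ai: "addmap (inv frob)" "bij (inv frob)"
    using addmap_inv[OF frob(1,2)] bij_imp_bij_inv[OF frob(2)] by auto
  have m: "(inv frob \<circ> A \<circ> frob, inv frob \<circ> C \<circ> frob) \<in> ?T" if "(A, C) \<in> T" for A C
    unfolding linT_def by (rule image_eqI[OF _ that]) simp
  have c: "inv frob \<circ> (*) (u * u) \<circ> frob = (*) u" for u
    by (simp add: fun_eq_iff) (metis frob_def frob(3) inv_frob(2))
  have sq: "\<exists>u. c = u * u" for c :: gf16 using inv_frob(1)[of c] unfolding frob_def by metis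
  note l = linT[OF basedD(1)[OF T(1)] frob(1,2) ai ai]
  show "geqv T ?T" by (rule l)
  show "based ?T"
    unfolding based_def using l(2) m[OF basedD(2)[OF T(1)]] m[OF basedD(3)[OF T(1)]]
    by (simp add: comp_def addmap_0[OF ai(1)] inv_frob(2) id_def)
  have "fst ` ?T = (\<lambda>A. inv frob \<circ> A \<circ> frob) ` (fst ` T)"
    unfolding linT_def image_image by (rule image_cong) auto
  also have "\<dots> = range (*)"
  proof -
    have "(\<lambda>A. inv frob \<circ> A \<circ> frob) ` range (*) \<subseteq> range (*)"
    proof
      fix A assume "A \<in> (\<lambda>A. inv frob \<circ> A \<circ> frob) ` range (*)"
      then obtain d where d: "A = inv frob \<circ> (*) d \<circ> frob" by blast
      obtain u where "d = u * u" using sq by blast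
      then have "A = (*) u" using d c by simp
      then show "A \<in> range (*)" by blast
    qed
    moreover have "range (*) \<subseteq> (\<lambda>A. inv frob \<circ> A \<circ> frob) ` range (*)"
    proof
      fix A :: gmap assume "A \<in> range (*)"
      then obtain u where "A = (*) u" by blast
      then have "A = inv frob \<circ> (*) (u * u) \<circ> frob" using c by simp
      then show "A \<in> (\<lambda>A. inv frob \<circ> A \<circ> frob) ` range (*)" by blast
    qed
    ultimately show ?thesis unfolding T(2) by blast
  qed
  finally show "fst ` ?T = range (*)" .
  show "((*) t, ?B) \<in> ?T" using m[OF T(3)] unfolding c .
  show "\<not> type_d (tab ?B)"
  proof
    assume d: "type_d (tab ?B)"
    have "B (B x) = B x + x" for x
    proof -
      have "?B (?B (inv frob x)) = ?B (inv frob x) + inv frob x" using d by (simp only: type_d_tab)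
      then have "frob (inv frob (B (B x))) = frob (inv frob (B x) + inv frob x)" by (simp add: inv_frob)
      then show ?thesis by (simp add: inv_frob addmapD[OF frob(1)])
    qed
    then show False using nd by (simp add: type_d_tab)
  qed
qed

text \<open>In the field, x^2 = x + 1 has only the roots \<open>G6\<close> and
  \<open>G7\<close>.\<close>

lemma field_family_type_d:
  assumes "field_family S" "A \<in> S" "B \<in> S" "C \<in> S"
    "type_d (tab A)" "type_d (tab B)" "type_d (tab C)"
  shows "A = B \<or> A = C \<or> B = C"
proof -
  obtain P :: gmap where P: "addmap P" "bij P" "S = range (\<lambda>c x. inv P (c * P x))"
    using assms(1) by (auto simp: field_family_def)
  have Pi: "P (inv P x) = x" "inv P (P x) = x" for x
    using P(2) by (simp_all add: surj_f_inv_f bij_is_surj bij_is_inj)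
  have *: "\<exists>c \<in> {G6, G7}. D = (\<lambda>x. inv P (c * P x))" if D: "D \<in> S" "type_d (tab D)" for D
  proof -
    obtain c where c: "D = (\<lambda>x. inv P (c * P x))" using D(1) unfolding P(3) by blast
    have "D (D x) = D x + x" for x using D(2) by (simp only: type_d_tab)
    from arg_cong[where f = P, OF this[of "inv P 1"]]
    have "c * c = c + 1" by (simp add: c Pi addmapD[OF P(1)])
    then have "c \<in> {G6, G7}" by (cases c) (simp_all add: gf16_ops)
    then show ?thesis using c by blast
  qed
  show ?thesis using *[OF assms(2,5)] *[OF assms(3,6)] *[OF assms(4,7)] by auto
qed

text \<open>The second components at w, w^2 and w^4 = \<open>G3\<close> are distinct, and at most
  two of them lie in the subfield GF(4). One of the three can therefore play the part of the
  generator B in \<open>based_mult_snd\<close>.\<close>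

lemma based_fst_mult:
  assumes T: "based T" "fst ` T = range (*)"
  shows "\<exists>f. based (gr f) \<and> geqv T (gr f)"
proof -
  note p = basedD(1)[OF T(1)]
  have ex: "\<exists>B. ((*) c, B) \<in> T" for c
  proof -
    have "(*) c \<in> fst ` T" unfolding T(2) by blast
    then show ?thesis by auto
  qed
  have ne: "B \<noteq> B'" if "((*) c, B) \<in> T" "((*) c', B') \<in> T" "c \<noteq> c'" for c c' B B'
    using phyp_differ2[OF p that(1,2), of 1] mult_neq[OF that(3)] by auto
  obtain B1 B2 B3 where B: "((*) G2, B1) \<in> T" "((*) G4, B2) \<in> T" "((*) G3, B3) \<in> T" using ex by metis
  have "B1 \<noteq> B2" "B1 \<noteq> B3" "B2 \<noteq> B3"
    using ne[OF B(1,2)] ne[OF B(1,3)] ne[OF B(2,3)] by auto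
  then consider "\<not> type_d (tab B1)" | "\<not> type_d (tab B2)" | "\<not> type_d (tab B3)"
    using field_family_type_d[OF based_snd_family[OF T(1)], of B1 B2 B3] B by (metis imageI snd_conv)
  then have "\<exists>T' B. based T' \<and> fst ` T' = range (*) \<and> geqv T T' \<and> (wm, B) \<in> T' \<and> \<not> type_d (tab B)"
  proof cases
    case 1
    then show ?thesis using T B(1) geqv_refl by blast
  next
    case 2
    have "G4 = G2 * G2" by (simp add: gf16_ops)
    then show ?thesis using frob_descent[OF T _ 2, of G2] B(2) by simp
  next
    case 3
    have "G3 = G4 * G4" "G4 = G2 * G2" by (simp_all add: gf16_ops)
    then obtain T1 B' where T1: "based T1" "fst ` T1 = range (*)" "geqv T T1" "((*) (G2 * G2), B') \<in> T1"
      "\<not> type_d (tab B')" using frob_descent[OF T _ 3, of G4] B(3) by auto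
    from frob_descent[OF T1(1,2,4,5)] show ?thesis using geqv_trans[OF T1(3)] by blast
  qed
  then obtain T' C where T': "based T'" "fst ` T' = range (*)" "geqv T T'" "(wm, C) \<in> T'" "\<not> type_d (tab C)"
    by blast
  obtain f where "T' = gr f" using based_mult_snd[OF T'(1,2,4,5)] by blast
  then show ?thesis using T'(1,3) by blast
qed

lemma based_geqv_gr:
  assumes T: "based T"
  shows "\<exists>f. based (gr f) \<and> geqv T (gr f)"
proof -
  note p = basedD(1)[OF T]
  have o: "osp (fst ` T)" unfolding osp_def using p by blast
  have z: "zmap \<in> fst ` T" "id \<in> fst ` T" using basedD(2,3)[OF T] by (auto intro: rev_image_eqI)
  obtain P Q :: gmap where PQ: "addmap P" "bij P" "addmap Q" "bij Q" "fst ` T = range (\<lambda>c x. Q (c * P x))"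
    using desarg_family[OF o z(1) osp_desarg[OF o z]] .
  have PQi: "P (inv P x) = x" "inv Q (Q x) = x" for x
    using PQ by (simp_all add: surj_f_inv_f bij_is_surj bij_is_inj)
  let ?T1 = "linT (inv P) (inv Q) id T"
  note l1 = linT[OF p addmap_inv[OF PQ(1,2)] bij_imp_bij_inv[OF PQ(2)] addmap_inv[OF PQ(3,4)]
      bij_imp_bij_inv[OF PQ(4)] addmap_id(2) bij_id]
  have "fst ` ?T1 = (\<lambda>A. inv Q \<circ> A \<circ> inv P) ` (fst ` T)"
    unfolding linT_def image_image by (rule image_cong) auto
  then have f1: "fst ` ?T1 = range (*)"
    unfolding PQ(5) image_image by (simp add: comp_def PQi)
  have z1: "(zmap, zmap) \<in> ?T1"
    unfolding linT_def
    by (rule image_eqI[OF _ basedD(2)[OF T]]) (simp add: comp_def addmap_0[OF addmap_inv[OF PQ(3,4)]])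
  have "id \<in> fst ` ?T1" unfolding f1 using mult_id(1) by (metis rangeI)
  then obtain B where B: "(id, B) \<in> ?T1" by auto
  have "id \<noteq> zmap" by (rule bij_neq_zmap[OF bij_id])
  then have bB: "bij B" using phyp_bij(2)[OF l1(2) z1] B by blast
  have aB: "addmap B" by (rule phypD(4)[OF l1(2) B])
  let ?T2 = "linT id id (inv B) ?T1"
  note l2 = linT[OF l1(2) addmap_id(2) bij_id addmap_id(2) bij_id addmap_inv[OF aB bB] bij_imp_bij_inv[OF bB]]
  have "fst ` ?T2 = fst ` ?T1" by (force simp: linT_def image_image)
  moreover have "(zmap, zmap) \<in> ?T2"
    unfolding linT_def[of id] by (rule image_eqI[OF _ z1]) (simp add: comp_def addmap_0[OF addmap_inv[OF aB bB]])
  moreover have "(id, id) \<in> ?T2"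
    unfolding linT_def[of id] by (rule image_eqI[OF _ B]) (simp add: inv_o_cancel[OF bij_is_inj[OF bB]])
  ultimately have "based ?T2" "fst ` ?T2 = range (*)" using l2(2) f1 by (auto simp: based_def)
  from based_fst_mult[OF this] show ?thesis
    using geqv_trans[OF l1(1) geqv_trans[OF l2(1)]] by blast
qed

section \<open>O-functions\<close>

type_synonym point = "gf16 \<times> gf16"

definition line_at :: "gf16 \<Rightarrow> gf16 \<Rightarrow> gf16 \<Rightarrow> point" where
  "line_at m t s = (m, gadd s (gmul m t))"

text \<open>The secants of a partial arc through the new point \<open>c\<close>, as pairs of slope and intercept. The horizontal
  line joins \<open>c\<close> to the point \<open>(0, 1, 0)\<close>, which belongs to every arc considered here.\<close>

primrec lines_at :: "point list \<Rightarrow> point \<Rightarrow> point list" where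
  "lines_at [] c = [(G0, snd c)]"
| "lines_at (p # ps) c =
    line_at (gmul (gadd (snd c) (snd p)) (ginv (gadd (fst c) (fst p)))) (fst c) (snd c) # lines_at ps c"

primrec off :: "point list \<Rightarrow> point \<Rightarrow> bool" where
  "off [] d = True"
| "off (l # ls) d \<longleftrightarrow> gadd (gmul (fst l) (fst d)) (snd l) \<noteq> snd d \<and> off ls d"
definition off_if where "off_if b ls d \<longleftrightarrow> \<not> b \<and> off ls d"
lemma off_eval: "off [] d = True" "off ((m, b) # ls) (t, s) = off_if (gadd (gmul m t) b = s) ls (t, s)"
  "off_if True ls d = False" "off_if False ls d = off ls d" by (simp_all add: off_if_def)

definition pgrp :: "gf16 \<Rightarrow> point list \<Rightarrow> point list" where
  "pgrp y ls = filter (\<lambda>p. fst p = y) ls"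
lemma pgrp_eval: "pgrp y [] = []" "pgrp y ((t, s) # ls) = cons_if (t = y) (t, s) (pgrp y ls)"
  by (simp_all add: pgrp_def cons_if_def)
primrec pgroups where
  "pgroups [] ls = []" | "pgroups (y # ys) ls = (y, pgrp y ls) # pgroups ys ls"

text \<open>The analogues of \<open>frame_op\<close> for the points \<open>(t, f t)\<close>: translation by and scaling to the point with
  first coordinate \<open>a\<close>, the inversion \<open>f' (1 / t) = f t / t\<close>, and the Frobenius map.\<close>

datatype oval_op = HTr gf16 | HInv | HSc gf16 | HFr

definition tr_pt :: "gf16 \<Rightarrow> gf16 \<Rightarrow> point \<Rightarrow> point" where "tr_pt a b p = (gadd (fst p) a, gadd (snd p) b)"
definition inv_pt :: "point \<Rightarrow> point" where "inv_pt p = (ginv (fst p), gmul (snd p) (ginv (fst p)))"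
definition sc_pt :: "gf16 \<Rightarrow> gf16 \<Rightarrow> point \<Rightarrow> point" where "sc_pt a b p = (gmul (fst p) a, gmul (snd p) b)"
definition fr_pt :: "point \<Rightarrow> point" where "fr_pt p = (gmul (fst p) (fst p), gmul (snd p) (snd p))"

primrec tr_all :: "point list \<Rightarrow> point list \<Rightarrow> point list" where
  "tr_all [] r = []" | "tr_all (p # ps) r = map (tr_pt (fst p) (snd p)) r"
primrec sc_all :: "point list \<Rightarrow> point list \<Rightarrow> point list" where
  "sc_all [] r = []" | "sc_all (p # ps) r = (if fst p = G0 then [] else map (sc_pt (ginv (fst p)) (ginv (snd p))) r)"
definition sc_if where "sc_if b a c r = (if b then [] else map (sc_pt a c) r)"
lemma sc_all_eval: "sc_all [] r = []" "sc_all ((a, b) # ps) r = sc_if (a = G0) (ginv a) (ginv b) r"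
  "sc_if True a c r = []" "sc_if False a c r = map (sc_pt a c) r" by (simp_all add: sc_if_def)

primrec move :: "oval_op \<Rightarrow> point list \<Rightarrow> point list" where
  "move (HTr a) r = tr_all (pgrp a r) r"
| "move HInv r = map inv_pt r"
| "move (HSc a) r = sc_all (pgrp a r) r"
| "move HFr r = map fr_pt r"
primrec moves where
  "moves [] r = r" | "moves (p # ps) r = moves ps (move p r)"

primrec pmem :: "gf16 \<Rightarrow> gf16 \<Rightarrow> point list \<Rightarrow> bool" where
  "pmem t s [] = False" | "pmem t s (p # ps) \<longleftrightarrow> (t = fst p \<and> s = snd p) \<or> pmem t s ps"
definition pmem_if where "pmem_if b s v t ps \<longleftrightarrow> (b \<and> s = v) \<or> pmem t s ps"
lemma pmem_eval: "pmem t s [] = False" "pmem t s ((u, v) # ps) = pmem_if (t = u) s v t ps"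
  "pmem_if True s v t ps = or_bool (s = v) (pmem t s ps)" "pmem_if False s v t ps = pmem t s ps"
  by (simp_all add: pmem_if_def or_bool_def)

primrec agrees :: "gf16 list \<Rightarrow> gf16 list \<Rightarrow> point list \<Rightarrow> bool" where
  "agrees [] l r = True" | "agrees (u # us) l r = conj_bool (pmem u (look u l) r) (agrees us l r)"

fun settle :: "(gf16 list \<times> oval_op list) list \<Rightarrow> point list list \<Rightarrow> bool" where
  "settle [] [] = True"
| "settle ((l, ps) # cs) (r # rs) \<longleftrightarrow> conj_bool (agrees gU l (moves ps r)) (settle cs rs)"
| "settle [] (r # rs) = False"
| "settle (c # cs) [] = False"

definition point_phase :: "point \<Rightarrow> point list list \<Rightarrow> point list list" where
  "point_phase c os = search lines_at off [(),(),(),(),(),(),(),(),(),(),(),(),()] [c, (G1, G1), (G0, G0)]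
     (pgroups (remove_lab (fst c) [G2, G3, G4, G5, G6, G7, G8, G9, G10, G11, G12, G13, G14, G15])
       (filter (off (lines_at [(G1, G1), (G0, G0)] c)) (concat os)))"

fun point_phases where
  "point_phases [] cs = True"
| "point_phases (q # os) (c # cs) \<longleftrightarrow> settle c (point_phase (hd q) (q # os)) \<and> point_phases os cs"
| "point_phases (q # os) [] = False"
lemma point_phases_eval: "point_phases [] cs = True"
  "point_phases ((x # q) # os) (c # cs) = conj_bool (settle c (point_phase x ((x # q) # os))) (point_phases os cs)"
  by (simp_all add: conj_bool_def)

text \<open>Some generator takes each point to a point that precedes it in the list, so every point
  can be traced back to the head. The generators t + 1, 1 / t and the Frobenius map are those
  changes that preserve f 0 = 0 and f 1 = 1.\<close>

primrec reach :: "point list \<Rightarrow> point list \<Rightarrow> bool" where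
  "reach ps [] = True"
| "reach ps (q # qs) = ((tr_pt G1 G1 q \<in> set ps \<or> inv_pt q \<in> set ps \<or> fr_pt q \<in> set ps) \<and> reach (q # ps) qs)"

text \<open>This is t^8, the inverse of squaring, and \<open>pointed_tab\<close> is t^2. Here (0, 1,
  0) is a point and (0, 0, 1) the nucleus, so the conic is z^2 = xy. The points (1, t, t^2), on the
  other hand, lie on a conic whose point (0, 0, 1) has been replaced by its nucleus (0, 1,
  0).\<close>

definition conic_tab :: "gf16 list" where
  "conic_tab = [G0, G1, G5, G4, G2, G3, G7, G6, G10, G11, G15, G14, G8, G9, G13, G12]"

definition pointed_tab :: "gf16 list" where
  "pointed_tab = [G0, G1, G4, G5, G3, G2, G7, G6, G12, G13, G8, G9, G15, G14, G11, G10]"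

text \<open>The values of t^12 + t^10 + w^11 t^8 + t^6 + w^2 t^4 + w^9 t^2, the o-polynomial of the
  Lunelli-Sce hyperoval.\<close>

definition lunelli_tab :: "gf16 list" where
  "lunelli_tab = [G0, G1, G5, G4, G6, G7, G2, G3, G11, G10, G12, G13, G9, G8, G15, G14]"

text \<open>The possible points (t, f t) besides those at 0 and 1, in orbits of the group of order
  24 generated by the maps in \<open>reach\<close>. As for spread sets, an orbit is dropped once its
  head has been settled.\<close>

definition point_orbits :: "(gf16 \<times> gf16) list list" where
  "point_orbits = [
    [(G6, G2), (G7, G3), (G7, G5), (G7, G14), (G6, G3), (G6, G4), (G6, G10), (G6, G13), (G6, G15), (G7, G2), (G7, G4), (G7, G9), (G7, G11), (G7, G12), (G7, G15), (G6, G5), (G6, G8), (G6, G11), (G6, G12), (G6, G14), (G7, G8), (G7, G10), (G7, G13), (G6, G9)],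
    [(G2, G10), (G3, G11), (G4, G14), (G5, G15), (G9, G5), (G11, G3), (G13, G10), (G14, G4), (G14, G8), (G15, G5), (G15, G9), (G2, G13), (G3, G12), (G4, G8), (G5, G9), (G8, G4), (G8, G14), (G9, G15), (G10, G2), (G10, G13), (G11, G12), (G12, G3), (G12, G11), (G13, G2)],
    [(G2, G4), (G3, G5), (G4, G3), (G5, G2), (G9, G2), (G11, G5), (G13, G4), (G14, G3), (G15, G2), (G8, G3), (G10, G4), (G12, G5)],
    [(G2, G6), (G3, G7), (G4, G6), (G5, G7), (G9, G3), (G11, G4), (G13, G8), (G14, G2), (G14, G12), (G15, G3), (G15, G13), (G2, G7), (G3, G6), (G4, G7), (G5, G6), (G8, G2), (G8, G11), (G9, G10), (G10, G5), (G10, G14), (G11, G15), (G12, G4), (G12, G9), (G13, G5)],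
    [(G2, G3), (G3, G2), (G4, G5), (G5, G4), (G9, G8), (G11, G10), (G13, G12), (G14, G15), (G15, G14), (G8, G9), (G10, G11), (G12, G13)],
    [(G2, G5), (G3, G4), (G4, G2), (G5, G3), (G9, G11), (G11, G14), (G13, G9), (G14, G13), (G15, G12), (G8, G10), (G10, G15), (G12, G8)],
    [(G2, G8), (G3, G9), (G4, G11), (G5, G10), (G9, G4), (G11, G2), (G13, G6), (G14, G5), (G14, G7), (G15, G4), (G15, G6), (G2, G14), (G3, G15), (G4, G12), (G5, G13), (G8, G5), (G8, G6), (G9, G7), (G10, G3), (G10, G7), (G11, G6), (G12, G2), (G12, G7), (G13, G3)],
    [(G2, G9), (G3, G8), (G4, G10), (G5, G11), (G9, G13), (G11, G9), (G13, G11), (G14, G9), (G14, G11), (G15, G8), (G15, G10), (G2, G15), (G3, G14), (G4, G13), (G5, G12), (G8, G12), (G8, G15), (G9, G14), (G10, G8), (G10, G12), (G11, G13), (G12, G10), (G12, G15), (G13, G14)],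
    [(G2, G11), (G3, G10), (G4, G15), (G5, G14), (G9, G12), (G11, G8), (G13, G7), (G14, G6), (G14, G10), (G15, G7), (G15, G11), (G2, G12), (G3, G13), (G4, G9), (G5, G8), (G8, G7), (G8, G13), (G9, G6), (G10, G6), (G10, G9), (G11, G7), (G12, G6), (G12, G14), (G13, G15)],
    [(G6, G7), (G7, G6)]]"

definition oval_certs :: "(gf16 list \<times> oval_op list) list list" where
  "oval_certs = [
    [(lunelli_tab, [HTr G11, HInv, HTr G2, HSc G11]),
     (lunelli_tab, [HTr G4, HInv, HSc G6]),
     (lunelli_tab, [HTr G5, HInv, HTr G3, HSc G13]),
     (lunelli_tab, [HFr, HTr G7, HInv, HSc G7]),
     (lunelli_tab, [HTr G5, HInv, HTr G5, HSc G12]),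
     (lunelli_tab, [HTr G14, HInv, HTr G1, HSc G13]),
     (lunelli_tab, [HTr G4, HInv, HTr G8, HSc G7]),
     (lunelli_tab, [HTr G6, HInv, HTr G3, HSc G8]),
     (lunelli_tab, [HInv, HTr G5, HSc G14]),
     (lunelli_tab, [HTr G3, HInv, HSc G13]),
     (lunelli_tab, [HTr G13, HInv, HTr G2, HSc G9]),
     (lunelli_tab, [HTr G7, HInv, HSc G9]),
     (lunelli_tab, [HInv, HTr G6, HSc G8]),
     (lunelli_tab, [HInv, HTr G1, HInv, HSc G14]),
     (lunelli_tab, [HTr G11, HInv, HTr G4, HSc G3]),
     (lunelli_tab, [HTr G10, HInv, HTr G13, HSc G3]),
     (lunelli_tab, [HInv, HSc G15]),
     (lunelli_tab, [HInv, HTr G5, HInv, HSc G10]),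
     (lunelli_tab, [HTr G6, HInv, HTr G2, HSc G6]),
     (lunelli_tab, [HTr G13, HSc G3]),
     (lunelli_tab, [HTr G1, HInv, HSc G8]),
     (lunelli_tab, [HInv, HTr G6, HSc G10]),
     (lunelli_tab, [HTr G11, HSc G4]),
     (lunelli_tab, [HTr G5, HInv, HTr G4, HSc G3]),
     (lunelli_tab, [HFr, HTr G13, HInv, HSc G13]),
     (lunelli_tab, [HTr G6, HInv, HTr G2, HSc G12]),
     (lunelli_tab, [HTr G2, HInv, HTr G3, HSc G15]),
     (lunelli_tab, [HTr G15, HInv, HSc G8]),
     (lunelli_tab, [HTr G13, HInv, HTr G1, HSc G13]),
     (lunelli_tab, [HTr G12, HInv, HTr G6, HSc G10]),
     (lunelli_tab, [HTr G4, HInv, HTr G9, HSc G3]),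
     (lunelli_tab, [HInv, HTr G9, HSc G2]),
     (lunelli_tab, [HTr G5, HInv, HTr G13, HSc G3]),
     (lunelli_tab, [HTr G12, HInv, HTr G3, HSc G4]),
     (lunelli_tab, [HFr, HTr G6, HInv, HSc G11]),
     (lunelli_tab, [HTr G5, HSc G9]),
     (lunelli_tab, [HFr, HTr G15, HInv, HSc G8]),
     (lunelli_tab, [HTr G6, HInv, HTr G2, HSc G15]),
     (lunelli_tab, [HInv, HFr, HTr G10, HInv, HSc G15]),
     (lunelli_tab, [HTr G13, HInv, HTr G1, HSc G7]),
     (lunelli_tab, [HTr G9, HInv, HTr G7, HSc G15]),
     (lunelli_tab, [HFr, HTr G8, HInv, HSc G14]),
     (lunelli_tab, [HTr G2, HInv, HTr G2, HSc G5]),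
     (lunelli_tab, [HFr, HTr G6, HInv, HSc G2]),
     (lunelli_tab, [HTr G3, HInv, HTr G6, HSc G13]),
     (lunelli_tab, [HTr G13, HInv, HTr G2, HSc G12]),
     (lunelli_tab, [HTr G8, HInv, HSc G2, HSc G9]),
     (lunelli_tab, [HFr, HTr G14, HInv, HSc G5]),
     (lunelli_tab, [HTr G2, HInv, HTr G6, HSc G8]),
     (lunelli_tab, [HTr G4, HInv, HTr G10, HSc G4]),
     (lunelli_tab, []),
     (lunelli_tab, [HFr, HTr G11, HInv, HSc G2]),
     (lunelli_tab, [HTr G1, HInv, HTr G6, HSc G13]),
     (lunelli_tab, [HTr G15, HInv, HTr G3, HSc G14]),
     (lunelli_tab, [HTr G8, HInv, HTr G2, HSc G5]),
     (lunelli_tab, [HTr G2, HInv, HTr G8, HSc G6]),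
     (lunelli_tab, [HTr G3, HInv, HTr G12, HSc G3]),
     (lunelli_tab, [HTr G12, HInv, HSc G12]),
     (lunelli_tab, [HTr G8, HInv, HTr G5, HSc G12]),
     (lunelli_tab, [HTr G14, HInv, HTr G6, HSc G11]),
     (lunelli_tab, [HFr, HTr G5, HInv, HSc G12]),
     (lunelli_tab, [HTr G12, HInv, HSc G7]),
     (lunelli_tab, [HTr G1, HInv, HTr G10, HInv]),
     (lunelli_tab, [HInv, HTr G8, HSc G7]),
     (lunelli_tab, [HInv, HTr G7, HInv, HSc G3]),
     (lunelli_tab, [HTr G8, HInv, HTr G3, HSc G13]),
     (lunelli_tab, [HTr G7, HInv, HTr G3, HSc G4]),
     (lunelli_tab, [HTr G6, HInv, HTr G1, HSc G12]),
     (lunelli_tab, [HTr G9, HInv, HTr G6, HSc G14]),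
     (lunelli_tab, [HTr G12, HInv, HTr G8, HSc G7]),
     (lunelli_tab, [HInv, HTr G3, HInv, HTr G6, HSc G11]),
     (lunelli_tab, [HTr G9, HInv, HTr G13, HSc G3]),
     (lunelli_tab, [HInv, HTr G10, HInv, HTr G4, HSc G15]),
     (lunelli_tab, [HTr G4, HInv, HSc G4]),
     (lunelli_tab, [HTr G1, HInv, HTr G8, HSc G5]),
     (lunelli_tab, [HTr G8, HInv, HTr G3, HSc G8]),
     (lunelli_tab, [HFr, HTr G5, HInv, HSc G8]),
     (lunelli_tab, [HTr G14, HInv, HTr G7, HSc G8]),
     (lunelli_tab, [HTr G6]),
     (lunelli_tab, [HTr G5, HInv, HTr G9, HSc G4]),
     (lunelli_tab, [HTr G5, HInv, HTr G2, HSc G12]),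
     (lunelli_tab, [HTr G2, HInv, HTr G10, HSc G6]),
     (lunelli_tab, [HTr G3, HInv, HSc G15]),
     (lunelli_tab, [HTr G9, HInv, HTr G4, HSc G10]),
     (lunelli_tab, [HTr G4, HInv, HTr G7, HSc G12]),
     (lunelli_tab, [HInv, HTr G8, HInv, HSc G9]),
     (lunelli_tab, [HTr G11, HInv, HTr G4, HSc G2]),
     (lunelli_tab, [HTr G14, HInv, HTr G13, HSc G3]),
     (lunelli_tab, [HTr G4, HInv, HTr G4, HSc G13]),
     (lunelli_tab, [HFr, HTr G8, HInv, HSc G4]),
     (lunelli_tab, [HFr, HTr G15, HInv, HSc G2]),
     (lunelli_tab, [HTr G8, HInv, HTr G6, HSc G11]),
     (lunelli_tab, [HTr G12, HInv, HTr G8, HSc G6]),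
     (lunelli_tab, [HTr G14, HInv, HTr G1, HSc G12]),
     (lunelli_tab, [HTr G14, HInv, HTr G4, HSc G3]),
     (lunelli_tab, [HInv, HTr G2, HSc G8]),
     (lunelli_tab, [HTr G12, HInv, HTr G5, HSc G2]),
     (lunelli_tab, [HTr G4, HInv, HSc G9]),
     (lunelli_tab, [HTr G1, HSc G9]),
     (lunelli_tab, [HInv, HTr G13, HInv, HTr G9, HSc G3]),
     (lunelli_tab, [HInv, HTr G9, HInv, HTr G11, HSc G4]),
     (lunelli_tab, [HInv, HFr, HTr G15, HInv, HSc G12]),
     (lunelli_tab, [HTr G11, HInv, HTr G10, HSc G5]),
     (lunelli_tab, [HTr G7, HInv, HTr G13, HSc G2]),
     (lunelli_tab, [HFr, HTr G6, HInv, HSc G5]),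
     (lunelli_tab, [HTr G1, HInv, HTr G2, HSc G7]),
     (lunelli_tab, [HTr G6, HInv, HTr G2, HSc G11]),
     (lunelli_tab, [HTr G6, HSc G14]),
     (lunelli_tab, [HInv, HTr G1, HInv, HSc G5]),
     (lunelli_tab, [HFr, HTr G10, HInv, HSc G10]),
     (lunelli_tab, [HInv, HTr G4, HSc G12]),
     (lunelli_tab, [HFr, HSc G8]),
     (lunelli_tab, [HInv, HTr G1, HInv, HSc G4]),
     (lunelli_tab, [HFr, HTr G14, HInv, HSc G7]),
     (lunelli_tab, [HTr G5, HInv, HTr G2, HSc G14]),
     (lunelli_tab, [HTr G6, HInv, HTr G10, HSc G4]),
     (lunelli_tab, [HTr G14, HInv, HTr G9, HSc G5]),
     (lunelli_tab, [HFr, HTr G10, HInv, HSc G15]),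
     (lunelli_tab, [HTr G15, HInv, HTr G6, HSc G11]),
     (lunelli_tab, [HTr G14, HInv, HTr G10, HSc G4]),
     (lunelli_tab, [HInv, HTr G9, HInv, HSc G7]),
     (lunelli_tab, [HInv, HTr G14, HInv, HTr G10, HSc G5]),
     (lunelli_tab, [HTr G1, HInv, HTr G6, HSc G9]),
     (lunelli_tab, [HInv, HSc G12]),
     (lunelli_tab, [HTr G1, HInv, HTr G3, HSc G7]),
     (lunelli_tab, [HTr G15, HInv, HTr G9, HSc G3]),
     (lunelli_tab, [HTr G8, HInv, HTr G8, HSc G5]),
     (lunelli_tab, [HTr G10, HInv, HTr G5, HSc G8]),
     (lunelli_tab, [HFr, HSc G3]),
     (lunelli_tab, [HInv, HTr G2, HInv, HSc G5]),
     (lunelli_tab, [HTr G9, HInv, HTr G1, HSc G8]),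
     (lunelli_tab, [HTr G1, HInv, HTr G3, HSc G9]),
     (lunelli_tab, [HTr G9, HInv, HTr G6, HSc G11]),
     (lunelli_tab, [HTr G10, HInv, HSc G9]),
     (lunelli_tab, [HInv, HTr G13, HInv, HSc G2]),
     (lunelli_tab, [HInv, HTr G8, HInv, HSc G5]),
     (lunelli_tab, [HTr G10, HInv, HTr G2, HSc G15]),
     (lunelli_tab, [HInv, HTr G11, HInv, HSc G3]),
     (lunelli_tab, [HTr G11, HInv, HSc G5]),
     (lunelli_tab, [HTr G8, HInv, HTr G13, HSc G3]),
     (lunelli_tab, [HTr G10, HInv, HTr G9, HSc G6]),
     (lunelli_tab, [HTr G7, HInv, HTr G7, HSc G8]),
     (lunelli_tab, [HTr G2, HInv, HTr G1, HSc G12]),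
     (lunelli_tab, [HTr G5, HInv, HTr G9, HSc G6]),
     (lunelli_tab, [HTr G10, HInv, HTr G7, HSc G9]),
     (lunelli_tab, [HInv, HTr G9, HSc G7]),
     (lunelli_tab, [HTr G11, HInv, HTr G6, HSc G8]),
     (lunelli_tab, [HTr G11, HInv, HSc G8]),
     (pointed_tab, [HTr G11, HInv, HSc G2]),
     (lunelli_tab, [HInv, HTr G15, HInv, HSc G4]),
     (lunelli_tab, [HTr G7, HInv, HTr G3, HSc G15]),
     (lunelli_tab, [HTr G9, HInv, HTr G5, HSc G8]),
     (lunelli_tab, [HTr G10, HInv, HTr G1, HSc G5]),
     (lunelli_tab, [HTr G13, HInv, HTr G8, HSc G2]),
     (lunelli_tab, [HTr G10, HSc G5]),
     (lunelli_tab, [HTr G9, HInv, HTr G1, HSc G5]),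
     (lunelli_tab, [HTr G15, HInv, HTr G13, HSc G3]),
     (lunelli_tab, [HFr, HTr G7, HInv, HSc G10]),
     (lunelli_tab, [HInv, HTr G11, HInv, HSc G4]),
     (lunelli_tab, [HFr, HTr G5, HInv, HSc G5]),
     (lunelli_tab, [HTr G15, HInv, HTr G12, HSc G2])],
    [(pointed_tab, [HTr G6, HInv])],
    [(pointed_tab, [])],
    [],
    [],
    [(conic_tab, [])],
    [],
    [],
    [],
    []]"

lemmas oval_eval = pair_eval remove_lab_eval prod.inject fst_conv snd_conv gmul_tab ginv.simps line_at_def lines_at.simps off_eval pgrp_eval pgroups.simps
  tr_pt_def inv_pt_def sc_pt_def fr_pt_def tr_all.simps sc_all_eval move.simps moves.simps pmem_eval agrees.simps settle.simps
  point_phase_def point_phases_eval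

lemma oval_phases: "point_phases point_orbits oval_certs"
  by (simp only: point_orbits_def oval_certs_def conic_tab_def pointed_tab_def lunelli_tab_def oval_eval)

lemma orbits_reach: "\<forall>q \<in> set point_orbits. q \<noteq> [] \<and> reach [hd q] (tl q)"
  by (simp add: point_orbits_def tr_pt_def inv_pt_def fr_pt_def gadd_tab gmul_tab)

lemma orbits_cover: "t \<notin> {G0, G1} \<Longrightarrow> s \<notin> {G0, G1} \<Longrightarrow> t \<noteq> s \<Longrightarrow> (t, s) \<in> set (concat point_orbits)"
  by (cases t; cases s) (simp_all add: point_orbits_def)

section \<open>Equivalences of o-functions\<close>

definition ofun :: "gmap \<Rightarrow> bool" where
  "ofun f \<longleftrightarrow> phyp (gr f) \<and> f 0 = 0"

definition oeq :: "gmap \<Rightarrow> gmap \<Rightarrow> bool" where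
  "oeq f g \<longleftrightarrow> geqv (gr f) (gr g)"

lemma oeq_trans: "oeq f g \<Longrightarrow> oeq g h \<Longrightarrow> oeq f h"
  unfolding oeq_def by (rule geqv_trans)

lemma gr_mem: "((*) t, (*) (f t)) \<in> gr f"
  by (simp add: gr_def)

lemma mult_eq: "(*) c = (*) d \<longleftrightarrow> c = (d :: gf16)"
  using mult_neq by blast

lemma ofun_zero: "ofun f \<Longrightarrow> (zmap, zmap) \<in> gr f"
  using gr_mem[of 0 f] by (simp add: ofun_def mult_id)

lemma ofun_inj:
  assumes "phyp (gr f)" "f t = f u" shows "t = u"
proof (rule ccontr)
  assume "t \<noteq> u"
  then have "(1 :: gf16) = 0"
    using phyp_differ2[OF assms(1) gr_mem[of t] gr_mem[of u], of 1] assms(2) by (simp add: mult_eq)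
  then show False by simp
qed

text \<open>An equality would make v + u and v + t the coefficients of a dependence between the
  three graphs. The inequality says that the determinant of the points (1, t, f t), (1, u, f u), (1,
  v, f v) is not zero.\<close>

lemma ofun_triple:
  assumes "phyp (gr f)" "t \<noteq> u" "t \<noteq> v" "u \<noteq> v"
  shows "f t * (v + u) + f u * (v + t) \<noteq> f v * (t + u)"
proof
  assume e: "f t * (v + u) + f u * (v + t) = f v * (t + u)"
  have s: "(v + u) + (v + t) = t + u" by (simp add: add.assoc add.left_commute)
  have "v + u = 0 \<and> v + t = 0"
  proof (rule phyp_triple[OF assms(1) gr_mem[of t] gr_mem[of u] gr_mem[of v]])
    show "t * (v + u) + u * (v + t) = v * ((v + u) + (v + t))"
      unfolding s by (simp add: algebra_simps)
    show "f t * (v + u) + f u * (v + t) = f v * ((v + u) + (v + t))" unfolding s by (rule e)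
  qed (use assms in \<open>simp_all add: mult_eq\<close>)
  then show False using assms(4) by simp
qed

lemma oval_tr:
  fixes a :: gf16
  assumes "ofun f" defines "f' \<equiv> \<lambda>t. f (t + a) + f a"
  shows "ofun f' \<and> oeq f f'"
proof -
  have m: "(\<lambda>x. c * x + d * x) = (*) (c + d)" for c d :: gf16
    by (simp add: fun_eq_iff distrib_right)
  have "shiftT ((*) a) ((*) (f a)) (gr f) = range (\<lambda>t. ((*) (t + a), (*) (f t + f a)))"
    by (simp only: shiftT_def gr_def image_image split_conv m)
  also have "\<dots> = gr f'"
  proof (rule set_eqI, rule iffI)
    fix p assume "p \<in> range (\<lambda>t. ((*) (t + a), (*) (f t + f a)))"
    then obtain t where "p = ((*) (t + a), (*) (f t + f a))" by blast
    then have "p = ((*) (t + a), (*) (f' (t + a)))" by (simp add: f'_def)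
    then show "p \<in> gr f'" unfolding gr_def by blast
  next
    fix p assume "p \<in> gr f'"
    then obtain t where "p = ((*) t, (*) (f' t))" unfolding gr_def by blast
    then have "p = ((*) ((t + a) + a), (*) (f (t + a) + f a))" by (simp add: f'_def)
    then show "p \<in> range (\<lambda>t. ((*) (t + a), (*) (f t + f a)))" by blast
  qed
  finally show ?thesis
    using shiftT[OF _ addmap_mult addmap_mult, of "gr f" a "f a"] assms(1)
    by (simp add: ofun_def oeq_def f'_def)
qed

lemma oval_inv:
  assumes "ofun f" defines "f' \<equiv> \<lambda>t. t * f (inverse t)"
  shows "ofun f' \<and> oeq f f'"
proof -
  have f0: "f 0 = 0" and p: "phyp (gr f)" using assms(1) by (simp_all add: ofun_def)
  have z: "((*) t, (*) (f t)) = (zmap, zmap) \<longleftrightarrow> t = 0" for t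
    using mult_eq[of t 0] f0 by (auto simp: mult_id)
  have c: "(*) b \<circ> (*) a = (*) (a * b)" for a b :: gf16 by (simp add: fun_eq_iff mult_ac)
  have e: "(inv ((*) t), (*) (f t) \<circ> inv ((*) t)) = ((*) (inverse t), (*) (f' (inverse t)))" if "t \<noteq> 0" for t
    using that by (simp add: inv_mult c f'_def)
  have "invT (gr f) = gr f'"
  proof (rule set_eqI, rule iffI)
    fix p assume "p \<in> invT (gr f)"
    then consider "p = (zmap, zmap)" | t where "t \<noteq> 0" "p = (inv ((*) t), (*) (f t) \<circ> inv ((*) t))"
      unfolding invT_def gr_def using z by auto
    then show "p \<in> gr f'"
    proof cases
      case 1
      have "((*) 0, (*) (f' 0)) = (zmap, zmap)" by (simp add: f'_def mult_id)
      then show ?thesis using 1 gr_mem[of 0 f'] by metis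
    next
      case 2
      then show ?thesis using e[OF 2(1)] gr_mem by metis
    qed
  next
    fix p assume "p \<in> gr f'"
    then obtain t where t: "p = ((*) t, (*) (f' t))" unfolding gr_def by blast
    show "p \<in> invT (gr f)"
    proof (cases "t = 0")
      case True
      then show ?thesis using t by (simp add: f'_def mult_id invT_def)
    next
      case False
      then have "p = (inv ((*) (inverse t)), (*) (f (inverse t)) \<circ> inv ((*) (inverse t)))"
        using e[of "inverse t"] t False by (metis inverse_inverse_eq nonzero_imp_inverse_nonzero)
      moreover have "(*) (inverse t) \<noteq> zmap" using False mult_zmap by simp
      ultimately show ?thesis using invT_mem[OF gr_mem] by metis
    qed
  qed
  then show ?thesis
    using invT[OF p ofun_zero[OF assms(1)]] by (simp add: ofun_def oeq_def f'_def)
qed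

lemma oval_lin:
  assumes f: "ofun f" and PQ: "addmap P" "bij P" "addmap Q" "bij Q" "addmap R" "bij R"
    and e: "\<And>t. Q \<circ> (*) t \<circ> P = (*) (h t)" "\<And>t. R \<circ> (*) (f t) \<circ> P = (*) (f' (h t))"
    and h: "surj h" "f' 0 = 0"
  shows "ofun f' \<and> oeq f f'"
proof -
  have "linT P Q R (gr f) = range (\<lambda>t. ((*) (h t), (*) (f' (h t))))"
    by (simp only: linT_def gr_def image_image split_conv e)
  also have "\<dots> = (\<lambda>t. ((*) t, (*) (f' t))) ` range h" by (simp add: image_image)
  also have "\<dots> = gr f'" unfolding h gr_def ..
  finally show ?thesis
    using linT[OF _ PQ, of "gr f"] f h(2) by (simp add: ofun_def oeq_def)
qed

lemma oval_sc:
  assumes "ofun f" "c \<noteq> 0" defines "f' \<equiv> \<lambda>t. f (c * t) * inverse (f c)"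
  shows "ofun f' \<and> oeq f f'"
proof -
  have f0: "f 0 = 0" and p: "phyp (gr f)" using assms(1) by (simp_all add: ofun_def)
  have fc: "f c \<noteq> 0" using ofun_inj[OF p, of c 0] assms(2) f0 by auto
  have b: "bij ((*) (inverse c))" "bij ((*) (inverse (f c)))" using assms(2) fc by (simp_all add: bij_mult)
  show ?thesis
  proof (rule oval_lin[OF assms(1) addmap_id(2) bij_id addmap_mult b(1) addmap_mult b(2)])
    show "(*) (inverse c) \<circ> (*) t \<circ> id = (*) (inverse c * t)" for t by (simp add: fun_eq_iff mult.assoc)
    show "(*) (inverse (f c)) \<circ> (*) (f t) \<circ> id = (*) (f' (inverse c * t))" for t
    proof -
      have "c * (inverse c * t) = t" using assms(2) by (simp add: mult.assoc[symmetric])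
      then have "f' (inverse c * t) = f t * inverse (f c)" by (simp only: f'_def)
      then show ?thesis by (simp add: fun_eq_iff mult_ac)
    qed
    show "surj ((*) (inverse c))" using b(1) by (rule bij_is_surj)
  qed (simp add: f'_def f0)
qed

lemma oval_fr:
  assumes "ofun f" defines "f' \<equiv> \<lambda>t. frob (f (inv frob t))"
  shows "ofun f' \<and> oeq f f'"
proof (rule oval_lin[OF assms(1) addmap_inv[OF frob(1,2)] bij_imp_bij_inv[OF frob(2)] frob(1,2) frob(1,2)])
  show "frob \<circ> (*) t \<circ> inv frob = (*) (frob t)" for t by (simp add: fun_eq_iff frob(3) inv_frob)
  show "frob \<circ> (*) (f t) \<circ> inv frob = (*) (f' (frob t))" for t
    by (simp add: fun_eq_iff frob(3) inv_frob f'_def)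
  show "surj frob" by (rule bij_is_surj[OF frob(2)])
  have "inv frob 0 = 0" by (rule addmap_0[OF addmap_inv[OF frob(1,2)]])
  then show "f' 0 = 0" using assms(1) by (simp add: f'_def ofun_def frob_def)
qed

definition through :: "gmap \<Rightarrow> point list \<Rightarrow> bool" where
  "through f r \<longleftrightarrow> (\<forall>p \<in> set r. f (fst p) = snd p)"

lemma pgrp_hd:
  assumes "pgrp a r = q # qs" shows "q \<in> set r" "fst q = a"
proof -
  have "q \<in> set (pgrp a r)" unfolding assms by simp
  then show "q \<in> set r" "fst q = a" by (auto simp: pgrp_def)
qed

text \<open>An operation that fails returns the empty list of points; then f itself serves as
  f'.\<close>

lemma through_move:
  assumes "ofun f" "through f r"
  shows "\<exists>f'. ofun f' \<and> oeq f f' \<and> through f' (move p r)"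
proof (cases p)
  case (HTr a)
  show ?thesis
  proof (cases "pgrp a r")
    case Nil
    then show ?thesis using assms HTr by (auto simp: through_def oeq_def geqv_refl)
  next
    case (Cons q qs)
    then have "q \<in> set r" "fst q = a" by (rule pgrp_hd)+
    then have "snd q = f a" using assms(2) by (auto simp: through_def)
    then have "through (\<lambda>t. f (t + a) + f a) (move p r)"
      using assms(2) HTr Cons \<open>fst q = a\<close>
      by (auto simp: through_def tr_pt_def plus_gf16_def[symmetric] add.assoc)
    then show ?thesis using oval_tr[OF assms(1), of a] by blast
  qed
next
  case HInv
  have "through (\<lambda>t. t * f (inverse t)) (move p r)"
    using assms HInv
    by (auto simp: through_def inv_pt_def ofun_def times_gf16_def[symmetric] inverse_gf16_def[symmetric])
  then show ?thesis using oval_inv[OF assms(1)] by blast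
next
  case (HSc a)
  show ?thesis
  proof (cases "pgrp a r")
    case Nil
    then show ?thesis using assms HSc by (auto simp: through_def oeq_def geqv_refl)
  next
    case (Cons q qs)
    then have q: "q \<in> set r" "fst q = a" by (rule pgrp_hd)+
    then have fa: "snd q = f a" using assms(2) by (auto simp: through_def)
    show ?thesis
    proof (cases "a = G0")
      case True
      then show ?thesis using assms HSc Cons q by (auto simp: through_def oeq_def geqv_refl)
    next
      case False
      then have a: "a \<noteq> 0" by (simp add: zero_gf16_def)
      have "through (\<lambda>t. f (a * t) * inverse (f a)) (move p r)"
        using assms(2) HSc Cons q fa False a
        by (auto simp: through_def sc_pt_def times_gf16_def[symmetric] inverse_gf16_def[symmetric] mult.left_commute)
      then show ?thesis using oval_sc[OF assms(1) a] by blast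
    qed
  qed
next
  case HFr
  have "through (\<lambda>t. frob (f (inv frob t))) (move p r)"
    using assms HFr
    by (auto simp: through_def fr_pt_def times_gf16_def[symmetric] frob_def[symmetric] inv_frob)
  then show ?thesis using oval_fr[OF assms(1)] by blast
qed

lemma through_moves:
  assumes "ofun f" "through f r"
  shows "\<exists>f'. ofun f' \<and> oeq f f' \<and> through f' (moves ps r)"
  using assms
proof (induction ps arbitrary: f r)
  case Nil
  then show ?case by (auto simp: oeq_def geqv_refl)
next
  case (Cons p ps)
  obtain f1 where "ofun f1" "oeq f f1" "through f1 (move p r)" using through_move[OF Cons.prems] by blast
  with Cons.IH[of f1 "move p r"] show ?case using oeq_trans by (auto intro: oeq_trans)
qed

lemma pmem_mem: "pmem t s r \<Longrightarrow> (t, s) \<in> set r"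
  by (induction r) auto

lemma agrees_mem: "agrees us l r \<Longrightarrow> u \<in> set us \<Longrightarrow> (u, look u l) \<in> set r"
  by (induction us) (auto simp: conj_bool_def pmem_mem)

lemma agrees_through:
  assumes "agrees gU l r" "through f r" shows "f = (\<lambda>t. look t l)"
proof
  fix t
  show "f t = look t l" using agrees_mem[OF assms(1) gU_mem, of t] assms(2) by (auto simp: through_def)
qed

section \<open>Soundness of the search for o-functions\<close>

definition standard :: "gmap set" where
  "standard = {\<lambda>t. look t conic_tab, \<lambda>t. look t pointed_tab, \<lambda>t. look t lunelli_tab}"

definition settled :: "gmap \<Rightarrow> bool" where
  "settled f \<longleftrightarrow> (\<exists>g \<in> standard. oeq f g)"

lemma settle_mem:
  "settle cs rs \<Longrightarrow> r \<in> set rs \<Longrightarrow> \<exists>(l, ps) \<in> set cs. agrees gU l (moves ps r)"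
  by (induction cs rs rule: settle.induct) (auto simp: conj_bool_def)

lemma settle_sound:
  assumes "settle cs rs" "r \<in> set rs" "ofun f" "through f r"
    and "\<And>l ps. (l, ps) \<in> set cs \<Longrightarrow> l \<in> {conic_tab, pointed_tab, lunelli_tab}"
  shows "settled f"
proof -
  obtain l ps where l: "(l, ps) \<in> set cs" "agrees gU l (moves ps r)"
    using settle_mem[OF assms(1,2)] by blast
  obtain f' where f': "oeq f f'" "through f' (moves ps r)" using through_moves[OF assms(3,4)] by blast
  have "f' = (\<lambda>t. look t l)" by (rule agrees_through[OF l(2) f'(2)])
  then have "f' \<in> standard" using assms(5)[OF l(1)] by (auto simp: standard_def)
  then show ?thesis using f'(1) by (auto simp: settled_def)
qed

text \<open>The normalization f 1 = 1 is required here and not in \<open>ofun\<close> because the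
  moves of a certificate may leave it and restore it only by scaling.\<close>

definition unsettled :: "gmap \<Rightarrow> bool" where
  "unsettled f \<longleftrightarrow> ofun f \<and> f 1 = 1 \<and> \<not> settled f"

lemma unsettled_oeq:
  assumes "unsettled f" "ofun f' \<and> oeq f f'" "f' 1 = 1" shows "unsettled f'"
  using assms oeq_trans by (auto simp: unsettled_def settled_def)

lemma unsettled_point:
  assumes "unsettled f"
  shows "\<exists>f'. unsettled f' \<and> f' (t + 1) = f t + 1"
    "\<exists>f'. unsettled f' \<and> f' (inverse t) = f t * inverse t"
    "\<exists>f'. unsettled f' \<and> f' (t * t) = f t * f t"
proof -
  have f: "ofun f" "f 0 = 0" "f 1 = 1" using assms by (auto simp: unsettled_def ofun_def)
  show "\<exists>f'. unsettled f' \<and> f' (t + 1) = f t + 1"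
    using unsettled_oeq[OF assms oval_tr[OF f(1), of 1]] f by (intro exI[of _ "\<lambda>t. f (t + 1) + f 1"]) (simp add: add.assoc)
  show "\<exists>f'. unsettled f' \<and> f' (inverse t) = f t * inverse t"
    using unsettled_oeq[OF assms oval_inv[OF f(1)]] f by (intro exI[of _ "\<lambda>t. t * f (inverse t)"]) simp
  have "inv frob 1 = 1" using inv_frob(2)[of 1] by (simp add: frob_def)
  then show "\<exists>f'. unsettled f' \<and> f' (t * t) = f t * f t"
    using unsettled_oeq[OF assms oval_fr[OF f(1)]] f inv_frob(2)[of t]
    by (intro exI[of _ "\<lambda>t. frob (f (inv frob t))"]) (simp add: frob_def)
qed

lemma reach_sound:
  assumes "reach ps qs" "q \<in> set ps \<union> set qs" "unsettled f" "f (fst q) = snd q"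
    and base: "\<And>p f. p \<in> set ps \<Longrightarrow> unsettled f \<Longrightarrow> f (fst p) = snd p \<Longrightarrow> thesis"
  shows thesis
  using assms
proof (induction qs arbitrary: ps q f)
  case Nil
  then show ?case by auto
next
  case (Cons p qs)
  have step: thesis if p: "unsettled f" "f (fst p) = snd p" for f
  proof -
    note u = unsettled_point[OF p(1), of "fst p", unfolded p(2)]
    consider "tr_pt G1 G1 p \<in> set ps" | "inv_pt p \<in> set ps" | "fr_pt p \<in> set ps"
      using Cons.prems(1) by auto
    then show thesis
    proof cases
      case 1
      then show thesis using u(1) Cons.prems(5)[OF 1]
        by (auto simp: tr_pt_def plus_gf16_def one_gf16_def)
    next
      case 2
      then show thesis using u(2) Cons.prems(5)[OF 2]
        by (auto simp: inv_pt_def times_gf16_def inverse_gf16_def)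
    next
      case 3
      then show thesis using u(3) Cons.prems(5)[OF 3]
        by (auto simp: fr_pt_def times_gf16_def)
    qed
  qed
  show ?case
  proof (rule Cons.IH[of "p # ps" q f])
    show "reach (p # ps) qs" "q \<in> set (p # ps) \<union> set qs" "unsettled f" "f (fst q) = snd q"
      using Cons.prems(1-4) by auto
    show thesis if "x \<in> set (p # ps)" "unsettled f" "f (fst x) = snd x" for x f
      using that step Cons.prems(5)[of x f] by auto
  qed
qed

lemma off_lines:
  assumes "phyp (gr f)" "t \<noteq> u" "\<And>v. v \<in> set vs \<Longrightarrow> v \<noteq> t \<and> v \<noteq> u"
  shows "off (lines_at (map (\<lambda>y. (y, f y)) vs) (t, f t)) (u, f u)"
  using assms(3)
proof (induction vs)
  case Nil
  have "f t \<noteq> f u" using ofun_inj[OF assms(1)] assms(2) by blast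
  then show ?case by (simp add: plus_gf16_def[symmetric] times_gf16_def[symmetric] zero_gf16_def[symmetric])
next
  case (Cons v vs)
  have v: "v \<noteq> t" "v \<noteq> u" using Cons.prems by auto
  have tv: "t + v \<noteq> 0" using v by simp
  \<comment> \<open>The slope of the secant through the points at t and v; its intercept is f t + m
    * t.\<close>
  define m where "m = (f t + f v) * inverse (t + v)"
  have mv: "m * (t + v) = f t + f v" using tv by (simp add: m_def mult.assoc)
  have "m * u + (f t + m * t) \<noteq> f u"
  proof
    assume "m * u + (f t + m * t) = f u"
    then have "f u * (t + v) = (m * u + (f t + m * t)) * (t + v)" by (simp only:)
    also have "\<dots> = (m * (t + v)) * u + f t * (t + v) + (m * (t + v)) * t"
      by (simp add: distrib_left distrib_right add_ac mult_ac)
    also have "\<dots> = f t * (u + v) + f v * (u + t)"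
      unfolding mv by (simp add: distrib_left distrib_right add_ac)
    finally have "f t * (v + u) + f v * (u + t) = f u * (t + v)" by (simp only: add.commute)
    then show False using ofun_triple[OF assms(1), of t v u] v assms(2) by (simp add: add.commute)
  qed
  then show ?case using Cons
    by (simp add: m_def line_at_def plus_gf16_def[symmetric] times_gf16_def[symmetric] inverse_gf16_def[symmetric])
qed

lemma pgroups_fst: "map fst (pgroups ys ls) = ys"
  by (induction ys) auto

lemma pgroups_mem: "(i, g) \<in> set (pgroups ys ls) \<Longrightarrow> g = pgrp i ls"
  by (induction ys) auto

lemma point_phase_sound:
  assumes f: "unsettled f" "f (fst c) = snd c" "fst c \<notin> {G0, G1}"
    and cov: "\<And>t. t \<notin> {G0, G1} \<Longrightarrow> (t, f t) \<in> set (concat os)"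
  shows "\<exists>r \<in> set (point_phase c os). through f r"
proof -
  have p: "phyp (gr f)" and f01: "f G0 = G0" "f G1 = G1"
    using f(1) by (auto simp: unsettled_def ofun_def zero_gf16_def one_gf16_def)
  define t where "t y = (y, f y)" for y
  let ?ys = "[G2, G3, G4, G5, G6, G7, G8, G9, G10, G11, G12, G13, G14, G15]"
  let ?us = "[(),(),(),(),(),(),(),(),(),(),(),(),()]"
  let ?gs = "pgroups (remove_lab (fst c) ?ys) (filter (off (lines_at [(G1, G1), (G0, G0)] c)) (concat os))"
  let ?ls = "[fst c, G1, G0]"
  have c: "c = t (fst c)" using f(2) by (cases c) (simp add: t_def)
  have mem: "fst c \<in> set ?ys" using f(3) by (cases "fst c") simp_all
  have d: "distinct ?ys" by simp
  have fs: "map fst ?gs = remove_lab (fst c) ?ys" by (rule pgroups_fst)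
  then have fs': "fst ` set ?gs = set ?ys - {fst c}"
    using remove_lab(1)[OF d] by (metis list.set_map)
  have "\<exists>ls'. set ls' = fst ` set ?gs \<union> set ?ls \<and>
      map t ls' \<in> set (search lines_at off ?us (map t ?ls) ?gs)"
  proof (rule search_sound[where L = UNIV])
    fix ls and i j :: gf16 assume "distinct (i # j # ls)"
    then show "off (lines_at (map t ls) (t i)) (t j)"
      unfolding t_def by (intro off_lines[OF p]) auto
  next
    show "length ?us = length ?gs"
      using remove_lab(3)[OF mem] fs by (metis (no_types, lifting) length_map length_Cons list.size(3) nat.inject)
    show "distinct (map fst ?gs @ ?ls)"
      unfolding fs using remove_lab(1,2)[OF d, of "fst c"] f(3) by auto
    fix i g assume ig: "(i, g) \<in> set ?gs"
    have "i \<in> set ?ys - {fst c}" using imageI[OF ig, of fst] unfolding fs' fst_conv .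
    then have i: "i \<in> set ?ys" "i \<noteq> fst c" by blast+
    have i01: "i \<noteq> G0" "i \<noteq> G1" using i(1) by auto
    have "t i \<in> set (concat os)" using cov[of i] i01 by (simp add: t_def)
    moreover have "off (lines_at (map (\<lambda>y. (y, f y)) [G1, G0]) (fst c, f (fst c))) (i, f i)"
      by (rule off_lines[OF p]) (use i i01 f(3) in auto)
    then have "off (lines_at [(G1, G1), (G0, G0)] c) (t i)"
      unfolding list.map f01 f(2) prod.collapse t_def .
    moreover have "fst (t i) = i" by (simp add: t_def)
    ultimately show "t i \<in> set g"
      unfolding pgroups_mem[OF ig] pgrp_def set_filter by blast
  qed (rule subset_UNIV)+
  moreover have "map t ?ls = [c, (G1, G1), (G0, G0)]"
    unfolding list.map c[symmetric] by (simp add: t_def f01)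
  ultimately obtain ls' where "map t ls' \<in> set (point_phase c os)"
    unfolding point_phase_def by metis
  moreover have "through f (map t ls')" by (auto simp: through_def t_def)
  ultimately show ?thesis by blast
qed

lemma point_phases_sound:
  "\<lbrakk>point_phases os cs; \<forall>q\<in>set os. q \<noteq> [] \<and> reach [hd q] (tl q) \<and> fst (hd q) \<notin> {G0, G1};
    \<forall>c\<in>set cs. \<forall>(l, ps)\<in>set c. l \<in> {conic_tab, pointed_tab, lunelli_tab};
    \<And>f t. unsettled f \<Longrightarrow> t \<notin> {G0, G1} \<Longrightarrow> (t, f t) \<in> set (concat os)\<rbrakk> \<Longrightarrow> \<not> unsettled f"
proof (induction os cs rule: point_phases.induct)
  case (1 cs)
  have "G2 \<notin> {G0, G1}" by simp
  then show ?case using 1(4)[of f G2] by auto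
next
  case (2 q os c cs)
  have s: "settle c (point_phase (hd q) (q # os))" "point_phases os cs" using 2(2) by auto
  have q: "q \<noteq> []" "reach [hd q] (tl q)" "fst (hd q) \<notin> {G0, G1}" using 2(3) by auto
  have head: False if g: "unsettled g" "g (fst (hd q)) = snd (hd q)" for g
  proof -
    obtain r where r: "r \<in> set (point_phase (hd q) (q # os))" "through g r"
      using point_phase_sound[OF g q(3) 2(5)[OF g(1)]] by blast
    have "settled g"
      by (rule settle_sound[OF s(1) r(1) _ r(2)]) (use g(1) 2(4) in \<open>auto simp: unsettled_def\<close>)
    then show False using g(1) by (simp add: unsettled_def)
  qed
  have no: False if "unsettled g" "p \<in> set q" "g (fst p) = snd p" for g p
  proof (rule reach_sound[OF q(2) _ that(1,3)])
    have "q = hd q # tl q" using q(1) by simp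
    then show "p \<in> set [hd q] \<union> set (tl q)" using that(2) by (metis Un_iff list.set(1,2) insert_iff)
  qed (use head in auto)
  show ?case
  proof (rule 2(1)[OF s(2)])
    fix g t assume g: "unsettled g" "t \<notin> {G0, G1}"
    have "(t, g t) \<in> set (concat (q # os))" by (rule 2(5)[OF g])
    moreover have "(t, g t) \<notin> set q" using no[OF g(1), of "(t, g t)"] by auto
    ultimately show "(t, g t) \<in> set (concat os)" by simp
  qed (use 2(3,4) in auto)
qed simp

lemma no_unsettled: "\<not> unsettled f"
proof (rule point_phases_sound[OF oval_phases])
  have "\<forall>q \<in> set point_orbits. fst (hd q) \<notin> {G0, G1}" by (simp add: point_orbits_def)
  then show "\<forall>q\<in>set point_orbits. q \<noteq> [] \<and> reach [hd q] (tl q) \<and> fst (hd q) \<notin> {G0, G1}"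
    using orbits_reach by blast
  show "\<forall>c\<in>set oval_certs. \<forall>(l, ps)\<in>set c. l \<in> {conic_tab, pointed_tab, lunelli_tab}"
    by (simp add: oval_certs_def)
  fix f t assume f: "unsettled f" "t \<notin> {G0, G1}"
  have p: "phyp (gr f)" and f01: "f G0 = G0" "f G1 = G1"
    using f(1) by (auto simp: unsettled_def ofun_def zero_gf16_def one_gf16_def)
  have "f t \<noteq> f G0" "f t \<noteq> f G1" using ofun_inj[OF p, of t] f(2) by blast+
  \<comment> \<open>Otherwise the points at 0, 1 and t lie on the line of slope 1.\<close>
  moreover have "t \<noteq> f t"
  proof
    assume e: "t = f t"
    have "f t * (G1 + G0) + f G0 * (G1 + t) \<noteq> f G1 * (t + G0)"
      by (rule ofun_triple[OF p]) (use f(2) in auto)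
    then show False using e f01 by (simp add: zero_gf16_def[symmetric] one_gf16_def[symmetric])
  qed
  ultimately show "(t, f t) \<in> set (concat point_orbits)"
    using f(2) f01 by (intro orbits_cover) auto
qed

lemma based_standard:
  assumes T: "based T"
  shows "\<exists>g \<in> standard. geqv T (gr g)"
proof -
  obtain f where f: "based (gr f)" "geqv T (gr f)" using based_geqv_gr[OF T] by blast
  have "f t = t" if t: "t \<in> {0, 1}" for t
  proof -
    have "((*) t, (*) t) \<in> gr f" using basedD(2,3)[OF f(1)] t by (auto simp: mult_id)
    then obtain u where "((*) t, (*) t) = ((*) u, (*) (f u))" unfolding gr_def by blast
    then have "t = u \<and> t = f u" unfolding prod.inject mult_eq .
    then show ?thesis by metis
  qed
  then have "f 0 = 0" "f 1 = 1" by simp_all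
  then have "settled f" using no_unsettled[of f] basedD(1)[OF f(1)] by (simp add: unsettled_def ofun_def)
  then show ?thesis using geqv_trans[OF f(2)] by (auto simp: settled_def oeq_def)
qed

section \<open>The nucleus of a pseudo-oval\<close>

definition sub16 :: "'v::ab_group_add set \<Rightarrow> bool" where
  "sub16 E \<longleftrightarrow> 0 \<in> E \<and> (\<forall>x\<in>E. \<forall>y\<in>E. x + y \<in> E) \<and> card E = 16"

lemma sub16D: "sub16 E \<Longrightarrow> 0 \<in> E" "sub16 E \<Longrightarrow> x \<in> E \<Longrightarrow> y \<in> E \<Longrightarrow> x + y \<in> E"
  "sub16 E \<Longrightarrow> card E = 16" "sub16 E \<Longrightarrow> finite E"
  by (auto simp: sub16_def intro: card_ge_0_finite)

definition sumset :: "'v::ab_group_add set \<Rightarrow> 'v set \<Rightarrow> 'v set" where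
  "sumset E F = {e + f | e f. e \<in> E \<and> f \<in> F}"

lemma sumsetI: "e \<in> E \<Longrightarrow> f \<in> F \<Longrightarrow> e + f \<in> sumset E F"
  by (auto simp: sumset_def)

lemma sumset_commute: "x \<in> sumset E F \<Longrightarrow> x \<in> sumset F E"
  by (force simp: sumset_def add.commute)

text \<open>Kept abstract so that it covers the triples over the concrete field and those over the
  given field.\<close>

locale char2_group =
  fixes dummy :: "'v::{ab_group_add, finite} itself"
  assumes char2: "x + x = (0 :: 'v)" and cardV: "CARD('v) = 4096"
begin

lemma uminus [simp]: "- x = (x :: 'v)"
  using char2[of x] by (simp add: minus_unique)

lemma double [simp]: "x + x = (0 :: 'v)"
  by (rule char2)

lemma add_eq_0: "x + y = 0 \<longleftrightarrow> x = (y :: 'v)"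
  by (metis char2 add_right_cancel)

lemma add_cancel [simp]: "x + (x + y) = (y :: 'v)"
  by (simp add: add.assoc[symmetric] char2)

lemma add_cancel2 [simp]: "y + x + x = (y :: 'v)"
  by (simp add: add.assoc char2)

lemma eq_add: "x = y + z \<Longrightarrow> z = y + (x :: 'v)"
  by simp

lemma regroup: "a + b = c + d \<Longrightarrow> (a + c) + (b + d) = (0 :: 'v)"
  by (metis add_eq_0 add.assoc add.commute)

definition indep :: "'v set \<Rightarrow> 'v set \<Rightarrow> 'v set \<Rightarrow> bool" where
  "indep A B C \<longleftrightarrow> (\<forall>a\<in>A. \<forall>b\<in>B. \<forall>c\<in>C. a + b + c = 0 \<longrightarrow> a = 0 \<and> b = 0 \<and> c = 0)"

lemma indep_inj:
  assumes "sub16 A" "sub16 B" "sub16 C" "indep A B C"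
  shows "inj_on (\<lambda>(a, b, c). a + b + c) (A \<times> B \<times> C)"
proof (rule inj_onI)
  fix p q assume pq: "p \<in> A \<times> B \<times> C" "q \<in> A \<times> B \<times> C"
    "(\<lambda>(a, b, c). a + b + c) p = (\<lambda>(a, b, c). a + b + c) q"
  obtain a b c a' b' c' where p: "p = (a, b, c)" "q = (a', b', c')" by (metis surj_pair)
  have m: "a \<in> A" "b \<in> B" "c \<in> C" "a' \<in> A" "b' \<in> B" "c' \<in> C" and e: "a + b + c = a' + b' + c'"
    using pq unfolding p by auto
  have "(a + a') + (b + b') + (c + c') = (a + b + c) + (a' + b' + c')" by (simp add: add_ac)
  also have "\<dots> = 0" unfolding e by (rule char2)
  finally have "a + a' = 0 \<and> b + b' = 0 \<and> c + c' = 0"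
    using assms(4) sub16D(2)[OF assms(1) m(1,4)] sub16D(2)[OF assms(2) m(2,5)] sub16D(2)[OF assms(3) m(3,6)]
    unfolding indep_def by blast
  then show "p = q" unfolding p by (simp add: add_eq_0)
qed

lemma indep_span:
  assumes "sub16 A" "sub16 B" "sub16 C" "indep A B C"
  shows "\<exists>a\<in>A. \<exists>b\<in>B. \<exists>c\<in>C. v = a + b + c"
proof -
  let ?f = "\<lambda>(a, b, c). a + b + c"
  have "card (?f ` (A \<times> B \<times> C)) = 4096"
    unfolding card_image[OF indep_inj[OF assms]]
    by (simp add: card_cartesian_product sub16D(3)[OF assms(1)] sub16D(3)[OF assms(2)] sub16D(3)[OF assms(3)])
  then have "?f ` (A \<times> B \<times> C) = UNIV" by (intro card_subset_eq) (simp_all add: cardV)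
  then have "v \<in> ?f ` (A \<times> B \<times> C)" by simp
  then show ?thesis by auto
qed

lemma span_indep:
  assumes "sub16 A" "sub16 B" "sub16 C" "\<And>v. \<exists>a\<in>A. \<exists>b\<in>B. \<exists>c\<in>C. v = a + b + c"
  shows "indep A B C"
proof -
  let ?f = "\<lambda>(a, b, c). a + b + c"
  have "?f ` (A \<times> B \<times> C) = UNIV"
  proof (rule set_eqI, rule iffI)
    fix v show "v \<in> ?f ` (A \<times> B \<times> C)"
    proof -
      obtain a b c where "a \<in> A" "b \<in> B" "c \<in> C" "v = a + b + c" using assms(4)[of v] by blast
      then show ?thesis by (intro image_eqI[of _ _ "(a, b, c)"]) auto
    qed
  qed simp
  then have "card (?f ` (A \<times> B \<times> C)) = card (A \<times> B \<times> C)"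
    by (simp add: cardV card_cartesian_product sub16D(3)[OF assms(1)] sub16D(3)[OF assms(2)] sub16D(3)[OF assms(3)])
  then have i: "inj_on ?f (A \<times> B \<times> C)" by (intro eq_card_imp_inj_on) (simp_all add: sub16D(4)[OF assms(1)] sub16D(4)[OF assms(2)] sub16D(4)[OF assms(3)])
  show ?thesis unfolding indep_def
  proof (intro ballI impI)
    fix a b c assume m: "a \<in> A" "b \<in> B" "c \<in> C" and e: "a + b + c = 0"
    have "(a, b, c) = (0, 0, 0)"
      by (rule inj_onD[OF i]) (use m e sub16D(1)[OF assms(1)] sub16D(1)[OF assms(2)] sub16D(1)[OF assms(3)] in auto)
    then show "a = 0 \<and> b = 0 \<and> c = 0" by simp
  qed
qed

lemma card_sumset:
  fixes E F :: "'v set"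
  assumes "sub16 E" "sub16 F" "\<And>x. x \<in> E \<Longrightarrow> x \<in> F \<Longrightarrow> x = 0"
  shows "card (sumset E F) = 256"
proof -
  have "inj_on (\<lambda>(e, f). e + f) (E \<times> F)"
  proof (rule inj_onI)
    fix p q assume pq: "p \<in> E \<times> F" "q \<in> E \<times> F" "(\<lambda>(e, f). e + f) p = (\<lambda>(e, f). e + f) q"
    obtain a b c d where p: "p = (a, b)" "q = (c, d)" by (metis surj_pair)
    have m: "a \<in> E" "b \<in> F" "c \<in> E" "d \<in> F" and e: "a + b = c + d"
      using pq unfolding p by auto
    have "a + c = b + d" using regroup[OF e] by (simp add: add_eq_0)
    then have "a + c = 0" using assms(3) sub16D(2)[OF assms(1) m(1,3)] sub16D(2)[OF assms(2) m(2,4)] by metis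
    then show "p = q" unfolding p using \<open>a + c = b + d\<close> by (simp add: add_eq_0)
  qed
  moreover have "sumset E F = (\<lambda>(e, f). e + f) ` (E \<times> F)" by (auto simp: sumset_def)
  ultimately show ?thesis
    by (simp add: card_image card_cartesian_product sub16D(3)[OF assms(1)] sub16D(3)[OF assms(2)])
qed

end

lemma card_sum_swap:
  assumes "finite W" "finite I"
  shows "(\<Sum>v\<in>W. card {i \<in> I. P v i}) = (\<Sum>i\<in>I. card {v \<in> W. P v i})"
proof -
  have "(\<Sum>v\<in>W. card {i \<in> I. P v i}) = (\<Sum>v\<in>W. \<Sum>i\<in>I. if P v i then 1 else 0)"
    using assms(2) by (simp add: sum.inter_filter[symmetric])
  also have "\<dots> = (\<Sum>i\<in>I. \<Sum>v\<in>W. if P v i then 1 else 0)" by (rule sum.swap)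
  also have "\<dots> = (\<Sum>i\<in>I. card {v \<in> W. P v i})"
    using assms(1) by (simp add: sum.inter_filter[symmetric])
  finally show ?thesis .
qed

locale oval_group = char2_group "TYPE('v)" for dummy :: "'v::{ab_group_add, finite} itself" +
  fixes Ov :: "'v set set"
  assumes card_Ov: "card Ov = 17" and sub: "E \<in> Ov \<Longrightarrow> sub16 E" and ind: "indep3 Ov"
begin

lemma finite_Ov: "finite Ov"
  using card_Ov by (intro card_ge_0_finite) simp

lemma third: "E \<in> Ov \<Longrightarrow> F \<in> Ov \<Longrightarrow> \<exists>W\<in>Ov. W \<noteq> E \<and> W \<noteq> F"
proof (rule ccontr)
  assume "\<not> ?thesis"
  then have "Ov \<subseteq> {E, F}" by blast
  then have "card Ov \<le> card {E, F}" by (intro card_mono) auto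
  also have "\<dots> \<le> 2" by (rule card_insert_le_m1) auto
  finally show False using card_Ov by simp
qed

lemma indep_members: "E \<in> Ov \<Longrightarrow> F \<in> Ov \<Longrightarrow> W \<in> Ov \<Longrightarrow> E \<noteq> F \<Longrightarrow> E \<noteq> W \<Longrightarrow> F \<noteq> W \<Longrightarrow> indep E F W"
  unfolding indep_def using indep3D[OF ind] by blast

section \<open>Secant and tangent spaces\<close>

lemma meet_zero:
  assumes "E \<in> Ov" "F \<in> Ov" "E \<noteq> F" "x \<in> E" "x \<in> F" shows "x = 0"
proof -
  obtain W where W: "W \<in> Ov" "W \<noteq> E" "W \<noteq> F" using third[OF assms(1,2)] by blast
  have "x + x + 0 = 0" by (simp add: char2)
  then show ?thesis
    using indep3D[OF ind assms(1,2) W(1) assms(3) _ _ assms(4,5) sub16D(1)[OF sub[OF W(1)]]] W by blast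
qed

text \<open>In the quotient by E the images of two other members meet only in zero.\<close>

lemma sumset_meet:
  assumes "E \<in> Ov" "F \<in> Ov" "W \<in> Ov" "E \<noteq> F" "E \<noteq> W" "F \<noteq> W" "x \<in> sumset E F" "x \<in> sumset E W"
  shows "x \<in> E"
proof -
  obtain e f e' w where x: "e \<in> E" "f \<in> F" "x = e + f" "e' \<in> E" "w \<in> W" "x = e' + w"
    using assms(7,8) by (auto simp: sumset_def)
  have "(e + e') + f + w = 0" using regroup[of e f e' w] x(3,6) by (simp add: add.assoc)
  then have "f = 0"
    using indep_members[OF assms(1-6)] sub16D(2)[OF sub[OF assms(1)] x(1,4)] x(2,5) unfolding indep_def by blast
  then show ?thesis using x by simp
qed

text \<open>In the 8-dimensional quotient by E the other sixteen members form a partial spread, one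
  short of a spread. \<open>tang E\<close> is the preimage of the missing element, that is, of zero
  and the uncovered vectors.\<close>

definition tang :: "'v set \<Rightarrow> 'v set" where
  "tang E = {v. v \<in> E \<or> (\<forall>F\<in>Ov. F \<noteq> E \<longrightarrow> v \<notin> sumset E F)}"

lemma tang_sumset: "v \<in> tang E \<Longrightarrow> F \<in> Ov \<Longrightarrow> F \<noteq> E \<Longrightarrow> v \<in> sumset E F \<Longrightarrow> v \<in> E"
  by (auto simp: tang_def)

lemma tang_member: "v \<in> E \<Longrightarrow> v \<in> tang E"
  by (simp add: tang_def)

lemma not_tang: "v \<notin> tang E \<Longrightarrow> \<exists>F\<in>Ov. F \<noteq> E \<and> v \<in> sumset E F"
  by (auto simp: tang_def)

lemma tang_meet:
  assumes "E \<in> Ov" "F \<in> Ov" "E \<noteq> F" "v \<in> tang E" "v \<in> F" shows "v = 0"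
proof -
  have "0 + v \<in> sumset E F" by (rule sumsetI[OF sub16D(1)[OF sub[OF assms(1)]] assms(5)])
  then have "v \<in> E" using tang_sumset[OF assms(4,2)] assms(3) by simp
  then show ?thesis by (rule meet_zero[OF assms(1-3) _ assms(5)])
qed

text \<open>The reason why \<open>tang E\<close> is closed under addition. Modulo E, each of the
  fifteen members besides E and F contains one vector of the coset u + F. These vectors are distinct
  and different from u, so the whole coset except u is covered.\<close>

lemma shift_not_tang:
  assumes E: "E \<in> Ov" and u: "u \<in> tang E" "u \<notin> E" and F: "F \<in> Ov" "F \<noteq> E"
    and w: "w \<in> sumset E F" "w \<notin> E"
  shows "u + w \<notin> tang E"
proof -
  note sE = sub[OF E] and sF = sub[OF F(1)]
  have "\<exists>f. f \<in> F \<and> (\<exists>e\<in>E. \<exists>k\<in>K. u = e + f + k)" if "K \<in> Ov" "K \<noteq> E" "K \<noteq> F" for K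
    using indep_span[OF sE sF sub[OF that(1)] indep_members[OF E F(1) that(1)], of u] F that by blast
  then obtain g where g: "\<And>K. K \<in> Ov - {E, F} \<Longrightarrow> g K \<in> F \<and> (\<exists>e\<in>E. \<exists>k\<in>K. u = e + g K + k)"
    by (metis Diff_iff insert_iff)
  \<comment> \<open>This is a bijection of the fifteen other members with the nonzero vectors of \<open>F\<close>; if \<open>g K\<close> is the
    component of \<open>w\<close> in \<open>F\<close>, then \<open>u + w\<close> lies in the sum of \<open>E\<close> and \<open>K\<close>.\<close>
  have uF: "u \<notin> sumset E K" if "K \<in> Ov" "K \<noteq> E" for K using tang_sumset[OF u(1) that] u(2) by blast
  have g0: "g K \<noteq> 0" if K: "K \<in> Ov - {E, F}" for K
  proof
    assume "g K = 0"
    then obtain e k where "e \<in> E" "k \<in> K" "u = e + k" using g[OF K] by auto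
    then show False using uF[of K] K sumsetI by blast
  qed
  have ginj: "inj_on g (Ov - {E, F})"
  proof (rule inj_onI, rule ccontr)
    fix K L assume K: "K \<in> Ov - {E, F}" "L \<in> Ov - {E, F}" "g K = g L" "K \<noteq> L"
    obtain e k where k: "e \<in> E" "k \<in> K" "u = e + g K + k" using g[OF K(1)] by blast
    obtain e' l where l: "e' \<in> E" "l \<in> L" "u = e' + g L + l" using g[OF K(2)] by blast
    have "(e + e') + k + l = (e + g K + k) + (e' + g K + l)"
      by (simp add: add_ac)
    also have "\<dots> = 0" using k(3) l(3) K(3) by (metis char2)
    finally have "k = 0"
      using indep_members[of E K L] K E sub16D(2)[OF sE k(1) l(1)] k(2) l(2) unfolding indep_def by blast
    then have "u \<in> sumset E F" using k g[OF K(1)] sumsetI by force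
    then show False using uF[OF F] by blast
  qed
  have "g ` (Ov - {E, F}) = F - {0}"
  proof (rule card_subset_eq)
    show "finite (F - {0})" using sub16D(4)[OF sF] by simp
    show "g ` (Ov - {E, F}) \<subseteq> F - {0}"
    proof
      fix x assume "x \<in> g ` (Ov - {E, F})"
      then obtain K where K: "K \<in> Ov - {E, F}" "x = g K" by blast
      show "x \<in> F - {0}" using g[OF K(1)] g0[OF K(1)] K(2) by simp
    qed
    have "card (Ov - {E, F}) = 15" using card_Ov E F finite_Ov by (simp add: card_Diff_subset)
    moreover have "card (F - {0}) = 15" using sub16D[OF sF] by simp
    ultimately show "card (g ` (Ov - {E, F})) = card (F - {0})" using card_image[OF ginj] by simp
  qed
  moreover obtain e0 f0 where w0: "e0 \<in> E" "f0 \<in> F" "w = e0 + f0" using w(1) by (auto simp: sumset_def)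
  have "f0 \<noteq> 0" using w(2) w0 by auto
  ultimately have "f0 \<in> g ` (Ov - {E, F})" using w0(2) by blast
  then obtain K where K: "K \<in> Ov - {E, F}" "f0 = g K" by blast
  obtain e k where k: "e \<in> E" "k \<in> K" "u = e + g K + k" using g[OF K(1)] by blast
  have uw: "u + w = (e0 + e) + k" unfolding k(3) w0(3) K(2) by (simp add: add_ac)
  have "u + w \<in> sumset E K" unfolding uw by (rule sumsetI[OF sub16D(2)[OF sE w0(1) k(1)] k(2)])
  moreover have "u + w \<notin> E"
  proof
    assume "u + w \<in> E"
    then have "(e0 + e) + (u + w) \<in> E" using sub16D(2)[OF sE] w0(1) k(1) by blast
    then have "k \<in> E" unfolding uw by simp
    then have "k = 0" using meet_zero[of E K k] E K k(2) by blast
    then have "u = e + g K" using k(3) by simp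
    then show False using uF[OF F] sumsetI[OF k(1)] g[OF K(1)] by blast
  qed
  ultimately show ?thesis using tang_sumset[of "u + w" E K] K by blast
qed

lemma tang_add:
  assumes "E \<in> Ov" "u \<in> tang E" "v \<in> tang E" shows "u + v \<in> tang E"
proof (rule ccontr)
  assume n: "u + v \<notin> tang E"
  then obtain F where F: "F \<in> Ov" "F \<noteq> E" "u + v \<in> sumset E F" using not_tang by blast
  have nE: "u + v \<notin> E" using n tang_member by blast
  show False
  proof (cases "u \<in> E")
    case False
    have "u + (u + v) \<notin> tang E" by (rule shift_not_tang[OF assms(1,2) False F nE])
    then show False using assms(3) by simp
  next
    case True
    obtain e f where e: "e \<in> E" "f \<in> F" "u + v = e + f" using F(3) by (auto simp: sumset_def)
    have "v = (u + e) + f" using eq_add[OF e(3)[symmetric]] by (simp add: add.assoc)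
    then have "v \<in> sumset E F" using sumsetI[OF sub16D(2)[OF sub[OF assms(1)] True e(1)] e(2)] by simp
    then have "v \<in> E" using tang_sumset[OF assms(3) F(1,2)] by blast
    then show False using nE sub16D(2)[OF sub[OF assms(1)] True] by blast
  qed
qed

lemma tang_zero: "E \<in> Ov \<Longrightarrow> 0 \<in> tang E"
  by (rule tang_member[OF sub16D(1)[OF sub]])

text \<open>Each of the sixteen sums E + F has 256 - 16 = 240 vectors outside of E, and 4096 - 16 *
  240 = 256.\<close>

lemma card_tang:
  assumes "E \<in> Ov" shows "card (tang E) = 256"
proof -
  have sE: "sub16 E" by (rule sub[OF assms])
  have U: "- tang E = (\<Union>F\<in>Ov - {E}. sumset E F - E)"
  proof (intro equalityI subsetI)
    fix v assume "v \<in> - tang E"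
    then have v: "v \<notin> tang E" by simp
    then have "v \<notin> E" using tang_member by blast
    then show "v \<in> (\<Union>F\<in>Ov - {E}. sumset E F - E)" using not_tang[OF v] by blast
  next
    fix v assume "v \<in> (\<Union>F\<in>Ov - {E}. sumset E F - E)"
    then show "v \<in> - tang E" using tang_sumset by blast
  qed
  have "card (- tang E) = (\<Sum>F\<in>Ov - {E}. card (sumset E F - E))"
    unfolding U
  proof (rule card_UN_disjoint)
    show "finite (Ov - {E})" using finite_Ov by simp
    show "\<forall>F\<in>Ov - {E}. \<forall>K\<in>Ov - {E}. F \<noteq> K \<longrightarrow> (sumset E F - E) \<inter> (sumset E K - E) = {}"
      using sumset_meet[OF assms] by blast
  qed simp
  also have "\<dots> = (\<Sum>F\<in>Ov - {E}. 240)"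
  proof (rule sum.cong)
    fix F assume F: "F \<in> Ov - {E}"
    have sF: "sub16 F" using sub F by blast
    have "E \<subseteq> sumset E F" using sumsetI[of _ E 0 F] sub16D(1)[OF sF] by force
    moreover have "card (sumset E F) = 256"
      by (rule card_sumset[OF sE sF]) (use meet_zero[OF assms, of F] F in blast)
    ultimately show "card (sumset E F - E) = 240"
      by (simp add: card_Diff_subset[OF sub16D(4)[OF sE]] sub16D(3)[OF sE])
  qed simp
  also have "\<dots> = 3840" using card_Ov assms finite_Ov by simp
  finally have "card (- tang E) = 3840" .
  moreover have "card (tang E) + card (- tang E) = 4096"
    unfolding cardV[symmetric] by (subst card_Un_disjoint[symmetric]) (auto simp: Un_commute)
  ultimately show ?thesis by simp
qed

lemma two_members: "\<exists>E\<in>Ov. \<exists>F\<in>Ov. E \<noteq> F"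
proof -
  have "Ov \<noteq> {}" using card_Ov by auto
  then obtain E where E: "E \<in> Ov" by blast
  obtain F where "F \<in> Ov" "F \<noteq> E" using third[OF E E] by blast
  then show ?thesis using E by blast
qed

section \<open>Counting the tangent spaces through a vector\<close>

definition off_set :: "'v set" where
  "off_set = {v. \<forall>E\<in>Ov. v \<notin> E}"

definition tcount :: "'v \<Rightarrow> nat" where
  "tcount v = card {E \<in> Ov. v \<in> tang E}"

lemma ex_tang:
  assumes "v \<in> off_set" shows "\<exists>E\<in>Ov. v \<in> tang E"
proof (rule ccontr)
  assume "\<not> ?thesis"
  then have "\<forall>E\<in>Ov. \<exists>F. F \<in> Ov \<and> F \<noteq> E \<and> v \<in> sumset E F" using not_tang by blast
  then obtain g where g: "\<And>E. E \<in> Ov \<Longrightarrow> g E \<in> Ov \<and> g E \<noteq> E \<and> v \<in> sumset E (g E)" by metis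
  \<comment> \<open>So \<open>g\<close> pairs off the seventeen members.\<close>
  have gg: "g (g E) = E" if E: "E \<in> Ov" for E
  proof (rule ccontr)
    assume n: "g (g E) \<noteq> E"
    have "v \<in> sumset (g E) E" using g[OF E] sumset_commute by blast
    moreover have "g E \<in> Ov" "g (g E) \<in> Ov" "g (g E) \<noteq> g E" "v \<in> sumset (g E) (g (g E))"
      using g[OF E] g[of "g E"] by blast+
    ultimately have "v \<in> g E"
      using sumset_meet[of "g E" E "g (g E)" v] E g[OF E] n by metis
    then show False using assms \<open>g E \<in> Ov\<close> by (simp add: off_set_def)
  qed
  let ?C = "(\<lambda>E. {E, g E}) ` Ov"
  have U: "\<Union>?C = Ov"
  proof (intro equalityI subsetI)
    fix x assume "x \<in> \<Union>?C"
    then obtain E where "E \<in> Ov" "x = E \<or> x = g E" by blast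
    then show "x \<in> Ov" using g[of E] by auto
  qed blast
  have "2 * card ?C = card (\<Union>?C)"
  proof (rule card_partition)
    show "finite ?C" using finite_Ov by simp
    show "finite (\<Union>?C)" unfolding U by (rule finite_Ov)
    show "card c = 2" if c: "c \<in> ?C" for c
    proof -
      obtain E where E: "E \<in> Ov" "c = {E, g E}" using c by blast
      then show ?thesis using g[OF E(1)] by (metis card_2_iff)
    qed
    show "c \<inter> d = {}" if cd: "c \<in> ?C" "d \<in> ?C" "c \<noteq> d" for c d
    proof -
      obtain E where E: "E \<in> Ov" "c = {E, g E}" using cd(1) by (rule imageE)
      obtain F where F: "F \<in> Ov" "d = {F, g F}" using cd(2) by (rule imageE)
      show ?thesis
      proof (rule ccontr)
        assume "c \<inter> d \<noteq> {}"
        then have "E = F \<or> E = g F \<or> g E = F \<or> g E = g F" unfolding E(2) F(2) by blast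
        then have "E = F \<or> E = g F" using gg[OF E(1)] gg[OF F(1)] by metis
        then have "c = d" using gg[OF F(1)] unfolding E(2) F(2) by auto
        then show False using cd(3) by simp
      qed
    qed
  qed
  then have "even (card Ov)" unfolding U by (metis dvd_triv_left)
  then show False by (simp add: card_Ov)
qed

lemma card_off_set: "card off_set = 3840"
proof -
  obtain E0 where E0: "E0 \<in> Ov" using two_members by blast
  then have "0 \<in> E0" by (rule sub16D(1)[OF sub])
  then have U: "\<Union>Ov = insert 0 (\<Union>E\<in>Ov. E - {0})" using E0 by blast
  have "card (\<Union>E\<in>Ov. E - {0}) = (\<Sum>E\<in>Ov. card (E - {0}))"
  proof (rule card_UN_disjoint[OF finite_Ov])
    show "\<forall>E\<in>Ov. \<forall>F\<in>Ov. E \<noteq> F \<longrightarrow> (E - {0}) \<inter> (F - {0}) = {}" using meet_zero by blast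
  qed simp
  also have "\<dots> = (\<Sum>E\<in>Ov. 15)"
  proof (rule sum.cong)
    show "card (E - {0}) = 15" if "E \<in> Ov" for E using sub16D[OF sub[OF that]] by simp
  qed simp
  also have "\<dots> = 255" by (simp add: card_Ov)
  finally have "card (\<Union>E\<in>Ov. E - {0}) = 255" .
  moreover have "card (insert 0 (\<Union>E\<in>Ov. E - {0})) = Suc (card (\<Union>E\<in>Ov. E - {0}))"
    by (rule card_insert_disjoint) auto
  ultimately have "card (\<Union>Ov) = 256" unfolding U by (simp only:)
  moreover have "off_set = - \<Union>Ov" by (auto simp: off_set_def)
  then have "card off_set + card (\<Union>Ov) = 4096"
    unfolding cardV[symmetric] by (subst card_Un_disjoint[symmetric]) auto
  ultimately show ?thesis by simp
qed

lemma card_tang_off: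
  assumes E: "E \<in> Ov" shows "card {v \<in> off_set. v \<in> tang E} = 240"
proof -
  have "{v \<in> off_set. v \<in> tang E} = tang E - E"
  proof (intro equalityI subsetI)
    fix v assume v: "v \<in> tang E - E"
    have "v \<notin> F" if F: "F \<in> Ov" for F
    proof
      assume "v \<in> F"
      then have "v = 0" using tang_meet[OF E F _ _ \<open>v \<in> F\<close>] v by blast
      then show False using v sub16D(1)[OF sub[OF E]] by blast
    qed
    then show "v \<in> {v \<in> off_set. v \<in> tang E}" using v by (simp add: off_set_def)
  qed (use E in \<open>auto simp: off_set_def\<close>)
  moreover have "E \<subseteq> tang E" using tang_member by blast
  ultimately show ?thesis
    using card_Diff_subset[OF sub16D(4)[OF sub[OF E]], of "tang E"] card_tang[OF E] sub16D(3)[OF sub[OF E]] by simp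
qed

lemma tang_pair_off:
  assumes "E \<in> Ov" "F \<in> Ov" "E \<noteq> F" "v \<in> tang E" "v \<in> tang F" "v \<noteq> 0"
  shows "v \<in> off_set"
proof -
  have "v \<notin> K" if K: "K \<in> Ov" for K
  proof
    assume v: "v \<in> K"
    show False
    proof (cases "K = E")
      case True
      then show False using tang_meet[OF assms(2,1) _ assms(5)] assms(3,6) v by metis
    next
      case False
      then show False using tang_meet[OF assms(1) K _ assms(4) v] assms(6) by metis
    qed
  qed
  then show ?thesis by (simp add: off_set_def)
qed

text \<open>The dimension formula 8 + 8 - 12 = 4 in the form of a count: a fibre of the sum map on
  the product of the tangent spaces injects into their intersection by a translation, so the
  intersection has at least 256 * 256 / 4096 = 16 elements.\<close>

lemma card_tang_pair:
  assumes E: "E \<in> Ov" and F: "F \<in> Ov" and n: "E \<noteq> F"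
  shows "card {v \<in> off_set. v \<in> tang E \<and> v \<in> tang F} \<ge> 15"
proof -
  let ?P = "tang E \<times> tang F" and ?s = "\<lambda>p. fst p + snd p"
  let ?k = "card (tang E \<inter> tang F)"
  have fib: "card {p \<in> ?P. ?s p = v} \<le> ?k" for v
  proof (cases "{p \<in> ?P. ?s p = v} = {}")
    case True
    then show ?thesis by (metis card.empty le0)
  next
    case False
    then obtain a b where ab: "a \<in> tang E" "b \<in> tang F" "a + b = v" by auto
    show ?thesis
    proof (rule card_inj_on_le)
      show "inj_on (\<lambda>p. a + fst p) {p \<in> ?P. ?s p = v}"
      proof (rule inj_onI)
        fix p q assume "p \<in> {p \<in> ?P. ?s p = v}" "q \<in> {p \<in> ?P. ?s p = v}" "a + fst p = a + fst q"
        then have "fst p = fst q" "fst p + snd p = fst q + snd q" by simp_all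
        then show "p = q" by (simp add: prod_eq_iff)
      qed
      show "(\<lambda>p. a + fst p) ` {p \<in> ?P. ?s p = v} \<subseteq> tang E \<inter> tang F"
      proof
        fix x assume "x \<in> (\<lambda>p. a + fst p) ` {p \<in> ?P. ?s p = v}"
        then obtain c d where cd: "c \<in> tang E" "d \<in> tang F" "c + d = v" "x = a + c" by auto
        have "(a + c) + (b + d) = 0" by (rule regroup) (simp add: ab(3) cd(3))
        then have "x = b + d" using cd(4) by (simp add: add_eq_0)
        then show "x \<in> tang E \<inter> tang F"
          using tang_add[OF E ab(1) cd(1)] tang_add[OF F ab(2) cd(2)] cd(4) by simp
      qed
    qed simp
  qed
  have "(\<Sum>p\<in>?P. card {v \<in> UNIV. ?s p = v}) = (\<Sum>v\<in>UNIV. card {p \<in> ?P. ?s p = v})"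
    by (rule card_sum_swap) simp_all
  moreover have "{v \<in> UNIV. ?s p = v} = {?s p}" for p by auto
  ultimately have "card ?P = (\<Sum>v\<in>UNIV. card {p \<in> ?P. ?s p = v})" by simp
  also have "\<dots> \<le> (\<Sum>v\<in>(UNIV :: 'v set). ?k)" by (rule sum_mono) (rule fib)
  finally have "256 * 256 \<le> 4096 * ?k"
    by (simp add: card_cartesian_product card_tang[OF E] card_tang[OF F] cardV)
  then have "?k \<ge> 16" by simp
  moreover have "{v \<in> off_set. v \<in> tang E \<and> v \<in> tang F} = tang E \<inter> tang F - {0}"
    using tang_pair_off[OF assms] E sub16D(1)[OF sub] by (auto simp: off_set_def)
  moreover have "0 \<in> tang E \<inter> tang F" using tang_zero E F by blast
  ultimately show ?thesis by simp
qed

lemma sum_tcount: "(\<Sum>v\<in>off_set. tcount v) = 4080"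
proof -
  have "(\<Sum>v\<in>off_set. tcount v) = (\<Sum>E\<in>Ov. card {v \<in> off_set. v \<in> tang E})"
    unfolding tcount_def by (rule card_sum_swap[OF _ finite_Ov]) simp
  also have "\<dots> = (\<Sum>E\<in>Ov. 240)" by (rule sum.cong[OF refl card_tang_off])
  also have "\<dots> = 4080" by (simp add: card_Ov)
  finally show ?thesis .
qed

text \<open>The squares count ordered pairs of tangent spaces through a vector: 240 vectors for
  equal members and at least 15 for distinct ones, 17 * (240 + 16 * 15) = 8160 in all.\<close>

lemma sum_tcount_square: "(\<Sum>v\<in>off_set. tcount v * tcount v) \<ge> 8160"
proof -
  have sq: "tcount v * tcount v = card {p \<in> Ov \<times> Ov. v \<in> tang (fst p) \<and> v \<in> tang (snd p)}" for v
  proof -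
    have "{p \<in> Ov \<times> Ov. v \<in> tang (fst p) \<and> v \<in> tang (snd p)} = {E \<in> Ov. v \<in> tang E} \<times> {E \<in> Ov. v \<in> tang E}"
      by auto
    then show ?thesis by (simp add: tcount_def card_cartesian_product)
  qed
  have "8160 = (\<Sum>E\<in>Ov. 480 :: nat)" by (simp add: card_Ov)
  also have "\<dots> \<le> (\<Sum>E\<in>Ov. \<Sum>F\<in>Ov. card {v \<in> off_set. v \<in> tang E \<and> v \<in> tang F})"
  proof (rule sum_mono)
    fix E assume E: "E \<in> Ov"
    have "480 = 240 + (\<Sum>F\<in>Ov - {E}. 15 :: nat)" using E finite_Ov by (simp add: card_Ov)
    also have "\<dots> \<le> card {v \<in> off_set. v \<in> tang E} + (\<Sum>F\<in>Ov - {E}. card {v \<in> off_set. v \<in> tang E \<and> v \<in> tang F})"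
      by (intro add_mono sum_mono) (use card_tang_off[OF E] card_tang_pair[OF E] in auto)
    also have "\<dots> = (\<Sum>F\<in>Ov. card {v \<in> off_set. v \<in> tang E \<and> v \<in> tang F})"
      by (subst sum.remove[OF finite_Ov E]) simp
    finally show "480 \<le> (\<Sum>F\<in>Ov. card {v \<in> off_set. v \<in> tang E \<and> v \<in> tang F})" .
  qed
  also have "\<dots> = (\<Sum>p\<in>Ov \<times> Ov. card {v \<in> off_set. v \<in> tang (fst p) \<and> v \<in> tang (snd p)})"
    by (simp add: sum.cartesian_product case_prod_beta)
  also have "\<dots> = (\<Sum>v\<in>off_set. tcount v * tcount v)"
    unfolding sq by (rule card_sum_swap[symmetric]) (simp_all add: finite_Ov)
  finally show ?thesis .
qed

lemma tcount_cases:
  assumes "v \<in> off_set" shows "tcount v = 1 \<or> tcount v = 17"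
proof -
  have le: "tcount v \<le> 17" for v
    unfolding tcount_def card_Ov[symmetric] by (rule card_mono[OF finite_Ov]) auto
  have ge: "1 \<le> tcount v" if "v \<in> off_set" for v
  proof -
    have "{E \<in> Ov. v \<in> tang E} \<noteq> {}" using ex_tang[OF that] by blast
    then show ?thesis unfolding tcount_def using finite_Ov by (simp add: Suc_le_eq card_gt_0_iff)
  qed
  \<comment> \<open>All summands are nonnegative, whereas the count of tangent spaces bounds the sum by 0 from above.\<close>
  let ?h = "\<lambda>v. (int (tcount v) - 1) * (17 - int (tcount v))"
  have "(\<Sum>v\<in>off_set. ?h v) = (\<Sum>v\<in>off_set. 18 * int (tcount v) - 17 - int (tcount v * tcount v))"
    by (rule sum.cong) (simp_all add: algebra_simps)
  also have "\<dots> = 18 * int (\<Sum>v\<in>off_set. tcount v) - 17 * int (card off_set)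
      - int (\<Sum>v\<in>off_set. tcount v * tcount v)"
    by (simp add: sum_subtractf sum_distrib_left)
  \<comment> \<open>The value is at most 18 * 4080 - 17 * 3840 - 8160 = 0.\<close>
  also have "\<dots> \<le> 0"
    unfolding sum_tcount card_off_set using sum_tcount_square by linarith
  finally have "(\<Sum>v\<in>off_set. ?h v) \<le> 0" .
  moreover have nn: "0 \<le> ?h v" if "v \<in> off_set" for v
    using le[of v] ge[OF that] by (intro mult_nonneg_nonneg) auto
  then have "0 \<le> (\<Sum>v\<in>off_set. ?h v)" by (rule sum_nonneg)
  ultimately have "(\<Sum>v\<in>off_set. ?h v) = 0" by simp
  then have "?h v = 0" using sum_nonneg_eq_0_iff[of off_set ?h] nn assms by simp
  then show ?thesis by auto
qed

definition nuc :: "'v set" where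
  "nuc = (\<Inter>E\<in>Ov. tang E)"

lemma nuc_tcount:
  assumes "v \<in> off_set" shows "tcount v = (if v \<in> nuc then 17 else 1)"
proof (cases "v \<in> nuc")
  case True
  then have "{E \<in> Ov. v \<in> tang E} = Ov" by (auto simp: nuc_def)
  then show ?thesis using True by (simp add: tcount_def card_Ov)
next
  case False
  have "tcount v \<noteq> 17"
  proof
    assume "tcount v = 17"
    then have "{E \<in> Ov. v \<in> tang E} = Ov" 
      unfolding tcount_def by (intro card_subset_eq[OF finite_Ov]) (auto simp: card_Ov)
    then show False using False by (auto simp: nuc_def)
  qed
  then show ?thesis using False tcount_cases[OF assms] by simp
qed

lemma nuc_off: "v \<in> nuc \<Longrightarrow> v \<noteq> 0 \<Longrightarrow> v \<in> off_set"
  using two_members tang_pair_off[of _ _ v] by (auto simp: nuc_def)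

text \<open>If n of the 3840 vectors lie in all tangent spaces and the others in one each, then 3840
  + 16 * n = 4080, so n = 15.\<close>

lemma sub16_nuc: "sub16 nuc"
proof -
  have "(\<Sum>v\<in>off_set. tcount v) = (\<Sum>v\<in>off_set. 1 + 16 * (if v \<in> nuc then 1 else 0))"
    by (rule sum.cong) (simp_all add: nuc_tcount)
  also have "\<dots> = (\<Sum>v\<in>off_set. 1) + 16 * (\<Sum>v\<in>off_set. if v \<in> nuc then 1 else 0)"
    by (simp only: sum.distrib sum_distrib_left)
  also have "(\<Sum>v\<in>off_set. if v \<in> nuc then 1 else 0) = card {v \<in> off_set. v \<in> nuc}"
    by (simp add: sum.inter_filter[symmetric])
  also have "(\<Sum>v\<in>off_set. 1) = card off_set" by simp
  finally have "card {v \<in> off_set. v \<in> nuc} = 15" unfolding sum_tcount card_off_set by simp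
  moreover have "{v \<in> off_set. v \<in> nuc} = nuc - {0}"
    using nuc_off two_members sub16D(1)[OF sub] by (auto simp: off_set_def)
  moreover have z: "0 \<in> nuc" using tang_zero by (simp add: nuc_def)
  ultimately have "card nuc = 16" by (simp add: card_Diff_singleton)
  moreover have "\<forall>x\<in>nuc. \<forall>y\<in>nuc. x + y \<in> nuc" using tang_add by (auto simp: nuc_def)
  ultimately show ?thesis using z by (simp add: sub16_def)
qed

lemma indep_nuc:
  assumes "E \<in> Ov" "F \<in> Ov" "E \<noteq> F" shows "indep E F nuc"
  unfolding indep_def
proof (intro ballI impI)
  fix e f n assume m: "e \<in> E" "f \<in> F" "n \<in> nuc" and s: "e + f + n = 0"
  have n: "n = e + f" using s by (simp add: add_eq_0)
  have t: "n \<in> tang E" "n \<in> tang F" using m(3) assms by (auto simp: nuc_def)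
  have "n \<in> E" using tang_sumset[OF t(1) assms(2)] assms(3) sumsetI[OF m(1,2)] n by auto
  then have "n = 0" using tang_meet[OF assms(2,1) _ t(2)] assms(3) by auto
  then have "e = f" using n by (metis add_eq_0)
  then have "e = 0" using meet_zero[OF assms m(1)] m(2) by simp
  then show "e = 0 \<and> f = 0 \<and> n = 0" using \<open>n = 0\<close> \<open>e = f\<close> by simp
qed

end

section \<open>Coordinates of a pseudo-oval\<close>

context char2_group
begin

lemma ex_outside_list:
  assumes "sub16 H" "length xs < 16" shows "\<exists>d \<in> H. d \<notin> set xs"
proof (rule ccontr)
  assume "\<not> ?thesis"
  then have "card H \<le> card (set xs)" by (intro card_mono) auto
  also have "\<dots> \<le> length xs" by (rule card_length)
  finally show False using assms sub16D(3)[OF assms(1)] by simp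
qed

lemma sub16_param:
  fixes H :: "'v set"
  assumes H: "sub16 H"
  shows "\<exists>h :: gf16 \<Rightarrow> 'v. addmap h \<and> inj h \<and> range h = H"
proof -
  obtain a where a: "a \<in> H" "a \<notin> set [0]" using ex_outside_list[OF H, of "[0]"] by auto
  obtain b where b: "b \<in> H" "b \<notin> set [0, a]" using ex_outside_list[OF H, of "[0, a]"] by auto
  obtain c where c: "c \<in> H" "c \<notin> set [0, a, b, a + b]"
    using ex_outside_list[OF H, of "[0, a, b, a + b]"] by auto
  obtain d where d: "d \<in> H" "d \<notin> set [0, a, b, a + b, c, a + c, b + c, a + b + c]"
    using ex_outside_list[OF H, of "[0, a, b, a + b, c, a + c, b + c, a + b + c]"] by auto
  let ?h = "lincomb a b c d"
  have h: "addmap ?h" by (rule addmap_lincomb) (rule char2)+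
  have i: "inj ?h"
  proof (rule addmap_inj[OF h])
    fix x assume "?h x = 0"
    then show "x = 0" using a(2) b(2) c(2) d(2)
      by (cases x) (simp_all add: lincomb_def zero_gf16_def[symmetric] add_eq_0)
  qed
  have "?h x \<in> H" for x
    unfolding lincomb_def using sub16D(1)[OF H] a(1) b(1) c(1) d(1) sub16D(2)[OF H] by simp
  then have "range ?h \<subseteq> H" by blast
  moreover have "card (range ?h) = card H" using card_image[OF i] sub16D(3)[OF H] by (simp add: card_gf16)
  ultimately have "range ?h = H" using card_subset_eq[OF sub16D(4)[OF H]] by blast
  then show ?thesis using h i by blast
qed

lemma indepD: "indep A B C \<Longrightarrow> a \<in> A \<Longrightarrow> b \<in> B \<Longrightarrow> c \<in> C \<Longrightarrow> a + b + c = 0 \<Longrightarrow> a = 0 \<and> b = 0 \<and> c = 0"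
  unfolding indep_def by blast

lemma sum_eq_0: "x = y + z \<Longrightarrow> x + y + z = (0 :: 'v)"
  by (metis add.assoc double)

lemma components:
  fixes h :: "gf16 \<Rightarrow> 'v"
  assumes ABC: "sub16 A" "sub16 B" "sub16 C" "indep A B C" and h: "addmap h"
  shows "\<exists>p q r. addmap p \<and> addmap q \<and> addmap r \<and> (\<forall>t. p t \<in> A \<and> q t \<in> B \<and> r t \<in> C \<and> h t = p t + q t + r t)"
proof -
  have "\<forall>t. \<exists>a b c. a \<in> A \<and> b \<in> B \<and> c \<in> C \<and> h t = a + b + c"
    using indep_span[OF ABC] by blast
  then obtain p q r where pqr: "\<And>t. p t \<in> A \<and> q t \<in> B \<and> r t \<in> C \<and> h t = p t + q t + r t" by metis
  then have m: "\<And>t. p t \<in> A" "\<And>t. q t \<in> B" "\<And>t. r t \<in> C" and hp: "\<And>t. h t = p t + q t + r t" by blast+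
  have "p (x + y) = p x + p y \<and> q (x + y) = q x + q y \<and> r (x + y) = r x + r y" for x y
  proof -
    have "(p (x + y) + (p x + p y)) + (q (x + y) + (q x + q y)) + (r (x + y) + (r x + r y)) =
        (p (x + y) + q (x + y) + r (x + y)) + ((p x + q x + r x) + (p y + q y + r y))"
      by (simp only: add_ac)
    also have "\<dots> = h (x + y) + (h x + h y)" by (simp only: hp)
    also have "\<dots> = 0" by (simp only: addmapD[OF h] double)
    finally have "p (x + y) + (p x + p y) = 0 \<and> q (x + y) + (q x + q y) = 0 \<and> r (x + y) + (r x + r y) = 0"
      by (intro indepD[OF ABC(4)] sub16D(2)[OF ABC(1)] sub16D(2)[OF ABC(2)] sub16D(2)[OF ABC(3)] m)
    then show ?thesis by (simp only: add_eq_0)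
  qed
  then show ?thesis using pqr unfolding addmap_def by blast
qed

lemma factor:
  fixes p p' :: "gf16 \<Rightarrow> 'v"
  assumes "addmap p" "inj p" "addmap p'" "range p' \<subseteq> range p"
  shows "\<exists>a. addmap a \<and> (\<forall>t. p (a t) = p' t)"
proof -
  have "\<forall>t. \<exists>s. p s = p' t" using assms(4) by (metis rangeI subsetD imageE)
  then obtain a where a: "\<And>t. p (a t) = p' t" by metis
  have "p (a (x + y)) = p (a x + a y)" for x y
    by (simp only: a addmapD[OF assms(1)] addmapD[OF assms(3)])
  then have "addmap a" using injD[OF assms(2)] by (auto simp: addmap_def)
  then show ?thesis using a by blast
qed

end

context oval_group
begin

text \<open>Four subspaces fix the coordinates: X becomes the graph of the zero pair, Y becomes
  \<open>ysub\<close>, the nucleus \<open>zsub\<close>, and U the graph of the identity pair. For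
  the latter, the components p, q, r of a parametrization of U are themselves used to parametrize X,
  Y and the nucleus.\<close>

lemma coordinates:
  "\<exists>(G :: gf16 vec3 \<Rightarrow> 'v) T. addmap G \<and> bij G \<and> based T \<and> (`) G ` members T = Ov"
proof -
  obtain X Y where XY: "X \<in> Ov" "Y \<in> Ov" "X \<noteq> Y" using two_members by blast
  obtain U where U: "U \<in> Ov" "U \<noteq> X" "U \<noteq> Y" using third[OF XY(1,2)] by blast
  note sX = sub[OF XY(1)] and sY = sub[OF XY(2)] and sN = sub16_nuc
  have ind3: "indep E Y nuc" if "E \<in> Ov" "E \<noteq> Y" for E using indep_nuc[OF that(1) XY(2) that(2)] .
  have swap: "indep E nuc F" "indep nuc E F" if "indep E F nuc" for E F
    using that unfolding indep_def by (metis add.commute add.left_commute)+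
  have par: "\<exists>(h :: gf16 \<Rightarrow> 'v) p q r. addmap h \<and> inj h \<and> range h = E \<and> addmap p \<and> addmap q \<and> addmap r \<and> inj p \<and>
      (\<forall>t. p t \<in> X \<and> q t \<in> Y \<and> r t \<in> nuc \<and> h t = p t + q t + r t)"
    if E: "E \<in> Ov" "E \<noteq> Y" for E
  proof -
    obtain h :: "gf16 \<Rightarrow> 'v" where h: "addmap h" "inj h" "range h = E" using sub16_param[OF sub[OF E(1)]] by blast
    obtain p q r where p: "addmap p" "addmap q" "addmap r"
        "\<And>t. p t \<in> X \<and> q t \<in> Y \<and> r t \<in> nuc \<and> h t = p t + q t + r t"
      using components[OF sX sY sN ind3[OF XY(1,3)] h(1)] by blast
    have ip: "inj p"
    proof (rule addmap_inj[OF p(1)])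
      fix t assume "p t = 0"
      then have "h t = q t + r t" using p(4)[of t] by simp
      then have "h t + q t + r t = 0" by (rule sum_eq_0)
      then have "h t = 0" using ind3[OF E] p(4)[of t] h(3) unfolding indep_def by blast
      then show "t = 0" using injD[OF h(2), of t 0] addmap_0[OF h(1)] by simp
    qed
    have all: "\<forall>t. p t \<in> X \<and> q t \<in> Y \<and> r t \<in> nuc \<and> h t = p t + q t + r t"
      by (rule allI) (rule p(4))
    show ?thesis
      by (rule exI[of _ h], rule exI[of _ p], rule exI[of _ q], rule exI[of _ r])
        (intro conjI h p(1-3) ip all)
  qed
  obtain h p q r :: "gf16 \<Rightarrow> 'v" where h: "addmap h" "inj h" "range h = U" and p: "addmap p" "addmap q" "addmap r" "inj p"
    and c': "\<forall>t. p t \<in> X \<and> q t \<in> Y \<and> r t \<in> nuc \<and> h t = p t + q t + r t"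
    using par[OF U(1,3)] by (elim exE conjE) (rule that; assumption)
  note c = c'[rule_format]
  have iq: "inj q"
  proof (rule addmap_inj[OF p(2)])
    fix t assume "q t = 0"
    then have "h t = p t + r t" using c[of t] by simp
    then have "h t + p t + r t = 0" by (rule sum_eq_0)
    then have "h t = 0" using indep_nuc[OF U(1) XY(1) U(2)] c[of t] h(3) unfolding indep_def by blast
    then show "t = 0" using injD[OF h(2), of t 0] addmap_0[OF h(1)] by simp
  qed
  have ir: "inj r"
  proof (rule addmap_inj[OF p(3)])
    fix t assume "r t = 0"
    then have "h t = p t + q t" using c[of t] by simp
    then have "h t + p t + q t = 0" by (rule sum_eq_0)
    then have "h t = 0" using indep_members[OF U(1) XY(1,2) U(2,3) XY(3)] c[of t] h(3) unfolding indep_def by blast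
    then show "t = 0" using injD[OF h(2), of t 0] addmap_0[OF h(1)] by simp
  qed
  have full: "range s = S" if "inj s" "sub16 S" "\<And>t. s t \<in> S" for s :: "gf16 \<Rightarrow> 'v" and S
  proof (rule card_subset_eq[OF sub16D(4)[OF that(2)]])
    show "range s \<subseteq> S" using that(3) by blast
    show "card (range s) = card S" using card_image[OF that(1)] sub16D(3)[OF that(2)] by (simp add: card_gf16)
  qed
  have R: "range p = X" "range q = Y" "range r = nuc"
    using full[OF p(4) sX] full[OF iq sY] full[OF ir sN] c by blast+
  define G :: "gf16 vec3 \<Rightarrow> 'v" where "G v = p (fst v) + q (fst (snd v)) + r (snd (snd v))" for v
  have aG: "addmap G"
    by (simp add: addmap_def G_def addmapD[OF p(1)] addmapD[OF p(2)] addmapD[OF p(3)] add_ac)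
  have iG: "inj G"
  proof (rule addmap_inj[OF aG])
    fix v assume "G v = 0"
    then have "p (fst v) = 0 \<and> q (fst (snd v)) = 0 \<and> r (snd (snd v)) = 0"
      using ind3[OF XY(1,3)] c unfolding indep_def G_def by blast
    then show "v = 0"
      using injD[OF p(4), of _ 0] injD[OF iq, of _ 0] injD[OF ir, of _ 0]
        addmap_0[OF p(1)] addmap_0[OF p(2)] addmap_0[OF p(3)] by (simp add: prod_eq_iff)
  qed
  have "CARD(gf16 vec3) = 4096" by (simp add: card_gf16 card_prod)
  then have "range G = UNIV" using card_image[OF iG] by (intro card_subset_eq) (simp_all add: cardV)
  then have bG: "bij G" using iG by (simp add: bij_def)
  have Gg: "G ` graph3 A B = range (\<lambda>t. p t + q (A t) + r (B t))" for A B
    by (simp add: graph3_def image_image G_def)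
  have GY: "G ` ysub = Y"
    by (simp add: ysub_def image_image G_def addmap_0[OF p(1)] addmap_0[OF p(3)] R)
  have GN: "G ` zsub = nuc"
    by (simp add: zsub_def image_image G_def addmap_0[OF p(1)] addmap_0[OF p(2)] R)
  have ex: "\<exists>A B. addmap A \<and> addmap B \<and> G ` graph3 A B = E" if E: "E \<in> Ov" "E \<noteq> Y" for E
  proof -
    obtain h' p' q' r' :: "gf16 \<Rightarrow> 'v" where h': "addmap h'" "inj h'" "range h' = E"
      and p': "addmap p'" "addmap q'" "addmap r'" "inj p'"
      and all: "\<forall>t. p' t \<in> X \<and> q' t \<in> Y \<and> r' t \<in> nuc \<and> h' t = p' t + q' t + r' t"
      using par[OF E] by (elim exE conjE) (rule that; assumption)
    note c' = all[rule_format]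
    obtain a where a: "addmap a" "\<And>t. p (a t) = p' t" using factor[OF p(1,4) p'(1)] c' R(1) by blast
    obtain b where b: "addmap b" "\<And>t. q (b t) = q' t" using factor[OF p(2) iq p'(2)] c' R(2) by blast
    obtain d where d: "addmap d" "\<And>t. r (d t) = r' t" using factor[OF p(3) ir p'(3)] c' R(3) by blast
    \<comment> \<open>The first component is bijective, so the member can be reparametrized by it
      and becomes a graph.\<close>
    have "bij a"
    proof (rule addmap_bij[OF a(1)])
      fix t assume "a t = 0"
      then have "p' t = p' 0" using a(2)[of t] addmap_0[OF p(1)] addmap_0[OF p'(1)] by simp
      then show "t = 0" using injD[OF p'(4)] by blast
    qed
    have ai: "a (inv a t) = t" for t by (rule surj_f_inv_f[OF bij_is_surj[OF \<open>bij a\<close>]])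
    have "addmap (inv a)" by (rule addmap_inv[OF a(1) \<open>bij a\<close>])
    moreover have "G ` graph3 (b \<circ> inv a) (d \<circ> inv a) = (\<lambda>t. h' (inv a t)) ` UNIV"
    proof -
      have "p t = p' (inv a t)" for t using a(2)[of "inv a t"] ai by simp
      then show ?thesis unfolding Gg by (simp add: b(2) d(2) c')
    qed
    moreover have "(\<lambda>t. h' (inv a t)) ` UNIV = h' ` range (inv a)" by (simp add: image_image)
    moreover have "range (inv a) = UNIV" using bij_imp_bij_inv[OF \<open>bij a\<close>] by (rule bij_is_surj)
    ultimately show ?thesis
      using addmap_comp[OF b(1)] addmap_comp[OF d(1)] h'(3) by metis
  qed
  define T where "T = {(A, B). addmap A \<and> addmap B \<and> G ` graph3 A B \<in> Ov}"
  have GeqY: "G ` S = Y \<longleftrightarrow> S = ysub" for S using GY inj_image_eq_iff[OF iG] by metis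
  have im: "(\<lambda>(A, B). G ` graph3 A B) ` T = Ov - {Y}"
  proof (intro equalityI subsetI)
    fix E assume "E \<in> (\<lambda>(A, B). G ` graph3 A B) ` T"
    then obtain A B where "E = G ` graph3 A B" "E \<in> Ov" by (auto simp: T_def)
    then show "E \<in> Ov - {Y}" using GeqY graph3_neq(1) by auto
  next
    fix E assume "E \<in> Ov - {Y}"
    then obtain A B where "addmap A" "addmap B" "G ` graph3 A B = E" "E \<in> Ov" using ex[of E] by blast
    then have "(A, B) \<in> T" "E = (\<lambda>(A, B). G ` graph3 A B) (A, B)" by (auto simp: T_def)
    then show "E \<in> (\<lambda>(A, B). G ` graph3 A B) ` T" by blast
  qed
  have "inj_on (\<lambda>(A, B). G ` graph3 A B) T"
    by (rule inj_onI) (auto simp: inj_image_eq_iff[OF iG] graph3_inj)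
  then have "card T = card (Ov - {Y})" unfolding im[symmetric] by (simp add: card_image)
  then have "card T = 16" using XY(2) finite_Ov by (simp add: card_Ov)
  then have wfT: "wf T" by (simp add: wf_def T_def)
  have mem: "(`) G ` members T = Ov"
  proof -
    have "(`) G ` members T = insert (G ` ysub) ((\<lambda>(A, B). G ` graph3 A B) ` T)"
      by (simp add: members_def image_image case_prod_beta)
    then show ?thesis unfolding im GY using XY(2) by auto
  qed
  have i3: "indep3 (insert zsub (members T))"
    unfolding indep3_def
  proof (intro ballI impI)
    fix A B C a b c assume A: "A \<in> insert zsub (members T)" "B \<in> insert zsub (members T)" "C \<in> insert zsub (members T)"
      "A \<noteq> B \<and> A \<noteq> C \<and> B \<noteq> C" "a \<in> A" "b \<in> B" "c \<in> C" "a + b + c = 0"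
    have I: "G ` S \<in> insert nuc Ov" if "S \<in> insert zsub (members T)" for S
      using that mem GN by blast
    have ne: "G ` A \<noteq> G ` B" "G ` A \<noteq> G ` C" "G ` B \<noteq> G ` C" using A(4) inj_image_eq_iff[OF iG] by metis+
    have "indep (G ` A) (G ` B) (G ` C)"
      using I[OF A(1)] I[OF A(2)] I[OF A(3)] ne indep_members[of "G ` A" "G ` B" "G ` C"]
        indep_nuc[of "G ` A" "G ` B"] indep_nuc[of "G ` A" "G ` C"] indep_nuc[of "G ` B" "G ` C"] swap
      by (metis insertE)
    moreover have "G a + G b + G c = 0"
      using A(8) addmapD[OF aG] addmap_0[OF aG] by metis
    ultimately have "G a = 0 \<and> G b = 0 \<and> G c = 0" using A(5,6,7) unfolding indep_def by blast
    then show "a = 0 \<and> b = 0 \<and> c = 0" using injD[OF iG, of _ 0] addmap_0[OF aG] by simp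
  qed
  have "G ` graph3 zmap zmap = X" unfolding Gg by (simp add: addmap_0[OF p(2)] addmap_0[OF p(3)] R)
  moreover have "G ` graph3 id id = U" unfolding Gg using c h(3) by simp
  ultimately have "(zmap, zmap) \<in> T" "(id, id) \<in> T"
    using XY(1) U(1) addmap_zero addmap_id(2) by (auto simp: T_def)
  then have "based T" using wfT i3 by (simp add: based_def phyp_def)
  then show ?thesis using aG bG mem by blast
qed

end

section \<open>Standard o-functions\<close>

text \<open>The first condition concerns the lines through (0, 1, 0), the second the collinearity of
  three points (1, t, f t). Unlike \<open>ofun\<close> it can be verified directly on a
  table.\<close>

definition oval_function :: "gmap \<Rightarrow> bool" where
  "oval_function f \<longleftrightarrow> (\<forall>t u. t \<noteq> u \<longrightarrow> f t \<noteq> f u) \<and>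
     (\<forall>t u v. t \<noteq> u \<longrightarrow> t \<noteq> v \<longrightarrow> u \<noteq> v \<longrightarrow> f t * (v + u) + f u * (v + t) \<noteq> f v * (t + u))"

definition line_eq :: "gf16 list \<Rightarrow> gf16 \<Rightarrow> gf16 \<Rightarrow> gf16 \<Rightarrow> bool" where
  "line_eq l t u v \<longleftrightarrow> t = u \<or> t = v \<or> u = v \<or>
     gadd (gmul (look t l) (gadd v u)) (gmul (look u l) (gadd v t)) \<noteq> gmul (look v l) (gadd t u)"

lemma line_eq_table:
  "\<forall>t u v. line_eq conic_tab t u v" "\<forall>t u v. line_eq pointed_tab t u v" "\<forall>t u v. line_eq lunelli_tab t u v"
  by (simp only: all_gf16 line_eq_def conic_tab_def pointed_tab_def lunelli_tab_def look_eval gadd_tab gmul_tab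
      gf16_eq simp_thms not_False_eq_True)+

lemma inj_table:
  "\<forall>t u. t = u \<or> look t conic_tab \<noteq> look u conic_tab"
  "\<forall>t u. t = u \<or> look t pointed_tab \<noteq> look u pointed_tab"
  "\<forall>t u. t = u \<or> look t lunelli_tab \<noteq> look u lunelli_tab"
  by (simp only: all_gf16 conic_tab_def pointed_tab_def lunelli_tab_def look_eval
      gf16_eq simp_thms not_False_eq_True)+

lemma standard_oval_function:
  assumes "g \<in> standard" shows "oval_function g"
proof -
  have "oval_function (\<lambda>t. look t l)"
    if "\<forall>t u v. line_eq l t u v" "\<forall>t u. t = u \<or> look t l \<noteq> look u l" for l
    unfolding oval_function_def plus_gf16_def times_gf16_def
    using that unfolding line_eq_def by blast
  then show ?thesis using assms line_eq_table inj_table unfolding standard_def by blast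
qed

text \<open>Eliminating c leaves two equations in a and b, and their determinant is the expression
  that \<open>oval_function\<close> excludes from being zero.\<close>

lemma oval_function_triple:
  assumes "oval_function f" "t \<noteq> u" "t \<noteq> v" "u \<noteq> v"
    and s: "a + b + c = 0" "t * a + u * b + v * c = 0" "f t * a + f u * b + f v * c = 0"
  shows "a = 0 \<and> b = 0 \<and> c = 0"
proof -
  have c: "c = a + b" using s(1) by simp
  have e1: "(t + v) * a = (u + v) * b"
  proof -
    have "(t + v) * a + (u + v) * b = t * a + u * b + v * c" unfolding c by (simp add: distrib_left distrib_right add_ac)
    then show ?thesis using s(2) by simp
  qed
  have e2: "(f t + f v) * a = (f u + f v) * b"
  proof -
    have "(f t + f v) * a + (f u + f v) * b = f t * a + f u * b + f v * c"
      unfolding c by (simp add: distrib_left distrib_right add_ac)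
    then show ?thesis using s(3) by simp
  qed
  have "((f t + f v) * (u + v)) * b = (f t + f v) * ((t + v) * a)" by (simp only: e1 mult.assoc)
  also have "\<dots> = (t + v) * ((f t + f v) * a)" by (simp only: mult.left_commute)
  also have "\<dots> = ((t + v) * (f u + f v)) * b" by (simp only: e2 mult.assoc)
  finally have "((f t + f v) * (u + v) + (t + v) * (f u + f v)) * b = 0" by (simp add: distrib_right)
  moreover have "(f t + f v) * (u + v) + (t + v) * (f u + f v) = (f t * (v + u) + f u * (v + t)) + f v * (t + u)"
    by (simp add: distrib_left distrib_right add_ac mult_ac)
  moreover have "(f t * (v + u) + f u * (v + t)) + f v * (t + u) \<noteq> 0"
    using assms(1-4) by (simp add: oval_function_def)
  ultimately have b: "b = 0" by simp
  then have "a = 0" using e1 assms(3) by simp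
  then show ?thesis using b c by simp
qed

lemma oval_function_pair:
  assumes "oval_function f" "t \<noteq> u" and s: "b + c = 0" "f t * b + f u * c = 0"
  shows "b = 0 \<and> c = (0 :: gf16)"
proof -
  have c: "c = b" using s(1) by simp
  have "(f t + f u) * b = 0" using s(2) unfolding c by (simp only: distrib_right)
  moreover have "f t + f u \<noteq> 0" using assms(1,2) by (simp add: oval_function_def)
  ultimately show ?thesis using c by simp
qed

lemma pair_axis:
  assumes "t \<noteq> u" and s: "b + c = 0" "t * b + u * c = 0"
  shows "b = 0 \<and> c = (0 :: gf16)"
proof -
  have c: "c = b" using s(1) by simp
  have "(t + u) * b = 0" using s(2) unfolding c by (simp only: distrib_right)
  moreover have "t + u \<noteq> 0" using assms(1) by simp
  ultimately show ?thesis using c by simp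
qed

section \<open>Independence of the eighteen subspaces of a standard model\<close>

interpretation gv: char2_group "TYPE(gf16 vec3)"
proof
  show "x + x = 0" for x :: "gf16 vec3" by (simp add: prod_eq_iff)
  show "CARD(gf16 vec3) = 4096" by (simp add: card_gf16 card_prod)
qed

definition gline :: "gmap \<Rightarrow> gf16 \<Rightarrow> gf16 vec3 set" where
  "gline f t = graph3 ((*) t) ((*) (f t))"

lemma gline_mem: "v \<in> gline f t \<longleftrightarrow> v = (fst v, t * fst v, f t * fst v)"
  by (auto simp: gline_def graph3_def)

lemma axis_mem: "v \<in> ysub \<longleftrightarrow> v = (0, fst (snd v), 0)" "v \<in> zsub \<longleftrightarrow> v = (0, 0, snd (snd v))"
  by (auto simp: ysub_def zsub_def)

lemma indep_gline:
  assumes "oval_function f" "t \<noteq> u" "t \<noteq> v" "u \<noteq> v" shows "gv.indep (gline f t) (gline f u) (gline f v)"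
  unfolding gv.indep_def
proof (intro ballI impI)
  fix x y z assume m: "x \<in> gline f t" "y \<in> gline f u" "z \<in> gline f v" and s: "x + y + z = 0"
  obtain a b c where abc: "x = (a, t * a, f t * a)" "y = (b, u * b, f u * b)" "z = (c, v * c, f v * c)"
    using m unfolding gline_mem by blast
  have "a + b + c = 0" "t * a + u * b + v * c = 0" "f t * a + f u * b + f v * c = 0"
    using s unfolding abc by (simp_all add: plus_prod_def zero_prod_def)
  from oval_function_triple[OF assms this] show "x = 0 \<and> y = 0 \<and> z = 0"
    unfolding abc by (simp add: zero_prod_def)
qed

lemma indep_ysub:
  assumes "oval_function f" "t \<noteq> u" shows "gv.indep ysub (gline f t) (gline f u)"
  unfolding gv.indep_def
proof (intro ballI impI)
  fix x y z assume m: "x \<in> ysub" "y \<in> gline f t" "z \<in> gline f u" and s: "x + y + z = 0"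
  obtain a b c where abc: "x = (0, a, 0)" "y = (b, t * b, f t * b)" "z = (c, u * c, f u * c)"
    using m unfolding gline_mem axis_mem by blast
  have e: "b + c = 0" "a + t * b + u * c = 0" "f t * b + f u * c = 0"
    using s unfolding abc plus_prod_def zero_prod_def fst_conv snd_conv prod.inject add_0_left add_0_right by blast+
  from oval_function_pair[OF assms e(1,3)] show "x = 0 \<and> y = 0 \<and> z = 0"
    using e(2) unfolding abc by (simp add: zero_prod_def)
qed

lemma indep_zsub:
  assumes "t \<noteq> u" shows "gv.indep zsub (gline f t) (gline f u)"
  unfolding gv.indep_def
proof (intro ballI impI)
  fix x y z assume m: "x \<in> zsub" "y \<in> gline f t" "z \<in> gline f u" and s: "x + y + z = 0"
  obtain a b c where abc: "x = (0, 0, a)" "y = (b, t * b, f t * b)" "z = (c, u * c, f u * c)"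
    using m unfolding gline_mem axis_mem by blast
  have e: "b + c = 0" "t * b + u * c = 0" "a + f t * b + f u * c = 0"
    using s unfolding abc plus_prod_def zero_prod_def fst_conv snd_conv prod.inject add_0_left add_0_right by blast+
  from pair_axis[OF assms e(1,2)] show "x = 0 \<and> y = 0 \<and> z = 0"
    using e(3) unfolding abc by (simp add: zero_prod_def)
qed

lemma indep_axes: "gv.indep zsub ysub (gline f t)"
  unfolding gv.indep_def
proof (intro ballI impI)
  fix x y z assume m: "x \<in> zsub" "y \<in> ysub" "z \<in> gline f t" and s: "x + y + z = 0"
  obtain a b c where abc: "x = (0, 0, a)" "y = (0, b, 0)" "z = (c, t * c, f t * c)"
    using m unfolding gline_mem axis_mem by blast
  show "x = 0 \<and> y = 0 \<and> z = 0"
    using s unfolding abc by (auto simp: plus_prod_def zero_prod_def)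
qed

lemma (in char2_group) indep_perm:
  assumes "indep A B C" shows "indep B A C" "indep A C B"
proof -
  show "indep B A C" unfolding indep_def
  proof (intro ballI impI)
    fix b a c assume m: "b \<in> B" "a \<in> A" "c \<in> C" "b + a + c = 0"
    then have "a + b + c = 0" by (simp add: add.commute)
    then show "b = 0 \<and> a = 0 \<and> c = 0" using assms m(1-3) unfolding indep_def by blast
  qed
  show "indep A C B" unfolding indep_def
  proof (intro ballI impI)
    fix a c b assume m: "a \<in> A" "c \<in> C" "b \<in> B" "a + c + b = 0"
    then have "a + b + c = 0" by (simp add: add_ac)
    then show "a = 0 \<and> c = 0 \<and> b = 0" using assms m(1-3) unfolding indep_def by blast
  qed
qed

lemma members_gr: "members (gr f) = insert ysub (range (gline f))"
  by (simp add: members_def gr_def image_image gline_def)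

lemma indep_members_gr:
  assumes f: "oval_function f" and m: "A \<in> insert zsub (members (gr f))" "B \<in> insert zsub (members (gr f))"
    "C \<in> insert zsub (members (gr f))" and n: "A \<noteq> B" "A \<noteq> C" "B \<noteq> C"
  shows "gv.indep A B C"
proof -
  \<comment> \<open>An order on the three kinds of members: only sorted triples need a case
    distinction, the others follow by permutation.\<close>
  define k where "k E = (if E = zsub then 0 else if E = ysub then 1 else (2 :: nat))" for E :: "gf16 vec3 set"
  have k: "E = zsub \<or> E = ysub \<or> (\<exists>t. E = gline f t)" if "E \<in> insert zsub (members (gr f))" for E
    using that unfolding members_gr by blast
  have k2: "k E = 2 \<Longrightarrow> E \<in> insert zsub (members (gr f)) \<Longrightarrow> \<exists>t. E = gline f t" for E
    using k[of E] by (auto simp: k_def split: if_splits)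
  have sorted: "gv.indep A B C" if m: "A \<in> insert zsub (members (gr f))" "B \<in> insert zsub (members (gr f))"
    "C \<in> insert zsub (members (gr f))" "A \<noteq> B" "A \<noteq> C" "B \<noteq> C" "k A \<le> k B" "k B \<le> k C" for A B C
  proof -
    have "k C = 2" using m(4-8) by (auto simp: k_def split: if_splits)
    then obtain v where C: "C = gline f v" using k2 m(3) by blast
    show ?thesis
    proof (cases "k B = 2")
      case False
      then have "A = zsub" "B = ysub" using m(4,7,8) by (auto simp: k_def split: if_splits)
      then show ?thesis using indep_axes C by simp
    next
      case True
      then obtain u where B: "B = gline f u" using k2 m(2) by blast
      have uv: "u \<noteq> v" using m(6) B C by blast
      consider "A = zsub" | "A = ysub" | t where "A = gline f t" using k[OF m(1)] by blast
      then show ?thesis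
      proof cases
        case 1
        then show ?thesis using indep_zsub[OF uv] B C by simp
      next
        case 2
        then show ?thesis using indep_ysub[OF f uv] B C by simp
      next
        case 3
        then have "t \<noteq> u" "t \<noteq> v" using m(4,5) B C by blast+
        then show ?thesis using indep_gline[OF f _ _ uv] 3 B C by simp
      qed
    qed
  qed
  have "k A \<le> k B \<and> k B \<le> k C \<or> k A \<le> k C \<and> k C \<le> k B \<or> k B \<le> k A \<and> k A \<le> k C \<or>
      k B \<le> k C \<and> k C \<le> k A \<or> k C \<le> k A \<and> k A \<le> k B \<or> k C \<le> k B \<and> k B \<le> k A" by linarith
  then show ?thesis
    using sorted[OF m(1,2,3) n] sorted[OF m(1,3,2) n(2,1) n(3)[symmetric]]
      sorted[OF m(2,1,3) n(1)[symmetric] n(3,2)] sorted[OF m(2,3,1) n(3) n(1)[symmetric] n(2)[symmetric]]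
      sorted[OF m(3,1,2) n(2)[symmetric] n(3)[symmetric] n(1)] sorted[OF m(3,2,1) n(3)[symmetric] n(2)[symmetric] n(1)[symmetric]]
      gv.indep_perm by metis
qed

lemma sub16_image:
  assumes "addmap h" "inj h" shows "sub16 (range (h :: gf16 \<Rightarrow> 'b::ab_group_add))"
  unfolding sub16_def
proof (intro conjI ballI)
  show "0 \<in> range h" using addmap_0[OF assms(1)] by (metis rangeI)
  show "card (range h) = 16" using card_image[OF assms(2)] by (simp add: card_gf16)
  fix x y assume "x \<in> range h" "y \<in> range h"
  then obtain a b where "x = h a" "y = h b" by blast
  then have "x + y = h (a + b)" by (simp add: addmapD[OF assms(1)])
  then show "x + y \<in> range h" by simp
qed

lemma sub16_members_gr:
  assumes "E \<in> insert zsub (members (gr f))" shows "sub16 E"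
proof -
  have "sub16 ysub" unfolding ysub_def
    by (rule sub16_image) (auto simp: addmap_def plus_prod_def inj_def)
  moreover have "sub16 zsub" unfolding zsub_def
    by (rule sub16_image) (auto simp: addmap_def plus_prod_def inj_def)
  moreover have "sub16 (gline f t)" for t unfolding gline_def graph3_def
    by (rule sub16_image) (auto simp: addmap_def plus_prod_def inj_def distrib_left)
  ultimately show ?thesis using assms unfolding members_gr by blast
qed

lemma card_members_gr: "card (members (gr f)) = 17"
proof -
  have "inj (gline f)" by (rule injI) (simp add: gline_def graph3_inj mult_eq)
  then have "card (range (gline f)) = 16" by (simp add: card_image card_gf16)
  moreover have "ysub \<notin> range (gline f)" 
  proof
    assume "ysub \<in> range (gline f)"
    then obtain t where "ysub = gline f t" by blast
    then show False using graph3_neq(1) unfolding gline_def by metis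
  qed
  ultimately show ?thesis unfolding members_gr by simp
qed

section \<open>Fields with sixteen elements\<close>

locale gf16_like =
  fixes dummy :: "'f::{field, finite} itself"
  assumes card16: "CARD('f) = 16"
begin

text \<open>The sum of all elements is invariant under the shift by 1, so 16 = 0, and 16 is a power
  of 2.\<close>

lemma two: "(2 :: 'f) = 0"
proof -
  have "(\<Sum>x\<in>UNIV. x) = (\<Sum>x\<in>UNIV. x + (1 :: 'f))"
    by (rule sum.reindex_bij_witness[of _ "\<lambda>x. x + 1" "\<lambda>x. x - 1"]) auto
  then have "of_nat 16 = (0 :: 'f)" by (simp add: sum.distrib card16)
  then have "(2 :: 'f) * (2 * (2 * 2)) = 0" by simp
  then show ?thesis by (simp only: mult_eq_0_iff simp_thms)
qed

lemma plus_self [simp]: "x + x = (0 :: 'f)"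
  using two by (metis mult_2 mult_zero_left)

lemma uminus_self [simp]: "- x = (x :: 'f)"
  by (metis plus_self minus_unique)

lemma plus_eq_0: "x + y = 0 \<longleftrightarrow> x = (y :: 'f)"
  by (metis plus_self add_right_cancel)

lemma plus_cancel [simp]: "x + (x + y) = (y :: 'f)"
  by (simp add: add.assoc[symmetric])

lemma square_add: "(x + y) ^ 2 = x ^ 2 + (y :: 'f) ^ 2"
  by (simp add: power2_sum two)

lemma power15:
  assumes "x \<noteq> (0 :: 'f)" shows "x ^ 15 = 1"
proof -
  let ?U = "UNIV - {0 :: 'f}"
  have "(\<Prod>y\<in>?U. y) = (\<Prod>y\<in>?U. x * y)"
    by (rule prod.reindex_bij_witness[of _ "\<lambda>y. x * y" "\<lambda>y. y / x"]) (use assms in auto)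
  also have "\<dots> = x ^ card ?U * (\<Prod>y\<in>?U. y)" by (simp add: prod.distrib)
  also have "card ?U = 15" by (simp add: card16)
  finally have "x ^ 15 * (\<Prod>y\<in>?U. y) = 1 * (\<Prod>y\<in>?U. y)" by simp
  moreover have "(\<Prod>y\<in>?U. y) \<noteq> 0" by (simp add: prod_zero_iff)
  ultimately show ?thesis by (simp only: mult_cancel_right simp_thms)
qed

lemma power16: "x ^ 16 = (x :: 'f)"
proof (cases "x = 0")
  case False
  have "x ^ 16 = x * x ^ 15" using power_add[of x 1 15] by simp
  then show ?thesis using power15[OF False] by simp
qed simp

lemma quartic_product:
  "(x ^ 2 + x + 1) * ((x ^ 4 + x + 1) * (x ^ 4 + x ^ 3 + 1)) = x ^ 10 + x ^ 5 + (1 :: 'f)"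
proof -
  have "(x ^ 2 + x + 1) * ((x ^ 4 + x + 1) * (x ^ 4 + x ^ 3 + 1)) = x ^ 10 + x ^ 5 + 1 +
     2 * (x + x ^ 2 + x ^ 3 + 2 * x ^ 4 + 2 * x ^ 5 + 2 * x ^ 6 + x ^ 7 + x ^ 8 + x ^ 9)"
    by algebra
  then show ?thesis by (simp add: two)
qed

lemma ex_generic: "\<exists>x :: 'f. x \<noteq> 0 \<and> x \<noteq> 1 \<and> x ^ 2 + x + 1 \<noteq> 0"
proof (rule ccontr)
  assume "\<not> ?thesis"
  then have a: "x = 0 \<or> x = 1 \<or> x ^ 2 + x + 1 = 0" for x :: 'f by blast
  have "\<exists>r :: 'f. \<forall>x. x ^ 2 + x + 1 = 0 \<longrightarrow> x = r \<or> x = r + 1"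
  proof (cases "\<exists>r :: 'f. r ^ 2 + r + 1 = 0")
    case True
    then obtain r :: 'f where r: "r ^ 2 + r + 1 = 0" by blast
    have "x = r \<or> x = r + 1" if "x ^ 2 + x + 1 = 0" for x
    proof -
      have "(x + r) ^ 2 + (x + r) = (x ^ 2 + x + 1) + (r ^ 2 + r + 1)"
        by (simp add: square_add add_ac)
      also have "\<dots> = 0" unfolding that r by simp
      finally have "(x + r) * (x + r + 1) = 0" by (simp add: power2_eq_square distrib_left)
      then have "x + r = 0 \<or> x + (r + 1) = 0" by (simp add: add.assoc)
      then show ?thesis by (simp only: plus_eq_0)
    qed
    then show ?thesis by blast
  qed blast
  then obtain r :: 'f where "\<And>x. x ^ 2 + x + 1 = 0 \<Longrightarrow> x = r \<or> x = r + 1" by blast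
  then have "UNIV \<subseteq> set [0, 1, r, r + 1]" using a by auto
  then have "CARD('f) \<le> card (set [0, 1, r, r + 1])" by (rule card_mono[OF finite_set])
  also have "\<dots> \<le> length [0, 1, r, r + 1]" by (rule card_length)
  finally show False by (simp add: card16)
qed

lemma inverse_root:
  assumes "(y :: 'f) \<noteq> 0" "y ^ 4 + y ^ 3 + 1 = 0" shows "inverse y ^ 4 = inverse y + 1"
proof -
  have "y ^ 4 + y ^ 3 = 1" using assms(2) by (simp only: plus_eq_0)
  then have "inverse y ^ 4 * (y ^ 4 + y ^ 3) = inverse y ^ 4" by simp
  moreover have "inverse y ^ 4 * y ^ 4 = 1" using assms(1) by (simp add: power_mult_distrib[symmetric])
  moreover have "inverse y ^ 4 * y ^ 3 = inverse y * (inverse y * y) ^ 3"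
    by (simp add: power_mult_distrib numeral_eq_Suc mult_ac)
  ultimately show ?thesis using assms(1) by (simp add: distrib_left add.commute)
qed

text \<open>An element outside of the subfield GF(4) is a root of one of the three irreducible quartics over GF(2), and
  \<open>x \<mapsto> x + 1\<close> and \<open>x \<mapsto> 1 / x\<close> permute these.\<close>

lemma ex_root: "\<exists>g :: 'f. g ^ 4 = g + 1"
proof -
  obtain x :: 'f where x: "x \<noteq> 0" "x \<noteq> 1" "x ^ 2 + x + 1 \<noteq> 0" using ex_generic by blast
  have "(x - 1) * ((x ^ 4 + x ^ 3 + x ^ 2 + x + 1) * (x ^ 10 + x ^ 5 + 1)) = x ^ 15 - 1" by algebra
  then have "(x ^ 4 + x ^ 3 + x ^ 2 + x + 1) * (x ^ 10 + x ^ 5 + 1) = 0"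
    using power15[OF x(1)] x(2) by simp
  then have "x ^ 4 + x ^ 3 + x ^ 2 + x + 1 = 0 \<or> x ^ 4 + x + 1 = 0 \<or> x ^ 4 + x ^ 3 + 1 = 0"
    unfolding quartic_product[symmetric] using x(3) by (simp only: mult_eq_0_iff simp_thms)
  then consider "x ^ 4 + (x + 1) = 0" | "x ^ 4 + x ^ 3 + 1 = 0" | "x ^ 4 + x ^ 3 + x ^ 2 + x + 1 = 0"
    by (auto simp: add.assoc)
  then show ?thesis
  proof cases
    case 1
    then show ?thesis by (intro exI[of _ x]) (simp only: plus_eq_0)
  next
    case 2
    then show ?thesis using inverse_root[OF x(1)] by blast
  next
    case 3
    have "(x + 1) ^ 4 + (x + 1) ^ 3 + 1 = (x ^ 4 + x ^ 3 + x ^ 2 + x + 1) + 2 * (2 * x ^ 3 + 4 * x ^ 2 + 3 * x + 1)"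
      by algebra
    then have "(x + 1) ^ 4 + (x + 1) ^ 3 + 1 = 0" using 3 two by simp
    moreover have "x + 1 \<noteq> 0" using x(2) by (simp add: plus_eq_0)
    ultimately show ?thesis using inverse_root by blast
  qed
qed

text \<open>The root g satisfies the equation of w. Hence the additive map that sends the powers of
  w to those of g respects multiplication by w, and then all products.\<close>

lemma field_iso: "\<exists>h :: gf16 \<Rightarrow> 'f. bij h \<and> addmap h \<and> (\<forall>x y. h (x * y) = h x * h y) \<and> h 1 = 1"
proof -
  obtain g :: 'f where g: "g ^ 4 = g + 1" using ex_root by blast
  have g4: "g * (g * (g * g)) = g + 1" using g by (simp add: numeral_eq_Suc)
  let ?h = "lincomb 1 g (g * g) (g * (g * g))"
  have a: "addmap ?h" by (rule addmap_lincomb) simp_all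
  have s: "?h (G2 * x) = g * ?h x" for x
    by (cases x) (simp_all add: times_gf16_def gmul_tab lincomb_def distrib_left g4 add_ac)
  have e: "G4 * x = G2 * (G2 * x)" "G8 * x = G2 * (G2 * (G2 * x))" for x
    by (simp_all add: mult.assoc[symmetric]) (simp_all add: times_gf16_def)
  have one: "G1 * x = x" for x by (simp add: one_gf16_def[symmetric])
  have m: "?h (y * x) = ?h y * ?h x" for x y
  proof -
    have l: "addmap (\<lambda>y. ?h (y * x))" "addmap (\<lambda>y. ?h y * ?h x)"
      by (simp_all add: addmap_def distrib_right addmapD[OF a])
    show ?thesis
      unfolding addmap_eq_lincomb[OF l(1), of y] addmap_eq_lincomb[OF l(2), of y] e one s lincomb_basis
      by (simp add: mult.assoc)
  qed
  have h1: "?h 1 = 1" by (simp add: one_gf16_def lincomb_basis)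
  have "inj ?h"
  proof (rule addmap_inj[OF a], rule ccontr)
    fix x assume x: "?h x = 0" "x \<noteq> 0"
    then have "?h (inverse x * x) = 0" unfolding m by simp
    then show False using x(2) h1 by simp
  qed
  moreover have "range ?h = UNIV"
    using card_image[OF \<open>inj ?h\<close>] by (intro card_subset_eq) (simp_all add: card_gf16 card16)
  ultimately have "bij ?h" by (simp add: bij_def)
  then show ?thesis using a m h1 by blast
qed

section \<open>Points of the projective plane\<close>

lemma vadd_eq: "vadd u v = u + (v :: 'f vec3)"
  by (cases u; cases v) (simp add: vadd_def plus_prod_def)

lemma vzero_eq: "vzero = (0 :: 'f vec3)"
  by (simp add: vzero_def zero_prod_def)

lemma group: "char2_group TYPE('f vec3)"
proof
  show "x + x = 0" for x :: "'f vec3" by (simp add: prod_eq_iff)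
  show "CARD('f vec3) = 4096" by (simp add: card16 card_prod)
qed

lemma proj3_iff: "proj3_subspace S \<longleftrightarrow> sub16 (S :: 'f vec3 set)"
  by (auto simp: proj3_subspace_def gf2_subspace_def sub16_def vadd_eq vzero_eq)

lemma span3_iff:
  fixes A :: "'f vec3 set"
  assumes "sub16 A" "sub16 B" "sub16 C"
  shows "span3 A B C = UNIV \<longleftrightarrow> char2_group.indep A B C"
proof
  assume u: "span3 A B C = UNIV"
  show "char2_group.indep A B C"
  proof (rule char2_group.span_indep[OF group assms])
    fix v
    have "v \<in> span3 A B C" using u by simp
    then show "\<exists>a\<in>A. \<exists>b\<in>B. \<exists>c\<in>C. v = a + b + c" unfolding span3_def vadd_eq by blast
  qed
next
  assume i: "char2_group.indep A B C"
  have "v \<in> span3 A B C" for v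
    using char2_group.indep_span[OF group assms i, of v] unfolding span3_def vadd_eq by blast
  then show "span3 A B C = UNIV" by blast
qed

lemma pseudo_oval_iff:
  "pseudo_oval (Ov :: 'f vec3 set set) \<longleftrightarrow> card Ov = 17 \<and> (\<forall>E\<in>Ov. sub16 E) \<and> indep3 Ov"
proof (cases "\<forall>E\<in>Ov. sub16 E")
  case True
  then have "(\<forall>A\<in>Ov. \<forall>B\<in>Ov. \<forall>C\<in>Ov. A \<noteq> B \<and> A \<noteq> C \<and> B \<noteq> C \<longrightarrow> span3 A B C = UNIV) \<longleftrightarrow> indep3 Ov"
    unfolding indep3_def char2_group.indep_def[OF group, symmetric] using span3_iff by metis
  then show ?thesis using True by (simp add: pseudo_oval_def proj3_iff)
next
  case False
  then show ?thesis by (auto simp: pseudo_oval_def proj3_iff)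
qed

lemma proj_equiv_iff:
  "proj_equiv O1 O2 \<longleftrightarrow> (\<exists>g :: 'f vec3 \<Rightarrow> 'f vec3. bij g \<and> addmap g \<and> (`) g ` O1 = O2)"
  by (simp add: proj_equiv_def gf2_linear_def addmap_def vadd_eq)

lemma image_inverse:
  assumes "bij g" "(`) g ` O1 = O2" shows "(`) (inv g) ` O2 = O1"
proof -
  have "inv g ` g ` S = S" for S using assms(1) by (simp add: image_inv_f_f bij_is_inj)
  then show ?thesis unfolding assms(2)[symmetric] image_image by simp
qed

lemma proj_equiv_sym: "proj_equiv O1 O2 \<Longrightarrow> proj_equiv O2 (O1 :: 'f vec3 set set)"
  unfolding proj_equiv_iff using image_inverse bij_imp_bij_inv addmap_inv by metis

lemma pseudo_oval_image:
  fixes k :: "'a::{ab_group_add, finite} \<Rightarrow> 'f vec3"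
  assumes "addmap k" "inj k" "card Ov = 17" "\<forall>E\<in>Ov. sub16 E" "indep3 Ov"
  shows "pseudo_oval ((`) k ` Ov)"
  unfolding pseudo_oval_iff
proof (intro conjI ballI)
  have "inj_on ((`) k) Ov" using inj_image_eq_iff[OF assms(2)] by (auto intro: inj_onI)
  then show "card ((`) k ` Ov) = 17" using card_image assms(3) by metis
  show "indep3 ((`) k ` Ov)" by (rule indep3_image[OF assms(1,2,5)])
  fix E assume "E \<in> (`) k ` Ov"
  then obtain S where S: "E = k ` S" "sub16 S" using assms(4) by blast
  have "card E = 16" using S sub16D(3)[OF S(2)] card_image[of k S] assms(2) by (metis inj_on_subset subset_UNIV)
  moreover have "0 \<in> E" using S(1) sub16D(1)[OF S(2)] addmap_0[OF assms(1)] by (metis imageI)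
  moreover have "x + y \<in> E" if xy: "x \<in> E" "y \<in> E" for x y
  proof -
    obtain a b where "a \<in> S" "b \<in> S" "x = k a" "y = k b" using xy unfolding S(1) by blast
    then show ?thesis using sub16D(2)[OF S(2)] addmapD[OF assms(1), of a b] unfolding S(1) by (metis imageI)
  qed
  ultimately show "sub16 E" by (simp add: sub16_def)
qed

lemma pseudo_oval_equiv:
  assumes "proj_equiv O1 O2" "pseudo_oval O2" shows "pseudo_oval (O1 :: 'f vec3 set set)"
proof -
  obtain g :: "'f vec3 \<Rightarrow> 'f vec3" where "bij g" "addmap g" "(`) g ` O2 = O1"
    using proj_equiv_sym[OF assms(1)] unfolding proj_equiv_iff by blast
  then show ?thesis
    using pseudo_oval_image[of g O2] assms(2) bij_is_inj unfolding pseudo_oval_iff by metis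
qed

definition pt :: "'f vec3 \<Rightarrow> 'f vec3 set" where
  "pt v = {smul t v | t. True}"

definition oset :: "('f \<Rightarrow> 'f) \<Rightarrow> 'f vec3 set set" where
  "oset F = insert (pt (0, 1, 0)) (range (\<lambda>t. pt (1, t, F t)))"

lemma mem_pt: "(x, y, z) \<in> pt (a, b, c) \<longleftrightarrow> (\<exists>k. x = k * a \<and> y = k * b \<and> z = k * c)"
  by (auto simp: pt_def smul_def)

lemma self_mem_pt: "v \<in> pt v"
proof -
  have "v = smul 1 v" by (cases v) (simp add: smul_def)
  then show ?thesis unfolding pt_def by blast
qed

lemma smul_smul: "smul s (smul t v) = smul (s * t) (v :: 'f vec3)"
  by (cases v) (simp add: smul_def mult.assoc)

lemma pt_smul: assumes "c \<noteq> 0" shows "pt (smul c v) = pt v"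
proof (intro equalityI subsetI)
  fix x assume "x \<in> pt (smul c v)"
  then show "x \<in> pt v" by (auto simp: pt_def smul_smul)
next
  fix x assume "x \<in> pt v"
  then obtain t where "x = smul t v" by (auto simp: pt_def)
  then have "x = smul (t / c) (smul c v)" using assms by (simp add: smul_smul)
  then show "x \<in> pt (smul c v)" unfolding pt_def by blast
qed

lemma pt_eq:
  "pt (1, t, s) = pt (1, u, r) \<longleftrightarrow> t = u \<and> s = r" "pt (1, t, s) \<noteq> pt (0, u, r)"
  "pt (0, u, r) \<noteq> pt (1, t, s)" "pt (0, 1, 0) \<noteq> pt (0, 0, 1)"
proof -
  show "pt (1, t, s) = pt (1, u, r) \<longleftrightarrow> t = u \<and> s = r"
  proof
    assume "pt (1, t, s) = pt (1, u, r)"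
    then have "(1, t, s) \<in> pt (1, u, r)" using self_mem_pt by blast
    then show "t = u \<and> s = r" by (simp add: mem_pt)
  qed simp
  show "pt (1, t, s) \<noteq> pt (0, u, r)"
  proof
    assume "pt (1, t, s) = pt (0, u, r)"
    then have "(1, t, s) \<in> pt (0, u, r)" using self_mem_pt by blast
    then show False by (simp add: mem_pt)
  qed
  then show "pt (0, u, r) \<noteq> pt (1, t, s)" by (rule not_sym)
  show "pt (0, 1, 0) \<noteq> pt (0, 0, 1)"
  proof
    assume "pt (0, 1, 0) = pt (0, 0, 1)"
    then have "(0, 1, 0) \<in> pt (0, 0, 1)" using self_mem_pt by blast
    then show False by (simp add: mem_pt)
  qed
qed

lemma pg_point_pt: "v \<noteq> 0 \<Longrightarrow> pg_point (pt v)"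
  unfolding pg_point_def pt_def vzero_eq by blast

lemma pg_point_cases:
  assumes "pg_point P"
  obtains y z where "P = pt (1, y, z)" | z where "P = pt (0, 1, z)" | "P = pt (0, 0, 1)"
proof -
  obtain v where v: "v \<noteq> 0" "P = pt v" using assms unfolding pg_point_def pt_def vzero_eq by blast
  obtain x y z where xyz: "v = (x, y, z)" by (cases v)
  consider "x \<noteq> 0" | "x = 0" "y \<noteq> 0" | "x = 0" "y = 0" "z \<noteq> 0"
    using v(1) unfolding xyz by (auto simp: zero_prod_def)
  then show thesis
  proof cases
    case 1
    then have "v = smul x (1, y / x, z / x)" by (simp add: xyz smul_def)
    then show thesis using that(1) v(2) pt_smul[OF 1] by metis
  next
    case 2
    then have "v = smul y (0, 1, z / y)" by (simp add: xyz smul_def)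
    then show thesis using that(2) v(2) pt_smul[OF 2(2)] by metis
  next
    case 3
    then have "v = smul z (0, 0, 1)" by (simp add: xyz smul_def)
    then show thesis using that(3) v(2) pt_smul[OF 3(3)] by metis
  qed
qed

lemma qform_pt: "(\<forall>x\<in>pt v. qform Q x = 0) \<longleftrightarrow> qform Q v = 0"
proof
  assume "\<forall>x\<in>pt v. qform Q x = 0" then show "qform Q v = 0" using self_mem_pt by blast
next
  assume q: "qform Q v = 0"
  obtain a b c d e f x y z where Q: "Q = (a, b, c, d, e, f)" "v = (x, y, z)" by (metis surj_pair)
  have "qform Q (smul s v) = s * s * qform Q v" for s
    unfolding Q by (simp add: qform_def smul_def algebra_simps)
  then show "\<forall>x\<in>pt v. qform Q x = 0" using q by (auto simp: pt_def)
qed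

lemma lform_pt: "(\<forall>x\<in>pt v. lform u x = 0) \<longleftrightarrow> lform u v = 0"
proof
  assume "\<forall>x\<in>pt v. lform u x = 0" then show "lform u v = 0" using self_mem_pt by blast
next
  assume q: "lform u v = 0"
  obtain a b c x y z where Q: "u = (a, b, c)" "v = (x, y, z)" by (metis surj_pair)
  have "lform u (smul s v) = s * lform u v" for s
    unfolding Q by (simp add: lform_def smul_def algebra_simps)
  then show "\<forall>x\<in>pt v. lform u x = 0" using q by (auto simp: pt_def)
qed

lemma square_root: "z * z = (y :: 'f) \<longleftrightarrow> z = y ^ 8"
proof
  assume z: "z * z = y"
  then have zz: "z ^ 2 = y" by (simp add: power2_eq_square)
  have "y ^ 8 = (z ^ 2) ^ 8" by (simp only: zz)
  also have "\<dots> = z" by (simp add: power_mult[symmetric] power16)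
  finally show "z = y ^ 8" ..
next
  assume "z = y ^ 8"
  then have "z * z = y ^ 16" by (simp add: power_add[symmetric])
  then show "z * z = y" by (simp add: power16)
qed

lemma points_in:
  assumes "\<And>y z. R (pt (1, y, z)) \<longleftrightarrow> z = F y" "\<And>z. R (pt (0, 1, z)) \<longleftrightarrow> P z" "R (pt (0, 0, 1)) \<longleftrightarrow> q"
  shows "{P. pg_point P \<and> R P} = range (\<lambda>t. pt (1, t, F t)) \<union> (\<lambda>z. pt (0, 1, z)) ` {z. P z} \<union> (if q then {pt (0, 0, 1)} else {})"
    (is "?L = ?R")
proof (intro equalityI subsetI)
  fix S assume "S \<in> ?L"
  then have S: "pg_point S" "R S" by auto
  from S(1) show "S \<in> ?R" by (cases rule: pg_point_cases) (use S(2) assms in auto)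
next
  fix S assume "S \<in> ?R"
  then show "S \<in> ?L" using assms by (auto split: if_splits simp: zero_prod_def intro!: pg_point_pt)
qed

lemma conic_oset: "conic (oset (\<lambda>t. t ^ 8))"
  unfolding conic_def
proof (intro exI conjI)
  \<comment> \<open>The form z^2 + xy. Its zeros with x = 1 have z equal to the square root t^8 of y
    = t.\<close>
  let ?Q = "(0, 0, 1, 1, 0, 0) :: 'f qcoeffs"
  show "nonsingular ?Q"
    by (auto simp: nonsingular_def qform_def qgrad_def vzero_def)
  have "{P. pg_point P \<and> (\<forall>x\<in>P. qform ?Q x = 0)} = range (\<lambda>t. pt (1, t, t ^ 8)) \<union>
      (\<lambda>z. pt (0, 1, z)) ` {z. z = 0} \<union> (if False then {pt (0, 0, 1)} else {})"
    by (rule points_in; unfold qform_pt) (simp_all add: qform_def plus_eq_0 square_root)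
  then show "oset (\<lambda>t. t ^ 8) = {P. pg_point P \<and> (\<forall>x\<in>P. qform ?Q x = 0)}"
    by (auto simp: oset_def)
qed

definition base_conic :: "'f vec3 set set" where
  "base_conic = insert (pt (0, 0, 1)) (range (\<lambda>t. pt (1, t, t ^ 2)))"

lemma conic_base: "conic base_conic"
  unfolding conic_def
proof (intro exI conjI)
  \<comment> \<open>The form y^2 + xz.\<close>
  let ?Q = "(0, 1, 0, 0, 1, 0) :: 'f qcoeffs"
  show "nonsingular ?Q"
    by (auto simp: nonsingular_def qform_def qgrad_def vzero_def)
  have "{P. pg_point P \<and> (\<forall>x\<in>P. qform ?Q x = 0)} = range (\<lambda>t. pt (1, t, t ^ 2)) \<union>
      (\<lambda>z. pt (0, 1, z)) ` {z. False} \<union> (if True then {pt (0, 0, 1)} else {})"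
    by (rule points_in; unfold qform_pt) (auto simp: qform_def plus_eq_0 power2_eq_square)
  also have "\<dots> = base_conic" by (simp add: base_conic_def)
  finally show "base_conic = {P. pg_point P \<and> (\<forall>x\<in>P. qform ?Q x = 0)}" ..
qed

text \<open>The form of a line through (0, 1, 0) has no y term, and a + c t^2 = 0 has exactly one
  solution for c \<noteq> 0 because squaring is bijective; for c = 0 the line meets the conic in (0,
  0, 1).\<close>

lemma nucleus_base: "nucleus base_conic (pt (0, 1, 0))"
  unfolding nucleus_def
proof (intro conjI allI impI)
  show "pg_point (pt (0, 1, 0))" by (rule pg_point_pt) (simp add: zero_prod_def)
  show "pt (0, 1, 0) \<notin> base_conic" unfolding base_conic_def by (simp add: pt_eq image_iff)
  fix L assume L: "pg_line L \<and> pt (0, 1, 0) \<in> L"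
  then obtain u where u: "u \<noteq> 0" "L = {P. pg_point P \<and> (\<forall>x\<in>P. lform u x = 0)}"
    unfolding pg_line_def vzero_eq by blast
  obtain a b c where abc: "u = (a, b, c)" by (cases u)
  have "lform u (0, 1, 0) = 0" using L lform_pt[of "(0, 1, 0)" u] unfolding u(2) by blast
  then have b: "b = 0" by (simp add: abc lform_def)
  have m: "pt v \<in> L \<longleftrightarrow> lform u v = 0" if "v \<noteq> 0" for v
    using pg_point_pt[OF that] lform_pt[of v u] unfolding u(2) by blast
  have m1: "pt (1, t, t ^ 2) \<in> L \<longleftrightarrow> a + c * (t * t) = 0" for t
    by (subst m) (simp_all add: abc b lform_def power2_eq_square zero_prod_def)
  have m2: "pt (0, 0, 1) \<in> L \<longleftrightarrow> c = 0"
    by (subst m) (simp_all add: abc lform_def zero_prod_def)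
  show "card (L \<inter> base_conic) = 1"
  proof (cases "c = 0")
    case True
    then have "a \<noteq> 0" using u(1) abc b by (simp add: zero_prod_def)
    then have "L \<inter> base_conic = {pt (0, 0, 1)}"
      using m1 m2 True unfolding base_conic_def by auto
    then show ?thesis by simp
  next
    case False
    have "a + c * (t * t) = 0 \<longleftrightarrow> t * t = a / c" for t
      using False by (auto simp: plus_eq_0 field_simps)
    moreover define s where "s = (a / c) ^ 8"
    ultimately have i: "pt (1, t, t ^ 2) \<in> L \<longleftrightarrow> t = s" for t unfolding m1 square_root by simp
    have "L \<inter> base_conic = {pt (1, s, s ^ 2)}"
      using i m2 False unfolding base_conic_def by auto
    then show ?thesis by simp
  qed
qed

text \<open>The conic y^2 = xz with its point (0, 0, 1) exchanged for its nucleus (0, 1, 0).\<close>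

lemma pointed_conic_oset: "pointed_conic (oset (\<lambda>t. t ^ 2))"
proof -
  have "pt (0, 0, 1) \<notin> range (\<lambda>t. pt (1, t, t ^ 2))" by (simp add: pt_eq image_iff)
  then have "base_conic - {pt (0, 0, 1)} = range (\<lambda>t. pt (1, t, t ^ 2))" unfolding base_conic_def by blast
  then have "oset (\<lambda>t. t ^ 2) = insert (pt (0, 1, 0)) (base_conic - {pt (0, 0, 1)})" by (simp add: oset_def)
  moreover have "pt (0, 0, 1) \<in> base_conic" by (simp add: base_conic_def)
  ultimately show ?thesis unfolding pointed_conic_def using conic_base nucleus_base by blast
qed

lemma oval_oset:
  assumes "pseudo_oval (oset F)" shows "oval (oset F)"
  unfolding oval_def
proof (intro conjI ballI impI)
  show "card (oset F) = CARD('f) + 1" using assms by (simp add: pseudo_oval_def card16)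
  show "pg_point P" if "P \<in> oset F" for P
    using that by (auto simp: oset_def zero_prod_def intro!: pg_point_pt)
  fix A B C assume ABC: "A \<in> oset F" "B \<in> oset F" "C \<in> oset F" "A \<noteq> B \<and> A \<noteq> C \<and> B \<noteq> C"
  then have U: "span3 A B C = UNIV" using assms unfolding pseudo_oval_def by blast
  show "\<not> collinear3 A B C"
  proof
    assume "collinear3 A B C"
    then obtain u where u: "u \<noteq> 0" "\<forall>x\<in>A. lform u x = 0" "\<forall>x\<in>B. lform u x = 0" "\<forall>x\<in>C. lform u x = 0"
      unfolding collinear3_def pg_line_def vzero_eq by blast
    have add: "lform u (x + y) = lform u x + lform u y" for x y
      by (cases u; cases x; cases y) (simp add: lform_def plus_prod_def algebra_simps)
    have z: "lform u v = 0" for v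
    proof -
      have "v \<in> span3 A B C" using U by simp
      then obtain a b c where "v = a + b + c" "a \<in> A" "b \<in> B" "c \<in> C" unfolding span3_def vadd_eq by blast
      then show ?thesis using u(2-4) by (simp add: add)
    qed
    obtain a b c where abc: "u = (a, b, c)" by (cases u)
    show False using z[of "(1, 0, 0)"] z[of "(0, 1, 0)"] z[of "(0, 0, 1)"] u(1)
      by (simp add: abc lform_def zero_prod_def)
  qed
qed

section \<open>Ovals and quadrics\<close>

text \<open>Fifteen roots are too many for a nonzero polynomial with at most fourteen
  coefficients.\<close>

lemma vanishing_poly:
  assumes "card X \<le> 1" "\<And>t. t \<notin> X \<Longrightarrow> poly (Poly xs) t = (0 :: 'f)" "length xs \<le> 14"
  shows "Poly xs = 0"
proof (rule ccontr)
  assume n: "Poly xs \<noteq> 0"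
  have "CARD('f) - card X \<le> card (UNIV - X)" 
    by (rule eq_imp_le[OF card_Diff_subset[symmetric]]) simp_all
  also have "\<dots> \<le> card {t. poly (Poly xs) t = 0}"
    by (rule card_mono) (use assms(2) in auto)
  also have "\<dots> \<le> length xs" using card_poly_roots_bound[OF n] degree_Poly[of xs] by linarith
  finally show False using assms(1,3) by (simp add: card16)
qed

lemma quadric_zero:
  assumes "nonsingular (Q :: 'f qcoeffs)" shows "Q \<noteq> (0, 0, 0, 0, 0, 0)"
proof
  assume "Q = (0, 0, 0, 0, 0, 0)"
  then have "qform Q (1, 0, 0) = 0 \<and> qgrad Q (1, 0, 0) = vzero"
    by (simp add: qform_def qgrad_def vzero_def)
  moreover have "(1, 0, 0) \<noteq> (vzero :: 'f vec3)" by (simp add: vzero_def)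
  ultimately show False using assms unfolding nonsingular_def by blast
qed

text \<open>Three coefficients are parameters because over the given field they are only known as
  images under an isomorphism.\<close>

definition lunelli :: "'f \<Rightarrow> 'f \<Rightarrow> 'f \<Rightarrow> 'f \<Rightarrow> 'f" where
  "lunelli k l m t = t ^ 12 + t ^ 10 + k * t ^ 8 + t ^ 6 + l * t ^ 4 + m * t ^ 2"

lemma lunelli_square:
  "lunelli k l m t * lunelli k l m t = t ^ 9 + t ^ 5 + k ^ 2 * t + t ^ 12 + l ^ 2 * t ^ 8 + m ^ 2 * t ^ 4"
proof -
  have p: "t ^ 24 = t ^ 9" "t ^ 20 = t ^ 5"
    using power_add[of t 16 8] power_add[of t 1 8] power_add[of t 16 4] power_add[of t 1 4] power16[of t] by simp_all
  have "lunelli k l m t * lunelli k l m t = lunelli k l m t ^ 2" by (simp add: power2_eq_square)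
  also have "\<dots> = t ^ 24 + t ^ 20 + k ^ 2 * t ^ 16 + t ^ 12 + l ^ 2 * t ^ 8 + m ^ 2 * t ^ 4"
    by (simp add: lunelli_def square_add power_mult_distrib power_mult[symmetric])
  finally show ?thesis by (simp add: p power16)
qed

text \<open>After reduction by t^16 = t the quadratic form at the points of the oval is a polynomial
  in t of degree at most 13, and its coefficients force Q = 0. One exceptional t is allowed so that
  quadrics through sixteen of the seventeen points are excluded too.\<close>

lemma lunelli_no_quadric:
  assumes X: "card {t. qform Q (1, t, lunelli k l m t) \<noteq> 0} \<le> 1"
  shows "Q = (0, 0, 0, 0, 0, 0)"
proof -
  obtain a b c d e f where Q: "Q = (a, b, c, d, e, f)" by (metis surj_pair)
  let ?xs = "[a, d + c * k ^ 2, b + e * m, f * m, c * m ^ 2 + e * l, c + f * l, e, f, c * l ^ 2 + e * k, c + f * k, e, f, c + e, f]"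
  have q: "qform Q (1, t, lunelli k l m t) = poly (Poly ?xs) t" for t
  proof -
    have "qform Q (1, t, lunelli k l m t) =
        a + b * t * t + c * (lunelli k l m t * lunelli k l m t) + d * t + e * lunelli k l m t + f * t * lunelli k l m t"
      by (simp add: Q qform_def mult.assoc)
    also have "\<dots> = a + t * (d + c * k ^ 2 + t * (b + e * m + t * (f * m + t * (c * m ^ 2 + e * l + t * (c + f * l +
        t * (e + t * (f + t * (c * l ^ 2 + e * k + t * (c + f * k + t * (e + t * (f + t * (c + e + t * f))))))))))))"
      unfolding lunelli_square unfolding lunelli_def by algebra
    finally show ?thesis
      by (simp only: Poly.simps poly_pCons poly_0 mult_zero_right add_0_right)
  qed
  have z: "Poly ?xs = 0"
    by (rule vanishing_poly[OF X]) (simp_all add: q[symmetric] del: Poly.simps)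
  have "f = 0" "e = 0" "c + e = 0" "a = 0" "d + c * k ^ 2 = 0" "b + e * m = 0"
    using z[unfolded Poly.simps pCons_eq_0_iff] by blast+
  then show ?thesis by (simp add: Q)
qed

text \<open>All seventeen points are required here, as sixteen of them do lie on a conic.\<close>

lemma pointed_no_quadric:
  fixes Q :: "'f qcoeffs"
  assumes "\<And>t. qform Q (1, t, t ^ 2) = 0" "qform Q (0, 1, 0) = 0"
  shows "Q = (0, 0, 0, 0, 0, 0)"
proof -
  obtain a b c d e f where Q: "Q = (a, b, c, d, e, f)" by (metis surj_pair)
  have b: "b = 0" using assms(2) by (simp add: Q qform_def)
  have "poly (Poly [a, d, e, f, c]) t = 0" for t :: 'f
    using assms(1)[of t] by (simp add: Q qform_def b algebra_simps power2_eq_square)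
  then have "Poly [a, d, e, f, c] = 0" by (intro vanishing_poly[of "{}"]) (simp_all del: Poly.simps)
  then show ?thesis by (simp add: Q b)
qed

end

section \<open>Invariance and uniqueness of the nucleus\<close>

context oval_group
begin

text \<open>The tangent spaces are defined by the members alone: if M v were on a sum of two
  members, so would be v.\<close>

lemma nuc_invariant:
  assumes M: "addmap M" "inj M" "\<And>E. E \<in> Ov \<Longrightarrow> M ` E = E" and v: "v \<in> nuc"
  shows "M v \<in> nuc"
proof (rule ccontr)
  assume "M v \<notin> nuc"
  then obtain E where E: "E \<in> Ov" "M v \<notin> tang E" by (auto simp: nuc_def)
  obtain F where F: "F \<in> Ov" "F \<noteq> E" "M v \<in> sumset E F" using not_tang[OF E(2)] by blast
  obtain e f where ef: "e \<in> E" "f \<in> F" "M v = e + f" using F(3) by (auto simp: sumset_def)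
  obtain e' where e': "e' \<in> E" "e = M e'" using ef(1) M(3)[OF E(1)] by blast
  obtain f' where f': "f' \<in> F" "f = M f'" using ef(2) M(3)[OF F(1)] by blast
  have "M v = M (e' + f')" using ef(3) e'(2) f'(2) addmapD[OF M(1)] by simp
  then have "v = e' + f'" using injD[OF M(2)] by blast
  then have "v \<in> sumset E F" using sumsetI[OF e'(1) f'(1)] by simp
  moreover have "v \<in> tang E" using v E(1) by (simp add: nuc_def)
  ultimately have "v \<in> E" using tang_sumset F(1,2) by blast
  then have "M v \<in> E" using M(3)[OF E(1)] by blast
  then show False using E(2) tang_member by blast
qed

text \<open>A further subspace independent of the members lies in every tangent space, and the
  nucleus has no more than 16 vectors. This identifies the nucleus of the models.\<close>

lemma nuc_eq:
  assumes Z: "sub16 Z" "Z \<notin> Ov" "indep3 (insert Z Ov)" shows "nuc = Z"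
proof -
  have "z \<in> tang E" if z: "z \<in> Z" and E: "E \<in> Ov" for z E
  proof (rule ccontr)
    assume n: "z \<notin> tang E"
    obtain F where F: "F \<in> Ov" "F \<noteq> E" "z \<in> sumset E F" using not_tang[OF n] by blast
    obtain e f where ef: "e \<in> E" "f \<in> F" "z = e + f" using F(3) by (auto simp: sumset_def)
    have "e + f + z = 0" using ef(3) by simp
    then have "z = 0"
      using indep3D[OF Z(3), of E F Z e f z] E F(1,2) Z(2) ef(1,2) z by blast
    then show False using n tang_zero[OF E] by simp
  qed
  then have "Z \<subseteq> nuc" unfolding nuc_def by blast
  then show ?thesis
    using card_subset_eq[OF sub16D(4)[OF sub16_nuc]] sub16D(3)[OF sub16_nuc] sub16D(3)[OF Z(1)] by metis
qed

end

context gf16_like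
begin

definition model :: "('f \<Rightarrow> 'f) \<Rightarrow> gmap \<Rightarrow> bool" where
  "model F f \<longleftrightarrow> oval_function f \<and> (\<exists>h :: gf16 \<Rightarrow> 'f. bij h \<and> addmap h \<and> (\<forall>x y. h (x * y) = h x * h y) \<and> h 1 = 1 \<and>
     (\<forall>t. F (h t) = h (f t)))"

lemma model_image:
  assumes "model F f"
  shows "\<exists>k :: gf16 vec3 \<Rightarrow> 'f vec3. addmap k \<and> bij k \<and> (`) k ` members (gr f) = oset F \<and> k ` zsub = pt (0, 0, 1)"
proof -
  obtain h :: "gf16 \<Rightarrow> 'f" where h: "bij h" "addmap h" "\<And>x y. h (x * y) = h x * h y" "h 1 = 1"
    and F: "\<And>t. F (h t) = h (f t)" using assms unfolding model_def by blast
  define k where "k v = (h (fst v), h (fst (snd v)), h (snd (snd v)))" for v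
  have h0: "h 0 = 0" by (rule addmap_0[OF h(2)])
  have ak: "addmap k" by (simp add: addmap_def k_def plus_prod_def addmapD[OF h(2)])
  have ik: "inj k"
    by (rule injI) (simp add: k_def prod_eq_iff inj_eq[OF bij_is_inj[OF h(1)]])
  have "range k = UNIV"
    by (rule card_subset_eq) (simp_all add: card_image[OF ik] card_prod card_gf16 card16)
  then have bk: "bij k" using ik by (simp add: bij_def)
  have s: "\<exists>x. h x = s" for s using h(1) by (metis bij_pointE)
  have line: "k ` range (\<lambda>x. (x * a, x * b, x * c)) = pt (h a, h b, h c)" for a b c
  proof -
    have "k ` range (\<lambda>x. (x * a, x * b, x * c)) = range (\<lambda>x. smul (h x) (h a, h b, h c))"
      by (simp add: image_image k_def h(3) smul_def)
    also have "\<dots> = pt (h a, h b, h c)" 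
    proof (intro equalityI subsetI)
      fix x assume "x \<in> pt (h a, h b, h c)"
      then obtain r where r: "x = smul r (h a, h b, h c)" by (auto simp: pt_def)
      obtain y where "h y = r" using s by blast
      then show "x \<in> range (\<lambda>x. smul (h x) (h a, h b, h c))" using r by blast
    qed (auto simp: pt_def)
    finally show ?thesis .
  qed
  have g: "k ` gline f t = pt (1, h t, F (h t))" for t
    using line[of 1 t "f t"] by (simp add: gline_def graph3_def F h(4) mult.commute)
  have y: "k ` ysub = pt (0, 1, 0)" using line[of 0 1 0] by (simp add: ysub_def h0 h(4))
  have z: "k ` zsub = pt (0, 0, 1)" using line[of 0 0 1] by (simp add: zsub_def h0 h(4))
  have "(`) k ` members (gr f) = insert (pt (0, 1, 0)) (range (\<lambda>t. pt (1, h t, F (h t))))"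
    unfolding members_gr by (simp add: image_image g y)
  also have "range (\<lambda>t. pt (1, h t, F (h t))) = (\<lambda>t. pt (1, t, F t)) ` range h" by (simp add: image_image)
  also have "range h = UNIV" by (rule bij_is_surj[OF h(1)])
  finally have "(`) k ` members (gr f) = oset F" unfolding oset_def .
  then show ?thesis using ak bk z by blast
qed

lemma model_group:
  assumes "model F f"
  shows "pseudo_oval (oset F)" "indep3 (insert (pt (0, 0, 1)) (oset F))" "sub16 (pt (0, 0, 1))" "pt (0, 0, 1) \<notin> oset F"
proof -
  obtain k :: "gf16 vec3 \<Rightarrow> 'f vec3" where k: "addmap k" "bij k" "(`) k ` members (gr f) = oset F" "k ` zsub = pt (0, 0, 1)"
    using model_image[OF assms] by (elim exE conjE) (rule that; assumption)
  have f: "oval_function f" using assms by (simp add: model_def)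
  have i: "indep3 (insert zsub (members (gr f)))"
    unfolding indep3_def gv.indep_def[symmetric] using indep_members_gr[OF f] by blast
  have i': "indep3 (members (gr f))"
    unfolding indep3_def
  proof (intro ballI impI)
    fix U V W u v w
    assume m: "U \<in> members (gr f)" "V \<in> members (gr f)" "W \<in> members (gr f)"
      "U \<noteq> V \<and> U \<noteq> W \<and> V \<noteq> W" "u \<in> U" "v \<in> V" "w \<in> W" "u + v + w = 0"
    show "u = 0 \<and> v = 0 \<and> w = 0"
      by (rule indep3D[OF i, of U V W]) (use m in simp_all)
  qed
  have sm: "\<forall>E\<in>members (gr f). sub16 E" by (intro ballI sub16_members_gr[of _ f] insertI2)
  show "pseudo_oval (oset F)"
    using pseudo_oval_image[OF k(1) bij_is_inj[OF k(2)] card_members_gr sm i'] unfolding k(3) .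
  have "(`) k ` insert zsub (members (gr f)) = insert (pt (0, 0, 1)) (oset F)" by (simp add: k(3,4))
  then show "indep3 (insert (pt (0, 0, 1)) (oset F))" using indep3_image[OF k(1) bij_is_inj[OF k(2)] i] by simp
  have "sub16 (range (\<lambda>x. k (0, 0, x)))"
  proof (rule sub16_image)
    show "addmap (\<lambda>x. k (0, 0, x))"
      unfolding addmap_def
    proof (intro allI)
      fix x y show "k (0, 0, x + y) = k (0, 0, x) + k (0, 0, y)"
        using addmapD[OF k(1), of "(0, 0, x)" "(0, 0, y)"] by (simp add: plus_prod_def)
    qed
    show "inj (\<lambda>x. k (0, 0, x))"
    proof (rule injI)
      fix x y assume "k (0, 0, x) = k (0, 0, y)"
      then have "(0 :: gf16, 0 :: gf16, x) = (0, 0, y)" by (rule injD[OF bij_is_inj[OF k(2)]])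
      then show "x = y" by simp
    qed
  qed
  moreover have "k ` zsub = range (\<lambda>x. k (0, 0, x))" by (simp add: zsub_def image_image)
  ultimately show "sub16 (pt (0, 0, 1))" using k(4) by simp
  show "pt (0, 0, 1) \<notin> oset F"
  proof
    assume "pt (0, 0, 1) \<in> oset F"
    then consider "pt (0, 0, 1) = pt (0, 1, 0)" | t where "pt (0, 0, 1) = pt (1, t, F t)"
      unfolding oset_def by blast
    then show False
    proof cases
      case 1
      show False by (rule notE[OF pt_eq(4) 1[symmetric]])
    next
      case 2
      show False by (rule notE[OF pt_eq(2) 2[symmetric]])
    qed
  qed
qed

lemma smul_linear:
  "smul c (u + v) = smul c u + smul c (v :: 'f vec3)" "smul (c + d) v = smul c v + smul d v" "smul 1 v = v"
  by (cases u; cases v; simp add: smul_def plus_prod_def distrib_left distrib_right)+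

lemma smul_cancel: "smul c v = smul d v \<Longrightarrow> v \<noteq> 0 \<Longrightarrow> c = d"
  by (cases v) (auto simp: smul_def zero_prod_def)

section \<open>Inequivalence\<close>

text \<open>The member of slope 0, the member (0, 1, 0) and the nucleus make M diagonal, and here
  the nucleus supplies the third axis. The member of slope 1 makes the three entries equal, and the
  other slopes t give p t = t * p 1.\<close>

lemma stabilizer_scalar:
  assumes F: "model F f" "F 0 = 0" "F 1 = 1" and M: "addmap M" "inj M" "\<And>E. E \<in> oset F \<Longrightarrow> M ` E = E"
  shows "\<exists>d. \<forall>v. M v = smul d v"
proof -
  note mg = model_group[OF F(1)]
  interpret og: oval_group "TYPE('f vec3)" "oset F"
    using group mg(1) unfolding pseudo_oval_iff oval_group_def oval_group_axioms_def by blast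
  have nuc: "og.nuc = pt (0, 0, 1)" by (rule og.nuc_eq[OF mg(3,4,2)])
  have mem: "M v \<in> pt (1, t, F t)" if "v \<in> pt (1, t, F t)" for v t
    using M(3)[of "pt (1, t, F t)"] that by (auto simp: oset_def)
  have my: "M v \<in> pt (0, 1, 0)" if "v \<in> pt (0, 1, 0)" for v
    using M(3)[of "pt (0, 1, 0)"] that by (auto simp: oset_def)
  have mz: "M v \<in> pt (0, 0, 1)" if "v \<in> pt (0, 0, 1)" for v
    using og.nuc_invariant[OF M(1,2,3)] that unfolding nuc by blast
  have "\<exists>k. M (x, 0, 0) = (k, 0, 0)" for x
    using mem[of "(x, 0, 0)" 0] by (cases "M (x, 0, 0)") (auto simp: mem_pt F(2))
  then obtain p where p: "\<And>x. M (x, 0, 0) = (p x, 0, 0)" by metis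
  have "\<exists>k. M (0, x, 0) = (0, k, 0)" for x
    using my[of "(0, x, 0)"] by (cases "M (0, x, 0)") (auto simp: mem_pt)
  then obtain q where q: "\<And>x. M (0, x, 0) = (0, q x, 0)" by metis
  have "\<exists>k. M (0, 0, x) = (0, 0, k)" for x
    using mz[of "(0, 0, x)"] by (cases "M (0, 0, x)") (auto simp: mem_pt)
  then obtain r where r: "\<And>x. M (0, 0, x) = (0, 0, r x)" by metis
  have Mv: "M (x, y, z) = (p x, q y, r z)" for x y z
  proof -
    have "(x, y, z) = (x, 0, 0) + (0, y, 0) + (0, 0, z)" by (simp add: plus_prod_def)
    then have "M (x, y, z) = M (x, 0, 0) + M (0, y, 0) + M (0, 0, z)" by (simp only: addmapD[OF M(1)])
    then show ?thesis by (simp add: p q r plus_prod_def)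
  qed
  have pqr: "q x = p x \<and> r x = p x" for x
    using mem[of "(x, x, x)" 1] by (auto simp: Mv mem_pt F(3))
  have pp: "p t = t * p 1" for t
  proof -
    have "M (1, t, F t) \<in> pt (1, t, F t)" by (rule mem[OF self_mem_pt])
    then have "\<exists>k. p 1 = k * 1 \<and> q t = k * t \<and> r (F t) = k * F t" unfolding Mv mem_pt .
    then have "q t = p 1 * t" by auto
    then show ?thesis using pqr[of t] by (simp add: mult.commute)
  qed
  have "M (x, y, z) = smul (p 1) (x, y, z)" for x y z
    using pp[of x] pp[of y] pp[of z] pqr[of y] pqr[of z] by (simp add: Mv smul_def mult.commute[of "p 1"])
  then show ?thesis by (metis prod_cases3)
qed

lemma smul_member:
  assumes "c \<noteq> 0" shows "smul c ` pt v = pt (v :: 'f vec3)"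
proof (intro equalityI subsetI)
  fix x assume "x \<in> smul c ` pt v" then show "x \<in> pt v" by (auto simp: pt_def smul_smul)
next
  fix x assume "x \<in> pt v"
  then obtain t where t: "x = smul t v" by (auto simp: pt_def)
  have "x = smul c (smul (t / c) v)" using assms by (simp add: t smul_smul)
  then show "x \<in> smul c ` pt v" unfolding pt_def by blast
qed

text \<open>The conjugate of a scalar under g is a map as in \<open>stabilizer_scalar\<close>, hence
  a scalar again.\<close>

lemma equiv_semilinear:
  assumes F: "model F f" "F 0 = 0" "F 1 = 1"
    and g: "bij g" "addmap g" "(`) g ` oset F' = oset F"
  shows "\<exists>\<sigma>. \<forall>c v. g (smul c v) = smul (\<sigma> c) (g v)"
proof -
  have "\<exists>d. \<forall>v. g (smul c v) = smul d (g v)" for c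
  proof (cases "c = 0")
    case True
    have "smul 0 v = 0" for v :: "'f vec3" by (cases v) (simp add: smul_def zero_prod_def)
    then show ?thesis using True addmap_0[OF g(2)] by metis
  next
    case False
    \<comment> \<open>This map fixes every member of the second pseudo-oval.\<close>
    define M where "M v = g (smul c (inv g v))" for v
    have gi: "g (inv g v) = v" "inv g (g v) = v" for v
      using g(1) by (simp_all add: surj_f_inv_f bij_is_surj bij_is_inj)
    have ai: "addmap (inv g)" by (rule addmap_inv[OF g(2,1)])
    have aM: "addmap M" by (simp add: addmap_def M_def addmapD[OF ai] smul_linear addmapD[OF g(2)])
    have iM: "inj M"
    proof (rule addmap_inj[OF aM])
      fix v assume "M v = 0"
      then have "smul c (inv g v) = smul c 0"
        using gi(2)[of "smul c (inv g v)"] addmap_0[OF ai] by (simp add: M_def smul_def zero_prod_def)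
      then have "smul (inverse c) (smul c (inv g v)) = smul (inverse c) (smul c 0)" by simp
      then have "inv g v = 0" using False by (simp add: smul_smul smul_linear(3))
      then show "v = 0" using gi(1)[of v] addmap_0[OF g(2)] by simp
    qed
    have "M ` E = E" if E: "E \<in> oset F" for E
    proof -
      obtain S where S: "S \<in> oset F'" "E = g ` S" using E unfolding g(3)[symmetric] by blast
      obtain v where v: "S = pt v" using S(1) unfolding oset_def by blast
      have "M ` E = g ` (smul c ` S)" unfolding S(2) by (simp add: image_image M_def gi)
      then show ?thesis unfolding v smul_member[OF False] using S(2) v by simp
    qed
    from stabilizer_scalar[OF F aM iM this] obtain d where "\<And>v. M v = smul d v" by blast
    then show ?thesis unfolding M_def using gi(2) by metis
  qed
  then show ?thesis by metis
qed

lemma qform_combination: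
  "\<exists>q. \<forall>x y z. qform Q (smul x A + smul y B + smul z C) = qform q (x, y, z :: 'f)"
proof -
  obtain a b c d e f where Q: "Q = (a, b, c, d, e, f)" by (metis surj_pair)
  obtain a1 a2 a3 b1 b2 b3 c1 c2 c3 where v: "A = (a1, a2, a3)" "B = (b1, b2, b3)" "C = (c1, c2, c3)"
    by (metis surj_pair)
  let ?p = "\<lambda>x1 x2 x3 y1 y2 y3. d * (x1 * y2 + x2 * y1) +
    e * (x1 * y3 + x3 * y1) + f * (x2 * y3 + x3 * y2)"
  let ?q = "(qform Q A, qform Q B, qform Q C, ?p a1 a2 a3 b1 b2 b3, ?p a1 a2 a3 c1 c2 c3, ?p b1 b2 b3 c1 c2 c3)"
  have "qform Q (smul x A + smul y B + smul z C) = qform ?q (x, y, z)" for x y z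
    unfolding Q v qform_def smul_def plus_prod_def prod.case fst_conv snd_conv
    by (simp add: distrib_left distrib_right add_ac mult_ac two)
  then show ?thesis by blast
qed

text \<open>\<sigma> turns out to be a field automorphism, so the coefficients of the form in the
  new basis can be carried back through its inverse.\<close>

lemma pullback:
  fixes g :: "'f vec3 \<Rightarrow> 'f vec3"
  assumes g: "bij g" "addmap g" and s: "\<And>c v. g (smul c v) = smul (\<sigma> c) (g v)"
  shows "\<exists>Q1. \<forall>v. qform Q1 v = 0 \<longleftrightarrow> qform Q (g v) = (0 :: 'f)"
proof -
  have g0: "g v \<noteq> 0" if "v \<noteq> 0" for v
    using that injD[OF bij_is_inj[OF g(1)], of v 0] addmap_0[OF g(2)] by metis
  let ?e = "(1, 0, 0) :: 'f vec3"
  have e: "?e \<noteq> 0" by (simp add: zero_prod_def)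
  have add: "\<sigma> (c + d) = \<sigma> c + \<sigma> d" for c d
  proof (rule smul_cancel[OF _ g0[OF e]])
    show "smul (\<sigma> (c + d)) (g ?e) = smul (\<sigma> c + \<sigma> d) (g ?e)"
      unfolding smul_linear(2) s[symmetric] addmapD[OF g(2)] ..
  qed
  have mul: "\<sigma> (c * d) = \<sigma> c * \<sigma> d" for c d
  proof (rule smul_cancel[OF _ g0[OF e]])
    show "smul (\<sigma> (c * d)) (g ?e) = smul (\<sigma> c * \<sigma> d) (g ?e)"
      unfolding smul_smul[symmetric] s[symmetric] ..
  qed
  have a: "addmap \<sigma>" using add by (simp add: addmap_def)
  have "inj \<sigma>"
  proof (rule addmap_inj[OF a])
    fix c assume "\<sigma> c = 0"
    then have "g (smul c ?e) = 0" unfolding s by (cases "g ?e") (simp add: smul_def zero_prod_def)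
    then have "smul c ?e = 0" using g0 by blast
    then show "c = 0" by (simp add: smul_def zero_prod_def)
  qed
  then have b: "bij \<sigma>" using finite_UNIV_inj_surj[of \<sigma>] by (simp add: bij_def)
  have i: "\<sigma> (inv \<sigma> c) = c" "inv \<sigma> (\<sigma> c) = c" for c
    using b by (simp_all add: surj_f_inv_f bij_is_surj bij_is_inj)
  obtain q where q: "\<And>x y z. qform Q (smul x (g (1, 0, 0)) + smul y (g (0, 1, 0)) + smul z (g (0, 0, 1))) = qform q (x, y, z)"
    using qform_combination by metis
  have gv: "qform Q (g (x, y, z)) = qform q (\<sigma> x, \<sigma> y, \<sigma> z)" for x y z
  proof -
    have "(x, y, z) = smul x (1, 0, 0) + smul y (0, 1, 0) + smul z (0, 0, 1)" by (simp add: smul_def plus_prod_def)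
    then have "g (x, y, z) = smul (\<sigma> x) (g (1, 0, 0)) + smul (\<sigma> y) (g (0, 1, 0)) + smul (\<sigma> z) (g (0, 0, 1))"
      by (simp only: addmapD[OF g(2)] s)
    then show ?thesis by (simp only: q)
  qed
  obtain q1 q2 q3 q4 q5 q6 where qq: "q = (q1, q2, q3, q4, q5, q6)" by (metis surj_pair)
  let ?Q = "(inv \<sigma> q1, inv \<sigma> q2, inv \<sigma> q3, inv \<sigma> q4, inv \<sigma> q5, inv \<sigma> q6)"
  have "\<sigma> (qform ?Q (x, y, z)) = qform q (\<sigma> x, \<sigma> y, \<sigma> z)" for x y z
    by (simp add: qq qform_def add mul i)
  moreover have "\<sigma> c = 0 \<longleftrightarrow> c = 0" for c using i(2) addmap_0[OF a] by metis
  ultimately have "qform ?Q (x, y, z) = 0 \<longleftrightarrow> qform Q (g (x, y, z)) = 0" for x y z unfolding gv by metis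
  then have "\<forall>v. qform ?Q v = 0 \<longleftrightarrow> qform Q (g v) = 0" by (metis prod_cases3)
  then show ?thesis by blast
qed

text \<open>Equivalences carry quadrics to quadrics, in the two versions needed: Q contains all
  points of the second oval, or all of them with the possible exception of (0, 1, 0). The vector
  \<open>v0\<close> guarantees that the pulled back form is not zero.\<close>

lemma equiv_quadric:
  assumes F: "model F f" "F 0 = 0" "F 1 = 1" and e: "proj_equiv (oset F') (oset F)"
    and Q: "qform Q v0 \<noteq> 0"
  shows "\<exists>n Q1. Q1 \<noteq> (0, 0, 0, 0, 0, 0) \<and> (\<forall>t. pt (1, t, F' t) \<noteq> n \<and> (\<forall>s. qform Q (1, s, F s) = 0) \<longrightarrow> qform Q1 (1, t, F' t) = 0) \<and>
     ((\<forall>s. qform Q (1, s, F s) = 0) \<and> qform Q (0, 1, 0) = 0 \<longrightarrow> (\<forall>t. qform Q1 (1, t, F' t) = 0) \<and> qform Q1 (0, 1, 0) = 0)"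
proof -
  obtain g :: "'f vec3 \<Rightarrow> 'f vec3" where g: "bij g" "addmap g" "(`) g ` oset F' = oset F"
    using e unfolding proj_equiv_iff by blast
  obtain \<sigma> where s: "\<And>c v. g (smul c v) = smul (\<sigma> c) (g v)" using equiv_semilinear[OF F g] by blast
  obtain Q1 where Q1: "\<And>v. qform Q1 v = 0 \<longleftrightarrow> qform Q (g v) = 0" using pullback[OF g(1,2) s] by blast
  have n0: "Q1 \<noteq> (0, 0, 0, 0, 0, 0)"
  proof
    assume "Q1 = (0, 0, 0, 0, 0, 0)"
    then have "qform Q1 v = 0" for v by (cases v) (simp add: qform_def)
    then have "qform Q (g v) = 0" for v using Q1 by blast
    then have "qform Q v0 = 0" using g(1) by (metis bij_pointE)
    then show False using Q by blast
  qed
  have m: "\<exists>w. g ` pt v = pt w \<and> pt w \<in> oset F" if "pt v \<in> oset F'" for v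
  proof -
    have "g ` pt v \<in> oset F" using g(3) that by blast
    then show ?thesis unfolding oset_def by auto
  qed
  have z: "qform Q1 v = 0" if "g ` pt v = pt w" "qform Q w = 0" for v w
  proof -
    have "g v \<in> pt w" using that(1) self_mem_pt by blast
    then show ?thesis using that(2) qform_pt[of w Q] Q1[of v] by blast
  qed
  have mem: "pt (1, t, F' t) \<in> oset F'" "pt (0, 1, 0) \<in> oset F'" for t by (simp_all add: oset_def)
  \<comment> \<open>The point that is sent to (0, 1, 0); it may be any point of the first
    oval.\<close>
  let ?n = "inv g ` pt (0, 1, 0)"
  have 1: "qform Q1 (1, t, F' t) = 0" if t: "pt (1, t, F' t) \<noteq> ?n" "\<forall>s. qform Q (1, s, F s) = 0" for t
  proof -
    have G: "g ` pt (1, t, F' t) \<in> oset F" using g(3) mem(1) by blast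
    have "g ` pt (1, t, F' t) \<noteq> pt (0, 1, 0)" using t(1) bij_is_inj[OF g(1)] by (metis image_inv_f_f)
    then obtain s where "g ` pt (1, t, F' t) = pt (1, s, F s)" using G unfolding oset_def by blast
    then show ?thesis using z t(2) by blast
  qed
  have 2: "qform Q1 v = 0" if v: "pt v \<in> oset F'" "\<forall>s. qform Q (1, s, F s) = 0" "qform Q (0, 1, 0) = 0" for v
  proof -
    have "g ` pt v \<in> oset F" using g(3) v(1) by blast
    then have "g ` pt v = pt (0, 1, 0) \<or> (\<exists>s. g ` pt v = pt (1, s, F s))" unfolding oset_def by blast
    then show ?thesis using z v(2,3) by blast
  qed
  show ?thesis by (intro exI[of _ ?n] exI[of _ Q1]) (use n0 1 2 mem in blast)
qed

lemma one_exception: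
  assumes "\<And>t. pt (1, t, F t) \<noteq> n \<Longrightarrow> qform Q (1, t, F t) = 0"
  shows "card {t. qform Q (1, t, F t) \<noteq> 0} \<le> 1"
proof -
  let ?S = "{t. qform Q (1, t, F t) \<noteq> 0}"
  have *: "pt (1, t, F t) = n" if t: "t \<in> ?S" for t
  proof (rule ccontr)
    assume "pt (1, t, F t) \<noteq> n"
    then have "qform Q (1, t, F t) = 0" by (rule assms)
    then show False using t by (simp only: mem_Collect_eq simp_thms)
  qed
  have "t = u" if tu: "t \<in> ?S" "u \<in> ?S" for t u
  proof -
    have "pt (1, t, F t) = pt (1, u, F u)" by (rule trans[OF *[OF tu(1)] *[OF tu(2), symmetric]])
    then have "t = u \<and> F t = F u" by (rule iffD1[OF pt_eq(1)])
    then show ?thesis by (rule conjunct1)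
  qed
  then have "card ?S \<le> Suc 0"
    unfolding card_le_Suc0_iff_eq[OF finite] by blast
  then show ?thesis by (simp only: One_nat_def)
qed

lemma lunelli_oset:
  assumes "pseudo_oval (oset (lunelli k l m))" shows "lunelli_sce_oval (oset (lunelli k l m))"
proof -
  let ?K = "oset (lunelli k l m)"
  have key: False if C: "conic C" and sub: "\<And>t. pt (1, t, lunelli k l m t) \<noteq> n \<Longrightarrow> pt (1, t, lunelli k l m t) \<in> C" for C n
  proof -
    obtain Q where Q: "nonsingular Q" "C = {P. pg_point P \<and> (\<forall>x\<in>P. qform Q x = 0)}"
      using C unfolding conic_def by blast
    have "qform Q (1, t, lunelli k l m t) = 0" if "pt (1, t, lunelli k l m t) \<noteq> n" for t
      using sub[OF that] qform_pt[of "(1, t, lunelli k l m t)" Q] unfolding Q(2) by blast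
    from lunelli_no_quadric[OF one_exception[OF this]] show False using quadric_zero[OF Q(1)] by simp
  qed
  \<comment> \<open>The empty set is not a point, so no exception is made.\<close>
  have "\<not> conic ?K" using key[of ?K "{}"] by (auto simp: oset_def)
  moreover have "\<not> pointed_conic ?K"
  proof
    assume "pointed_conic ?K"
    then obtain C p n where C: "conic C" "p \<in> C" "nucleus C n" "?K = insert n (C - {p})"
      unfolding pointed_conic_def by (elim exE conjE) (rule that; assumption)
    have "pt (1, t, lunelli k l m t) \<in> C" if "pt (1, t, lunelli k l m t) \<noteq> n" for t
    proof -
      have "pt (1, t, lunelli k l m t) \<in> ?K" by (simp add: oset_def)
      then show ?thesis using C(4) that by blast
    qed
    then show False by (rule key[OF C(1)])
  qed
  ultimately show ?thesis using oval_oset[OF assms] by (simp add: lunelli_sce_oval_def)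
qed

section \<open>The three models and the classification\<close>

lemma tables_products:
  "\<forall>t. look t conic_tab = ((t * t) * (t * t)) * ((t * t) * (t * t))" "\<forall>t. look t pointed_tab = t * t"
  "\<forall>t. look t lunelli_tab = (((t * t) * (t * t)) * ((t * t) * (t * t))) * ((t * t) * (t * t)) +
    (((t * t) * (t * t)) * ((t * t) * (t * t))) * (t * t) + G14 * (((t * t) * (t * t)) * ((t * t) * (t * t))) +
    ((t * t) * (t * t)) * (t * t) + G4 * ((t * t) * (t * t)) + G10 * (t * t)"
  by (simp_all only: times_gf16_def plus_gf16_def all_gf16 conic_tab_def pointed_tab_def lunelli_tab_def
      look_eval gmul_tab gadd_tab simp_thms)

lemma tables_polynomial:
  "look t conic_tab = t ^ 8" "look t pointed_tab = t ^ 2"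
  "look t lunelli_tab = t ^ 12 + t ^ 10 + G14 * t ^ 8 + t ^ 6 + G4 * t ^ 4 + G10 * t ^ 2"
proof -
  have p12: "t ^ 12 = t ^ 8 * t ^ 4" using power_add[of t 8 4] by simp
  have p10: "t ^ 10 = t ^ 8 * t ^ 2" using power_add[of t 8 2] by simp
  have p8: "t ^ 8 = t ^ 4 * t ^ 4" using power_add[of t 4 4] by simp
  have p6: "t ^ 6 = t ^ 4 * t ^ 2" using power_add[of t 4 2] by simp
  have p4: "t ^ 4 = t ^ 2 * t ^ 2" using power_add[of t 2 2] by simp
  note p = p12 p10 p8 p6 p4 power2_eq_square
  show "look t conic_tab = t ^ 8" "look t pointed_tab = t ^ 2"
    "look t lunelli_tab = t ^ 12 + t ^ 10 + G14 * t ^ 8 + t ^ 6 + G4 * t ^ 4 + G10 * t ^ 2"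
    unfolding p using tables_products by blast+
qed

lemma models:
  "\<exists>k l m. model (\<lambda>t. t ^ 8) (\<lambda>t. look t conic_tab) \<and> model (\<lambda>t. t ^ 2) (\<lambda>t. look t pointed_tab) \<and>
     model (lunelli k l m) (\<lambda>t. look t lunelli_tab)"
proof -
  obtain h :: "gf16 \<Rightarrow> 'f" where h: "bij h" "addmap h" "\<forall>x y. h (x * y) = h x * h y" "h 1 = 1"
    using field_iso by blast
  have pw: "h (t ^ n) = h t ^ n" for t n using h(3,4) by (induction n) simp_all
  have o: "oval_function (\<lambda>t. look t conic_tab)" "oval_function (\<lambda>t. look t pointed_tab)"
    "oval_function (\<lambda>t. look t lunelli_tab)" by (rule standard_oval_function, simp add: standard_def)+
  show ?thesis
  proof (intro exI conjI)
    show "model (\<lambda>t. t ^ 8) (\<lambda>t. look t conic_tab)"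
      unfolding model_def using o(1) h by (intro conjI exI[of _ h]) (auto simp: tables_polynomial pw)
    show "model (\<lambda>t. t ^ 2) (\<lambda>t. look t pointed_tab)"
      unfolding model_def using o(2) h by (intro conjI exI[of _ h]) (auto simp: tables_polynomial pw)
    show "model (lunelli (h G14) (h G4) (h G10)) (\<lambda>t. look t lunelli_tab)"
      unfolding model_def using o(3) h
      by (intro conjI exI[of _ h]) (auto simp: tables_polynomial pw lunelli_def addmapD[OF h(2)])
  qed
qed

lemma classification:
  assumes Ov: "pseudo_oval (Ov :: 'f vec3 set set)"
    and m: "model F1 (\<lambda>t. look t conic_tab)" "model F2 (\<lambda>t. look t pointed_tab)" "model F3 (\<lambda>t. look t lunelli_tab)"
  shows "proj_equiv Ov (oset F1) \<or> proj_equiv Ov (oset F2) \<or> proj_equiv Ov (oset F3)"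
proof -
  interpret og: oval_group "TYPE('f vec3)" Ov
    using group Ov unfolding pseudo_oval_iff oval_group_def oval_group_axioms_def by blast
  obtain G :: "gf16 vec3 \<Rightarrow> 'f vec3" and T where G: "addmap G" "bij G" "based T" "(`) G ` members T = Ov"
    using og.coordinates by blast
  obtain f where f: "f \<in> standard" "geqv T (gr f)" using based_standard[OF G(3)] by blast
  obtain k where k: "addmap k" "bij k" "(`) k ` members T = members (gr f)"
    using f(2) unfolding geqv_def by blast
  have "proj_equiv Ov (oset F)" if F: "model F f" for F
  proof -
    obtain j :: "gf16 vec3 \<Rightarrow> 'f vec3" where j: "addmap j" "bij j" "(`) j ` members (gr f) = oset F" "j ` zsub = pt (0, 0, 1)"
      using model_image[OF F] by (elim exE conjE) (rule that; assumption)
    let ?g = "j \<circ> k \<circ> inv G"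
    have "inv G ` G ` S = S" for S using G(2) by (simp add: image_inv_f_f bij_is_inj)
    then have "(`) (inv G) ` Ov = members T" unfolding G(4)[symmetric] image_image by simp
    moreover have "(`) ?g ` Ov = (`) j ` (`) k ` (`) (inv G) ` Ov" by (simp add: image_image)
    ultimately have "(`) ?g ` Ov = oset F" using k(3) j(3) by simp
    moreover have "bij ?g" using bij_comp[OF bij_imp_bij_inv[OF G(2)] bij_comp[OF k(2) j(2)]] by (simp add: o_assoc)
    moreover have "addmap ?g" using addmap_comp[OF addmap_comp[OF j(1) k(1)] addmap_inv[OF G(1,2)]] .
    ultimately show ?thesis unfolding proj_equiv_iff by blast
  qed
  then show ?thesis using f(1) m unfolding standard_def by blast
qed

end

theorem theorem6:
  assumes "CARD('f::{field,finite}) = 16"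
  shows "\<exists>C P K :: 'f vec3 set set.
           conic C \<and> pointed_conic P \<and> lunelli_sce_oval K \<and>
           (\<forall>Ov :: 'f vec3 set set. pseudo_oval Ov \<longleftrightarrow>
               proj_equiv Ov (arising C) \<or> proj_equiv Ov (arising P) \<or> proj_equiv Ov (arising K)) \<and>
           \<not> proj_equiv (arising C) (arising P) \<and>
           \<not> proj_equiv (arising C) (arising K) \<and>
           \<not> proj_equiv (arising P) (arising K)"
proof -
  interpret gf16_like "TYPE('f)" by standard (rule assms)
  obtain k l m where md: "model (\<lambda>t. t ^ 8) (\<lambda>t. look t conic_tab)" "model (\<lambda>t. t ^ 2) (\<lambda>t. look t pointed_tab)"
     "model (lunelli k l m) (\<lambda>t. look t lunelli_tab)" using models by blast
  let ?C = "oset (\<lambda>t. t ^ 8)" and ?P = "oset (\<lambda>t. t ^ 2)" and ?K = "oset (lunelli k l m)"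
  have ar: "arising K = K" for K :: "'f vec3 set set" by (simp add: arising_def)
  let ?QC = "(0, 0, 1, 1, 0, 0) :: 'f qcoeffs" and ?QP = "(0, 1, 0, 0, 1, 0) :: 'f qcoeffs"
  have qC: "qform ?QC (1, s, s ^ 8) = 0" "qform ?QC (0, 1, 0) = 0" for s
    using square_root[of "s ^ 8" s] by (simp_all add: qform_def)
  have qP: "qform ?QP (1, s, s ^ 2) = 0" for s by (simp add: qform_def power2_eq_square)
  have nC: "qform ?QC (0, 0, 1) \<noteq> 0" and nP: "qform ?QP (0, 1, 0) \<noteq> 0" by (simp_all add: qform_def)
  have r: "(0 :: 'f) ^ 8 = 0" "(1 :: 'f) ^ 8 = 1" "(0 :: 'f) ^ 2 = 0" "(1 :: 'f) ^ 2 = 1" by simp_all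
  \<comment> \<open>The quadric of the conic would be carried to one through all seventeen points of
    the pointed conic.\<close>
  have CP: "\<not> proj_equiv ?C ?P"
  proof
    assume e: "proj_equiv ?C ?P"
    obtain n Q where Q: "Q \<noteq> (0, 0, 0, 0, 0, 0)"
      "\<forall>t. pt (1, t, t ^ 2) \<noteq> n \<and> (\<forall>s. qform ?QC (1, s, s ^ 8) = 0) \<longrightarrow> qform Q (1, t, t ^ 2) = 0"
      "(\<forall>s. qform ?QC (1, s, s ^ 8) = 0) \<and> qform ?QC (0, 1, 0) = 0 \<longrightarrow>
        (\<forall>t. qform Q (1, t, t ^ 2) = 0) \<and> qform Q (0, 1, 0) = 0"
      using equiv_quadric[OF md(1) r(1,2) proj_equiv_sym[OF e] nC] by (elim exE conjE) (rule that; assumption)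
    then have "\<And>t. qform Q (1, t, t ^ 2) = 0" "qform Q (0, 1, 0) = 0" using qC by blast+
    then show False using pointed_no_quadric[of Q] Q(1) by blast
  qed
  have CK: "\<not> proj_equiv ?C ?K"
  proof
    assume e: "proj_equiv ?C ?K"
    obtain n Q where Q: "Q \<noteq> (0, 0, 0, 0, 0, 0)"
      "\<forall>t. pt (1, t, lunelli k l m t) \<noteq> n \<and> (\<forall>s. qform ?QC (1, s, s ^ 8) = 0) \<longrightarrow> qform Q (1, t, lunelli k l m t) = 0"
      "(\<forall>s. qform ?QC (1, s, s ^ 8) = 0) \<and> qform ?QC (0, 1, 0) = 0 \<longrightarrow>
        (\<forall>t. qform Q (1, t, lunelli k l m t) = 0) \<and> qform Q (0, 1, 0) = 0"
      using equiv_quadric[OF md(1) r(1,2) proj_equiv_sym[OF e] nC] by (elim exE conjE) (rule that; assumption)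
    then have "\<And>t. qform Q (1, t, lunelli k l m t) = 0" using qC by blast
    then show False using lunelli_no_quadric[OF one_exception[of "lunelli k l m" "{}" Q]] Q(1) by blast
  qed
  \<comment> \<open>The conic through sixteen points of the pointed conic would yield a quadric
    through all points of the third oval except possibly the one that corresponds to (0, 1,
    0).\<close>
  have PK: "\<not> proj_equiv ?P ?K"
  proof
    assume e: "proj_equiv ?P ?K"
    obtain n Q where Q: "Q \<noteq> (0, 0, 0, 0, 0, 0)"
      "\<forall>t. pt (1, t, lunelli k l m t) \<noteq> n \<and> (\<forall>s. qform ?QP (1, s, s ^ 2) = 0) \<longrightarrow> qform Q (1, t, lunelli k l m t) = 0"
      "(\<forall>s. qform ?QP (1, s, s ^ 2) = 0) \<and> qform ?QP (0, 1, 0) = 0 \<longrightarrow>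
        (\<forall>t. qform Q (1, t, lunelli k l m t) = 0) \<and> qform Q (0, 1, 0) = 0"
      using equiv_quadric[OF md(2) r(3,4) proj_equiv_sym[OF e] nP] by (elim exE conjE) (rule that; assumption)
    then have "\<And>t. pt (1, t, lunelli k l m t) \<noteq> n \<Longrightarrow> qform Q (1, t, lunelli k l m t) = 0"
      using qP by blast
    then show False using lunelli_no_quadric[OF one_exception[of "lunelli k l m" n Q]] Q(1) by blast
  qed
  have po: "pseudo_oval ?C" "pseudo_oval ?P" "pseudo_oval ?K"
    using model_group(1)[OF md(1)] model_group(1)[OF md(2)] model_group(1)[OF md(3)] .
  have iff: "pseudo_oval Ov \<longleftrightarrow> proj_equiv Ov ?C \<or> proj_equiv Ov ?P \<or> proj_equiv Ov ?K" for Ov :: "'f vec3 set set"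
    using classification[OF _ md] pseudo_oval_equiv po by blast
  show ?thesis
    unfolding ar
    by (rule exI[of _ ?C], rule exI[of _ ?P], rule exI[of _ ?K])
      (intro conjI allI iff CP CK PK conic_oset pointed_conic_oset lunelli_oset[OF po(3)])
qed

end
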